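(* Let $M$ be a graded $R$-module, let $f=(f_1,\ldots,f_r)$ be a tuple of homogeneous elements of $R$, let $I=(f_1,\ldots,f_r)$, and let $\ell$ be an integer and $\gamma\in G$. (a) If $\ell >\mathrm{cd}_B (R/(I+\mathrm{ann}_R (M)))$, then $$\gamma \not\in \bigcup_{i\geq 0} \bigl(\mathrm{Supp}_G(H^{\ell +i}_B(M))+\mathscr{E}_{i+1}^I\bigr)\ \Longrightarrow\ \gamma \not\in \mathrm{Supp}_G(H^{\ell }_B(M)).$$ (b) If $\ell =\mathrm{cd}_B (R/(I+\mathrm{ann}_R (M)))$ and $\gamma \not\in \bigcup_{i>0} \bigl(\mathrm{Supp}_G(H^{\ell +i}_B(M))+\mathscr{E}_{i+1}^I\bigr)$, then $$(H^{\ell }_B(M)/IH^{\ell }_B(M))_\gamma \subseteq H^{\ell }_B(M/IM)_\gamma$$ (via the natural map), and equality holds if moreover $\gamma \not\in \bigcup_{i> 0} \bigl(\mathrm{Supp}_G(H^{\ell +i}_B(M))+\mathscr{E}_{i}^I\bigr)$.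
   Context: $G$ is a finitely generated abelian group, $S$ is a commutative ring, and $R=S[X_1,\ldots,X_n]$ is $G$-graded with $\deg(X_i)=\gamma_i\in G$ and $\deg(s)=0$ for $s\in S$. $B\subseteq (X_1,\ldots,X_n)$ is a finitely generated graded $R$-ideal. $H^i_B(M)$ denotes the $i$-th cohomology of the Čech complex of $M$ on a finite set of homogeneous generators of $B$. $\mathrm{cd}_B(M):=\inf\{i : H^j_B(M)=0\ \forall j>i\}$. $\mathrm{Supp}_G(M):=\{\gamma\in G: M_\gamma\neq 0\}$. With $\delta_i:=\deg(f_i)$, set $\mathscr{E}_0^I:=\{0\}$ and, for $i>0$, $\mathscr{E}_i^I:=\{\delta_{j_1}+\cdots+\delta_{j_i} : j_1<\cdots<j_i\}$ (empty for $i>r$). For subsets $A,A'$ of $G$, $A+A'=\{a+a'\}$ (empty if one of them is empty). The natural map $H^\ell_B(M)/IH^\ell_B(M)\to H^\ell_B(M/IM)$ is the one induced by $M\to M/IM$. *)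

theory Defs
  imports "HOL-Algebra.Algebra" "HOL-Library.Extended_Real"
begin

section \<open>The graded polynomial ring\<close>

text \<open>As in \<^theory>\<open>HOL-Algebra.Indexed_Polynomials\<close>, a monomial is a multiset of indices of
  variables and a polynomial is its coefficient function; that theory provides the set of
  polynomials, their addition, constants and variables. The variables here are indexed
  by \<open>0, \<dots>, n - 1\<close>.\<close>

definition mpoly_ring :: "('s, 'k) ring_scheme \<Rightarrow> nat \<Rightarrow> (nat multiset \<Rightarrow> 's) ring" where
  "mpoly_ring S n =
    \<lparr>carrier = ring.indexed_pset S {..<n} (carrier S),
     monoid.mult = (\<lambda>p q m. \<Oplus>\<^bsub>S\<^esub>k\<in>{k. k \<subseteq># m}. p k \<otimes>\<^bsub>S\<^esub> q (m - k)),
     monoid.one = ring.indexed_const S \<one>\<^bsub>S\<^esub>,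
     ring.zero = ring.indexed_const S \<zero>\<^bsub>S\<^esub>,
     ring.add = ring.indexed_padd S\<rparr>"

text \<open>All grading groups are written multiplicatively, following \<^theory>\<open>HOL-Algebra.Group\<close>.\<close>

definition monom_deg :: "('g, 'k) monoid_scheme \<Rightarrow> (nat \<Rightarrow> 'g) \<Rightarrow> nat multiset \<Rightarrow> 'g" where
  "monom_deg G \<gamma> m = (\<Otimes>\<^bsub>G\<^esub>i\<in>set_mset m. \<gamma> i [^]\<^bsub>G\<^esub> count m i)"

definition mpoly_grade ::
  "('s, 'k) ring_scheme \<Rightarrow> nat \<Rightarrow> ('g, 'l) monoid_scheme \<Rightarrow> (nat \<Rightarrow> 'g) \<Rightarrow> 'g
    \<Rightarrow> (nat multiset \<Rightarrow> 's) set" where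
  "mpoly_grade S n G \<gamma> g =
    {p \<in> carrier (mpoly_ring S n). \<forall>m. p m \<noteq> \<zero>\<^bsub>S\<^esub> \<longrightarrow> monom_deg G \<gamma> m = g}"


section \<open>Graded modules, quotients, annihilators\<close>

text \<open>A grading is a family of subsets indexed by the group; \<open>Rg\<close> is the grading of the ring \<open>R\<close>
  and \<open>Mg\<close> that of the module \<open>M\<close>.\<close>

definition graded_module ::
  "('g, 'k) monoid_scheme \<Rightarrow> ('r, 'l) ring_scheme \<Rightarrow> ('g \<Rightarrow> 'r set)
    \<Rightarrow> ('r, 'm, 'o) module_scheme \<Rightarrow> ('g \<Rightarrow> 'm set) \<Rightarrow> bool" where
  "graded_module G R Rg M Mg \<longleftrightarrow>
    module R M \<and>
    (\<forall>g\<in>carrier G. subgroup (Mg g) (add_monoid M)) \<and>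
    (\<forall>g\<in>carrier G. \<forall>h\<in>carrier G. \<forall>a\<in>Rg g. \<forall>x\<in>Mg h. a \<odot>\<^bsub>M\<^esub> x \<in> Mg (g \<otimes>\<^bsub>G\<^esub> h)) \<and>
    (\<forall>x\<in>carrier M. \<exists>!c. c \<in> (\<Pi>\<^sub>E g\<in>carrier G. Mg g) \<and>
       finite {g \<in> carrier G. c g \<noteq> \<zero>\<^bsub>M\<^esub>} \<and>
       x = (\<Oplus>\<^bsub>M\<^esub>g\<in>{g \<in> carrier G. c g \<noteq> \<zero>\<^bsub>M\<^esub>}. c g))"

definition supp ::
  "('g, 'k) monoid_scheme \<Rightarrow> ('r, 'm, 'o) module_scheme \<Rightarrow> ('g \<Rightarrow> 'm set) \<Rightarrow> 'g set" where
  "supp G M Mg = {g \<in> carrier G. Mg g \<noteq> {\<zero>\<^bsub>M\<^esub>}}"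

definition self_module :: "('r, 'l) ring_scheme \<Rightarrow> ('r, 'r) module" where
  "self_module R =
    \<lparr>carrier = carrier R, monoid.mult = monoid.mult R, monoid.one = \<one>\<^bsub>R\<^esub>,
     ring.zero = \<zero>\<^bsub>R\<^esub>, ring.add = ring.add R,
     module.smult = monoid.mult R\<rparr>"

text \<open>A module record also has a multiplication and a unit, on which \<^locale>\<open>module\<close> puts no
  condition; they are left \<^const>\<open>undefined\<close> below.\<close>

definition quot_module :: "('r, 'm, 'o) module_scheme \<Rightarrow> 'm set \<Rightarrow> ('r, 'm set) module" where
  "quot_module M N =
    \<lparr>carrier = a_rcosets\<^bsub>M\<^esub> N, monoid.mult = undefined, monoid.one = undefined,
     ring.zero = N,
     ring.add = (\<lambda>U V. U <+>\<^bsub>M\<^esub> V),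
     module.smult = (\<lambda>a U. \<Union>x\<in>U. N +>\<^bsub>M\<^esub> (a \<odot>\<^bsub>M\<^esub> x))\<rparr>"

definition quot_grade ::
  "('r, 'm, 'o) module_scheme \<Rightarrow> 'm set \<Rightarrow> ('g \<Rightarrow> 'm set) \<Rightarrow> 'g \<Rightarrow> 'm set set" where
  "quot_grade M N Mg g = (\<lambda>x. N +>\<^bsub>M\<^esub> x) ` Mg g"

definition annihilator :: "('r, 'l) ring_scheme \<Rightarrow> ('r, 'm, 'o) module_scheme \<Rightarrow> 'r set" where
  "annihilator R M = {a \<in> carrier R. \<forall>x\<in>carrier M. a \<odot>\<^bsub>M\<^esub> x = \<zero>\<^bsub>M\<^esub>}"

definition ideal_smult ::
  "('r, 'l) ring_scheme \<Rightarrow> 'r set \<Rightarrow> ('r, 'm) module \<Rightarrow> 'm set" where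
  "ideal_smult R I M = \<Inter>{N. submodule N R M \<and> (\<forall>a\<in>I. \<forall>x\<in>carrier M. a \<odot>\<^bsub>M\<^esub> x \<in> N)}"


section \<open>Localization of a module at the powers of one element\<close>

text \<open>\<open>frac R M s x a\<close> is the fraction \<open>x / s\<^sup>a\<close>, as an equivalence class of pairs.\<close>

definition frac ::
  "('r, 'l) ring_scheme \<Rightarrow> ('r, 'm, 'o) module_scheme \<Rightarrow> 'r \<Rightarrow> 'm \<Rightarrow> nat \<Rightarrow> ('m \<times> nat) set" where
  "frac R M s x a =
    {(y, b). y \<in> carrier M \<and>
       (\<exists>k. (s [^]\<^bsub>R\<^esub> (k + b)) \<odot>\<^bsub>M\<^esub> x = (s [^]\<^bsub>R\<^esub> (k + a)) \<odot>\<^bsub>M\<^esub> y)}"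

definition loc_module ::
  "('r, 'l) ring_scheme \<Rightarrow> ('r, 'm, 'o) module_scheme \<Rightarrow> 'r \<Rightarrow> ('r, ('m \<times> nat) set) module" where
  "loc_module R M s =
    \<lparr>carrier = {frac R M s x a | x a. x \<in> carrier M},
     monoid.mult = undefined, monoid.one = undefined,
     ring.zero = frac R M s \<zero>\<^bsub>M\<^esub> 0,
     ring.add = (\<lambda>C D. \<Union>(x, a)\<in>C. \<Union>(y, b)\<in>D.
       frac R M s ((s [^]\<^bsub>R\<^esub> b) \<odot>\<^bsub>M\<^esub> x \<oplus>\<^bsub>M\<^esub> (s [^]\<^bsub>R\<^esub> a) \<odot>\<^bsub>M\<^esub> y) (a + b)),
     module.smult = (\<lambda>r C. \<Union>(x, a)\<in>C. frac R M s (r \<odot>\<^bsub>M\<^esub> x) a)\<rparr>"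

text \<open>For homogeneous \<open>s\<close>, the fraction \<open>x / s\<^sup>a\<close> has degree \<open>deg x - a deg s\<close>. If \<open>s = 0\<close>, its
  degree \<open>d\<close> is not unique, but then the localization vanishes.\<close>

definition loc_grade ::
  "('g, 'k) monoid_scheme \<Rightarrow> ('r, 'l) ring_scheme \<Rightarrow> ('g \<Rightarrow> 'r set)
    \<Rightarrow> ('r, 'm, 'o) module_scheme \<Rightarrow> ('g \<Rightarrow> 'm set) \<Rightarrow> 'r \<Rightarrow> 'g \<Rightarrow> ('m \<times> nat) set set" where
  "loc_grade G R Rg M Mg s g =
    {frac R M s x a | x a. \<exists>d\<in>carrier G. s \<in> Rg d \<and> x \<in> Mg (g \<otimes>\<^bsub>G\<^esub> d [^]\<^bsub>G\<^esub> a)}"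


section \<open>The Cech complex on a list of elements\<close>

text \<open>Cohomological degrees are integers; in negative degrees there are no cells, and the modules
  of the complex and its cohomology are zero.\<close>

definition cech_cells :: "'r list \<Rightarrow> int \<Rightarrow> nat set set" where
  "cech_cells bs p = {\<sigma>. \<sigma> \<subseteq> {..<length bs} \<and> int (card \<sigma>) = p}"

definition cech_elem :: "('r, 'l) ring_scheme \<Rightarrow> 'r list \<Rightarrow> nat set \<Rightarrow> 'r" where
  "cech_elem R bs \<sigma> = (\<Otimes>\<^bsub>R\<^esub>i\<in>\<sigma>. bs ! i)"

definition cech_loc ::
  "('r, 'l) ring_scheme \<Rightarrow> 'r list \<Rightarrow> ('r, 'm, 'o) module_scheme \<Rightarrow> nat set
    \<Rightarrow> ('r, ('m \<times> nat) set) module" where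
  "cech_loc R bs M \<sigma> = loc_module R M (cech_elem R bs \<sigma>)"

definition cech_module ::
  "('r, 'l) ring_scheme \<Rightarrow> 'r list \<Rightarrow> ('r, 'm, 'o) module_scheme \<Rightarrow> int
    \<Rightarrow> ('r, nat set \<Rightarrow> ('m \<times> nat) set) module" where
  "cech_module R bs M p =
    \<lparr>carrier = (\<Pi>\<^sub>E \<sigma>\<in>cech_cells bs p. carrier (cech_loc R bs M \<sigma>)),
     monoid.mult = undefined, monoid.one = undefined,
     ring.zero = (\<lambda>\<sigma>\<in>cech_cells bs p. \<zero>\<^bsub>cech_loc R bs M \<sigma>\<^esub>),
     ring.add = (\<lambda>c d. \<lambda>\<sigma>\<in>cech_cells bs p. c \<sigma> \<oplus>\<^bsub>cech_loc R bs M \<sigma>\<^esub> d \<sigma>),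
     module.smult = (\<lambda>r c. \<lambda>\<sigma>\<in>cech_cells bs p. r \<odot>\<^bsub>cech_loc R bs M \<sigma>\<^esub> c \<sigma>)\<rparr>"

definition cech_grade ::
  "('g, 'k) monoid_scheme \<Rightarrow> ('r, 'l) ring_scheme \<Rightarrow> ('g \<Rightarrow> 'r set) \<Rightarrow> 'r list
    \<Rightarrow> ('r, 'm, 'o) module_scheme \<Rightarrow> ('g \<Rightarrow> 'm set) \<Rightarrow> int \<Rightarrow> 'g
    \<Rightarrow> (nat set \<Rightarrow> ('m \<times> nat) set) set" where
  "cech_grade G R Rg bs M Mg p g =
    (\<Pi>\<^sub>E \<sigma>\<in>cech_cells bs p. loc_grade G R Rg M Mg (cech_elem R bs \<sigma>) g)"

text \<open>The localization map from the component \<open>\<tau> - {i}\<close> to the component \<open>\<tau>\<close>, for \<open>i \<in> \<tau>\<close>: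
  with \<open>b\<^sub>\<tau>\<close> the product of the \<open>b\<^sub>j\<close> for \<open>j \<in> \<tau>\<close>, it sends \<open>x / (b\<^sub>\<tau> / b\<^sub>i)\<^sup>a\<close>
  to \<open>b\<^sub>i\<^sup>a x / b\<^sub>\<tau>\<^sup>a\<close>.\<close>

definition cech_res ::
  "('r, 'l) ring_scheme \<Rightarrow> 'r list \<Rightarrow> ('r, 'm, 'o) module_scheme \<Rightarrow> nat set \<Rightarrow> nat
    \<Rightarrow> ('m \<times> nat) set \<Rightarrow> ('m \<times> nat) set" where
  "cech_res R bs M \<tau> i C =
    the_elem ((\<lambda>(x, a). frac R M (cech_elem R bs \<tau>) (((bs ! i) [^]\<^bsub>R\<^esub> a) \<odot>\<^bsub>M\<^esub> x) a) ` C)"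

definition cech_diff ::
  "('r, 'l) ring_scheme \<Rightarrow> 'r list \<Rightarrow> ('r, 'm, 'o) module_scheme \<Rightarrow> int
    \<Rightarrow> (nat set \<Rightarrow> ('m \<times> nat) set) \<Rightarrow> (nat set \<Rightarrow> ('m \<times> nat) set)" where
  "cech_diff R bs M p c =
    (\<lambda>\<tau>\<in>cech_cells bs (p + 1).
      \<Oplus>\<^bsub>cech_loc R bs M \<tau>\<^esub>i\<in>\<tau>.
        ((\<ominus>\<^bsub>R\<^esub> \<one>\<^bsub>R\<^esub>) [^]\<^bsub>R\<^esub> card {j \<in> \<tau>. j < i}) \<odot>\<^bsub>cech_loc R bs M \<tau>\<^esub>
          cech_res R bs M \<tau> i (c (\<tau> - {i})))"

definition cech_cocycles ::
  "('r, 'l) ring_scheme \<Rightarrow> 'r list \<Rightarrow> ('r, 'm, 'o) module_scheme \<Rightarrow> int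
    \<Rightarrow> (nat set \<Rightarrow> ('m \<times> nat) set) set" where
  "cech_cocycles R bs M p =
    {c \<in> carrier (cech_module R bs M p). cech_diff R bs M p c = \<zero>\<^bsub>cech_module R bs M (p + 1)\<^esub>}"

definition cech_coboundaries ::
  "('r, 'l) ring_scheme \<Rightarrow> 'r list \<Rightarrow> ('r, 'm, 'o) module_scheme \<Rightarrow> int
    \<Rightarrow> (nat set \<Rightarrow> ('m \<times> nat) set) set" where
  "cech_coboundaries R bs M p = cech_diff R bs M (p - 1) ` carrier (cech_module R bs M (p - 1))"

definition cech_H ::
  "('r, 'l) ring_scheme \<Rightarrow> 'r list \<Rightarrow> ('r, 'm, 'o) module_scheme \<Rightarrow> int
    \<Rightarrow> ('r, (nat set \<Rightarrow> ('m \<times> nat) set) set) module" where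
  "cech_H R bs M p =
    quot_module ((cech_module R bs M p)\<lparr>carrier := cech_cocycles R bs M p\<rparr>)
      (cech_coboundaries R bs M p)"

definition cech_H_grade ::
  "('g, 'k) monoid_scheme \<Rightarrow> ('r, 'l) ring_scheme \<Rightarrow> ('g \<Rightarrow> 'r set) \<Rightarrow> 'r list
    \<Rightarrow> ('r, 'm, 'o) module_scheme \<Rightarrow> ('g \<Rightarrow> 'm set) \<Rightarrow> int \<Rightarrow> 'g
    \<Rightarrow> (nat set \<Rightarrow> ('m \<times> nat) set) set set" where
  "cech_H_grade G R Rg bs M Mg p =
    quot_grade ((cech_module R bs M p)\<lparr>carrier := cech_cocycles R bs M p\<rparr>)
      (cech_coboundaries R bs M p)
      (\<lambda>g. cech_cocycles R bs M p \<inter> cech_grade G R Rg bs M Mg p g)"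

definition cech_H_supp ::
  "('g, 'k) monoid_scheme \<Rightarrow> ('r, 'l) ring_scheme \<Rightarrow> ('g \<Rightarrow> 'r set) \<Rightarrow> 'r list
    \<Rightarrow> ('r, 'm, 'o) module_scheme \<Rightarrow> ('g \<Rightarrow> 'm set) \<Rightarrow> int \<Rightarrow> 'g set" where
  "cech_H_supp G R Rg bs M Mg p = supp G (cech_H R bs M p) (cech_H_grade G R Rg bs M Mg p)"

text \<open>The infimum is over integers \<open>i\<close>, hence is \<open>-\<infinity>\<close> if all the cohomology vanishes.\<close>

definition cech_cd :: "('r, 'l) ring_scheme \<Rightarrow> 'r list \<Rightarrow> ('r, 'm, 'o) module_scheme \<Rightarrow> ereal" where
  "cech_cd R bs M =
    (INF i\<in>{i::int. \<forall>j>i. carrier (cech_H R bs M j) = {\<zero>\<^bsub>cech_H R bs M j\<^esub>}}.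
      ereal (real_of_int i))"


section \<open>Induced maps in cohomology\<close>

definition loc_map ::
  "('r, 'l) ring_scheme \<Rightarrow> ('r, 'n, 'o) module_scheme \<Rightarrow> 'r \<Rightarrow> ('m \<Rightarrow> 'n)
    \<Rightarrow> ('m \<times> nat) set \<Rightarrow> ('n \<times> nat) set" where
  "loc_map R N s h C = the_elem ((\<lambda>(x, a). frac R N s (h x) a) ` C)"

definition cech_map ::
  "('r, 'l) ring_scheme \<Rightarrow> 'r list \<Rightarrow> ('r, 'n, 'o) module_scheme \<Rightarrow> ('m \<Rightarrow> 'n) \<Rightarrow> int
    \<Rightarrow> (nat set \<Rightarrow> ('m \<times> nat) set) \<Rightarrow> (nat set \<Rightarrow> ('n \<times> nat) set)" where
  "cech_map R bs N h p c = (\<lambda>\<sigma>\<in>cech_cells bs p. loc_map R N (cech_elem R bs \<sigma>) h (c \<sigma>))"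

definition cech_H_map ::
  "('r, 'l) ring_scheme \<Rightarrow> 'r list \<Rightarrow> ('r, 'n, 'o) module_scheme \<Rightarrow> ('m \<Rightarrow> 'n) \<Rightarrow> int
    \<Rightarrow> (nat set \<Rightarrow> ('m \<times> nat) set) set \<Rightarrow> (nat set \<Rightarrow> ('n \<times> nat) set) set" where
  "cech_H_map R bs N h p U =
    the_elem ((\<lambda>c. cech_coboundaries R bs N p +>\<^bsub>cech_module R bs N p\<^esub> cech_map R bs N h p c) ` U)"

text \<open>The natural map from \<open>H\<^sup>p(M) / I H\<^sup>p(M)\<close> to \<open>H\<^sup>p(M / I M)\<close>, obtained by factoring the map
  induced in cohomology by the projection of \<open>M\<close> onto \<open>M / I M\<close>.\<close>

definition cech_H_quot_map ::
  "('r, 'l) ring_scheme \<Rightarrow> 'r list \<Rightarrow> 'r set \<Rightarrow> ('r, 'm) module \<Rightarrow> int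
    \<Rightarrow> (nat set \<Rightarrow> ('m \<times> nat) set) set set \<Rightarrow> (nat set \<Rightarrow> ('m set \<times> nat) set) set" where
  "cech_H_quot_map R bs I M p V =
    the_elem (cech_H_map R bs (quot_module M (ideal_smult R I M))
      (\<lambda>x. ideal_smult R I M +>\<^bsub>M\<^esub> x) p ` V)"


section \<open>Sums of degrees of distinct generators\<close>

definition deg_sums :: "('g, 'k) monoid_scheme \<Rightarrow> nat \<Rightarrow> (nat \<Rightarrow> 'g) \<Rightarrow> nat \<Rightarrow> 'g set" where
  "deg_sums G r \<delta> i = {\<Otimes>\<^bsub>G\<^esub>j\<in>J. \<delta> j | J. J \<subseteq> {..<r} \<and> card J = i}"

end

theory Submission
  imports Defs
begin

text \<open>
  In terms of spectral sequences, the statement compares the two ways of computing the cohomology of the double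
  complex formed by the Cech complex of \<open>M\<close> in one direction and the Koszul complex of
  \<open>f\<^sub>1, \<dots>, f\<^sub>r\<close> in the other. If the Koszul homology is taken first, nothing is left in the Cech
  degrees above \<open>cd = cd\<^sub>B (R / (I + ann M))\<close>, because the Koszul homology is killed by
  \<open>I + ann M\<close>; if the Cech cohomology is taken first, the pieces are the modules
  \<open>H\<^sup>p(M)\<close>, shifted by sums of the degrees \<open>\<delta>\<^sub>j\<close>. The hypotheses on \<open>g\<close> say that the pieces of
  degree \<open>g\<close> that could interfere are zero. Below, the comparison is carried out as a diagram chase with
  elements.

  A Cech cochain has finitely many entries, so it is a family of fractions
  \<open>x\<^sub>\<rho> / b\<^sub>\<rho>\<^sup>a\<close> with a common exponent, and the Cech complex is the colimit over \<open>a\<close> of alternating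
  complexes of families of numerators. A statement about cohomology becomes a statement about numerators that
  holds after multiplication by some power of the \<open>b\<^sub>\<rho>\<close>. The same alternating complex, for the
  sequence \<open>f\<close> and \<open>a = 1\<close>, is the Koszul complex: the generator indexed by a set is placed at
  the complement of that set.

  The lemma \<open>rel_exact_of_killed\<close> says that a subquotient \<open>Z / N\<close> killed by an ideal
  \<open>J\<close> is exact in degree \<open>p\<close> if \<open>R / J\<close> is exact in all degrees from \<open>p\<close> on. The reason is descending
  induction on the degree: a cocycle lifts to a finite free module that maps onto the submodule generated by its entries, and
  the failure of the lift to be a cocycle lives in the relations, one degree higher.

  By \<open>cdiff_contraction\<close>, multiplication by \<open>f\<^sub>j\<close> is null-homotopic on the Koszul
  complex, so the preceding paragraph applies to the Koszul homology. The lemma \<open>lift_to_cocycle\<close> then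
  replaces, in Cech degrees at least \<open>cd\<close>, a Koszul chain whose Cech differential is a Koszul cycle by a Cech
  cocycle with the same Koszul boundary. Three consequences give the theorem: \<open>vanishes_above\<close> is
  part (a), \<open>cocycle_in_image\<close> gives the injectivity in part (b) and \<open>lift_cocycle_mod_image\<close> the
  surjectivity.

  The corrections provided by \<open>rel_exact_of_killed\<close> carry no degree, but the projections to homogeneous
  components commute with both differentials, so at each step the corrections may be replaced by their
  components of the right degree.
\<close>

section \<open>Additive maps, linear maps and finite sums\<close>

text \<open>The projections to homogeneous components are additive but not linear, hence two kinds of maps.\<close>

definition additive_map ::
  "('x, 'k) ring_scheme \<Rightarrow> ('y, 'l) ring_scheme \<Rightarrow> ('x \<Rightarrow> 'y) \<Rightarrow> bool" where
  "additive_map P Q h \<longleftrightarrow> h \<in> carrier P \<rightarrow> carrier Q \<and>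
    (\<forall>x\<in>carrier P. \<forall>y\<in>carrier P. h (x \<oplus>\<^bsub>P\<^esub> y) = h x \<oplus>\<^bsub>Q\<^esub> h y)"

definition linear_map ::
  "('r, 'q) ring_scheme \<Rightarrow> ('r, 'x, 'k) module_scheme \<Rightarrow> ('r, 'y, 'l) module_scheme \<Rightarrow> ('x \<Rightarrow> 'y) \<Rightarrow> bool" where
  "linear_map R P Q h \<longleftrightarrow> additive_map P Q h \<and>
    (\<forall>r\<in>carrier R. \<forall>x\<in>carrier P. h (r \<odot>\<^bsub>P\<^esub> x) = r \<odot>\<^bsub>Q\<^esub> h x)"

lemma additive_map_closed: "additive_map P Q h \<Longrightarrow> x \<in> carrier P \<Longrightarrow> h x \<in> carrier Q"
  by (auto simp: additive_map_def)

lemma additive_map_add: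
  "additive_map P Q h \<Longrightarrow> x \<in> carrier P \<Longrightarrow> y \<in> carrier P \<Longrightarrow> h (x \<oplus>\<^bsub>P\<^esub> y) = h x \<oplus>\<^bsub>Q\<^esub> h y"
  by (auto simp: additive_map_def)

lemma additive_map_zero:
  assumes "abelian_group P" "abelian_group Q" "additive_map P Q h"
  shows "h \<zero>\<^bsub>P\<^esub> = \<zero>\<^bsub>Q\<^esub>"
proof -
  interpret P: abelian_group P by fact
  interpret Q: abelian_group Q by fact
  have "h \<zero>\<^bsub>P\<^esub> \<oplus>\<^bsub>Q\<^esub> h \<zero>\<^bsub>P\<^esub> = h \<zero>\<^bsub>P\<^esub>"
    using additive_map_add[OF assms(3), of "\<zero>\<^bsub>P\<^esub>" "\<zero>\<^bsub>P\<^esub>"] by simp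
  then show ?thesis
    using additive_map_closed[OF assms(3) P.zero_closed] Q.add.r_cancel_one' by metis
qed

lemma additive_map_minus:
  assumes "abelian_group P" "abelian_group Q" "additive_map P Q h" "x \<in> carrier P"
  shows "h (\<ominus>\<^bsub>P\<^esub> x) = \<ominus>\<^bsub>Q\<^esub> h x"
proof -
  interpret P: abelian_group P by fact
  interpret Q: abelian_group Q by fact
  have "h (\<ominus>\<^bsub>P\<^esub> x) \<oplus>\<^bsub>Q\<^esub> h x = \<zero>\<^bsub>Q\<^esub>"
    using additive_map_add[OF assms(3), of "\<ominus>\<^bsub>P\<^esub> x" x] additive_map_zero[OF assms(1-3)] assms(4)
    by (simp add: P.l_neg)
  then show ?thesis
    using additive_map_closed[OF assms(3)] assms(4) Q.minus_equality by (metis P.a_inv_closed)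
qed

lemma additive_map_diff:
  assumes "abelian_group P" "abelian_group Q" "additive_map P Q h" "x \<in> carrier P" "y \<in> carrier P"
  shows "h (x \<ominus>\<^bsub>P\<^esub> y) = h x \<ominus>\<^bsub>Q\<^esub> h y"
proof -
  interpret P: abelian_group P by fact
  show ?thesis
    using additive_map_add[OF assms(3)] additive_map_minus[OF assms(1-3)] assms(4,5)
    by (simp add: a_minus_def)
qed

lemma additive_map_finsum:
  assumes "abelian_group P" "abelian_group Q" "additive_map P Q h" "f \<in> A \<rightarrow> carrier P"
  shows "h (\<Oplus>\<^bsub>P\<^esub>i\<in>A. f i) = (\<Oplus>\<^bsub>Q\<^esub>i\<in>A. h (f i))"
proof -
  interpret P: abelian_group P by fact
  interpret Q: abelian_group Q by fact
  show ?thesis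
  proof (cases "finite A")
    case True
    then show ?thesis using assms(4)
    proof (induction A)
      case empty
      then show ?case using additive_map_zero[OF assms(1-3)] by simp
    next
      case (insert a A)
      then have "f \<in> A \<rightarrow> carrier P" "f a \<in> carrier P" by auto
      moreover have "(\<lambda>i. h (f i)) \<in> A \<rightarrow> carrier Q" "h (f a) \<in> carrier Q"
        using calculation additive_map_closed[OF assms(3)] by auto
      ultimately show ?case
        using insert additive_map_add[OF assms(3)] by simp
    qed
  next
    case False
    then show ?thesis using additive_map_zero[OF assms(1-3)] by simp
  qed
qed

lemma linear_map_additive: "linear_map R P Q h \<Longrightarrow> additive_map P Q h"
  by (simp add: linear_map_def)

lemma linear_map_smult:
  "linear_map R P Q h \<Longrightarrow> r \<in> carrier R \<Longrightarrow> x \<in> carrier P \<Longrightarrow> h (r \<odot>\<^bsub>P\<^esub> x) = r \<odot>\<^bsub>Q\<^esub> h x"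
  by (simp add: linear_map_def)

context abelian_group
begin

lemma finsum_neg:
  "f \<in> A \<rightarrow> carrier G \<Longrightarrow> (\<Oplus>i\<in>A. \<ominus> f i) = \<ominus> (\<Oplus>i\<in>A. f i)"
proof -
  assume "f \<in> A \<rightarrow> carrier G"
  moreover have "additive_map G G (\<lambda>x. \<ominus> x)"
    by (auto simp: additive_map_def minus_add)
  ultimately show ?thesis
    using additive_map_finsum[OF abelian_group_axioms abelian_group_axioms, of "\<lambda>x. \<ominus> x" f A] by simp
qed

lemma finsum_all_zero: "(\<And>i. i \<in> A \<Longrightarrow> f i = \<zero>) \<Longrightarrow> (\<Oplus>i\<in>A. f i) = \<zero>"
  by (metis add.finprod_one_eqI)

lemma finsum_one_nonzero:
  assumes "finite A" "i \<in> A" "f i \<in> carrier G" "\<And>j. j \<in> A \<Longrightarrow> j \<noteq> i \<Longrightarrow> f j = \<zero>"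
  shows "(\<Oplus>j\<in>A. f j) = f i"
proof -
  have "A = insert i (A - {i})" using assms by auto
  moreover have "(\<Oplus>j\<in>A - {i}. f j) = \<zero>" using assms by (intro finsum_all_zero) auto
  moreover have "f \<in> A - {i} \<rightarrow> carrier G" using assms by auto
  ultimately show ?thesis
    using finsum_insert[of "A - {i}" i f] assms by simp
qed

text \<open>The terms cancel in pairs, by induction on the index set. To observe that the sum equals its own
  negative would not suffice, because of 2-torsion.\<close>

lemma finsum_antisym_zero:
  assumes "finite A" "\<And>i j. i \<in> A \<Longrightarrow> j \<in> A \<Longrightarrow> i \<noteq> j \<Longrightarrow> F i j \<in> carrier G"
    and "\<And>i j. i \<in> A \<Longrightarrow> j \<in> A \<Longrightarrow> i \<noteq> j \<Longrightarrow> F j i = \<ominus> F i j"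
  shows "(\<Oplus>i\<in>A. \<Oplus>j\<in>A - {i}. F i j) = \<zero>"
  using assms
proof (induction A)
  case empty
  show ?case by simp
next
  case (insert k A)
  have c: "F i j \<in> carrier G" if "i \<in> insert k A" "j \<in> insert k A" "i \<noteq> j" for i j
    using insert.prems(1) that by blast
  have 1: "(\<Oplus>j\<in>insert k A - {i}. F i j) = F i k \<oplus> (\<Oplus>j\<in>A - {i}. F i j)" if "i \<in> A" for i
  proof -
    have e: "insert k A - {i} = insert k (A - {i})" using that insert.hyps by auto
    have "(\<lambda>j. F i j) \<in> A - {i} \<rightarrow> carrier G" using c that by auto
    moreover have "F i k \<in> carrier G" using c[of i k] that insert.hyps by auto
    ultimately show ?thesis unfolding e using insert.hyps by (subst finsum_insert) auto
  qed
  have 2: "insert k A - {k} = A" using insert.hyps by auto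
  have ck: "(\<lambda>j. F k j) \<in> A \<rightarrow> carrier G" using c insert.hyps by auto
  have ck': "(\<lambda>j. F j k) \<in> A \<rightarrow> carrier G" using c insert.hyps by auto
  have ci: "(\<Oplus>j\<in>A - {i}. F i j) \<in> carrier G" if "i \<in> A" for i
    using c that by (intro finsum_closed) auto
  have "(\<Oplus>i\<in>insert k A. \<Oplus>j\<in>insert k A - {i}. F i j)
      = (\<Oplus>j\<in>A. F k j) \<oplus> (\<Oplus>i\<in>A. \<Oplus>j\<in>insert k A - {i}. F i j)"
    using insert.hyps 2 ck ci 1 funcset_mem[OF ck'] by (subst finsum_insert) (auto intro!: finsum_closed)
  also have "(\<Oplus>i\<in>A. \<Oplus>j\<in>insert k A - {i}. F i j) = (\<Oplus>i\<in>A. F i k \<oplus> (\<Oplus>j\<in>A - {i}. F i j))"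
    using 1 ci ck' by (intro finsum_cong') auto
  also have "\<dots> = (\<Oplus>i\<in>A. F i k) \<oplus> (\<Oplus>i\<in>A. \<Oplus>j\<in>A - {i}. F i j)"
    using ci ck' by (intro finsum_addf) auto
  also have "(\<Oplus>i\<in>A. \<Oplus>j\<in>A - {i}. F i j) = \<zero>"
    by (rule insert.IH) (use insert.prems(1) in blast, rule insert.prems(2), auto)
  also have "(\<Oplus>i\<in>A. F i k) = (\<Oplus>i\<in>A. \<ominus> F k i)"
    using insert.prems(2)[of k] insert.hyps ck by (intro finsum_cong') auto
  also have "\<dots> = \<ominus> (\<Oplus>j\<in>A. F k j)" by (rule finsum_neg[OF ck])
  finally show ?case using ck by (simp add: r_neg)
qed

lemma minus_eq_zero_iff: "x \<in> carrier G \<Longrightarrow> y \<in> carrier G \<Longrightarrow> x \<ominus> y = \<zero> \<longleftrightarrow> x = y"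
  by (metis a_minus_def minus_equality minus_minus r_neg a_inv_closed)

end

section \<open>The alternating differential\<close>

definition cells :: "nat \<Rightarrow> int \<Rightarrow> nat set set" where
  "cells s p = {\<rho>. \<rho> \<subseteq> {..<s} \<and> int (card \<rho>) = p}"

definition dcoef :: "('r, 'l) ring_scheme \<Rightarrow> (nat \<Rightarrow> 'r) \<Rightarrow> nat \<Rightarrow> nat set \<Rightarrow> nat \<Rightarrow> 'r" where
  "dcoef R b a \<tau> i = (\<ominus>\<^bsub>R\<^esub> \<one>\<^bsub>R\<^esub>) [^]\<^bsub>R\<^esub> card {j \<in> \<tau>. j < i} \<otimes>\<^bsub>R\<^esub> b i [^]\<^bsub>R\<^esub> a"

text \<open>If the family \<open>x\<close> consists of the numerators of a Cech cochain with denominators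
  \<open>b\<^sub>\<rho>\<^sup>a\<close>, these are the numerators of its differential, with the same exponent. For \<open>a = 1\<close> this is
  also the differential of the Koszul cochain complex of the sequence \<open>b\<close>.\<close>

definition cdiff ::
  "('r, 'l) ring_scheme \<Rightarrow> ('r, 'x, 'o) module_scheme \<Rightarrow> (nat \<Rightarrow> 'r) \<Rightarrow> nat \<Rightarrow> (nat set \<Rightarrow> 'x)
    \<Rightarrow> nat set \<Rightarrow> 'x" where
  "cdiff R P b a x \<tau> = (\<Oplus>\<^bsub>P\<^esub>i\<in>\<tau>. dcoef R b a \<tau> i \<odot>\<^bsub>P\<^esub> x (\<tau> - {i}))"

definition bprod :: "('r, 'l) ring_scheme \<Rightarrow> (nat \<Rightarrow> 'r) \<Rightarrow> nat set \<Rightarrow> 'r" where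
  "bprod R b \<rho> = (\<Otimes>\<^bsub>R\<^esub>i\<in>\<rho>. b i)"

lemma cells_finite: "\<rho> \<in> cells s p \<Longrightarrow> finite \<rho>"
  by (auto simp: cells_def dest: finite_subset)

lemma finite_cells: "finite (cells s p)"
  by (rule finite_subset[of _ "Pow {..<s}"]) (auto simp: cells_def)

lemma cells_remove: "\<tau> \<in> cells s (p + 1) \<Longrightarrow> i \<in> \<tau> \<Longrightarrow> \<tau> - {i} \<in> cells s p"
  using cells_finite[of \<tau> s "p + 1"]
  by (auto simp: cells_def card_Diff_singleton) (metis One_nat_def Suc_pred card_gt_0_iff
      empty_iff of_nat_Suc add.commute add_left_cancel)

lemma cells_remove': "\<tau> \<in> cells s p \<Longrightarrow> i \<in> \<tau> \<Longrightarrow> \<tau> - {i} \<in> cells s (p - 1)"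
  using cells_remove[of \<tau> s "p - 1"] by simp

lemma cells_above: "p > int s \<Longrightarrow> cells s p = {}"
  using card_mono[of "{..<s}"] unfolding cells_def
  by (simp, metis finite_lessThan card_lessThan linorder_not_less of_nat_le_iff)

lemma cells_below: "p < 0 \<Longrightarrow> cells s p = {}"
  by (auto simp: cells_def)

lemma cells_top: "cells s (int s) = {{..<s}}"
  using card_subset_eq[of "{..<s}"] by (auto simp: cells_def)

lemma (in cring) neg_one_pow_closed [simp, intro]: "(\<ominus> \<one>) [^] (k::nat) \<in> carrier R"
  by simp

lemma (in cring) dcoef_closed [simp]: "b \<in> UNIV \<rightarrow> carrier R \<Longrightarrow> dcoef R b a \<tau> i \<in> carrier R"
  by (simp add: dcoef_def Pi_iff)

lemma (in cring) bprod_closed [simp]: "b \<in> UNIV \<rightarrow> carrier R \<Longrightarrow> bprod R b \<rho> \<in> carrier R"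
  by (simp add: bprod_def Pi_iff)

lemma (in cring) bprod_remove:
  assumes "b \<in> UNIV \<rightarrow> carrier R" "finite \<tau>" "i \<in> \<tau>"
  shows "bprod R b \<tau> = b i \<otimes> bprod R b (\<tau> - {i})"
proof -
  have "\<tau> = insert i (\<tau> - {i})" using assms by auto
  moreover have "bprod R b (insert i (\<tau> - {i})) = b i \<otimes> bprod R b (\<tau> - {i})"
    unfolding bprod_def using assms by (intro finprod_insert) auto
  ultimately show ?thesis by simp
qed

lemma (in cring) sign_swap_less:
  fixes \<tau> :: "nat set"
  assumes "finite \<tau>" "i \<in> \<tau>" "i < j"
  shows "(\<ominus> \<one>) [^] card {k \<in> \<tau>. k < j} \<otimes> (\<ominus> \<one>) [^] card {k \<in> \<tau> - {j}. k < i}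
    = \<ominus> ((\<ominus> \<one>) [^] card {k \<in> \<tau>. k < i} \<otimes> (\<ominus> \<one>) [^] card {k \<in> \<tau> - {i}. k < j})"
proof -
  have "{k \<in> \<tau>. k < j} = insert i {k \<in> \<tau> - {i}. k < j}" using assms by auto
  then have 1: "card {k \<in> \<tau>. k < j} = Suc (card {k \<in> \<tau> - {i}. k < j})"
    using assms by simp
  have 2: "{k \<in> \<tau> - {j}. k < i} = {k \<in> \<tau>. k < i}" using assms(3) by auto
  have "x \<otimes> \<ominus> \<one> \<otimes> y = \<ominus> (y \<otimes> x)" if "x \<in> carrier R" "y \<in> carrier R" for x y
  proof -
    have "x \<otimes> \<ominus> \<one> \<otimes> y = \<ominus> (x \<otimes> y)" using that by (simp add: l_minus r_minus)
    then show ?thesis using m_comm[OF that] by (simp only:)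
  qed
  then show ?thesis unfolding 1 2 nat_pow_Suc by (simp only: neg_one_pow_closed)
qed

text \<open>Of two elements removed in either order, only the removal of the smaller one changes the number of elements
  below the other. All the relations between alternating sums below come from this change of sign.\<close>

lemma (in cring) sign_swap:
  fixes \<tau> :: "nat set"
  assumes "finite \<tau>" "i \<in> \<tau>" "j \<in> \<tau>" "i \<noteq> j"
  shows "(\<ominus> \<one>) [^] card {k \<in> \<tau>. k < j} \<otimes> (\<ominus> \<one>) [^] card {k \<in> \<tau> - {j}. k < i}
    = \<ominus> ((\<ominus> \<one>) [^] card {k \<in> \<tau>. k < i} \<otimes> (\<ominus> \<one>) [^] card {k \<in> \<tau> - {i}. k < j})"
proof (cases "i < j")
  case True
  then show ?thesis using sign_swap_less assms by blast
next
  case False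
  then have "j < i" using assms by simp
  then show ?thesis
    using sign_swap_less[OF assms(1,3)] by (metis (no_types, lifting) m_closed minus_minus neg_one_pow_closed)
qed

lemma (in cring) dcoef_swap:
  assumes b: "b \<in> UNIV \<rightarrow> carrier R" and "finite \<tau>" "i \<in> \<tau>" "j \<in> \<tau>" "i \<noteq> j"
  shows "dcoef R b a \<tau> j \<otimes> dcoef R b a (\<tau> - {j}) i
    = \<ominus> (dcoef R b a \<tau> i \<otimes> dcoef R b a (\<tau> - {i}) j)"
proof -
  let ?s = "\<lambda>T i. (\<ominus> \<one>) [^] card {k \<in> T. k < i}"
  have bc: "b i [^] a \<in> carrier R" for i using b by auto
  have "dcoef R b a \<tau> j \<otimes> dcoef R b a (\<tau> - {j}) i
    = (?s \<tau> j \<otimes> ?s (\<tau> - {j}) i) \<otimes> (b i [^] a \<otimes> b j [^] a)"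
    unfolding dcoef_def using bc by (simp add: m_ac)
  also have "\<dots> = (\<ominus> (?s \<tau> i \<otimes> ?s (\<tau> - {i}) j)) \<otimes> (b i [^] a \<otimes> b j [^] a)"
    using sign_swap[OF assms(2-5)] by simp
  also have "\<dots> = \<ominus> (dcoef R b a \<tau> i \<otimes> dcoef R b a (\<tau> - {i}) j)"
    unfolding dcoef_def using bc by (simp add: m_ac l_minus r_minus)
  finally show ?thesis .
qed

lemma (in cring) sign_square: "(\<ominus> \<one>) [^] (k::nat) \<otimes> (\<ominus> \<one>) [^] k = \<one>"
  by (induction k) (auto simp: m_ac l_minus r_minus)

lemma (in cring) sign_transfer:
  assumes "u \<in> carrier R" "v \<in> carrier R" "w \<in> carrier R" "y \<in> carrier R"
    and "u \<otimes> w = \<ominus> (v \<otimes> y)" "u \<otimes> u = \<one>" "y \<otimes> y = \<one>"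
  shows "w \<otimes> y = \<ominus> (u \<otimes> v)"
proof -
  have "w \<otimes> y = u \<otimes> u \<otimes> w \<otimes> y" using assms(3,4,6) by simp
  also have "\<dots> = u \<otimes> (u \<otimes> w) \<otimes> y" using assms(1-4) by (simp add: m_assoc)
  also have "\<dots> = \<ominus> (u \<otimes> v \<otimes> (y \<otimes> y))"
    unfolding assms(5) using assms(1-4) by (simp add: l_minus r_minus m_assoc)
  finally show ?thesis using assms by simp
qed

context module
begin

lemma cdiff_closed:
  "b \<in> UNIV \<rightarrow> carrier R \<Longrightarrow> (\<And>\<rho>. x \<rho> \<in> carrier M) \<Longrightarrow> cdiff R M b a x \<tau> \<in> carrier M"
  unfolding cdiff_def by (intro finsum_closed) auto

lemma cdiff_cong:
  assumes "b \<in> UNIV \<rightarrow> carrier R" "\<And>\<rho>. y \<rho> \<in> carrier M" "\<And>i. i \<in> \<tau> \<Longrightarrow> x (\<tau> - {i}) = y (\<tau> - {i})"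
  shows "cdiff R M b a x \<tau> = cdiff R M b a y \<tau>"
  unfolding cdiff_def using assms by (intro finsum_cong') auto

lemma cdiff_zero: "b \<in> UNIV \<rightarrow> carrier R \<Longrightarrow> cdiff R M b a (\<lambda>_. \<zero>\<^bsub>M\<^esub>) \<tau> = \<zero>\<^bsub>M\<^esub>"
  unfolding cdiff_def by (intro M.finsum_all_zero) auto

lemma cdiff_add:
  assumes "b \<in> UNIV \<rightarrow> carrier R" "\<And>\<rho>. x \<rho> \<in> carrier M" "\<And>\<rho>. y \<rho> \<in> carrier M"
  shows "cdiff R M b a (\<lambda>\<rho>. x \<rho> \<oplus>\<^bsub>M\<^esub> y \<rho>) \<tau> = cdiff R M b a x \<tau> \<oplus>\<^bsub>M\<^esub> cdiff R M b a y \<tau>"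
proof -
  have "cdiff R M b a (\<lambda>\<rho>. x \<rho> \<oplus>\<^bsub>M\<^esub> y \<rho>) \<tau>
    = (\<Oplus>\<^bsub>M\<^esub>i\<in>\<tau>. dcoef R b a \<tau> i \<odot>\<^bsub>M\<^esub> x (\<tau> - {i}) \<oplus>\<^bsub>M\<^esub> dcoef R b a \<tau> i \<odot>\<^bsub>M\<^esub> y (\<tau> - {i}))"
    unfolding cdiff_def using assms by (intro finsum_cong') (auto simp: smult_r_distr)
  also have "\<dots> = cdiff R M b a x \<tau> \<oplus>\<^bsub>M\<^esub> cdiff R M b a y \<tau>"
    unfolding cdiff_def using assms by (intro finsum_addf) auto
  finally show ?thesis .
qed

lemma cdiff_smult:
  assumes "b \<in> UNIV \<rightarrow> carrier R" "\<And>\<rho>. x \<rho> \<in> carrier M" "r \<in> carrier R"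
  shows "cdiff R M b a (\<lambda>\<rho>. r \<odot>\<^bsub>M\<^esub> x \<rho>) \<tau> = r \<odot>\<^bsub>M\<^esub> cdiff R M b a x \<tau>"
proof (cases "finite \<tau>")
  case True
  have "r \<odot>\<^bsub>M\<^esub> cdiff R M b a x \<tau> = (\<Oplus>\<^bsub>M\<^esub>i\<in>\<tau>. r \<odot>\<^bsub>M\<^esub> (dcoef R b a \<tau> i \<odot>\<^bsub>M\<^esub> x (\<tau> - {i})))"
    unfolding cdiff_def using assms True by (intro finsum_smult_ldistr) auto
  also have "\<dots> = cdiff R M b a (\<lambda>\<rho>. r \<odot>\<^bsub>M\<^esub> x \<rho>) \<tau>"
    unfolding cdiff_def using assms
    by (intro finsum_cong') (auto simp flip: smult_assoc1 simp: R.m_comm)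
  finally show ?thesis by simp
next
  case False
  then show ?thesis unfolding cdiff_def using assms by simp
qed

lemma cdiff_minus:
  assumes "b \<in> UNIV \<rightarrow> carrier R" "\<And>\<rho>. x \<rho> \<in> carrier M"
  shows "cdiff R M b a (\<lambda>\<rho>. \<ominus>\<^bsub>M\<^esub> x \<rho>) \<tau> = \<ominus>\<^bsub>M\<^esub> cdiff R M b a x \<tau>"
proof -
  have "cdiff R M b a (\<lambda>\<rho>. \<ominus>\<^bsub>M\<^esub> x \<rho>) \<tau> = cdiff R M b a (\<lambda>\<rho>. (\<ominus> \<one>) \<odot>\<^bsub>M\<^esub> x \<rho>) \<tau>"
    using assms by (intro cdiff_cong) (auto simp: smult_l_minus)
  then show ?thesis
    using cdiff_smult[OF assms, of "\<ominus> \<one>"] cdiff_closed[OF assms] by (simp add: smult_l_minus)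
qed

lemma cdiff_diff:
  assumes "b \<in> UNIV \<rightarrow> carrier R" "\<And>\<rho>. x \<rho> \<in> carrier M" "\<And>\<rho>. y \<rho> \<in> carrier M"
  shows "cdiff R M b a (\<lambda>\<rho>. x \<rho> \<ominus>\<^bsub>M\<^esub> y \<rho>) \<tau> = cdiff R M b a x \<tau> \<ominus>\<^bsub>M\<^esub> cdiff R M b a y \<tau>"
  unfolding a_minus_def
  using assms by (simp add: cdiff_add cdiff_minus)

text \<open>Expanding all the fractions by the same power is a map of complexes: these maps make the complexes for
  the various exponents a directed system, whose colimit is the Cech complex.\<close>

lemma cdiff_shift:
  assumes b: "b \<in> UNIV \<rightarrow> carrier R" and x: "\<And>\<rho>. x \<rho> \<in> carrier M" and "finite \<tau>"
  shows "cdiff R M b (a + k) (\<lambda>\<rho>. bprod R b \<rho> [^] k \<odot>\<^bsub>M\<^esub> x \<rho>) \<tau>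
    = bprod R b \<tau> [^] k \<odot>\<^bsub>M\<^esub> cdiff R M b a x \<tau>"
proof -
  have "dcoef R b (a + k) \<tau> i \<odot>\<^bsub>M\<^esub> (bprod R b (\<tau> - {i}) [^] k \<odot>\<^bsub>M\<^esub> x (\<tau> - {i}))
      = bprod R b \<tau> [^] k \<odot>\<^bsub>M\<^esub> (dcoef R b a \<tau> i \<odot>\<^bsub>M\<^esub> x (\<tau> - {i}))" if i: "i \<in> \<tau>" for i
  proof -
    have bi: "b i \<in> carrier R" using b by auto
    have "dcoef R b (a + k) \<tau> i \<otimes> bprod R b (\<tau> - {i}) [^] k = bprod R b \<tau> [^] k \<otimes> dcoef R b a \<tau> i"
      unfolding dcoef_def bprod_remove[OF b \<open>finite \<tau>\<close> i]
      using bi b by (simp add: R.nat_pow_mult[symmetric] R.nat_pow_distrib R.m_ac)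
    then show ?thesis using b x by (simp flip: smult_assoc1)
  qed
  then have "cdiff R M b (a + k) (\<lambda>\<rho>. bprod R b \<rho> [^] k \<odot>\<^bsub>M\<^esub> x \<rho>) \<tau>
    = (\<Oplus>\<^bsub>M\<^esub>i\<in>\<tau>. bprod R b \<tau> [^] k \<odot>\<^bsub>M\<^esub> (dcoef R b a \<tau> i \<odot>\<^bsub>M\<^esub> x (\<tau> - {i})))"
    unfolding cdiff_def using b x by (intro finsum_cong') auto
  also have "\<dots> = bprod R b \<tau> [^] k \<odot>\<^bsub>M\<^esub> cdiff R M b a x \<tau>"
    unfolding cdiff_def using b x assms(3) by (intro finsum_smult_ldistr[symmetric]) auto
  finally show ?thesis .
qed

lemma cdiff_cdiff:
  assumes b: "b \<in> UNIV \<rightarrow> carrier R" and x: "\<And>\<rho>. x \<rho> \<in> carrier M" and fin: "finite \<tau>"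
  shows "cdiff R M b a (cdiff R M b a x) \<tau> = \<zero>\<^bsub>M\<^esub>"
proof -
  let ?F = "\<lambda>i j. (dcoef R b a \<tau> i \<otimes> dcoef R b a (\<tau> - {i}) j) \<odot>\<^bsub>M\<^esub> x (\<tau> - {i} - {j})"
  have "dcoef R b a \<tau> i \<odot>\<^bsub>M\<^esub> cdiff R M b a x (\<tau> - {i}) = (\<Oplus>\<^bsub>M\<^esub>j\<in>\<tau> - {i}. ?F i j)" for i
  proof -
    have "dcoef R b a \<tau> i \<odot>\<^bsub>M\<^esub> cdiff R M b a x (\<tau> - {i}) =
      (\<Oplus>\<^bsub>M\<^esub>j\<in>\<tau> - {i}. dcoef R b a \<tau> i \<odot>\<^bsub>M\<^esub> (dcoef R b a (\<tau> - {i}) j \<odot>\<^bsub>M\<^esub> x (\<tau> - {i} - {j})))"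
      unfolding cdiff_def using b x fin by (intro finsum_smult_ldistr) auto
    then show ?thesis using b x by (simp add: smult_assoc1)
  qed
  then have "cdiff R M b a (cdiff R M b a x) \<tau> = (\<Oplus>\<^bsub>M\<^esub>i\<in>\<tau>. \<Oplus>\<^bsub>M\<^esub>j\<in>\<tau> - {i}. ?F i j)"
    unfolding cdiff_def[of _ _ _ _ "cdiff R M b a x"] by simp
  also have "\<dots> = \<zero>\<^bsub>M\<^esub>"
  proof (rule M.finsum_antisym_zero[OF fin])
    fix i j assume ij: "i \<in> \<tau>" "j \<in> \<tau>" "i \<noteq> j"
    show "?F i j \<in> carrier M" using b x by simp
    have "\<tau> - {j} - {i} = \<tau> - {i} - {j}" by auto
    then show "?F j i = \<ominus>\<^bsub>M\<^esub> ?F i j"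
      using dcoef_swap[OF b fin ij] b x by (simp add: smult_l_minus)
  qed
  finally show ?thesis .
qed

text \<open>Contraction by \<open>j\<close> is a homotopy. For \<open>j \<in> \<tau>\<close> a single term of the sum survives; for \<open>j \<notin> \<tau>\<close> the sum is,
  up to sign, the differential of \<open>z\<close> at \<open>insert j \<tau>\<close> without its term at \<open>\<tau>\<close>. Hence the elements of the
  sequence annihilate Koszul cohomology.\<close>

lemma cdiff_contraction:
  assumes b: "b \<in> UNIV \<rightarrow> carrier R" and z: "\<And>\<rho>. z \<rho> \<in> carrier M" and fin: "finite \<tau>"
    and cocycle: "j \<notin> \<tau> \<Longrightarrow> cdiff R M b 1 z (insert j \<tau>) = \<zero>\<^bsub>M\<^esub>"
  shows "cdiff R M b 1 (\<lambda>\<rho>. if j \<in> \<rho> then \<zero>\<^bsub>M\<^esub>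
      else (\<ominus> \<one>) [^] card {k \<in> insert j \<rho>. k < j} \<odot>\<^bsub>M\<^esub> z (insert j \<rho>)) \<tau> = b j \<odot>\<^bsub>M\<^esub> z \<tau>"
    (is "cdiff R M b 1 ?h \<tau> = _")
proof (cases "j \<in> \<tau>")
  case True
  have bj: "b j \<in> carrier R" using b by auto
  have "dcoef R b 1 \<tau> j \<odot>\<^bsub>M\<^esub> ?h (\<tau> - {j}) = b j \<odot>\<^bsub>M\<^esub> z \<tau>"
  proof -
    have "insert j (\<tau> - {j}) = \<tau>" using True by auto
    moreover have "dcoef R b 1 \<tau> j \<otimes> (\<ominus> \<one>) [^] card {k \<in> \<tau>. k < j} = b j"
      using bj sign_square[of "card {k \<in> \<tau>. k < j}"] by (simp add: dcoef_def R.m_ac R.m_lcomm)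
    ultimately show ?thesis using b z by (simp flip: smult_assoc1)
  qed
  moreover have "cdiff R M b 1 ?h \<tau> = dcoef R b 1 \<tau> j \<odot>\<^bsub>M\<^esub> ?h (\<tau> - {j})"
    unfolding cdiff_def using True fin b z by (intro M.finsum_one_nonzero) auto
  ultimately show ?thesis by simp
next
  case False
  let ?T = "insert j \<tau>"
  let ?s = "(\<ominus> \<one>) [^] card {k \<in> ?T. k < j}"
  have bj: "b j \<in> carrier R" using b by auto
  have "dcoef R b 1 \<tau> i \<odot>\<^bsub>M\<^esub> ?h (\<tau> - {i}) = \<ominus>\<^bsub>M\<^esub> (?s \<odot>\<^bsub>M\<^esub> (dcoef R b 1 ?T i \<odot>\<^bsub>M\<^esub> z (?T - {i})))"
    if i: "i \<in> \<tau>" for i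
  proof -
    have ij: "i \<noteq> j" using i False by auto
    have bi: "b i \<in> carrier R" using b by auto
    let ?e = "\<lambda>T k. (\<ominus> \<one>) [^] card {l \<in> T. l < k}"
    have Tj: "?T - {j} = \<tau>" and Ti: "insert j (\<tau> - {i}) = ?T - {i}" using False ij by auto
    have "?e ?T j \<otimes> ?e (?T - {j}) i = \<ominus> (?e ?T i \<otimes> ?e (?T - {i}) j)"
      using fin i ij by (intro sign_swap) auto
    then have "?e ?T j \<otimes> ?e \<tau> i = \<ominus> (?e ?T i \<otimes> ?e (?T - {i}) j)" using Tj by simp
    then have "?e \<tau> i \<otimes> ?e (?T - {i}) j = \<ominus> (?e ?T j \<otimes> ?e ?T i)"
      by (rule sign_transfer[rotated 4]) (simp_all add: sign_square)
    then have e: "?e \<tau> i \<otimes> ?e (?T - {i}) j = \<ominus> (?s \<otimes> ?e ?T i)" .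
    have "dcoef R b 1 \<tau> i \<otimes> ?e (?T - {i}) j = (?e \<tau> i \<otimes> ?e (?T - {i}) j) \<otimes> b i"
      unfolding dcoef_def using bi by (simp add: R.m_ac)
    also have "\<dots> = \<ominus> (?s \<otimes> dcoef R b 1 ?T i)"
      unfolding e dcoef_def using bi by (simp add: R.m_ac R.l_minus R.r_minus)
    finally have "dcoef R b 1 \<tau> i \<otimes> ?e (?T - {i}) j = \<ominus> (?s \<otimes> dcoef R b 1 ?T i)" .
    moreover have "?h (\<tau> - {i}) = ?e (?T - {i}) j \<odot>\<^bsub>M\<^esub> z (?T - {i})" using False Ti by simp
    ultimately show ?thesis
      using b z by (simp add: smult_l_minus flip: smult_assoc1)
  qed
  then have "cdiff R M b 1 ?h \<tau> = (\<Oplus>\<^bsub>M\<^esub>i\<in>\<tau>. \<ominus>\<^bsub>M\<^esub> (?s \<odot>\<^bsub>M\<^esub> (dcoef R b 1 ?T i \<odot>\<^bsub>M\<^esub> z (?T - {i}))))"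
    unfolding cdiff_def using b z by (intro finsum_cong') auto
  also have "\<dots> = \<ominus>\<^bsub>M\<^esub> (\<Oplus>\<^bsub>M\<^esub>i\<in>\<tau>. ?s \<odot>\<^bsub>M\<^esub> (dcoef R b 1 ?T i \<odot>\<^bsub>M\<^esub> z (?T - {i})))"
    using b z by (intro M.finsum_neg) auto
  also have "\<dots> = \<ominus>\<^bsub>M\<^esub> (?s \<odot>\<^bsub>M\<^esub> (\<Oplus>\<^bsub>M\<^esub>i\<in>\<tau>. dcoef R b 1 ?T i \<odot>\<^bsub>M\<^esub> z (?T - {i})))"
    using b z fin by (subst finsum_smult_ldistr) auto
  finally have 1: "cdiff R M b 1 ?h \<tau> = \<ominus>\<^bsub>M\<^esub> (?s \<odot>\<^bsub>M\<^esub> (\<Oplus>\<^bsub>M\<^esub>i\<in>\<tau>. dcoef R b 1 ?T i \<odot>\<^bsub>M\<^esub> z (?T - {i})))" .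
  have "cdiff R M b 1 z ?T = dcoef R b 1 ?T j \<odot>\<^bsub>M\<^esub> z \<tau> \<oplus>\<^bsub>M\<^esub> (\<Oplus>\<^bsub>M\<^esub>i\<in>\<tau>. dcoef R b 1 ?T i \<odot>\<^bsub>M\<^esub> z (?T - {i}))"
    unfolding cdiff_def using b z fin False by (subst finsum_insert) auto
  moreover have S: "(\<Oplus>\<^bsub>M\<^esub>i\<in>\<tau>. dcoef R b 1 ?T i \<odot>\<^bsub>M\<^esub> z (?T - {i})) \<in> carrier M"
    using b z by (intro finsum_closed) auto
  moreover have "dcoef R b 1 ?T j \<odot>\<^bsub>M\<^esub> z \<tau> \<in> carrier M" using b z by simp
  ultimately have 2: "dcoef R b 1 ?T j \<odot>\<^bsub>M\<^esub> z \<tau> = \<ominus>\<^bsub>M\<^esub> (\<Oplus>\<^bsub>M\<^esub>i\<in>\<tau>. dcoef R b 1 ?T i \<odot>\<^bsub>M\<^esub> z (?T - {i}))"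
    using cocycle[OF False] by (simp only: M.minus_equality)
  have "?s \<otimes> dcoef R b 1 ?T j = b j"
    unfolding dcoef_def using bj sign_square[of "card {k \<in> ?T. k < j}"]
      R.m_assoc[of ?s ?s "b j [^] (1::nat)"] by simp
  then have "b j \<odot>\<^bsub>M\<^esub> z \<tau> = ?s \<odot>\<^bsub>M\<^esub> (dcoef R b 1 ?T j \<odot>\<^bsub>M\<^esub> z \<tau>)"
    using b z smult_assoc1[of ?s "dcoef R b 1 ?T j" "z \<tau>"] by simp
  then have "b j \<odot>\<^bsub>M\<^esub> z \<tau> = \<ominus>\<^bsub>M\<^esub> (?s \<odot>\<^bsub>M\<^esub> (\<Oplus>\<^bsub>M\<^esub>i\<in>\<tau>. dcoef R b 1 ?T i \<odot>\<^bsub>M\<^esub> z (?T - {i})))"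
    unfolding 2 using S by (simp only: smult_r_minus neg_one_pow_closed)
  then show ?thesis using 1 by (simp only:)
qed

end

lemma cdiff_additive_map:
  assumes "module R P" "module R Q" "b \<in> UNIV \<rightarrow> carrier R"
    and "\<And>\<rho>. x \<rho> \<in> carrier P" "additive_map P Q h"
    and "\<And>i. i \<in> \<tau> \<Longrightarrow> h (dcoef R b a \<tau> i \<odot>\<^bsub>P\<^esub> x (\<tau> - {i})) = dcoef R b a \<tau> i \<odot>\<^bsub>Q\<^esub> y (\<tau> - {i})"
    and "\<And>\<rho>. y \<rho> \<in> carrier Q"
  shows "h (cdiff R P b a x \<tau>) = cdiff R Q b a y \<tau>"
proof -
  interpret P: module R P by fact
  interpret Q: module R Q by fact
  have "h (cdiff R P b a x \<tau>) = (\<Oplus>\<^bsub>Q\<^esub>i\<in>\<tau>. h (dcoef R b a \<tau> i \<odot>\<^bsub>P\<^esub> x (\<tau> - {i})))"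
    unfolding cdiff_def using assms
    by (intro additive_map_finsum) (auto intro: P.abelian_group_axioms Q.abelian_group_axioms)
  also have "\<dots> = cdiff R Q b a y \<tau>"
    unfolding cdiff_def using assms by (intro Q.finsum_cong') auto
  finally show ?thesis .
qed

lemma cdiff_linear_map:
  assumes "module R P" "module R Q" "b \<in> UNIV \<rightarrow> carrier R"
    and "\<And>\<rho>. x \<rho> \<in> carrier P" "linear_map R P Q h"
  shows "h (cdiff R P b a x \<tau>) = cdiff R Q b a (\<lambda>\<rho>. h (x \<rho>)) \<tau>"
proof -
  interpret P: module R P by fact
  interpret Q: module R Q by fact
  show ?thesis
    using assms linear_map_additive[OF assms(5)]
    by (intro cdiff_additive_map) (auto simp: linear_map_smult additive_map_closed)
qed

section \<open>Function modules and submodules\<close>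

text \<open>Function modules stand for finite free modules and for the terms of the Koszul complex. Functions are
  not restricted to the finitely many indices that matter, so that one module serves for all of them; the
  values at the other indices are arbitrary.\<close>

definition fun_module :: "('r, 'm, 'o) module_scheme \<Rightarrow> ('r, 'i \<Rightarrow> 'm) module" where
  "fun_module M =
    \<lparr>carrier = {f. \<forall>i. f i \<in> carrier M}, monoid.mult = undefined, monoid.one = undefined,
     ring.zero = (\<lambda>_. \<zero>\<^bsub>M\<^esub>),
     ring.add = (\<lambda>f g i. f i \<oplus>\<^bsub>M\<^esub> g i),
     module.smult = (\<lambda>r f i. r \<odot>\<^bsub>M\<^esub> f i)\<rparr>"

lemma fun_module_simps [simp]:
  "f \<in> carrier (fun_module M) \<longleftrightarrow> (\<forall>i. f i \<in> carrier M)"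
  "\<zero>\<^bsub>fun_module M\<^esub> = (\<lambda>_. \<zero>\<^bsub>M\<^esub>)"
  "f \<oplus>\<^bsub>fun_module M\<^esub> g = (\<lambda>i. f i \<oplus>\<^bsub>M\<^esub> g i)"
  "r \<odot>\<^bsub>fun_module M\<^esub> f = (\<lambda>i. r \<odot>\<^bsub>M\<^esub> f i)"
  by (auto simp: fun_module_def)

lemma fun_module_is_module:
  assumes "module R M"
  shows "module R (fun_module M)"
proof -
  interpret module R M by fact
  show ?thesis
  proof (rule moduleI)
    show "cring R" by (rule R.is_cring)
    show "abelian_group (fun_module M :: ('a, 'i \<Rightarrow> 'c) module)"
    proof (rule abelian_groupI)
      fix f :: "'i \<Rightarrow> 'c" assume "f \<in> carrier (fun_module M)"
      then show "\<exists>g\<in>carrier (fun_module M). g \<oplus>\<^bsub>fun_module M\<^esub> f = \<zero>\<^bsub>fun_module M\<^esub>"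
        by (intro bexI[of _ "\<lambda>i. \<ominus>\<^bsub>M\<^esub> f i"]) (auto simp: M.l_neg)
    qed (auto simp: M.a_assoc intro: M.a_comm)
  qed (auto simp: smult_l_distr smult_r_distr smult_assoc1)
qed

lemma linear_map_eval: "linear_map R (fun_module M) M (\<lambda>f. f i)"
  by (auto simp: linear_map_def additive_map_def)

lemma fun_module_diff:
  assumes "module R M" "f \<in> carrier (fun_module M)" "g \<in> carrier (fun_module M)"
  shows "(f \<ominus>\<^bsub>fun_module M\<^esub> g) i = f i \<ominus>\<^bsub>M\<^esub> g i"
  by (rule additive_map_diff[OF module.axioms(2)[OF fun_module_is_module[OF assms(1)]]
        module.axioms(2)[OF assms(1)] linear_map_additive[OF linear_map_eval] assms(2,3)])

lemma cdiff_fun_module: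
  assumes "module R M" "b \<in> UNIV \<rightarrow> carrier R" "\<And>\<rho> i. x \<rho> i \<in> carrier M"
  shows "cdiff R (fun_module M) b a x \<tau> i = cdiff R M b a (\<lambda>\<rho>. x \<rho> i) \<tau>"
  using cdiff_linear_map[OF fun_module_is_module[OF assms(1)] assms(1,2) _ linear_map_eval, of x] assms(3)
  by simp

lemma self_module_simps [simp]:
  "carrier (self_module R) = carrier R" "\<zero>\<^bsub>self_module R\<^esub> = \<zero>\<^bsub>R\<^esub>"
  "x \<oplus>\<^bsub>self_module R\<^esub> y = x \<oplus>\<^bsub>R\<^esub> y" "x \<odot>\<^bsub>self_module R\<^esub> y = x \<otimes>\<^bsub>R\<^esub> y"
  by (auto simp: self_module_def)

lemma (in cring) self_module_is_module: "module R (self_module R)"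
proof (rule moduleI)
  show "abelian_group (self_module R)"
    by (rule abelian_groupI) (auto simp: a_assoc intro: a_comm l_neg a_inv_closed)
qed (auto simp: l_distr r_distr m_assoc intro: is_cring)

lemma (in cring) a_inv_self_module: "x \<in> carrier R \<Longrightarrow> \<ominus>\<^bsub>self_module R\<^esub> x = \<ominus> x"
proof -
  assume x: "x \<in> carrier R"
  interpret S: module R "self_module R" by (rule self_module_is_module)
  show ?thesis using x S.minus_equality[of "\<ominus> x" x] by (simp add: l_neg)
qed

context module
begin

lemma submodule_closed:
  assumes "submodule N R M"
  shows "x \<in> N \<Longrightarrow> x \<in> carrier M" "\<zero>\<^bsub>M\<^esub> \<in> N"
    "x \<in> N \<Longrightarrow> y \<in> N \<Longrightarrow> x \<oplus>\<^bsub>M\<^esub> y \<in> N"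
    "x \<in> N \<Longrightarrow> y \<in> N \<Longrightarrow> x \<ominus>\<^bsub>M\<^esub> y \<in> N"
    "x \<in> N \<Longrightarrow> \<ominus>\<^bsub>M\<^esub> x \<in> N"
    "r \<in> carrier R \<Longrightarrow> x \<in> N \<Longrightarrow> r \<odot>\<^bsub>M\<^esub> x \<in> N"
proof -
  show z: "\<zero>\<^bsub>M\<^esub> \<in> N"
    using submodule.axioms(1)[OF assms] subgroup.one_closed by fastforce
qed (use submoduleE[OF assms] in \<open>auto simp: a_minus_def\<close>)

lemma submodule_finsum:
  assumes "submodule N R M" "f \<in> A \<rightarrow> N"
  shows "(\<Oplus>\<^bsub>M\<^esub>i\<in>A. f i) \<in> N"
proof (cases "finite A")
  case True
  then show ?thesis using assms(2)
  proof (induction A)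
    case (insert i A)
    then have "f i \<in> N" "f \<in> A \<rightarrow> N" by auto
    moreover have "f i \<in> carrier M" "f \<in> A \<rightarrow> carrier M"
      using calculation submodule_closed(1)[OF assms(1)] by auto
    ultimately show ?case
      using insert.hyps insert.IH submodule_closed(3)[OF assms(1)] by simp
  qed (simp add: submodule_closed[OF assms(1)])
qed (simp add: submodule_closed[OF assms(1)])

end

lemma submodule_preimage:
  assumes "module R P" "module R Q" "linear_map R P Q h" "submodule N R Q"
  shows "submodule {x \<in> carrier P. h x \<in> N} R P"
proof -
  interpret P: module R P by fact
  interpret Q: module R Q by fact
  note h = linear_map_additive[OF assms(3)]
  show ?thesis
  proof (rule P.submoduleI)
    show "\<zero>\<^bsub>P\<^esub> \<in> {x \<in> carrier P. h x \<in> N}"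
      using additive_map_zero[OF P.abelian_group_axioms Q.abelian_group_axioms h]
        Q.submodule_closed(2)[OF assms(4)] by simp
    show "\<ominus>\<^bsub>P\<^esub> x \<in> {x \<in> carrier P. h x \<in> N}" if "x \<in> {x \<in> carrier P. h x \<in> N}" for x
      using that additive_map_minus[OF P.abelian_group_axioms Q.abelian_group_axioms h]
        Q.submodule_closed(5)[OF assms(4)] by simp
    show "x \<oplus>\<^bsub>P\<^esub> y \<in> {x \<in> carrier P. h x \<in> N}"
      if "x \<in> {x \<in> carrier P. h x \<in> N}" "y \<in> {x \<in> carrier P. h x \<in> N}" for x y
      using that additive_map_add[OF h] Q.submodule_closed(3)[OF assms(4)] by simp
    show "r \<odot>\<^bsub>P\<^esub> x \<in> {x \<in> carrier P. h x \<in> N}"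
      if "r \<in> carrier R" "x \<in> {x \<in> carrier P. h x \<in> N}" for r x
      using that linear_map_smult[OF assms(3)] Q.submodule_closed(6)[OF assms(4)] by simp
  qed auto
qed

lemma (in abelian_group) diff_diff_add_cancel:
  assumes "x \<in> carrier G" "y \<in> carrier G" "z \<in> carrier G"
  shows "(x \<ominus> y \<ominus> z) \<oplus> y = x \<ominus> z"
proof -
  have "(x \<oplus> y' \<oplus> z') \<oplus> y = (x \<oplus> z') \<oplus> (y' \<oplus> y)" if "y' \<in> carrier G" "z' \<in> carrier G" for y' z'
    using that assms by (simp add: a_ac)
  from this[of "\<ominus> y" "\<ominus> z"] show ?thesis
    using assms by (simp add: a_minus_def l_neg)
qed

section \<open>Exactness of the Cech complex of a subquotient\<close>

text \<open>Exactness in degree \<open>p\<close> of the Cech complex of \<open>Z / N\<close>. The quotient is not formed: an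
  induction can then range over the submodules \<open>Z\<close> of a fixed module, within one type.\<close>

definition rel_exact ::
  "('r, 'l) ring_scheme \<Rightarrow> ('r, 'x, 'o) module_scheme \<Rightarrow> (nat \<Rightarrow> 'r) \<Rightarrow> nat \<Rightarrow> 'x set \<Rightarrow> 'x set
    \<Rightarrow> int \<Rightarrow> bool" where
  "rel_exact R P b s Z N p \<longleftrightarrow>
    (\<forall>a x. (\<forall>\<rho>. x \<rho> \<in> Z) \<longrightarrow> (\<forall>\<tau>\<in>cells s (p + 1). cdiff R P b a x \<tau> \<in> N) \<longrightarrow>
      (\<exists>k y. (\<forall>\<rho>. y \<rho> \<in> Z) \<and>
        (\<forall>\<rho>\<in>cells s p. bprod R b \<rho> [^]\<^bsub>R\<^esub> k \<odot>\<^bsub>P\<^esub> x \<rho> \<ominus>\<^bsub>P\<^esub> cdiff R P b (a + k) y \<rho> \<in> N)))"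

lemma rel_exactE:
  assumes "rel_exact R P b s Z N p" "\<And>\<rho>. x \<rho> \<in> Z"
    and "\<And>\<tau>. \<tau> \<in> cells s (p + 1) \<Longrightarrow> cdiff R P b a x \<tau> \<in> N"
  obtains k y where "\<And>\<rho>. y \<rho> \<in> Z"
    "\<And>\<rho>. \<rho> \<in> cells s p \<Longrightarrow>
      bprod R b \<rho> [^]\<^bsub>R\<^esub> k \<odot>\<^bsub>P\<^esub> x \<rho> \<ominus>\<^bsub>P\<^esub> cdiff R P b (a + k) y \<rho> \<in> N"
proof -
  have "\<exists>k y. (\<forall>\<rho>. y \<rho> \<in> Z) \<and> (\<forall>\<rho>\<in>cells s p.
      bprod R b \<rho> [^]\<^bsub>R\<^esub> k \<odot>\<^bsub>P\<^esub> x \<rho> \<ominus>\<^bsub>P\<^esub> cdiff R P b (a + k) y \<rho> \<in> N)"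
    using assms unfolding rel_exact_def by simp
  then show thesis using that by auto
qed

lemma finite_uniform_exponent:
  fixes Q :: "'c \<Rightarrow> nat \<Rightarrow> bool"
  assumes "finite C" "\<And>c. c \<in> C \<Longrightarrow> \<exists>k. Q c k" "\<And>c k j. c \<in> C \<Longrightarrow> Q c k \<Longrightarrow> Q c (k + j)"
  shows "\<exists>k. \<forall>c\<in>C. Q c k"
  using assms
proof (induction C)
  case (insert c C)
  then obtain k where k: "\<forall>c\<in>C. Q c k" by blast
  obtain k' where k': "Q c k'" using insert by blast
  have "Q c (k + k')" using k' insert.prems(2)[of c k' k] by (simp add: add.commute)
  then show ?case using k insert.prems(2) by blast
qed simp

context module
begin

lemma smult_diff_distr:
  "r \<in> carrier R \<Longrightarrow> x \<in> carrier M \<Longrightarrow> y \<in> carrier M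
    \<Longrightarrow> r \<odot>\<^bsub>M\<^esub> (x \<ominus>\<^bsub>M\<^esub> y) = r \<odot>\<^bsub>M\<^esub> x \<ominus>\<^bsub>M\<^esub> r \<odot>\<^bsub>M\<^esub> y"
  by (simp add: a_minus_def smult_r_distr smult_r_minus)

lemma smult_pow_add:
  "r \<in> carrier R \<Longrightarrow> x \<in> carrier M
    \<Longrightarrow> r [^] (k + j) \<odot>\<^bsub>M\<^esub> x = r [^] (k::nat) \<odot>\<^bsub>M\<^esub> (r [^] j \<odot>\<^bsub>M\<^esub> x)"
  by (simp add: smult_assoc1 flip: R.nat_pow_mult)

lemma coboundary_shift:
  assumes "b \<in> UNIV \<rightarrow> carrier R" "\<And>\<rho>. y \<rho> \<in> carrier M" "x \<in> carrier M" "finite \<rho>"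
  shows "bprod R b \<rho> [^] (k + j) \<odot>\<^bsub>M\<^esub> x \<ominus>\<^bsub>M\<^esub>
      cdiff R M b (a + (k + j)) (\<lambda>\<rho>. bprod R b \<rho> [^] j \<odot>\<^bsub>M\<^esub> y \<rho>) \<rho>
    = bprod R b \<rho> [^] j \<odot>\<^bsub>M\<^esub> (bprod R b \<rho> [^] k \<odot>\<^bsub>M\<^esub> x \<ominus>\<^bsub>M\<^esub> cdiff R M b (a + k) y \<rho>)"
proof -
  have "cdiff R M b (a + (k + j)) (\<lambda>\<rho>. bprod R b \<rho> [^] j \<odot>\<^bsub>M\<^esub> y \<rho>) \<rho>
      = bprod R b \<rho> [^] j \<odot>\<^bsub>M\<^esub> cdiff R M b (a + k) y \<rho>"
    using cdiff_shift[OF assms(1,2,4), of "a + k" j] by (simp add: add.assoc)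
  then show ?thesis
    using assms smult_pow_add[of "bprod R b \<rho>" x j k] cdiff_closed[OF assms(1,2)]
    by (simp add: smult_diff_distr add.commute)
qed

end

lemma rel_exact_trivial:
  assumes "module R P" "submodule Z R P" "cells s p = {}"
  shows "rel_exact R P b s Z N p"
  using module.submodule_closed(2)[OF assms(1,2)] assms(3) by (auto simp: rel_exact_def)

text \<open>The cocycle \<open>x\<close> has finitely many entries, so it is the image, under a linear map \<open>\<phi>\<close> from a
  finite free module onto the submodule that they generate, of the cochain \<open>e\<close> of basis vectors. The
  differential of \<open>e\<close> is a cocycle with values in the relations; by exactness in the next
  degree it can be corrected to a cocycle modulo \<open>J\<close> in the free module, where exactness holds one
  coordinate at a time.\<close>

lemma rel_exact_step:
  fixes R (structure)
  assumes "module R P" and b: "b \<in> UNIV \<rightarrow> carrier R"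
    and Z: "submodule Z R P" and N: "submodule N R P"
    and J: "J \<subseteq> carrier R" and JZ: "\<And>r z. r \<in> J \<Longrightarrow> z \<in> Z \<Longrightarrow> r \<odot>\<^bsub>P\<^esub> z \<in> N"
    and self: "rel_exact R (self_module R) b s (carrier R) J p"
    and J_ideal: "submodule J R (self_module R)"
    and nextdeg: "\<And>K. submodule K R (fun_module (self_module R) :: ('r, nat set \<Rightarrow> 'r) module)
        \<Longrightarrow> {r. \<forall>c. r c \<in> J} \<subseteq> K
        \<Longrightarrow> rel_exact R (fun_module (self_module R)) b s K {r. \<forall>c. r c \<in> J} (p + 1)"
  shows "rel_exact R P b s Z N p"
  unfolding rel_exact_def
proof (intro allI impI)
  fix a x assume x: "\<forall>\<rho>. x \<rho> \<in> Z" and cyc: "\<forall>\<tau>\<in>cells s (p + 1). cdiff R P b a x \<tau> \<in> N"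
  interpret P: module R P by fact
  interpret S: module R "self_module R" by (rule P.R.self_module_is_module)
  define F :: "('r, nat set \<Rightarrow> 'r) module" where "F = fun_module (self_module R)"
  have Fm: "module R F" unfolding F_def by (rule fun_module_is_module[OF S.module_axioms])
  interpret F: module R F by (rule Fm)
  have cF: "f \<in> carrier F \<longleftrightarrow> (\<forall>c. f c \<in> carrier R)" for f by (simp add: F_def)
  let ?C = "cells s p"
  let ?JF = "{r. \<forall>c. r c \<in> J} :: (nat set \<Rightarrow> 'r) set"
  have xc: "x \<rho> \<in> carrier P" for \<rho> using x P.submodule_closed(1)[OF Z] by blast
  define \<phi> where "\<phi> r = (\<Oplus>\<^bsub>P\<^esub>c\<in>?C. r c \<odot>\<^bsub>P\<^esub> x c)" for r :: "nat set \<Rightarrow> 'r"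
  have \<phi>: "linear_map R F P \<phi>"
  proof -
    have "\<phi> r \<in> carrier P" if "r \<in> carrier F" for r
      unfolding \<phi>_def using that xc by (intro P.finsum_closed) (auto simp: cF)
    moreover have "\<phi> (q \<oplus>\<^bsub>F\<^esub> r) = \<phi> q \<oplus>\<^bsub>P\<^esub> \<phi> r" if "q \<in> carrier F" "r \<in> carrier F" for q r
    proof -
      have "\<phi> (q \<oplus>\<^bsub>F\<^esub> r) = (\<Oplus>\<^bsub>P\<^esub>c\<in>?C. q c \<odot>\<^bsub>P\<^esub> x c \<oplus>\<^bsub>P\<^esub> r c \<odot>\<^bsub>P\<^esub> x c)"
        unfolding \<phi>_def using that xc
        by (intro P.finsum_cong') (auto simp: cF F_def P.smult_l_distr)
      also have "\<dots> = \<phi> q \<oplus>\<^bsub>P\<^esub> \<phi> r"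
        unfolding \<phi>_def using that xc by (intro P.finsum_addf) (auto simp: cF)
      finally show ?thesis .
    qed
    moreover have "\<phi> (t \<odot>\<^bsub>F\<^esub> r) = t \<odot>\<^bsub>P\<^esub> \<phi> r" if "t \<in> carrier R" "r \<in> carrier F" for t r
    proof -
      have "t \<odot>\<^bsub>P\<^esub> \<phi> r = (\<Oplus>\<^bsub>P\<^esub>c\<in>?C. t \<odot>\<^bsub>P\<^esub> (r c \<odot>\<^bsub>P\<^esub> x c))"
        unfolding \<phi>_def using that xc finite_cells by (intro P.finsum_smult_ldistr) (auto simp: cF)
      also have "\<dots> = \<phi> (t \<odot>\<^bsub>F\<^esub> r)"
        unfolding \<phi>_def using that xc
        by (intro P.finsum_cong') (auto simp: cF F_def P.smult_assoc1)
      finally show ?thesis by simp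
    qed
    ultimately show ?thesis unfolding linear_map_def additive_map_def by blast
  qed
  note \<phi>a = linear_map_additive[OF \<phi>]
  note \<phi>c = additive_map_closed[OF \<phi>a]
  have \<phi>Z: "\<phi> r \<in> Z" if "r \<in> carrier F" for r
    unfolding \<phi>_def using that x P.submodule_closed(6)[OF Z]
    by (intro P.submodule_finsum[OF Z]) (auto simp: cF)
  have \<phi>N: "\<phi> r \<in> N" if "\<And>c. c \<in> ?C \<Longrightarrow> r c \<in> J" for r
    unfolding \<phi>_def using that x JZ by (intro P.submodule_finsum[OF N]) auto
  define e where "e \<rho> = (\<lambda>c. if c = \<rho> then \<one> else \<zero>)" for \<rho> :: "nat set"
  have ec: "e \<rho> \<in> carrier F" for \<rho> by (simp add: cF e_def)
  have \<phi>e: "\<phi> (e \<rho>) = x \<rho>" if "\<rho> \<in> ?C" for \<rho>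
  proof -
    have "(\<Oplus>\<^bsub>P\<^esub>c\<in>?C. e \<rho> c \<odot>\<^bsub>P\<^esub> x c) = e \<rho> \<rho> \<odot>\<^bsub>P\<^esub> x \<rho>"
      using that xc finite_cells by (intro P.finsum_one_nonzero) (auto simp: e_def)
    then show ?thesis using xc by (simp add: \<phi>_def e_def)
  qed
  \<comment> \<open>The relations between the entries of \<open>x\<close>, modulo \<open>N\<close>.\<close>
  define K where "K = {r \<in> carrier F. \<phi> r \<in> N}"
  have K: "submodule K R F" unfolding K_def
    by (rule submodule_preimage[OF Fm P.module_axioms \<phi> N])
  have JK: "?JF \<subseteq> K"
    using \<phi>N J by (auto simp: K_def cF)
  define w where "w \<tau> = (if \<tau> \<in> cells s (p + 1) then cdiff R F b a e \<tau> else \<zero>\<^bsub>F\<^esub>)" for \<tau>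
  have dec: "cdiff R F b a e \<tau> \<in> carrier F" for \<tau> by (rule F.cdiff_closed[OF b ec])
  have wK: "w \<tau> \<in> K" for \<tau>
  proof (cases "\<tau> \<in> cells s (p + 1)")
    case True
    have "\<phi> (cdiff R F b a e \<tau>) = cdiff R P b a (\<lambda>\<rho>. \<phi> (e \<rho>)) \<tau>"
      by (rule cdiff_linear_map[OF Fm P.module_axioms b ec \<phi>])
    also have "\<dots> = cdiff R P b a x \<tau>"
      using \<phi>e cells_remove[OF True] by (intro P.cdiff_cong[OF b xc]) auto
    finally show ?thesis using True cyc dec by (simp add: w_def K_def)
  next
    case False
    then show ?thesis using F.submodule_closed(2)[OF K] by (simp add: w_def)
  qed
  have dw: "cdiff R F b a w \<tau> \<in> ?JF" if "\<tau> \<in> cells s (p + 1 + 1)" for \<tau>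
  proof -
    have "cdiff R F b a w \<tau> = cdiff R F b a (cdiff R F b a e) \<tau>"
      using cells_remove[OF that] by (intro F.cdiff_cong[OF b dec]) (simp add: w_def)
    also have "\<dots> = \<zero>\<^bsub>F\<^esub>" by (rule F.cdiff_cdiff[OF b ec cells_finite[OF that]])
    finally show ?thesis using S.submodule_closed(2)[OF J_ideal] by (simp add: F_def)
  qed
  obtain k y where y: "\<And>\<rho>. y \<rho> \<in> K"
    and ky: "\<And>\<tau>. \<tau> \<in> cells s (p + 1) \<Longrightarrow>
      bprod R b \<tau> [^] k \<odot>\<^bsub>F\<^esub> w \<tau> \<ominus>\<^bsub>F\<^esub> cdiff R F b (a + k) y \<tau> \<in> ?JF"
    by (rule rel_exactE[OF nextdeg[OF K[unfolded F_def] JK, folded F_def] wK dw]) (assumption, rule that)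
  have yc: "y \<rho> \<in> carrier F" for \<rho> using y by (auto simp: K_def)
  have bk: "bprod R b \<rho> [^] (j::nat) \<in> carrier R" for \<rho> j using b by simp
  \<comment> \<open>The corrected lift: a cocycle modulo \<open>J\<close>, still mapped to \<open>x\<close> modulo \<open>N\<close> up to a power.\<close>
  define u where "u \<rho> = bprod R b \<rho> [^] k \<odot>\<^bsub>F\<^esub> e \<rho> \<ominus>\<^bsub>F\<^esub> y \<rho>" for \<rho>
  have bec: "bprod R b \<rho> [^] k \<odot>\<^bsub>F\<^esub> e \<rho> \<in> carrier F" for \<rho> using ec bk F.smult_closed by blast
  have uc: "u \<rho> \<in> carrier F" for \<rho> unfolding u_def using bec yc F.minus_closed by blast
  have du: "cdiff R F b (a + k) u \<tau> \<in> ?JF" if \<tau>: "\<tau> \<in> cells s (p + 1)" for \<tau>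
  proof -
    have "cdiff R F b (a + k) u \<tau> = cdiff R F b (a + k) (\<lambda>\<rho>. bprod R b \<rho> [^] k \<odot>\<^bsub>F\<^esub> e \<rho>) \<tau>
        \<ominus>\<^bsub>F\<^esub> cdiff R F b (a + k) y \<tau>"
      unfolding u_def by (rule F.cdiff_diff[OF b bec yc])
    also have "cdiff R F b (a + k) (\<lambda>\<rho>. bprod R b \<rho> [^] k \<odot>\<^bsub>F\<^esub> e \<rho>) \<tau>
        = bprod R b \<tau> [^] k \<odot>\<^bsub>F\<^esub> w \<tau>"
      using F.cdiff_shift[OF b ec cells_finite[OF \<tau>]] \<tau> by (simp add: w_def)
    finally show ?thesis using ky[OF \<tau>] by (simp only:)
  qed
  \<comment> \<open>Only the coordinates in \<open>?C\<close> enter in \<open>\<phi>\<close>, and finitely many exponents have a common bound.\<close>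
  let ?Q = "\<lambda>c j. \<exists>v. (\<forall>\<rho>. v \<rho> \<in> carrier R) \<and> (\<forall>\<rho>\<in>?C.
    bprod R b \<rho> [^] j \<odot>\<^bsub>self_module R\<^esub> u \<rho> c \<ominus>\<^bsub>self_module R\<^esub> cdiff R (self_module R) b (a + k + j) v \<rho> \<in> J)"
  have ucc: "u \<rho> c \<in> carrier R" for \<rho> c using uc by (simp add: cF)
  have "\<exists>j. \<forall>c\<in>?C. ?Q c j"
  proof (rule finite_uniform_exponent[OF finite_cells])
    fix c assume "c \<in> ?C"
    have duc: "cdiff R (self_module R) b (a + k) (\<lambda>\<rho>. u \<rho> c) \<tau> \<in> J" if "\<tau> \<in> cells s (p + 1)" for \<tau>
      using du[OF that] cdiff_fun_module[OF S.module_axioms b, of u "a + k" \<tau> c] ucc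
      by (auto simp: F_def dest: spec[of _ c])
    show "\<exists>j. ?Q c j"
      by (rule rel_exactE[OF self ucc duc]) blast+
  next
    fix c j j' assume "?Q c j"
    then obtain v where v: "\<forall>\<rho>. v \<rho> \<in> carrier R"
      and vJ: "\<forall>\<rho>\<in>?C. bprod R b \<rho> [^] j \<odot>\<^bsub>self_module R\<^esub> u \<rho> c \<ominus>\<^bsub>self_module R\<^esub>
        cdiff R (self_module R) b (a + k + j) v \<rho> \<in> J" by blast
    have "bprod R b \<rho> [^] (j + j') \<odot>\<^bsub>self_module R\<^esub> u \<rho> c \<ominus>\<^bsub>self_module R\<^esub>
        cdiff R (self_module R) b (a + k + (j + j'))
          (\<lambda>\<rho>. bprod R b \<rho> [^] j' \<odot>\<^bsub>self_module R\<^esub> v \<rho>) \<rho> \<in> J" if "\<rho> \<in> ?C" for \<rho>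
      using S.coboundary_shift[OF b, of v "u \<rho> c" \<rho> j j' "a + k"] v ucc cells_finite[OF that]
        S.submodule_closed(6)[OF J_ideal bk] vJ that by simp
    moreover have "\<forall>\<rho>. bprod R b \<rho> [^] j' \<odot>\<^bsub>self_module R\<^esub> v \<rho> \<in> carrier R" using v bk by simp
    ultimately show "?Q c (j + j')" by (intro exI conjI ballI) auto
  qed
  then obtain j v where v: "\<And>c \<rho>. c \<in> ?C \<Longrightarrow> v c \<rho> \<in> carrier R"
    and vJ: "\<And>c \<rho>. c \<in> ?C \<Longrightarrow> \<rho> \<in> ?C \<Longrightarrow>
      bprod R b \<rho> [^] j \<odot>\<^bsub>self_module R\<^esub> u \<rho> c \<ominus>\<^bsub>self_module R\<^esub>
        cdiff R (self_module R) b (a + k + j) (v c) \<rho> \<in> J"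
    by metis
  define y' where "y' \<rho> = (\<lambda>c. if c \<in> ?C then v c \<rho> else \<zero>)" for \<rho> :: "nat set"
  have y'c: "y' \<rho> \<in> carrier F" for \<rho> using v by (simp add: y'_def cF)
  have \<phi>y'c: "\<phi> (y' \<rho>) \<in> carrier P" for \<rho> using \<phi>c y'c by blast
  have "bprod R b \<rho> [^] (k + j) \<odot>\<^bsub>P\<^esub> x \<rho> \<ominus>\<^bsub>P\<^esub> cdiff R P b (a + (k + j)) (\<lambda>\<rho>. \<phi> (y' \<rho>)) \<rho> \<in> N"
    if \<rho>: "\<rho> \<in> ?C" for \<rho>
  proof -
    let ?bu = "bprod R b \<rho> [^] j \<odot>\<^bsub>F\<^esub> u \<rho>" and ?dy = "cdiff R F b (a + k + j) y' \<rho>"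
    have buc: "?bu \<in> carrier F" using uc bk F.smult_closed by blast
    have dyc: "?dy \<in> carrier F" by (rule F.cdiff_closed[OF b y'c])
    have "(?bu \<ominus>\<^bsub>F\<^esub> ?dy) c \<in> J" if c: "c \<in> ?C" for c
    proof -
      have "(?bu \<ominus>\<^bsub>F\<^esub> ?dy) c = ?bu c \<ominus>\<^bsub>self_module R\<^esub> ?dy c"
        using fun_module_diff[OF S.module_axioms buc[unfolded F_def] dyc[unfolded F_def]]
        by (simp add: F_def)
      also have "?dy c = cdiff R (self_module R) b (a + k + j) (\<lambda>\<rho>. y' \<rho> c) \<rho>"
        unfolding F_def using y'c by (intro cdiff_fun_module[OF S.module_axioms b]) (auto simp: cF)
      also have "(\<lambda>\<rho>. y' \<rho> c) = v c" using c by (auto simp: y'_def)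
      finally show ?thesis using vJ[OF c \<rho>] by (simp add: F_def)
    qed
    then have 1: "\<phi> (?bu \<ominus>\<^bsub>F\<^esub> ?dy) \<in> N" by (rule \<phi>N)
    have "\<phi> (?bu \<ominus>\<^bsub>F\<^esub> ?dy) = \<phi> ?bu \<ominus>\<^bsub>P\<^esub> \<phi> ?dy"
      by (rule additive_map_diff[OF F.abelian_group_axioms P.abelian_group_axioms \<phi>a buc dyc])
    also have "\<phi> ?dy = cdiff R P b (a + k + j) (\<lambda>\<rho>. \<phi> (y' \<rho>)) \<rho>"
      by (rule cdiff_linear_map[OF Fm P.module_axioms b y'c \<phi>])
    also have "\<phi> ?bu = bprod R b \<rho> [^] j \<odot>\<^bsub>P\<^esub> \<phi> (u \<rho>)"
      by (rule linear_map_smult[OF \<phi> bk uc])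
    also have "\<phi> (u \<rho>) = \<phi> (bprod R b \<rho> [^] k \<odot>\<^bsub>F\<^esub> e \<rho>) \<ominus>\<^bsub>P\<^esub> \<phi> (y \<rho>)"
      unfolding u_def
      by (rule additive_map_diff[OF F.abelian_group_axioms P.abelian_group_axioms \<phi>a bec yc])
    also have "\<phi> (bprod R b \<rho> [^] k \<odot>\<^bsub>F\<^esub> e \<rho>) = bprod R b \<rho> [^] k \<odot>\<^bsub>P\<^esub> x \<rho>"
      using linear_map_smult[OF \<phi> bk ec] \<phi>e[OF \<rho>] by simp
    finally have 2: "\<phi> (?bu \<ominus>\<^bsub>F\<^esub> ?dy) =
      bprod R b \<rho> [^] j \<odot>\<^bsub>P\<^esub> (bprod R b \<rho> [^] k \<odot>\<^bsub>P\<^esub> x \<rho> \<ominus>\<^bsub>P\<^esub> \<phi> (y \<rho>))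
        \<ominus>\<^bsub>P\<^esub> cdiff R P b (a + k + j) (\<lambda>\<rho>. \<phi> (y' \<rho>)) \<rho>" .
    let ?d = "cdiff R P b (a + k + j) (\<lambda>\<rho>. \<phi> (y' \<rho>)) \<rho>"
    let ?n = "bprod R b \<rho> [^] j \<odot>\<^bsub>P\<^esub> \<phi> (y \<rho>)"
    let ?m = "bprod R b \<rho> [^] (k + j) \<odot>\<^bsub>P\<^esub> x \<rho>"
    have dc: "?d \<in> carrier P" by (rule P.cdiff_closed[OF b \<phi>y'c])
    have nN: "?n \<in> N" using y P.submodule_closed(6)[OF N bk] by (simp add: K_def)
    have nc: "?n \<in> carrier P" using nN P.submodule_closed(1)[OF N] by blast
    have mc: "?m \<in> carrier P" using bk xc by simp
    have "bprod R b \<rho> [^] j \<odot>\<^bsub>P\<^esub> (bprod R b \<rho> [^] k \<odot>\<^bsub>P\<^esub> x \<rho> \<ominus>\<^bsub>P\<^esub> \<phi> (y \<rho>)) = ?m \<ominus>\<^bsub>P\<^esub> ?n"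
      using P.smult_pow_add[of "bprod R b \<rho>" "x \<rho>" j k] b bk xc \<phi>c[OF yc]
      by (simp add: P.smult_diff_distr add.commute)
    then have "\<phi> (?bu \<ominus>\<^bsub>F\<^esub> ?dy) = ?m \<ominus>\<^bsub>P\<^esub> ?n \<ominus>\<^bsub>P\<^esub> ?d" using 2 by simp
    then have "?m \<ominus>\<^bsub>P\<^esub> ?d = \<phi> (?bu \<ominus>\<^bsub>F\<^esub> ?dy) \<oplus>\<^bsub>P\<^esub> ?n"
    proof -
      have "?m \<ominus>\<^bsub>P\<^esub> ?d = (?m \<ominus>\<^bsub>P\<^esub> ?n \<ominus>\<^bsub>P\<^esub> ?d) \<oplus>\<^bsub>P\<^esub> ?n"
        using P.diff_diff_add_cancel[OF mc nc dc] by simp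
      then show ?thesis using \<open>\<phi> (?bu \<ominus>\<^bsub>F\<^esub> ?dy) = ?m \<ominus>\<^bsub>P\<^esub> ?n \<ominus>\<^bsub>P\<^esub> ?d\<close> by simp
    qed
    then show ?thesis
      using P.submodule_closed(3)[OF N 1 nN] by (simp add: add.assoc)
  qed
  then show "\<exists>k y. (\<forall>\<rho>. y \<rho> \<in> Z) \<and> (\<forall>\<rho>\<in>?C. bprod R b \<rho> [^] k \<odot>\<^bsub>P\<^esub> x \<rho> \<ominus>\<^bsub>P\<^esub> cdiff R P b (a + k) y \<rho> \<in> N)"
    using \<phi>Z y'c by (intro exI[of _ "k + j"] exI[of _ "\<lambda>\<rho>. \<phi> (y' \<rho>)"]) blast
qed

lemma ideal_imp_submodule_self:
  assumes "cring R" "ideal J R"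
  shows "submodule J R (self_module R)"
proof -
  interpret cring R by fact
  interpret J: ideal J R by fact
  interpret S: module R "self_module R" by (rule self_module_is_module)
  show ?thesis
    by (rule S.submoduleI)
      (auto simp: a_inv_self_module J.a_Hcarr J.I_l_closed)
qed

text \<open>Descending induction on the degree, which starts where there are no cells. It runs over the submodules of
  one function module over \<open>R\<close>, which contains the relations of all the presentations used in
  \<open>rel_exact_step\<close>.\<close>

lemma rel_exact_of_killed:
  fixes R (structure)
  assumes "module R P" and b: "b \<in> UNIV \<rightarrow> carrier R"
    and Z: "submodule Z R P" and N: "submodule N R P"
    and J: "ideal J R" and JZ: "\<And>r z. r \<in> J \<Longrightarrow> z \<in> Z \<Longrightarrow> r \<odot>\<^bsub>P\<^esub> z \<in> N"
    and self: "\<And>i. i \<ge> q \<Longrightarrow> rel_exact R (self_module R) b s (carrier R) J i"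
    and "p \<ge> q"
  shows "rel_exact R P b s Z N p"
proof -
  interpret P: module R P by fact
  interpret S: module R "self_module R" by (rule P.R.self_module_is_module)
  note JS = ideal_imp_submodule_self[OF P.R.is_cring J]
  have Jc: "J \<subseteq> carrier R" using S.submodule_closed(1)[OF JS] by auto
  let ?F = "fun_module (self_module R) :: ('a, nat set \<Rightarrow> 'a) module"
  have Fm: "module R ?F" by (rule fun_module_is_module[OF S.module_axioms])
  interpret F: module R ?F by (rule Fm)
  have JF: "submodule {r. \<forall>c. r c \<in> J} R ?F"
  proof (rule F.submoduleI)
    fix r :: "nat set \<Rightarrow> 'a" assume r: "r \<in> {r. \<forall>c. r c \<in> J}"
    have "(\<ominus>\<^bsub>?F\<^esub> r) c = \<ominus>\<^bsub>self_module R\<^esub> (r c)" for c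
      using r Jc by (intro additive_map_minus[OF F.abelian_group_axioms S.abelian_group_axioms
            linear_map_additive[OF linear_map_eval]]) auto
    then show "\<ominus>\<^bsub>?F\<^esub> r \<in> {r. \<forall>c. r c \<in> J}" using r S.submodule_closed(5)[OF JS] by simp
  qed (use Jc S.submodule_closed[OF JS] in auto)
  have "rel_exact R ?F b s K {r. \<forall>c. r c \<in> J} i"
    if "submodule K R ?F" "i \<ge> q" "{r. \<forall>c. r c \<in> J} \<subseteq> K" for K i
    using that
  proof (induction "nat (int s + 1 - i)" arbitrary: K i rule: less_induct)
    case less
    show ?case
    proof (cases "i > int s")
      case True
      then show ?thesis by (intro rel_exact_trivial[OF Fm less.prems(1)] cells_above)
    next
      case False
      show ?thesis
      proof (rule rel_exact_step[OF Fm b less.prems(1) JF Jc])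
        show "r \<odot>\<^bsub>?F\<^esub> z \<in> {r. \<forall>c. r c \<in> J}" if r: "r \<in> J" and z: "z \<in> K" for r z
        proof -
          have "z \<in> carrier ?F" using F.submodule_closed(1)[OF less.prems(1)] z by blast
          then show ?thesis using J r by (auto intro!: ideal.I_r_closed)
        qed
        show "rel_exact R (self_module R) b s (carrier R) J i" by (rule self[OF less.prems(2)])
        show "submodule J R (self_module R)" by fact
        show "rel_exact R ?F b s K' {r. \<forall>c. r c \<in> J} (i + 1)"
          if "submodule K' R ?F" "{r. \<forall>c. r c \<in> J} \<subseteq> K'" for K'
          using False less.prems(2) that by (intro less.hyps) auto
      qed
    qed
  qed
  then show ?thesis
    using \<open>p \<ge> q\<close>
    by (intro rel_exact_step[OF \<open>module R P\<close> b Z N Jc JZ self JS]) auto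
qed

section \<open>Graded modules and homogeneous scalars\<close>

context module
begin

lemma linear_map_cdiff:
  assumes "b \<in> UNIV \<rightarrow> carrier R"
  shows "linear_map R (fun_module M) M (\<lambda>u. cdiff R M b a u \<tau>)"
  using assms by (auto simp: linear_map_def additive_map_def cdiff_closed cdiff_add cdiff_smult)

lemma fun_submoduleI:
  assumes "N \<subseteq> carrier (fun_module M)" "\<zero>\<^bsub>fun_module M\<^esub> \<in> N"
    and "\<And>x y. x \<in> N \<Longrightarrow> y \<in> N \<Longrightarrow> x \<oplus>\<^bsub>fun_module M\<^esub> y \<in> N"
    and "\<And>c x. c \<in> carrier R \<Longrightarrow> x \<in> N \<Longrightarrow> c \<odot>\<^bsub>fun_module M\<^esub> x \<in> N"
  shows "submodule N R (fun_module M)"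
proof -
  interpret F: module R "fun_module M" by (rule fun_module_is_module[OF module_axioms])
  show ?thesis
  proof (rule F.submoduleI)
    fix x assume x: "x \<in> N"
    then have "\<ominus>\<^bsub>fun_module M\<^esub> x = (\<ominus> \<one>) \<odot>\<^bsub>fun_module M\<^esub> x"
      using F.smult_l_minus[of \<one> x] F.smult_one[of x] assms(1) by auto
    then show "\<ominus>\<^bsub>fun_module M\<^esub> x \<in> N" using assms(4)[OF _ x, of "\<ominus> \<one>"] by simp
  qed (use assms in auto)
qed

lemma ideal_transporter:
  assumes Z: "Z \<subseteq> carrier M" and N: "submodule N R M"
  shows "ideal {c \<in> carrier R. \<forall>z\<in>Z. c \<odot>\<^bsub>M\<^esub> z \<in> N} R"
proof (rule idealI)
  show "ring R" by (rule R.ring_axioms)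
  have zc: "z \<in> carrier M" if "z \<in> Z" for z using Z that by auto
  show "subgroup {c \<in> carrier R. \<forall>z\<in>Z. c \<odot>\<^bsub>M\<^esub> z \<in> N} (add_monoid R)"
    by (rule R.add.subgroupI)
      (use zc submodule_closed[OF N] in \<open>auto simp: smult_l_distr smult_l_minus intro!: exI[of _ \<zero>]\<close>)
  fix a x assume a: "a \<in> {c \<in> carrier R. \<forall>z\<in>Z. c \<odot>\<^bsub>M\<^esub> z \<in> N}" and x: "x \<in> carrier R"
  show "x \<otimes> a \<in> {c \<in> carrier R. \<forall>z\<in>Z. c \<odot>\<^bsub>M\<^esub> z \<in> N}"
    using a x zc submodule_closed[OF N] by (auto simp: smult_assoc1)
  then show "a \<otimes> x \<in> {c \<in> carrier R. \<forall>z\<in>Z. c \<odot>\<^bsub>M\<^esub> z \<in> N}"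
    using a x by (simp add: R.m_comm)
qed

end

text \<open>The grading enters through the projections \<open>pr h\<close> onto the homogeneous components, by which cochains are
  replaced by their components of a given degree.\<close>

locale graded_mod = module R M + G: comm_group G
  for R :: "('r, 'k) ring_scheme" (structure) and M :: "('r, 'm, 'o) module_scheme" (structure)
    and G :: "('g, 'q) monoid_scheme" (structure) +
  fixes Mg :: "'g \<Rightarrow> 'm set" and pr
  assumes Mg_subgroup: "h \<in> carrier G \<Longrightarrow> subgroup (Mg h) (add_monoid M)"
    and pr_mem: "h \<in> carrier G \<Longrightarrow> x \<in> carrier M \<Longrightarrow> pr h x \<in> Mg h"
    and pr_add: "h \<in> carrier G \<Longrightarrow> x \<in> carrier M \<Longrightarrow> y \<in> carrier M \<Longrightarrow>
      pr h (x \<oplus>\<^bsub>M\<^esub> y) = pr h x \<oplus>\<^bsub>M\<^esub> pr h y"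
    and pr_id: "h \<in> carrier G \<Longrightarrow> x \<in> Mg h \<Longrightarrow> pr h x = x"
begin

lemma Mg_closed:
  assumes "h \<in> carrier G"
  shows "x \<in> Mg h \<Longrightarrow> x \<in> carrier M" "\<zero>\<^bsub>M\<^esub> \<in> Mg h"
    "x \<in> Mg h \<Longrightarrow> y \<in> Mg h \<Longrightarrow> x \<oplus>\<^bsub>M\<^esub> y \<in> Mg h"
    "x \<in> Mg h \<Longrightarrow> y \<in> Mg h \<Longrightarrow> x \<ominus>\<^bsub>M\<^esub> y \<in> Mg h"
    "x \<in> Mg h \<Longrightarrow> \<ominus>\<^bsub>M\<^esub> x \<in> Mg h"
proof -
  note s = Mg_subgroup[OF assms]
  show "x \<in> Mg h \<Longrightarrow> x \<in> carrier M" using subgroup.subset[OF s] by auto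
  show "\<zero>\<^bsub>M\<^esub> \<in> Mg h" using subgroup.one_closed[OF s] by simp
  show a: "x \<in> Mg h \<Longrightarrow> y \<in> Mg h \<Longrightarrow> x \<oplus>\<^bsub>M\<^esub> y \<in> Mg h" for y
    using subgroup.m_closed[OF s] by simp
  show i: "x \<in> Mg h \<Longrightarrow> \<ominus>\<^bsub>M\<^esub> x \<in> Mg h" for x
    using subgroup.m_inv_closed[OF s] by (simp add: a_inv_def)
  show "x \<in> Mg h \<Longrightarrow> y \<in> Mg h \<Longrightarrow> x \<ominus>\<^bsub>M\<^esub> y \<in> Mg h"
    using a i by (simp add: a_minus_def)
qed

lemma pr_closed [simp]: "h \<in> carrier G \<Longrightarrow> x \<in> carrier M \<Longrightarrow> pr h x \<in> carrier M"
  using pr_mem Mg_closed(1) by blast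

lemma pr_additive: "h \<in> carrier G \<Longrightarrow> additive_map M M (pr h)"
  by (auto simp: additive_map_def pr_add)

lemma pr_diff:
  "h \<in> carrier G \<Longrightarrow> x \<in> carrier M \<Longrightarrow> y \<in> carrier M \<Longrightarrow>
    pr h (x \<ominus>\<^bsub>M\<^esub> y) = pr h x \<ominus>\<^bsub>M\<^esub> pr h y"
  by (rule additive_map_diff[OF M.abelian_group_axioms M.abelian_group_axioms pr_additive])

lemma pr_minus: "h \<in> carrier G \<Longrightarrow> x \<in> carrier M \<Longrightarrow> pr h (\<ominus>\<^bsub>M\<^esub> x) = \<ominus>\<^bsub>M\<^esub> pr h x"
  by (rule additive_map_minus[OF M.abelian_group_axioms M.abelian_group_axioms pr_additive])

lemma pr_zero: "h \<in> carrier G \<Longrightarrow> pr h \<zero>\<^bsub>M\<^esub> = \<zero>\<^bsub>M\<^esub>"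
  by (rule additive_map_zero[OF M.abelian_group_axioms M.abelian_group_axioms pr_additive])

text \<open>Homogeneity of a scalar is expressed through its action on \<open>M\<close>, in the form in which it makes the
  projections commute with the differentials.\<close>

definition homog where
  "homog c d \<longleftrightarrow> c \<in> carrier R \<and> d \<in> carrier G \<and>
    (\<forall>h\<in>carrier G. \<forall>x\<in>carrier M. pr (h \<otimes>\<^bsub>G\<^esub> d) (c \<odot>\<^bsub>M\<^esub> x) = c \<odot>\<^bsub>M\<^esub> pr h x)"

lemma homogD:
  assumes "homog c d"
  shows "c \<in> carrier R" "d \<in> carrier G"
    "h \<in> carrier G \<Longrightarrow> x \<in> carrier M \<Longrightarrow> pr (h \<otimes>\<^bsub>G\<^esub> d) (c \<odot>\<^bsub>M\<^esub> x) = c \<odot>\<^bsub>M\<^esub> pr h x"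
  using assms by (auto simp: homog_def)

lemma homog_mem:
  assumes "homog c d" "h \<in> carrier G" "x \<in> Mg h"
  shows "c \<odot>\<^bsub>M\<^esub> x \<in> Mg (h \<otimes>\<^bsub>G\<^esub> d)"
proof -
  have "c \<odot>\<^bsub>M\<^esub> x = pr (h \<otimes>\<^bsub>G\<^esub> d) (c \<odot>\<^bsub>M\<^esub> x)"
    using homogD(3)[OF assms(1,2)] pr_id[OF assms(2,3)] Mg_closed(1)[OF assms(2,3)] by simp
  then show ?thesis
    using pr_mem[of "h \<otimes>\<^bsub>G\<^esub> d" "c \<odot>\<^bsub>M\<^esub> x"] homogD(1,2)[OF assms(1)] assms(2) Mg_closed(1)[OF assms(2,3)]
    by simp
qed

lemma homog_one: "homog \<one> \<one>\<^bsub>G\<^esub>"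
  by (simp add: homog_def)

lemma homog_mult: "homog c d \<Longrightarrow> homog c' d' \<Longrightarrow> homog (c \<otimes> c') (d \<otimes>\<^bsub>G\<^esub> d')"
  unfolding homog_def
proof (intro conjI ballI)
  assume c: "c \<in> carrier R \<and> d \<in> carrier G \<and>
      (\<forall>h\<in>carrier G. \<forall>x\<in>carrier M. pr (h \<otimes>\<^bsub>G\<^esub> d) (c \<odot>\<^bsub>M\<^esub> x) = c \<odot>\<^bsub>M\<^esub> pr h x)"
    and c': "c' \<in> carrier R \<and> d' \<in> carrier G \<and>
      (\<forall>h\<in>carrier G. \<forall>x\<in>carrier M. pr (h \<otimes>\<^bsub>G\<^esub> d') (c' \<odot>\<^bsub>M\<^esub> x) = c' \<odot>\<^bsub>M\<^esub> pr h x)"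
  show "c \<otimes> c' \<in> carrier R" "d \<otimes>\<^bsub>G\<^esub> d' \<in> carrier G" using c c' by auto
  fix h x assume h: "h \<in> carrier G" and x: "x \<in> carrier M"
  have "h \<otimes>\<^bsub>G\<^esub> (d \<otimes>\<^bsub>G\<^esub> d') = (h \<otimes>\<^bsub>G\<^esub> d') \<otimes>\<^bsub>G\<^esub> d"
    using h c c' by (simp add: G.m_ac)
  then show "pr (h \<otimes>\<^bsub>G\<^esub> (d \<otimes>\<^bsub>G\<^esub> d')) (c \<otimes> c' \<odot>\<^bsub>M\<^esub> x) = c \<otimes> c' \<odot>\<^bsub>M\<^esub> pr h x"
    using h x c c' by (simp add: smult_assoc1)
qed

lemma homog_pow: "homog c d \<Longrightarrow> homog (c [^] (k::nat)) (d [^]\<^bsub>G\<^esub> k)"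
  by (induction k) (auto simp: homog_one homog_mult)

lemma homog_neg: "homog c d \<Longrightarrow> homog (\<ominus> c) d"
  by (auto simp: homog_def smult_l_minus pr_minus)

lemma homog_sign: "homog ((\<ominus> \<one>) [^] (k::nat)) \<one>\<^bsub>G\<^esub>"
  using homog_pow[OF homog_neg[OF homog_one], of k] by simp

lemma homog_dcoef:
  assumes "\<And>i. homog (b i) (\<beta> i)"
  shows "homog (dcoef R b a \<tau> i) (\<beta> i [^]\<^bsub>G\<^esub> a)"
  using homog_mult[OF homog_sign homog_pow[OF assms]] homogD(2)[OF assms]
  unfolding dcoef_def by simp

definition bdeg where "bdeg \<beta> \<rho> = (\<Otimes>\<^bsub>G\<^esub>i\<in>\<rho>. \<beta> i)"

lemma bdeg_closed [simp]: "(\<And>i. \<beta> i \<in> carrier G) \<Longrightarrow> bdeg \<beta> \<rho> \<in> carrier G"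
  unfolding bdeg_def by (intro G.finprod_closed) auto

lemma bdeg_insert:
  "(\<And>i. \<beta> i \<in> carrier G) \<Longrightarrow> finite \<rho> \<Longrightarrow> i \<notin> \<rho> \<Longrightarrow> bdeg \<beta> (insert i \<rho>) = \<beta> i \<otimes>\<^bsub>G\<^esub> bdeg \<beta> \<rho>"
  unfolding bdeg_def by (intro G.finprod_insert) auto

lemma bdeg_remove:
  assumes "\<And>i. \<beta> i \<in> carrier G" "finite \<rho>" "i \<in> \<rho>"
  shows "bdeg \<beta> \<rho> = \<beta> i \<otimes>\<^bsub>G\<^esub> bdeg \<beta> (\<rho> - {i})"
  using bdeg_insert[OF assms(1), of "\<rho> - {i}" i] assms(2,3) by (simp add: insert_absorb)

lemma homog_bprod:
  assumes "\<And>i. homog (b i) (\<beta> i)"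
  shows "homog (bprod R b \<rho>) (bdeg \<beta> \<rho>)"
proof (cases "finite \<rho>")
  case True
  then show ?thesis
  proof (induction \<rho>)
    case empty
    then show ?case by (simp add: bprod_def bdeg_def homog_one)
  next
    case (insert i \<rho>)
    have "bprod R b (insert i \<rho>) = b i \<otimes> bprod R b \<rho>"
      unfolding bprod_def using insert.hyps homogD(1)[OF assms] by (intro R.finprod_insert) auto
    then show ?case
      using homog_mult[OF assms insert.IH] bdeg_insert[of \<beta>, OF homogD(2)[OF assms] insert.hyps] by simp
  qed
next
  case False
  then show ?thesis by (simp add: bprod_def bdeg_def homog_one)
qed

lemma cdiff_mem:
  assumes hb: "\<And>i. homog (b i) (\<beta> i)" and h: "h \<in> carrier G"
    and "\<And>i. i \<in> \<tau> \<Longrightarrow> dg (\<tau> - {i}) \<in> carrier G \<and> dg (\<tau> - {i}) \<otimes>\<^bsub>G\<^esub> \<beta> i [^]\<^bsub>G\<^esub> (a::nat) = h"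
    and "\<And>i. i \<in> \<tau> \<Longrightarrow> x (\<tau> - {i}) \<in> Mg (dg (\<tau> - {i}))"
  shows "cdiff R M b a x \<tau> \<in> Mg h"
proof -
  have "dcoef R b a \<tau> i \<odot>\<^bsub>M\<^esub> x (\<tau> - {i}) \<in> Mg h" if "i \<in> \<tau>" for i
  proof -
    have "dcoef R b a \<tau> i \<odot>\<^bsub>M\<^esub> x (\<tau> - {i}) \<in> Mg (dg (\<tau> - {i}) \<otimes>\<^bsub>G\<^esub> \<beta> i [^]\<^bsub>G\<^esub> a)"
      by (rule homog_mem[OF homog_dcoef[where b = b and \<beta> = \<beta>, OF hb]]) (use assms(3,4)[OF that] in auto)
    then show ?thesis using assms(3)[OF that] by simp
  qed
  then have 1: "(\<lambda>i. dcoef R b a \<tau> i \<odot>\<^bsub>M\<^esub> x (\<tau> - {i})) \<in> \<tau> \<rightarrow> Mg h" by auto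
  have "(\<Oplus>\<^bsub>M\<^esub>i\<in>T. F i) \<in> Mg h" if "F \<in> T \<rightarrow> Mg h" for T :: "nat set" and F
  proof (cases "finite T")
    case True
    then show ?thesis using that
    proof (induction T)
      case (insert i T)
      then have "F i \<in> Mg h" "F \<in> T \<rightarrow> Mg h" by auto
      moreover have "F i \<in> carrier M" "F \<in> T \<rightarrow> carrier M"
        using calculation Mg_closed(1)[OF h] by auto
      ultimately show ?case using insert.hyps insert.IH Mg_closed(3)[OF h] by simp
    qed (simp add: Mg_closed[OF h])
  qed (simp add: Mg_closed[OF h])
  then show ?thesis unfolding cdiff_def using 1 by blast
qed

lemma pr_cdiff:
  assumes hb: "\<And>i. homog (b i) (\<beta> i)" and h: "h \<in> carrier G"
    and dg: "\<And>\<rho>. dg \<rho> \<in> carrier G"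
    and dgh: "\<And>i. i \<in> \<tau> \<Longrightarrow> dg (\<tau> - {i}) \<otimes>\<^bsub>G\<^esub> \<beta> i [^]\<^bsub>G\<^esub> (a::nat) = h"
    and x: "\<And>\<rho>. x \<rho> \<in> carrier M"
  shows "pr h (cdiff R M b a x \<tau>) = cdiff R M b a (\<lambda>\<rho>. pr (dg \<rho>) (x \<rho>)) \<tau>"
proof (rule cdiff_additive_map[OF module_axioms module_axioms _ x pr_additive[OF h]])
  show "b \<in> UNIV \<rightarrow> carrier R" using homogD(1)[OF hb] by auto
  show "pr (dg \<rho>) (x \<rho>) \<in> carrier M" for \<rho> using x dg by simp
  show "pr h (dcoef R b a \<tau> i \<odot>\<^bsub>M\<^esub> x (\<tau> - {i})) = dcoef R b a \<tau> i \<odot>\<^bsub>M\<^esub> pr (dg (\<tau> - {i})) (x (\<tau> - {i}))"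
    if "i \<in> \<tau>" for i
    using homogD(3)[OF homog_dcoef[where b = b and \<beta> = \<beta> and a = a and \<tau> = \<tau> and i = i, OF hb] dg x,
        of "\<tau> - {i}" "\<tau> - {i}"]
      dgh[OF that] by simp
qed

end

section \<open>The double complex of Cech and Koszul cochains\<close>

text \<open>The sequence \<open>b\<close>, with degrees \<open>\<beta>\<close>, gives the Cech direction and the sequence \<open>f\<close>, with
  degrees \<open>\<delta>\<close>, the Koszul direction. A double cochain is a function of two sets of indices, one for each
  direction.\<close>

locale double_complex = graded_mod R M G Mg pr
  for R :: "('r, 'k) ring_scheme" (structure) and M :: "('r, 'm, 'o) module_scheme" (structure)
    and G :: "('g, 'q) monoid_scheme" (structure) and Mg pr +
  fixes b :: "nat \<Rightarrow> 'r" and \<beta> and s :: nat and f :: "nat \<Rightarrow> 'r" and \<delta> and r :: nat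
  assumes hb: "homog (b i) (\<beta> i)" and hf: "homog (f i) (\<delta> i)"
begin

lemma b_closed: "b \<in> UNIV \<rightarrow> carrier R" using homogD(1)[OF hb] by auto
lemma f_closed: "f \<in> UNIV \<rightarrow> carrier R" using homogD(1)[OF hf] by auto
lemma \<beta>_closed [simp]: "\<beta> i \<in> carrier G" by (rule homogD(2)[OF hb])
lemma \<delta>_closed [simp]: "\<delta> i \<in> carrier G" by (rule homogD(2)[OF hf])

lemma bpow_closed [simp]: "bprod R b \<rho> [^] (k::nat) \<in> carrier R"
  using b_closed by simp

abbreviation F where "F \<equiv> fun_module M :: ('r, nat set \<Rightarrow> 'm) module"

lemma F_module: "module R F"
  by (rule fun_module_is_module[OF module_axioms])

text \<open>The Koszul differential. It is set to zero outside the subsets of \<open>{..<r}\<close>, where it would not be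
  homogeneous: removing an element \<open>j \<ge> r\<close> from \<open>J\<close> does not change the complement of \<open>J\<close>.\<close>

definition D where "D u J = (if J \<subseteq> {..<r} then cdiff R M f 1 u J else \<zero>\<^bsub>M\<^esub>)"

abbreviation d where "d a x \<rho> J \<equiv> cdiff R M b a (\<lambda>\<rho>'. x \<rho>' J) \<rho>"

lemma D_cell: "J \<in> cells r q \<Longrightarrow> D u J = cdiff R M f 1 u J"
  by (auto simp: D_def cells_def)

lemma D_closed: "(\<And>J. u J \<in> carrier M) \<Longrightarrow> D u J \<in> carrier M"
  by (simp add: D_def cdiff_closed[OF f_closed])

lemma linear_map_D: "linear_map R F M (\<lambda>u. D u J)"
proof (cases "J \<subseteq> {..<r}")
  case True
  then show ?thesis using linear_map_cdiff[OF f_closed] by (simp add: D_def)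
next
  case False
  then show ?thesis by (simp add: D_def linear_map_def additive_map_def)
qed

lemma D_diff:
  assumes "\<And>J. u J \<in> carrier M" "\<And>J. v J \<in> carrier M"
  shows "D (\<lambda>J. u J \<ominus>\<^bsub>M\<^esub> v J) J = D u J \<ominus>\<^bsub>M\<^esub> D v J"
  using M.minus_eq_zero_iff[of "\<zero>\<^bsub>M\<^esub>" "\<zero>\<^bsub>M\<^esub>"]
  by (simp add: D_def cdiff_diff[OF f_closed assms])

lemma D_smult:
  assumes "\<And>J. u J \<in> carrier M" "c \<in> carrier R"
  shows "D (\<lambda>J. c \<odot>\<^bsub>M\<^esub> u J) J = c \<odot>\<^bsub>M\<^esub> D u J"
  by (simp add: D_def cdiff_smult[OF f_closed assms] assms)

lemma D_cong:
  assumes "J \<in> cells r (q + 1)" "\<And>J. v J \<in> carrier M" "\<And>J. J \<in> cells r q \<Longrightarrow> u J = v J"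
  shows "D u J = D v J"
  unfolding D_cell[OF assms(1)] using assms(2,3) cells_remove[OF assms(1)]
  by (intro cdiff_cong[OF f_closed]) auto

lemma D_D:
  assumes "\<And>J. u J \<in> carrier M" "J \<in> cells r q"
  shows "D (D u) J = \<zero>\<^bsub>M\<^esub>"
proof -
  have "D (D u) J = cdiff R M f 1 (cdiff R M f 1 u) J"
    unfolding D_cell[OF assms(2)] using assms(2)
    by (intro cdiff_cong[OF f_closed] cdiff_closed[OF f_closed] assms(1)) (auto simp: D_def cells_def)
  then show ?thesis using cdiff_cdiff[OF f_closed assms(1) cells_finite[OF assms(2)]] by simp
qed

lemma d_closed: "(\<And>\<rho> J. x \<rho> J \<in> carrier M) \<Longrightarrow> d a x \<rho> J \<in> carrier M"
  by (rule cdiff_closed[OF b_closed])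

lemma D_d:
  assumes "\<And>\<rho> J. x \<rho> J \<in> carrier M"
  shows "D (\<lambda>J. d a x \<rho> J) J = d a (\<lambda>\<rho>. D (x \<rho>)) \<rho> J"
proof -
  have "cdiff R F b a x \<rho> = (\<lambda>J. d a x \<rho> J)"
    using cdiff_fun_module[OF module_axioms b_closed, of x] assms by auto
  moreover have "(\<lambda>u. D u J) (cdiff R F b a x \<rho>) = cdiff R M b a (\<lambda>\<rho>. D (x \<rho>) J) \<rho>"
    using cdiff_linear_map[OF F_module module_axioms b_closed _ linear_map_D, of x] assms by simp
  ultimately show ?thesis by simp
qed

lemma d_d: "(\<And>\<rho> J. x \<rho> J \<in> carrier M) \<Longrightarrow> \<tau> \<in> cells s p \<Longrightarrow> d a (d a x) \<tau> J = \<zero>\<^bsub>M\<^esub>"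
  using cdiff_cdiff[OF b_closed _ cells_finite, of "\<lambda>\<rho>. x \<rho> J"] by blast

text \<open>The cochain index \<open>J\<close> stands for the Koszul generator indexed by the complement of \<open>J\<close>,
  whence the shift by the degrees of the complement.\<close>

definition deg where
  "deg g a \<rho> J = (g \<otimes>\<^bsub>G\<^esub> inv\<^bsub>G\<^esub> (bdeg \<delta> ({..<r} - J))) \<otimes>\<^bsub>G\<^esub> bdeg \<beta> \<rho> [^]\<^bsub>G\<^esub> (a::nat)"

lemma deg_closed [simp]: "g \<in> carrier G \<Longrightarrow> deg g a \<rho> J \<in> carrier G"
  by (simp add: deg_def)

lemma deg_top: "g \<in> carrier G \<Longrightarrow> deg g a \<rho> {..<r} = g \<otimes>\<^bsub>G\<^esub> bdeg \<beta> \<rho> [^]\<^bsub>G\<^esub> a"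
  by (simp add: deg_def bdeg_def)

lemma deg_shift:
  "g \<in> carrier G \<Longrightarrow> deg g a \<rho> J \<otimes>\<^bsub>G\<^esub> bdeg \<beta> \<rho> [^]\<^bsub>G\<^esub> k = deg g (a + k) \<rho> J"
  by (simp add: deg_def G.m_assoc G.nat_pow_mult)

lemma bdeg_pow_step:
  "finite \<rho> \<Longrightarrow> i \<in> \<rho> \<Longrightarrow> bdeg \<beta> (\<rho> - {i}) [^]\<^bsub>G\<^esub> (a::nat) \<otimes>\<^bsub>G\<^esub> \<beta> i [^]\<^bsub>G\<^esub> a = bdeg \<beta> \<rho> [^]\<^bsub>G\<^esub> a"
  using bdeg_remove[of \<beta> \<rho> i] by (simp add: G.nat_pow_distrib G.m_comm)

lemma deg_d:
  "g \<in> carrier G \<Longrightarrow> finite \<rho> \<Longrightarrow> i \<in> \<rho> \<Longrightarrow>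
    deg g a (\<rho> - {i}) J \<otimes>\<^bsub>G\<^esub> \<beta> i [^]\<^bsub>G\<^esub> a = deg g a \<rho> J"
  using bdeg_pow_step[of \<rho> i a] by (simp add: deg_def G.m_assoc)

lemma deg_D:
  assumes "g \<in> carrier G" "J \<subseteq> {..<r}" "j \<in> J"
  shows "deg g a \<rho> (J - {j}) \<otimes>\<^bsub>G\<^esub> \<delta> j [^]\<^bsub>G\<^esub> (1::nat) = deg g a \<rho> J"
proof -
  have e: "{..<r} - (J - {j}) = insert j ({..<r} - J)" using assms by auto
  have "bdeg \<delta> ({..<r} - (J - {j})) = \<delta> j \<otimes>\<^bsub>G\<^esub> bdeg \<delta> ({..<r} - J)"
    unfolding e using assms by (intro bdeg_insert) auto
  then have "inv\<^bsub>G\<^esub> (bdeg \<delta> ({..<r} - (J - {j}))) \<otimes>\<^bsub>G\<^esub> \<delta> j = inv\<^bsub>G\<^esub> (bdeg \<delta> ({..<r} - J))"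
    using G.inv_mult[of "\<delta> j" "bdeg \<delta> ({..<r} - J)"]
      G.m_assoc[of "inv\<^bsub>G\<^esub> (bdeg \<delta> ({..<r} - J))" "inv\<^bsub>G\<^esub> (\<delta> j)" "\<delta> j"]
      G.m_comm[of "inv\<^bsub>G\<^esub> (\<delta> j)" "inv\<^bsub>G\<^esub> (bdeg \<delta> ({..<r} - J))"] by simp
  moreover have "(x \<otimes>\<^bsub>G\<^esub> y \<otimes>\<^bsub>G\<^esub> z) \<otimes>\<^bsub>G\<^esub> w = x \<otimes>\<^bsub>G\<^esub> (y \<otimes>\<^bsub>G\<^esub> w) \<otimes>\<^bsub>G\<^esub> z"
    if "x \<in> carrier G" "y \<in> carrier G" "z \<in> carrier G" "w \<in> carrier G" for x y z w
    using that by (simp add: G.m_ac)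
  ultimately show ?thesis
    using assms(1) by (simp add: deg_def)
qed

definition hom where "hom g a x \<longleftrightarrow> (\<forall>\<rho> J. x \<rho> J \<in> Mg (deg g a \<rho> J))"

lemma hom_closed: "g \<in> carrier G \<Longrightarrow> hom g a x \<Longrightarrow> x \<rho> J \<in> carrier M"
  unfolding hom_def using Mg_closed(1)[OF deg_closed, of g "x \<rho> J" a \<rho> J] by simp

lemma hom_diff: "g \<in> carrier G \<Longrightarrow> hom g a x \<Longrightarrow> hom g a y \<Longrightarrow> hom g a (\<lambda>\<rho> J. x \<rho> J \<ominus>\<^bsub>M\<^esub> y \<rho> J)"
  by (simp add: hom_def Mg_closed)

lemma bpow_mem:
  assumes "h \<in> carrier G" "x \<in> Mg h"
  shows "bprod R b \<rho> [^] (k::nat) \<odot>\<^bsub>M\<^esub> x \<in> Mg (h \<otimes>\<^bsub>G\<^esub> bdeg \<beta> \<rho> [^]\<^bsub>G\<^esub> k)"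
  by (rule homog_mem[OF homog_pow[OF homog_bprod[OF hb]] assms])

lemma hom_shift:
  assumes "g \<in> carrier G" "hom g a x"
  shows "hom g (a + k) (\<lambda>\<rho> J. bprod R b \<rho> [^] k \<odot>\<^bsub>M\<^esub> x \<rho> J)"
  using assms bpow_mem[OF deg_closed[OF assms(1)]] deg_shift[OF assms(1)] unfolding hom_def by metis

lemma hom_d: "g \<in> carrier G \<Longrightarrow> hom g a x \<Longrightarrow> finite \<tau> \<Longrightarrow> d a x \<tau> J \<in> Mg (deg g a \<tau> J)"
  by (rule cdiff_mem[OF hb, of _ _ "\<lambda>\<rho>. deg g a \<rho> J"]) (auto simp: deg_d hom_def)

lemma hom_D:
  assumes "g \<in> carrier G" "hom g a x"
  shows "hom g a (\<lambda>\<rho>. D (x \<rho>))"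
  unfolding hom_def
proof (intro allI)
  fix \<rho> J
  show "D (x \<rho>) J \<in> Mg (deg g a \<rho> J)"
  proof (cases "J \<subseteq> {..<r}")
    case True
    then show ?thesis
      unfolding D_def using assms deg_D[OF assms(1) True]
      by (auto intro!: cdiff_mem[OF hf, of _ _ "\<lambda>J. deg g a \<rho> J"] simp: hom_def)
  next
    case False
    then show ?thesis using assms by (simp add: D_def Mg_closed)
  qed
qed

abbreviation prh where "prh g a x \<equiv> (\<lambda>\<rho> J. pr (deg g a \<rho> J) (x \<rho> J))"

lemma hom_pr: "g \<in> carrier G \<Longrightarrow> (\<And>\<rho> J. x \<rho> J \<in> carrier M) \<Longrightarrow> hom g a (prh g a x)"
  by (simp add: hom_def pr_mem)

lemma pr_d:
  assumes "g \<in> carrier G" "\<And>\<rho> J. x \<rho> J \<in> carrier M" "finite \<tau>"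
  shows "pr (deg g a \<tau> J) (d a x \<tau> J) = d a (prh g a x) \<tau> J"
  by (rule pr_cdiff[OF hb, of _ "\<lambda>\<rho>. deg g a \<rho> J"]) (use assms deg_d in auto)

lemma pr_D:
  assumes "g \<in> carrier G" "\<And>\<rho> J. x \<rho> J \<in> carrier M"
  shows "pr (deg g a \<rho> J) (D (x \<rho>) J) = D (prh g a x \<rho>) J"
proof (cases "J \<subseteq> {..<r}")
  case True
  have "pr (deg g a \<rho> J) (cdiff R M f 1 (x \<rho>) J) = cdiff R M f 1 (prh g a x \<rho>) J"
    by (rule pr_cdiff[OF hf, of _ "\<lambda>J. deg g a \<rho> J"]) (use assms deg_D[OF assms(1) True] in auto)
  then show ?thesis using True by (simp add: D_def)
next
  case False
  then show ?thesis using assms by (simp add: D_def pr_zero)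
qed

text \<open>Koszul cocycles and coboundaries in degree \<open>q\<close>. The values outside the cells of the relevant size are
  unconstrained in both, so they do not contribute to the quotient.\<close>

definition Zk where "Zk q = {x \<in> carrier F. \<forall>J\<in>cells r (q + 1). D x J = \<zero>\<^bsub>M\<^esub>}"
definition Bk where "Bk q = {x \<in> carrier F. \<exists>y\<in>carrier F. \<forall>J\<in>cells r q. x J = D y J}"

lemma D_zero: "D (\<lambda>_. \<zero>\<^bsub>M\<^esub>) J = \<zero>\<^bsub>M\<^esub>"
  by (simp add: D_def cdiff_zero[OF f_closed])

lemma D_add:
  assumes "\<And>J. u J \<in> carrier M" "\<And>J. v J \<in> carrier M"
  shows "D (\<lambda>J. u J \<oplus>\<^bsub>M\<^esub> v J) J = D u J \<oplus>\<^bsub>M\<^esub> D v J"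
  by (simp add: D_def cdiff_add[OF f_closed assms])

lemma Zk_submodule: "submodule (Zk q) R F"
  by (rule fun_submoduleI) (auto simp: Zk_def D_zero D_add D_smult)

lemma Bk_submodule: "submodule (Bk q) R F"
proof (rule fun_submoduleI)
  show "\<zero>\<^bsub>F\<^esub> \<in> Bk q" by (auto simp: Bk_def D_zero intro!: bexI[of _ "\<lambda>_. \<zero>\<^bsub>M\<^esub>"])
  fix x y assume "x \<in> Bk q" "y \<in> Bk q"
  then obtain x' y' where "x \<in> carrier F" "x' \<in> carrier F" "\<forall>J\<in>cells r q. x J = D x' J"
    "y \<in> carrier F" "y' \<in> carrier F" "\<forall>J\<in>cells r q. y J = D y' J" by (auto simp: Bk_def)
  then show "x \<oplus>\<^bsub>F\<^esub> y \<in> Bk q"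
    by (auto simp: Bk_def D_add intro!: bexI[of _ "\<lambda>J. x' J \<oplus>\<^bsub>M\<^esub> y' J"])
next
  fix c x assume c: "c \<in> carrier R" and "x \<in> Bk q"
  then obtain x' where "x \<in> carrier F" "x' \<in> carrier F" "\<forall>J\<in>cells r q. x J = D x' J"
    by (auto simp: Bk_def)
  then show "c \<odot>\<^bsub>F\<^esub> x \<in> Bk q"
    using c by (auto simp: Bk_def D_smult intro!: bexI[of _ "\<lambda>J. c \<odot>\<^bsub>M\<^esub> x' J"])
qed (auto simp: Bk_def)

lemma f_kills:
  assumes "j < r" "z \<in> Zk q"
  shows "f j \<odot>\<^bsub>F\<^esub> z \<in> Bk q"
proof -
  have zc: "z J \<in> carrier M" for J using assms by (simp add: Zk_def)
  have fj: "f j \<in> carrier R" using f_closed by auto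
  let ?h = "\<lambda>J. if j \<in> J then \<zero>\<^bsub>M\<^esub>
      else (\<ominus> \<one>) [^] card {k \<in> insert j J. k < j} \<odot>\<^bsub>M\<^esub> z (insert j J)"
  have "D ?h J = f j \<odot>\<^bsub>M\<^esub> z J" if J: "J \<in> cells r q" for J
    unfolding D_cell[OF J]
  proof (rule cdiff_contraction[OF f_closed zc cells_finite[OF J]])
    assume "j \<notin> J"
    then have "insert j J \<in> cells r (q + 1)"
      using J assms(1) cells_finite[OF J] by (auto simp: cells_def)
    then show "cdiff R M f 1 z (insert j J) = \<zero>\<^bsub>M\<^esub>"
      using assms(2) D_cell by (auto simp: Zk_def)
  qed
  then show ?thesis
    unfolding Bk_def using zc fj by (auto intro!: bexI[of _ ?h])
qed

text \<open>The vanishing of the degree \<open>h\<close> part of the \<open>p\<close>-th Cech cohomology, in terms of numerators.\<close>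

definition vanishes where
  "vanishes p h \<longleftrightarrow> (\<forall>a x. (\<forall>\<rho>. x \<rho> \<in> Mg (h \<otimes>\<^bsub>G\<^esub> bdeg \<beta> \<rho> [^]\<^bsub>G\<^esub> a)) \<longrightarrow>
    (\<forall>\<tau>\<in>cells s (p + 1). cdiff R M b a x \<tau> = \<zero>\<^bsub>M\<^esub>) \<longrightarrow>
    (\<exists>k y. (\<forall>\<rho>. y \<rho> \<in> Mg (h \<otimes>\<^bsub>G\<^esub> bdeg \<beta> \<rho> [^]\<^bsub>G\<^esub> (a + k))) \<and>
      (\<forall>\<rho>\<in>cells s p. bprod R b \<rho> [^] k \<odot>\<^bsub>M\<^esub> x \<rho> = cdiff R M b (a + k) y \<rho>)))"

text \<open>The vanishing hypotheses for the individual \<open>J\<close> combine to a statement about double cochains, because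
  there are finitely many \<open>J\<close>.\<close>

lemma vanishing_family:
  assumes g: "g \<in> carrier G" and u: "hom g a u"
    and du: "\<And>\<tau> J. \<tau> \<in> cells s (p + 1) \<Longrightarrow> J \<in> cells r q \<Longrightarrow> d a u \<tau> J = \<zero>\<^bsub>M\<^esub>"
    and van: "\<And>J. J \<in> cells r q \<Longrightarrow> vanishes p (g \<otimes>\<^bsub>G\<^esub> inv\<^bsub>G\<^esub> (bdeg \<delta> ({..<r} - J)))"
  obtains k w where "hom g (a + k) w"
    "\<And>\<rho> J. \<rho> \<in> cells s p \<Longrightarrow> J \<in> cells r q \<Longrightarrow>
      bprod R b \<rho> [^] k \<odot>\<^bsub>M\<^esub> u \<rho> J = d (a + k) w \<rho> J"
proof -
  let ?Q = "\<lambda>J k. \<exists>y. (\<forall>\<rho>. y \<rho> \<in> Mg (deg g (a + k) \<rho> J)) \<and>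
    (\<forall>\<rho>\<in>cells s p. bprod R b \<rho> [^] k \<odot>\<^bsub>M\<^esub> u \<rho> J = cdiff R M b (a + k) y \<rho>)"
  have "\<exists>k. \<forall>J\<in>cells r q. ?Q J k"
  proof (rule finite_uniform_exponent[OF finite_cells])
    fix J assume J: "J \<in> cells r q"
    have "\<forall>\<rho>. u \<rho> J \<in> Mg (g \<otimes>\<^bsub>G\<^esub> inv\<^bsub>G\<^esub> (bdeg \<delta> ({..<r} - J)) \<otimes>\<^bsub>G\<^esub> bdeg \<beta> \<rho> [^]\<^bsub>G\<^esub> a)"
      using u by (simp add: hom_def deg_def)
    then show "\<exists>k. ?Q J k"
      using van[OF J, unfolded vanishes_def, rule_format, of "\<lambda>\<rho>. u \<rho> J" a] du[OF _ J]
      unfolding deg_def by blast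
  next
    fix J and k j :: nat assume "?Q J k"
    then obtain y where y: "\<And>\<rho>. y \<rho> \<in> Mg (deg g (a + k) \<rho> J)"
      and uy: "\<And>\<rho>. \<rho> \<in> cells s p \<Longrightarrow> bprod R b \<rho> [^] k \<odot>\<^bsub>M\<^esub> u \<rho> J = cdiff R M b (a + k) y \<rho>"
      by blast
    have yc: "y \<rho> \<in> carrier M" for \<rho> using y Mg_closed(1)[OF deg_closed[OF g]] by blast
    let ?y = "\<lambda>\<rho>. bprod R b \<rho> [^] j \<odot>\<^bsub>M\<^esub> y \<rho>"
    have "?y \<rho> \<in> Mg (deg g (a + (k + j)) \<rho> J)" for \<rho>
      using bpow_mem[OF deg_closed[OF g] y[of \<rho>], of \<rho> j] deg_shift[OF g, of "a + k" \<rho> J j]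
      by (simp add: add.assoc)
    moreover have "bprod R b \<rho> [^] (k + j) \<odot>\<^bsub>M\<^esub> u \<rho> J = cdiff R M b (a + (k + j)) ?y \<rho>"
      if "\<rho> \<in> cells s p" for \<rho>
      using cdiff_shift[OF b_closed yc cells_finite[OF that], of "a + k" j] uy[OF that]
        smult_pow_add[of "bprod R b \<rho>" "u \<rho> J" j k] b_closed hom_closed[OF g u]
      by (simp add: add.assoc add.commute[of j k])
    ultimately show "?Q J (k + j)" by (intro exI[of _ ?y]) simp
  qed
  then obtain k where "\<forall>J\<in>cells r q. ?Q J k" by blast
  then obtain w where w: "\<And>J \<rho>. J \<in> cells r q \<Longrightarrow> w J \<rho> \<in> Mg (deg g (a + k) \<rho> J)"
    and uw: "\<And>J \<rho>. J \<in> cells r q \<Longrightarrow> \<rho> \<in> cells s p \<Longrightarrow>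
      bprod R b \<rho> [^] k \<odot>\<^bsub>M\<^esub> u \<rho> J = cdiff R M b (a + k) (w J) \<rho>"
    by metis
  define W where "W \<rho> J = (if J \<in> cells r q then w J \<rho> else \<zero>\<^bsub>M\<^esub>)" for \<rho> J
  have "hom g (a + k) W" using w g by (simp add: hom_def W_def Mg_closed)
  moreover have "bprod R b \<rho> [^] k \<odot>\<^bsub>M\<^esub> u \<rho> J = d (a + k) W \<rho> J"
    if "\<rho> \<in> cells s p" "J \<in> cells r q" for \<rho> J
    using uw[OF that(2,1)] that(2) by (simp add: W_def)
  ultimately show thesis using that by blast
qed

text \<open>A column-by-column diagram chase. The first step corrects \<open>v\<close> by Koszul cocycles so that its Cech
  differential becomes a Koszul boundary \<open>D v2\<close>, which is possible because the Koszul cohomology has no Cech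
  cohomology in these degrees. The element \<open>v2\<close> has one degree more in the Cech direction and one less in the
  Koszul direction; by induction it can be replaced by a Cech cocycle, hence by a Cech
  coboundary, and then its Koszul image is subtracted from \<open>v\<close>. The number \<open>n\<close> is the Koszul degree of
  \<open>v\<close> plus one, so that the induction starts where there are no cells.\<close>

lemma lift_to_cocycle:
  assumes g: "g \<in> carrier G"
    and ex: "\<And>q p'. p' > p \<Longrightarrow> rel_exact R F b s (Zk q) (Bk q) p'"
    and v: "hom g a v"
    and Ddv: "\<And>\<tau> J. \<tau> \<in> cells s (p + 1) \<Longrightarrow> J \<in> cells r (int n) \<Longrightarrow> D (\<lambda>J. d a v \<tau> J) J = \<zero>\<^bsub>M\<^esub>"
    and van: "\<And>i J. i \<ge> 1 \<Longrightarrow> J \<in> cells r (int n - 1 - i) \<Longrightarrow>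
      vanishes (p + i) (g \<otimes>\<^bsub>G\<^esub> inv\<^bsub>G\<^esub> (bdeg \<delta> ({..<r} - J)))"
  shows "\<exists>k u. hom g (a + k) u \<and>
    (\<forall>\<tau>\<in>cells s (p + 1). \<forall>J\<in>cells r (int n - 1). d (a + k) u \<tau> J = \<zero>\<^bsub>M\<^esub>) \<and>
    (\<forall>\<rho>\<in>cells s p. \<forall>J\<in>cells r (int n). D (u \<rho>) J = bprod R b \<rho> [^] k \<odot>\<^bsub>M\<^esub> D (v \<rho>) J)"
  using assms
proof (induction n arbitrary: p a v)
  case 0
  have "cells r (int 0 - 1) = {}" by (rule cells_below) simp
  moreover have "D (v \<rho>) J \<in> carrier M" for \<rho> J using D_closed hom_closed[OF g 0(3)] by blast
  ultimately show ?case
    using 0(3) by (intro exI[of _ 0] exI[of _ v]) simp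
next
  case (Suc n)
  note v = Suc.prems(3)
  let ?q = "int n"
  have q: "int (Suc n) = ?q + 1" "int (Suc n) - 1 = ?q" by auto
  interpret F: module R F by (rule F_module)
  have vc: "v \<rho> J \<in> carrier M" for \<rho> J by (rule hom_closed[OF g v])
  have dvc: "d a v \<rho> J \<in> carrier M" for \<rho> J by (rule d_closed[OF vc])
  define z where "z \<tau> = (if \<tau> \<in> cells s (p + 1) then (\<lambda>J. d a v \<tau> J) else (\<lambda>_. \<zero>\<^bsub>M\<^esub>))" for \<tau>
  have zZ: "z \<tau> \<in> Zk ?q" for \<tau>
    using Suc.prems(4)[unfolded q] dvc by (auto simp: Zk_def z_def D_zero)
  have zc: "z \<tau> J \<in> carrier M" for \<tau> J using dvc by (simp add: z_def)
  have dz: "cdiff R F b a z \<tau> \<in> Bk ?q" if \<tau>: "\<tau> \<in> cells s (p + 1 + 1)" for \<tau>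
  proof -
    have "cdiff R F b a z \<tau> J = \<zero>\<^bsub>M\<^esub>" for J
    proof -
      have "cdiff R F b a z \<tau> J = d a z \<tau> J"
        by (rule cdiff_fun_module[OF module_axioms b_closed zc])
      also have "\<dots> = d a (d a v) \<tau> J"
        using cells_remove[OF \<tau>] by (intro cdiff_cong[OF b_closed dvc]) (simp add: z_def)
      also have "\<dots> = \<zero>\<^bsub>M\<^esub>" by (rule d_d[OF vc \<tau>])
      finally show ?thesis .
    qed
    then have "cdiff R F b a z \<tau> = \<zero>\<^bsub>F\<^esub>" by auto
    then show ?thesis using F.submodule_closed(2)[OF Bk_submodule, of ?q] by metis
  qed
  \<comment> \<open>The family \<open>z\<close> is a Cech cocycle of Koszul cocycles: it equals the differential of \<open>y\<close> up to a
    Koszul boundary.\<close>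
  have "rel_exact R F b s (Zk ?q) (Bk ?q) (p + 1)" by (rule Suc.prems(2)) simp
  from rel_exactE[OF this zZ dz] obtain k y where y: "\<And>\<rho>. y \<rho> \<in> Zk ?q"
    and yB: "\<And>\<rho>. \<rho> \<in> cells s (p + 1) \<Longrightarrow>
      bprod R b \<rho> [^] k \<odot>\<^bsub>F\<^esub> z \<rho> \<ominus>\<^bsub>F\<^esub> cdiff R F b (a + k) y \<rho> \<in> Bk ?q"
    by metis
  have yc: "y \<rho> J \<in> carrier M" for \<rho> J using y by (simp add: Zk_def)
  have "\<exists>v2. v2 \<in> carrier F \<and> (\<tau> \<in> cells s (p + 1) \<longrightarrow> (\<forall>J\<in>cells r ?q.
      bprod R b \<tau> [^] k \<odot>\<^bsub>M\<^esub> d a v \<tau> J \<ominus>\<^bsub>M\<^esub> d (a + k) y \<tau> J = D v2 J))" for \<tau>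
  proof (cases "\<tau> \<in> cells s (p + 1)")
    case True
    have c1: "bprod R b \<tau> [^] k \<odot>\<^bsub>F\<^esub> z \<tau> \<in> carrier F" using zc by simp
    have c2: "cdiff R F b (a + k) y \<tau> \<in> carrier F"
      by (rule F.cdiff_closed[OF b_closed]) (simp add: yc)
    have "(bprod R b \<tau> [^] k \<odot>\<^bsub>F\<^esub> z \<tau> \<ominus>\<^bsub>F\<^esub> cdiff R F b (a + k) y \<tau>) J
      = bprod R b \<tau> [^] k \<odot>\<^bsub>M\<^esub> d a v \<tau> J \<ominus>\<^bsub>M\<^esub> d (a + k) y \<tau> J" for J
      using fun_module_diff[OF module_axioms c1 c2, of J]
        cdiff_fun_module[OF module_axioms b_closed, of y "a + k" \<tau> J] yc True by (simp add: z_def)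
    moreover obtain v2 where "v2 \<in> carrier F"
      "\<forall>J\<in>cells r ?q. (bprod R b \<tau> [^] k \<odot>\<^bsub>F\<^esub> z \<tau> \<ominus>\<^bsub>F\<^esub> cdiff R F b (a + k) y \<tau>) J = D v2 J"
      using yB[OF True] unfolding Bk_def by blast
    ultimately show ?thesis by (intro exI[of _ v2]) simp
  next
    case False
    then show ?thesis by (intro exI[of _ "\<lambda>_. \<zero>\<^bsub>M\<^esub>"]) simp
  qed
  then obtain v2 where v2: "\<And>\<tau>. v2 \<tau> \<in> carrier F"
    and v2D: "\<And>\<tau> J. \<tau> \<in> cells s (p + 1) \<Longrightarrow> J \<in> cells r ?q \<Longrightarrow>
      bprod R b \<tau> [^] k \<odot>\<^bsub>M\<^esub> d a v \<tau> J \<ominus>\<^bsub>M\<^esub> d (a + k) y \<tau> J = D (v2 \<tau>) J"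
    by metis
  have v2c: "v2 \<tau> J \<in> carrier M" for \<tau> J using v2 by simp
  \<comment> \<open>Both sides of the relation are replaced by their components of the degree of \<open>v\<close>.\<close>
  define y' where "y' = prh g (a + k) y"
  define v2' where "v2' = prh g (a + k) v2"
  have hy': "hom g (a + k) y'" unfolding y'_def by (rule hom_pr[OF g yc])
  have hv2': "hom g (a + k) v2'" unfolding v2'_def by (rule hom_pr[OF g v2c])
  have y'c: "y' \<rho> J \<in> carrier M" for \<rho> J by (rule hom_closed[OF g hy'])
  have v2'c: "v2' \<rho> J \<in> carrier M" for \<rho> J by (rule hom_closed[OF g hv2'])
  have Dy': "D (y' \<rho>) J = \<zero>\<^bsub>M\<^esub>" if "J \<in> cells r (?q + 1)" for \<rho> J
  proof -
    have "D (y \<rho>) J = \<zero>\<^bsub>M\<^esub>" using y that by (simp add: Zk_def)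
    then show ?thesis using pr_D[OF g, of y "a + k" \<rho> J] yc pr_zero[OF deg_closed[OF g]] by (simp add: y'_def)
  qed
  define v1 where "v1 \<rho> J = bprod R b \<rho> [^] k \<odot>\<^bsub>M\<^esub> v \<rho> J \<ominus>\<^bsub>M\<^esub> y' \<rho> J" for \<rho> J
  have hbv: "hom g (a + k) (\<lambda>\<rho> J. bprod R b \<rho> [^] k \<odot>\<^bsub>M\<^esub> v \<rho> J)" by (rule hom_shift[OF g v])
  have hv1: "hom g (a + k) v1" unfolding v1_def by (rule hom_diff[OF g hbv hy'])
  have v1c: "v1 \<rho> J \<in> carrier M" for \<rho> J by (rule hom_closed[OF g hv1])
  have dv1: "d (a + k) v1 \<tau> J = D (v2' \<tau>) J" if \<tau>: "\<tau> \<in> cells s (p + 1)" and J: "J \<in> cells r ?q" for \<tau> J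
  proof -
    note fin = cells_finite[OF \<tau>]
    have bd: "d (a + k) (\<lambda>\<rho> J. bprod R b \<rho> [^] k \<odot>\<^bsub>M\<^esub> v \<rho> J) \<tau> J = bprod R b \<tau> [^] k \<odot>\<^bsub>M\<^esub> d a v \<tau> J"
      using cdiff_shift[OF b_closed vc fin] .
    have "d (a + k) v1 \<tau> J = bprod R b \<tau> [^] k \<odot>\<^bsub>M\<^esub> d a v \<tau> J \<ominus>\<^bsub>M\<^esub> d (a + k) y' \<tau> J"
      unfolding v1_def bd[symmetric] using vc y'c by (intro cdiff_diff[OF b_closed]) auto
    also have "\<dots> = pr (deg g (a + k) \<tau> J)
        (bprod R b \<tau> [^] k \<odot>\<^bsub>M\<^esub> d a v \<tau> J \<ominus>\<^bsub>M\<^esub> d (a + k) y \<tau> J)"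
    proof -
      have "pr (deg g (a + k) \<tau> J) (bprod R b \<tau> [^] k \<odot>\<^bsub>M\<^esub> d a v \<tau> J) = bprod R b \<tau> [^] k \<odot>\<^bsub>M\<^esub> d a v \<tau> J"
        unfolding bd[symmetric] by (rule pr_id[OF deg_closed[OF g] hom_d[OF g hbv fin]])
      moreover have "pr (deg g (a + k) \<tau> J) (d (a + k) y \<tau> J) = d (a + k) y' \<tau> J"
        unfolding y'_def by (rule pr_d[OF g yc fin])
      ultimately show ?thesis 
        using pr_diff[where x = "bprod R b \<tau> [^] k \<odot>\<^bsub>M\<^esub> d a v \<tau> J" and y = "d (a + k) y \<tau> J",
            OF deg_closed[OF g]] dvc d_closed[where x = y and a = "a + k" and \<rho> = \<tau> and J = J] yc by simp
    qed
    also have "\<dots> = D (v2' \<tau>) J"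
      unfolding v2D[OF \<tau> J] v2'_def by (rule pr_D[OF g v2c])
    finally show ?thesis .
  qed
  have "\<exists>k' u. hom g (a + k + k') u \<and>
    (\<forall>\<tau>\<in>cells s (p + 1 + 1). \<forall>J\<in>cells r (int n - 1). d (a + k + k') u \<tau> J = \<zero>\<^bsub>M\<^esub>) \<and>
    (\<forall>\<rho>\<in>cells s (p + 1). \<forall>J\<in>cells r (int n). D (u \<rho>) J = bprod R b \<rho> [^] k' \<odot>\<^bsub>M\<^esub> D (v2' \<rho>) J)"
  proof (rule Suc.IH[OF g])
    show "rel_exact R F b s (Zk q) (Bk q) p'" if "p' > p + 1" for q p'
      using that by (intro Suc.prems(2)) simp
    show "hom g (a + k) v2'" by (rule hv2')
    show "D (\<lambda>J. d (a + k) v2' \<tau> J) J = \<zero>\<^bsub>M\<^esub>" if \<tau>: "\<tau> \<in> cells s (p + 1 + 1)" and J: "J \<in> cells r (int n)" for \<tau> J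
    proof -
      have "D (\<lambda>J. d (a + k) v2' \<tau> J) J = d (a + k) (\<lambda>\<rho>. D (v2' \<rho>)) \<tau> J" by (rule D_d[OF v2'c])
      also have "\<dots> = d (a + k) (d (a + k) v1) \<tau> J"
        using cells_remove[OF \<tau>] dv1[OF _ J]
        by (intro cdiff_cong[OF b_closed d_closed[OF v1c]]) simp
      also have "\<dots> = \<zero>\<^bsub>M\<^esub>" by (rule d_d[OF v1c \<tau>])
      finally show ?thesis .
    qed
    show "vanishes (p + 1 + i) (g \<otimes>\<^bsub>G\<^esub> inv\<^bsub>G\<^esub> (bdeg \<delta> ({..<r} - J)))"
      if "1 \<le> i" "J \<in> cells r (int n - 1 - i)" for i J
      using Suc.prems(5)[of "1 + i" J] that by (simp add: algebra_simps)
  qed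
  then obtain k' u where hu: "hom g (a + k + k') u"
    and du: "\<And>\<tau> J. \<tau> \<in> cells s (p + 1 + 1) \<Longrightarrow> J \<in> cells r (?q - 1) \<Longrightarrow> d (a + k + k') u \<tau> J = \<zero>\<^bsub>M\<^esub>"
    and Du: "\<And>\<rho> J. \<rho> \<in> cells s (p + 1) \<Longrightarrow> J \<in> cells r ?q \<Longrightarrow>
      D (u \<rho>) J = bprod R b \<rho> [^] k' \<odot>\<^bsub>M\<^esub> D (v2' \<rho>) J"
    by metis
  have "vanishes (p + 1) (g \<otimes>\<^bsub>G\<^esub> inv\<^bsub>G\<^esub> (bdeg \<delta> ({..<r} - J)))" if "J \<in> cells r (?q - 1)" for J
    using Suc.prems(5)[of 1 J] that by simp
  from vanishing_family[OF g hu du this] obtain k'' w where hw: "hom g (a + k + k' + k'') w"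
    and dw: "\<And>\<rho> J. \<rho> \<in> cells s (p + 1) \<Longrightarrow> J \<in> cells r (?q - 1) \<Longrightarrow>
      bprod R b \<rho> [^] k'' \<odot>\<^bsub>M\<^esub> u \<rho> J = d (a + k + k' + k'') w \<rho> J"
    by metis
  \<comment> \<open>Subtracting \<open>D w\<close> does not change the Koszul differential, since \<open>D D = 0\<close>, and cancels the Cech
    differential of \<open>v1\<close>.\<close>
  let ?K = "k' + k''"
  define u1 where "u1 \<rho> J = bprod R b \<rho> [^] ?K \<odot>\<^bsub>M\<^esub> v1 \<rho> J \<ominus>\<^bsub>M\<^esub> D (w \<rho>) J" for \<rho> J
  have wc: "w \<rho> J \<in> carrier M" for \<rho> J by (rule hom_closed[OF g hw])
  have uc: "u \<rho> J \<in> carrier M" for \<rho> J by (rule hom_closed[OF g hu])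
  have Dwc: "D (w \<rho>) J \<in> carrier M" for \<rho> J by (rule D_closed[OF wc])
  have aK: "a + k + k' + k'' = a + k + ?K" by simp
  have "hom g (a + k + ?K) u1"
    unfolding u1_def using hom_diff[OF g hom_shift[OF g hv1, of ?K] hom_D[OF g hw, unfolded aK]] .
  moreover have "d (a + k + ?K) u1 \<tau> J = \<zero>\<^bsub>M\<^esub>" if \<tau>: "\<tau> \<in> cells s (p + 1)" and J: "J \<in> cells r ?q" for \<tau> J
  proof -
    note fin = cells_finite[OF \<tau>]
    have Dv2'c: "D (v2' \<tau>) J \<in> carrier M" by (rule D_closed[OF v2'c])
    have "d (a + k + ?K) u1 \<tau> J = d (a + k + ?K) (\<lambda>\<rho> J. bprod R b \<rho> [^] ?K \<odot>\<^bsub>M\<^esub> v1 \<rho> J) \<tau> J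
        \<ominus>\<^bsub>M\<^esub> d (a + k + ?K) (\<lambda>\<rho>. D (w \<rho>)) \<tau> J"
      unfolding u1_def using v1c Dwc by (intro cdiff_diff[OF b_closed]) auto
    also have "d (a + k + ?K) (\<lambda>\<rho> J. bprod R b \<rho> [^] ?K \<odot>\<^bsub>M\<^esub> v1 \<rho> J) \<tau> J
        = bprod R b \<tau> [^] ?K \<odot>\<^bsub>M\<^esub> D (v2' \<tau>) J"
      using cdiff_shift[OF b_closed v1c fin] dv1[OF \<tau> J] by simp
    also have "d (a + k + ?K) (\<lambda>\<rho>. D (w \<rho>)) \<tau> J = D (\<lambda>J. d (a + k + ?K) w \<tau> J) J"
      by (rule D_d[OF wc, symmetric])
    also have "\<dots> = D (\<lambda>J. bprod R b \<tau> [^] k'' \<odot>\<^bsub>M\<^esub> u \<tau> J) J"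
      using J uc dw[OF \<tau>] by (intro D_cong[of J "?q - 1"]) (auto simp: aK)
    also have "\<dots> = bprod R b \<tau> [^] k'' \<odot>\<^bsub>M\<^esub> D (u \<tau>) J" by (rule D_smult[OF uc bpow_closed])
    also have "\<dots> = bprod R b \<tau> [^] ?K \<odot>\<^bsub>M\<^esub> D (v2' \<tau>) J"
      unfolding Du[OF \<tau> J] using smult_pow_add[of "bprod R b \<tau>" "D (v2' \<tau>) J" k'' k'] b_closed Dv2'c
      by (simp add: add.commute)
    finally show ?thesis using Dv2'c M.minus_eq_zero_iff by simp
  qed
  moreover have "D (u1 \<rho>) J = bprod R b \<rho> [^] (k + ?K) \<odot>\<^bsub>M\<^esub> D (v \<rho>) J"
    if J: "J \<in> cells r (?q + 1)" for \<rho> J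
  proof -
    have Dvc: "D (v \<rho>) J \<in> carrier M" by (rule D_closed[OF vc])
    have bvc: "bprod R b \<rho> [^] k \<odot>\<^bsub>M\<^esub> v \<rho> J \<in> carrier M" for J using vc by simp
    have bv1c: "bprod R b \<rho> [^] ?K \<odot>\<^bsub>M\<^esub> v1 \<rho> J \<in> carrier M" for J using v1c by simp
    have "D (v1 \<rho>) J = D (\<lambda>J. bprod R b \<rho> [^] k \<odot>\<^bsub>M\<^esub> v \<rho> J) J \<ominus>\<^bsub>M\<^esub> D (y' \<rho>) J"
      unfolding v1_def by (rule D_diff[OF bvc y'c])
    also have "\<dots> = bprod R b \<rho> [^] k \<odot>\<^bsub>M\<^esub> D (v \<rho>) J"
      unfolding D_smult[OF vc bpow_closed] Dy'[OF J] using Dvc by (simp add: a_minus_def)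
    finally have 1: "D (v1 \<rho>) J = bprod R b \<rho> [^] k \<odot>\<^bsub>M\<^esub> D (v \<rho>) J" .
    have Dv1c: "D (v1 \<rho>) J \<in> carrier M" by (rule D_closed[OF v1c])
    have "D (u1 \<rho>) J = D (\<lambda>J. bprod R b \<rho> [^] ?K \<odot>\<^bsub>M\<^esub> v1 \<rho> J) J \<ominus>\<^bsub>M\<^esub> D (D (w \<rho>)) J"
      unfolding u1_def by (rule D_diff[OF bv1c Dwc])
    also have "\<dots> = bprod R b \<rho> [^] ?K \<odot>\<^bsub>M\<^esub> D (v1 \<rho>) J"
      unfolding D_smult[OF v1c bpow_closed] D_D[OF wc J] using Dv1c
      by (simp add: a_minus_def)
    also have "\<dots> = bprod R b \<rho> [^] (k + ?K) \<odot>\<^bsub>M\<^esub> D (v \<rho>) J"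
      unfolding 1 using smult_pow_add[of "bprod R b \<rho>" "D (v \<rho>) J" ?K k] b_closed Dvc
      by (simp add: add.commute)
    finally show ?thesis .
  qed
  ultimately show ?case
    unfolding q by (intro exI[of _ "k + ?K"] exI[of _ u1]) (auto simp: add.assoc)
qed

section \<open>Vanishing, injectivity and surjectivity in terms of numerators\<close>

abbreviation top where "top \<equiv> {..<r}"

text \<open>The submodule \<open>I M\<close>, as the image of the last Koszul differential; the set \<open>top\<close> carries the term
  \<open>K\<^sub>0 = M\<close>.\<close>

definition image_top where "image_top = {D v top | v. v \<in> carrier F}"

lemma top_cell: "top \<in> cells r (int r)" by (simp add: cells_top)

lemma image_topI: "(\<And>J. v J \<in> carrier M) \<Longrightarrow> D v top \<in> image_top"
  by (auto simp: image_top_def)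

lemma image_top_submodule: "submodule image_top R M"
proof (rule submoduleI)
  show "image_top \<subseteq> carrier M" by (auto simp: image_top_def D_closed)
  show "\<zero>\<^bsub>M\<^esub> \<in> image_top" using image_topI[of "\<lambda>_. \<zero>\<^bsub>M\<^esub>"] by (simp add: D_zero)
  show sm: "c \<odot>\<^bsub>M\<^esub> x \<in> image_top" if c: "c \<in> carrier R" and x: "x \<in> image_top" for c x
  proof -
    obtain v where v: "\<And>J. v J \<in> carrier M" "x = D v top" using x by (auto simp: image_top_def)
    show ?thesis using image_topI[of "\<lambda>J. c \<odot>\<^bsub>M\<^esub> v J"] v c by (simp add: D_smult)
  qed
  show "x \<oplus>\<^bsub>M\<^esub> y \<in> image_top" if x: "x \<in> image_top" and y: "y \<in> image_top" for x y
  proof -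
    obtain v w where "\<And>J. v J \<in> carrier M" "x = D v top" "\<And>J. w J \<in> carrier M" "y = D w top"
      using x y by (auto simp: image_top_def)
    then show ?thesis using image_topI[of "\<lambda>J. v J \<oplus>\<^bsub>M\<^esub> w J"] by (simp add: D_add)
  qed
  show "\<ominus>\<^bsub>M\<^esub> x \<in> image_top" if x: "x \<in> image_top" for x
  proof -
    have "x \<in> carrier M" using x by (auto simp: image_top_def D_closed)
    then show ?thesis using sm[of "\<ominus> \<one>" x] x by (simp add: smult_l_minus)
  qed
qed

lemma image_top_pr:
  fixes a :: nat
  assumes "g \<in> carrier G" "x \<in> image_top"
  shows "pr (g \<otimes>\<^bsub>G\<^esub> bdeg \<beta> \<rho> [^]\<^bsub>G\<^esub> a) x \<in> image_top"
proof -
  obtain v where v: "\<And>J. v J \<in> carrier M" "x = D v top" using assms by (auto simp: image_top_def)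
  have "pr (deg g a \<rho> top) (D v top) = D (prh g a (\<lambda>_. v) \<rho>) top"
    using pr_D[OF assms(1), of "\<lambda>_. v" a \<rho>] v by blast
  then show ?thesis
    using v assms(1) image_topI[of "prh g a (\<lambda>_. v) \<rho>"] by (simp add: deg_top)
qed

text \<open>The case of \<open>lift_to_cocycle\<close> where the Koszul boundary is taken in \<open>K\<^sub>0 = M\<close>.\<close>

lemma lift_image_top:
  assumes g: "g \<in> carrier G"
    and ex: "\<And>q p'. p' > p \<Longrightarrow> rel_exact R F b s (Zk q) (Bk q) p'"
    and w: "\<And>\<rho>. w \<rho> \<in> Mg (g \<otimes>\<^bsub>G\<^esub> bdeg \<beta> \<rho> [^]\<^bsub>G\<^esub> a)"
    and wT: "\<And>\<rho>. \<rho> \<in> cells s p \<Longrightarrow> w \<rho> \<in> image_top"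
    and dw: "\<And>\<tau>. \<tau> \<in> cells s (p + 1) \<Longrightarrow> cdiff R M b a w \<tau> = \<zero>\<^bsub>M\<^esub>"
    and van: "\<And>i J. i \<ge> 1 \<Longrightarrow> J \<in> cells r (int r - 1 - i) \<Longrightarrow>
      vanishes (p + i) (g \<otimes>\<^bsub>G\<^esub> inv\<^bsub>G\<^esub> (bdeg \<delta> ({..<r} - J)))"
  obtains k u where "hom g (a + k) u"
    "\<And>\<tau> J. \<tau> \<in> cells s (p + 1) \<Longrightarrow> J \<in> cells r (int r - 1) \<Longrightarrow> d (a + k) u \<tau> J = \<zero>\<^bsub>M\<^esub>"
    "\<And>\<rho>. \<rho> \<in> cells s p \<Longrightarrow> D (u \<rho>) top = bprod R b \<rho> [^] k \<odot>\<^bsub>M\<^esub> w \<rho>"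
proof -
  have "\<exists>v. v \<in> carrier F \<and> (\<rho> \<in> cells s p \<longrightarrow> w \<rho> = D v top)" for \<rho>
  proof (cases "\<rho> \<in> cells s p")
    case True
    then show ?thesis using wT[OF True] by (auto simp: image_top_def)
  next
    case False
    then show ?thesis by (intro exI[of _ "\<lambda>_. \<zero>\<^bsub>M\<^esub>"]) simp
  qed
  then obtain v where v: "\<And>\<rho>. v \<rho> \<in> carrier F"
    and wv: "\<And>\<rho>. \<rho> \<in> cells s p \<Longrightarrow> w \<rho> = D (v \<rho>) top" by metis
  have vc: "v \<rho> J \<in> carrier M" for \<rho> J using v by simp
  define v' where "v' = prh g a v"
  have hv': "hom g a v'" unfolding v'_def by (rule hom_pr[OF g vc])
  have v'c: "v' \<rho> J \<in> carrier M" for \<rho> J by (rule hom_closed[OF g hv'])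
  have wc: "w \<rho> \<in> carrier M" for \<rho> using w Mg_closed(1)[OF deg_closed[OF g]] deg_top[OF g] by metis
  have wv': "D (v' \<rho>) top = w \<rho>" if \<rho>: "\<rho> \<in> cells s p" for \<rho>
  proof -
    have "D (v' \<rho>) top = pr (deg g a \<rho> top) (w \<rho>)"
      unfolding v'_def wv[OF \<rho>] by (rule pr_D[OF g vc, symmetric])
    then show ?thesis using pr_id[OF deg_closed[OF g]] w deg_top[OF g] by metis
  qed
  have "\<exists>k u. hom g (a + k) u \<and>
    (\<forall>\<tau>\<in>cells s (p + 1). \<forall>J\<in>cells r (int r - 1). d (a + k) u \<tau> J = \<zero>\<^bsub>M\<^esub>) \<and>
    (\<forall>\<rho>\<in>cells s p. \<forall>J\<in>cells r (int r). D (u \<rho>) J = bprod R b \<rho> [^] k \<odot>\<^bsub>M\<^esub> D (v' \<rho>) J)"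
  proof (rule lift_to_cocycle[OF g ex hv' _ van])
    fix \<tau> J assume \<tau>: "\<tau> \<in> cells s (p + 1)" and "J \<in> cells r (int r)"
    then have J: "J = top" by (simp add: cells_top)
    have "D (\<lambda>J. d a v' \<tau> J) J = d a (\<lambda>\<rho>. D (v' \<rho>)) \<tau> J" by (rule D_d[OF v'c])
    also have "\<dots> = cdiff R M b a w \<tau>"
      using cells_remove[OF \<tau>] wv' unfolding J by (intro cdiff_cong[OF b_closed wc]) simp
    finally show "D (\<lambda>J. d a v' \<tau> J) J = \<zero>\<^bsub>M\<^esub>" using dw[OF \<tau>] by simp
  qed
  then show thesis using that wv' top_cell by metis
qed

lemma bdeg_shift:
  "g \<in> carrier G \<Longrightarrow> g \<otimes>\<^bsub>G\<^esub> bdeg \<beta> \<rho> [^]\<^bsub>G\<^esub> (a::nat) \<otimes>\<^bsub>G\<^esub> bdeg \<beta> \<rho> [^]\<^bsub>G\<^esub> (k::nat)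
    = g \<otimes>\<^bsub>G\<^esub> bdeg \<beta> \<rho> [^]\<^bsub>G\<^esub> (a + k)"
  by (simp add: G.m_assoc G.nat_pow_mult)

text \<open>Up to a coboundary, \<open>x\<close> takes values in the submodule generated by the products \<open>f\<^sub>j y\<close>, so it is
  the Koszul boundary of a chain whose Cech differential is a Koszul cycle. By \<open>lift_image_top\<close> this chain
  may be taken to consist of Cech cocycles \<open>u\<close>.\<close>

lemma cocycle_in_image:
  assumes g: "g \<in> carrier G"
    and ex: "\<And>q p'. p' > p \<Longrightarrow> rel_exact R F b s (Zk q) (Bk q) p'"
    and x: "\<And>\<rho>. x \<rho> \<in> Mg (g \<otimes>\<^bsub>G\<^esub> bdeg \<beta> \<rho> [^]\<^bsub>G\<^esub> a)"
    and dx: "\<And>\<tau>. \<tau> \<in> cells s (p + 1) \<Longrightarrow> cdiff R M b a x \<tau> = \<zero>\<^bsub>M\<^esub>"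
    and y: "\<And>\<rho>. y \<rho> \<in> carrier M"
    and xy: "\<And>\<rho>. \<rho> \<in> cells s p \<Longrightarrow>
      bprod R b \<rho> [^] k \<odot>\<^bsub>M\<^esub> x \<rho> \<ominus>\<^bsub>M\<^esub> cdiff R M b (a + k) y \<rho> \<in> image_top"
    and van: "\<And>i J. i \<ge> 1 \<Longrightarrow> J \<in> cells r (int r - 1 - i) \<Longrightarrow>
      vanishes (p + i) (g \<otimes>\<^bsub>G\<^esub> inv\<^bsub>G\<^esub> (bdeg \<delta> ({..<r} - J)))"
  obtains k' y' u where "\<And>\<rho>. y' \<rho> \<in> Mg (g \<otimes>\<^bsub>G\<^esub> bdeg \<beta> \<rho> [^]\<^bsub>G\<^esub> (a + k'))"
    "hom g (a + k') u"
    "\<And>\<tau> J. \<tau> \<in> cells s (p + 1) \<Longrightarrow> J \<in> cells r (int r - 1) \<Longrightarrow> d (a + k') u \<tau> J = \<zero>\<^bsub>M\<^esub>"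
    "\<And>\<rho>. \<rho> \<in> cells s p \<Longrightarrow>
      bprod R b \<rho> [^] k' \<odot>\<^bsub>M\<^esub> x \<rho> = cdiff R M b (a + k') y' \<rho> \<oplus>\<^bsub>M\<^esub> D (u \<rho>) top"
proof -
  let ?dg = "\<lambda>a \<rho>. g \<otimes>\<^bsub>G\<^esub> bdeg \<beta> \<rho> [^]\<^bsub>G\<^esub> (a::nat)"
  have dg: "?dg a \<rho> \<in> carrier G" for a \<rho> using g by simp
  have xc: "x \<rho> \<in> carrier M" for \<rho> by (rule Mg_closed(1)[OF dg x])
  define y' where "y' \<rho> = pr (?dg (a + k) \<rho>) (y \<rho>)" for \<rho>
  have y': "y' \<rho> \<in> Mg (?dg (a + k) \<rho>)" for \<rho> unfolding y'_def by (rule pr_mem[OF dg y])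
  have y'c: "y' \<rho> \<in> carrier M" for \<rho> by (rule Mg_closed(1)[OF dg y'])
  have step: "?dg a (\<tau> - {i}) \<otimes>\<^bsub>G\<^esub> \<beta> i [^]\<^bsub>G\<^esub> a = ?dg a \<tau>" if "finite \<tau>" "i \<in> \<tau>" for a \<tau> i
    using bdeg_pow_step[OF that, of a] g by (simp add: G.m_assoc)
  have bx: "bprod R b \<rho> [^] k \<odot>\<^bsub>M\<^esub> x \<rho> \<in> Mg (?dg (a + k) \<rho>)" for \<rho>
    using bpow_mem[OF dg x[of \<rho>], of \<rho> k] bdeg_shift[OF g] by simp
  have dy': "cdiff R M b (a + k) y' \<rho> \<in> Mg (?dg (a + k) \<rho>)" if "finite \<rho>" for \<rho>
    by (rule cdiff_mem[OF hb, of _ _ "?dg (a + k)"]) (use that dg y' step in auto)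
  define w where "w \<rho> = (if \<rho> \<in> cells s p then
      bprod R b \<rho> [^] k \<odot>\<^bsub>M\<^esub> x \<rho> \<ominus>\<^bsub>M\<^esub> cdiff R M b (a + k) y' \<rho> else \<zero>\<^bsub>M\<^esub>)" for \<rho>
  have w: "w \<rho> \<in> Mg (?dg (a + k) \<rho>)" for \<rho>
    using Mg_closed[OF dg] bx dy' cells_finite by (simp add: w_def)
  have bxc: "bprod R b \<rho> [^] k \<odot>\<^bsub>M\<^esub> x \<rho> \<in> carrier M" for \<rho> using xc by simp
  have dyc: "cdiff R M b (a + k) y \<rho> \<in> carrier M" for \<rho> by (rule cdiff_closed[OF b_closed y])
  have dy'c: "cdiff R M b (a + k) y' \<rho> \<in> carrier M" for \<rho> by (rule cdiff_closed[OF b_closed y'c])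
  have wT: "w \<rho> \<in> image_top" if \<rho>: "\<rho> \<in> cells s p" for \<rho>
  proof -
    have "pr (?dg (a + k) \<rho>) (cdiff R M b (a + k) y \<rho>) = cdiff R M b (a + k) y' \<rho>"
      unfolding y'_def by (rule pr_cdiff[OF hb dg, of "?dg (a + k)"]) (use dg y step cells_finite[OF \<rho>] in auto)
    then have "w \<rho> = pr (?dg (a + k) \<rho>) (bprod R b \<rho> [^] k \<odot>\<^bsub>M\<^esub> x \<rho> \<ominus>\<^bsub>M\<^esub> cdiff R M b (a + k) y \<rho>)"
      using \<rho> pr_diff[OF dg bxc dyc] pr_id[OF dg bx] by (simp add: w_def)
    then show ?thesis using image_top_pr[OF g xy[OF \<rho>]] by simp
  qed
  have dw: "cdiff R M b (a + k) w \<tau> = \<zero>\<^bsub>M\<^esub>" if \<tau>: "\<tau> \<in> cells s (p + 1)" for \<tau>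
  proof -
    note fin = cells_finite[OF \<tau>]
    have "cdiff R M b (a + k) w \<tau> = cdiff R M b (a + k)
        (\<lambda>\<rho>. bprod R b \<rho> [^] k \<odot>\<^bsub>M\<^esub> x \<rho> \<ominus>\<^bsub>M\<^esub> cdiff R M b (a + k) y' \<rho>) \<tau>"
      using cells_remove[OF \<tau>] bxc dy'c by (intro cdiff_cong[OF b_closed]) (auto simp: w_def)
    also have "\<dots> = cdiff R M b (a + k) (\<lambda>\<rho>. bprod R b \<rho> [^] k \<odot>\<^bsub>M\<^esub> x \<rho>) \<tau>
        \<ominus>\<^bsub>M\<^esub> cdiff R M b (a + k) (cdiff R M b (a + k) y') \<tau>"
      by (rule cdiff_diff[OF b_closed bxc dy'c])
    also have "\<dots> = \<zero>\<^bsub>M\<^esub>"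
      using cdiff_shift[OF b_closed xc fin, of a k] dx[OF \<tau>] cdiff_cdiff[OF b_closed y'c fin]
        M.minus_eq_zero_iff[of "\<zero>\<^bsub>M\<^esub>" "\<zero>\<^bsub>M\<^esub>"] by simp
    finally show ?thesis .
  qed
  from lift_image_top[OF g ex w wT dw van] obtain k' u where hu: "hom g (a + k + k') u"
    and du: "\<And>\<tau> J. \<tau> \<in> cells s (p + 1) \<Longrightarrow> J \<in> cells r (int r - 1) \<Longrightarrow> d (a + k + k') u \<tau> J = \<zero>\<^bsub>M\<^esub>"
    and Du: "\<And>\<rho>. \<rho> \<in> cells s p \<Longrightarrow> D (u \<rho>) top = bprod R b \<rho> [^] k' \<odot>\<^bsub>M\<^esub> w \<rho>"
    by metis
  show thesis
  proof (rule that[of "\<lambda>\<rho>. bprod R b \<rho> [^] k' \<odot>\<^bsub>M\<^esub> y' \<rho>" "k + k'" u])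
    show "bprod R b \<rho> [^] k' \<odot>\<^bsub>M\<^esub> y' \<rho> \<in> Mg (?dg (a + (k + k')) \<rho>)" for \<rho>
      using bpow_mem[OF dg y'[of \<rho>], of \<rho> k'] bdeg_shift[OF g, of \<rho> "a + k" k'] by (simp add: add.assoc)
    show "hom g (a + (k + k')) u" using hu by (simp add: add.assoc)
    show "d (a + (k + k')) u \<tau> J = \<zero>\<^bsub>M\<^esub>" if "\<tau> \<in> cells s (p + 1)" "J \<in> cells r (int r - 1)" for \<tau> J
      using du[OF that] by (simp add: add.assoc)
    fix \<rho> assume \<rho>: "\<rho> \<in> cells s p"
    let ?A = "bprod R b \<rho> [^] (k + k') \<odot>\<^bsub>M\<^esub> x \<rho>" and ?B = "bprod R b \<rho> [^] k' \<odot>\<^bsub>M\<^esub> cdiff R M b (a + k) y' \<rho>"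
    have Ac: "?A \<in> carrier M" and Bc: "?B \<in> carrier M" using xc dy'c by auto
    have "D (u \<rho>) top = ?A \<ominus>\<^bsub>M\<^esub> ?B"
      unfolding Du[OF \<rho>] using \<rho> bxc dy'c smult_pow_add[of "bprod R b \<rho>" "x \<rho>" k' k] b_closed xc
      by (simp add: w_def smult_diff_distr add.commute)
    moreover have "cdiff R M b (a + (k + k')) (\<lambda>\<rho>. bprod R b \<rho> [^] k' \<odot>\<^bsub>M\<^esub> y' \<rho>) \<rho> = ?B"
      using cdiff_shift[OF b_closed y'c cells_finite[OF \<rho>], of "a + k" k'] by (simp add: add.assoc)
    moreover have "?B \<oplus>\<^bsub>M\<^esub> (?A \<ominus>\<^bsub>M\<^esub> ?B) = ?A"
      using Ac Bc by (simp add: a_minus_def M.a_lcomm[of ?B ?A] M.r_neg)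
    ultimately show "?A = cdiff R M b (a + (k + k')) (\<lambda>\<rho>. bprod R b \<rho> [^] k' \<odot>\<^bsub>M\<^esub> y' \<rho>) \<rho> \<oplus>\<^bsub>M\<^esub> D (u \<rho>) top"
      by simp
  qed
qed

text \<open>Here the cocycles \<open>u\<close> of \<open>cocycle_in_image\<close> are themselves coboundaries, by the hypothesis for
  \<open>i = 0\<close>; then so is their combination with coefficients \<open>f\<^sub>j\<close>.\<close>

lemma vanishes_above:
  assumes g: "g \<in> carrier G"
    and ex: "\<And>q p'. p' > p \<Longrightarrow> rel_exact R F b s (Zk q) (Bk q) p'"
    and exM: "rel_exact R M b s (carrier M) image_top p"
    and van: "\<And>i J. i \<ge> 0 \<Longrightarrow> J \<in> cells r (int r - 1 - i) \<Longrightarrow>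
      vanishes (p + i) (g \<otimes>\<^bsub>G\<^esub> inv\<^bsub>G\<^esub> (bdeg \<delta> ({..<r} - J)))"
  shows "vanishes p g"
  unfolding vanishes_def
proof (intro allI impI)
  let ?dg = "\<lambda>a \<rho>. g \<otimes>\<^bsub>G\<^esub> bdeg \<beta> \<rho> [^]\<^bsub>G\<^esub> (a::nat)"
  fix a x assume x: "\<forall>\<rho>. x \<rho> \<in> Mg (?dg a \<rho>)" and dx: "\<forall>\<tau>\<in>cells s (p + 1). cdiff R M b a x \<tau> = \<zero>\<^bsub>M\<^esub>"
  have dg: "?dg a \<rho> \<in> carrier G" for a \<rho> using g by simp
  have xm: "x \<rho> \<in> Mg (?dg a \<rho>)" for \<rho> using x by simp
  have xc: "x \<rho> \<in> carrier M" for \<rho> using x Mg_closed(1)[OF dg] by blast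
  have z: "\<zero>\<^bsub>M\<^esub> \<in> image_top" by (rule submodule_closed(2)[OF image_top_submodule])
  have dxT: "cdiff R M b a x \<tau> \<in> image_top" if "\<tau> \<in> cells s (p + 1)" for \<tau> using dx z that by simp
  from rel_exactE[OF exM xc dxT] obtain k y where y: "\<And>\<rho>. y \<rho> \<in> carrier M"
    and xy: "\<And>\<rho>. \<rho> \<in> cells s p \<Longrightarrow>
      bprod R b \<rho> [^] k \<odot>\<^bsub>M\<^esub> x \<rho> \<ominus>\<^bsub>M\<^esub> cdiff R M b (a + k) y \<rho> \<in> image_top"
    by metis
  have dx': "cdiff R M b a x \<tau> = \<zero>\<^bsub>M\<^esub>" if "\<tau> \<in> cells s (p + 1)" for \<tau> using dx that by blast
  have van1: "vanishes (p + i) (g \<otimes>\<^bsub>G\<^esub> inv\<^bsub>G\<^esub> (bdeg \<delta> ({..<r} - J)))"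
    if "i \<ge> 1" "J \<in> cells r (int r - 1 - i)" for i J using van[of i J] that by simp
  from cocycle_in_image[OF g ex xm dx' y xy van1] obtain k' y' u where
    y': "\<And>\<rho>. y' \<rho> \<in> Mg (?dg (a + k') \<rho>)" and hu: "hom g (a + k') u"
    and du: "\<And>\<tau> J. \<tau> \<in> cells s (p + 1) \<Longrightarrow> J \<in> cells r (int r - 1) \<Longrightarrow> d (a + k') u \<tau> J = \<zero>\<^bsub>M\<^esub>"
    and xu: "\<And>\<rho>. \<rho> \<in> cells s p \<Longrightarrow>
      bprod R b \<rho> [^] k' \<odot>\<^bsub>M\<^esub> x \<rho> = cdiff R M b (a + k') y' \<rho> \<oplus>\<^bsub>M\<^esub> D (u \<rho>) top"
    by metis
  have "vanishes p (g \<otimes>\<^bsub>G\<^esub> inv\<^bsub>G\<^esub> (bdeg \<delta> ({..<r} - J)))" if "J \<in> cells r (int r - 1)" for J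
    using van[of 0 J] that by simp
  from vanishing_family[OF g hu du this] obtain k'' w where hw: "hom g (a + k' + k'') w"
    and dw: "\<And>\<rho> J. \<rho> \<in> cells s p \<Longrightarrow> J \<in> cells r (int r - 1) \<Longrightarrow>
      bprod R b \<rho> [^] k'' \<odot>\<^bsub>M\<^esub> u \<rho> J = d (a + k' + k'') w \<rho> J"
    by metis
  have wc: "w \<rho> J \<in> carrier M" for \<rho> J by (rule hom_closed[OF g hw])
  have uc: "u \<rho> J \<in> carrier M" for \<rho> J by (rule hom_closed[OF g hu])
  have y'c: "y' \<rho> \<in> carrier M" for \<rho> by (rule Mg_closed(1)[OF dg y'])
  let ?by = "\<lambda>\<rho>. bprod R b \<rho> [^] k'' \<odot>\<^bsub>M\<^esub> y' \<rho>"
  let ?Y = "\<lambda>\<rho>. ?by \<rho> \<oplus>\<^bsub>M\<^esub> D (w \<rho>) top"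
  have Dwc: "D (w \<rho>) top \<in> carrier M" for \<rho> by (rule D_closed[OF wc])
  have byc: "?by \<rho> \<in> carrier M" for \<rho> using y'c by simp
  have bym: "?by \<rho> \<in> Mg (?dg (a + (k' + k'')) \<rho>)" for \<rho>
    using bpow_mem[OF dg y'[of \<rho>], of \<rho> k''] bdeg_shift[OF g, of \<rho> "a + k'" k''] by (simp add: add.assoc)
  have Dwm: "D (w \<rho>) top \<in> Mg (?dg (a + (k' + k'')) \<rho>)" for \<rho>
    using hom_D[OF g hw] deg_top[OF g] unfolding hom_def by (metis add.assoc)
  have Y: "?Y \<rho> \<in> Mg (?dg (a + (k' + k'')) \<rho>)" for \<rho>
    by (rule Mg_closed(3)[OF dg bym Dwm])
  have "bprod R b \<rho> [^] (k' + k'') \<odot>\<^bsub>M\<^esub> x \<rho> = cdiff R M b (a + (k' + k'')) ?Y \<rho>" if \<rho>: "\<rho> \<in> cells s p" for \<rho>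
  proof -
    have "cdiff R M b (a + (k' + k'')) ?Y \<rho> = cdiff R M b (a + (k' + k'')) ?by \<rho> \<oplus>\<^bsub>M\<^esub>
        d (a + (k' + k'')) (\<lambda>\<rho>. D (w \<rho>)) \<rho> top"
      by (rule cdiff_add[OF b_closed byc Dwc])
    also have "cdiff R M b (a + (k' + k'')) ?by \<rho> = bprod R b \<rho> [^] k'' \<odot>\<^bsub>M\<^esub> cdiff R M b (a + k') y' \<rho>"
      using cdiff_shift[OF b_closed y'c cells_finite[OF \<rho>], of "a + k'" k''] by (simp add: add.assoc)
    also have "d (a + (k' + k'')) (\<lambda>\<rho>. D (w \<rho>)) \<rho> top = D (\<lambda>J. d (a + (k' + k'')) w \<rho> J) top"
      by (rule D_d[OF wc, symmetric])
    also have "\<dots> = D (\<lambda>J. bprod R b \<rho> [^] k'' \<odot>\<^bsub>M\<^esub> u \<rho> J) top"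
      using top_cell uc dw[OF \<rho>] by (intro D_cong[of top "int r - 1"]) (auto simp: add.assoc)
    also have "\<dots> = bprod R b \<rho> [^] k'' \<odot>\<^bsub>M\<^esub> D (u \<rho>) top" by (rule D_smult[OF uc bpow_closed])
    also have "bprod R b \<rho> [^] k'' \<odot>\<^bsub>M\<^esub> cdiff R M b (a + k') y' \<rho> \<oplus>\<^bsub>M\<^esub> bprod R b \<rho> [^] k'' \<odot>\<^bsub>M\<^esub> D (u \<rho>) top
      = bprod R b \<rho> [^] k'' \<odot>\<^bsub>M\<^esub> (bprod R b \<rho> [^] k' \<odot>\<^bsub>M\<^esub> x \<rho>)"
      unfolding xu[OF \<rho>]
      by (rule smult_r_distr[symmetric, OF bpow_closed cdiff_closed[OF b_closed y'c] D_closed[OF uc]])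
    finally show ?thesis
      using smult_pow_add[of "bprod R b \<rho>" "x \<rho>" k'' k'] b_closed xc by (simp add: add.commute)
  qed
  then show "\<exists>k y. (\<forall>\<rho>. y \<rho> \<in> Mg (?dg (a + k) \<rho>)) \<and>
      (\<forall>\<rho>\<in>cells s p. bprod R b \<rho> [^] k \<odot>\<^bsub>M\<^esub> x \<rho> = cdiff R M b (a + k) y \<rho>)"
    using Y by (intro exI[of _ "k' + k''"] exI[of _ ?Y]) blast
qed

text \<open>A lift \<open>x\<close> of a cocycle of \<open>M / I M\<close> has a differential with values in \<open>I M\<close>. This
  differential is the Koszul image of a Cech cocycle, and then of a Cech coboundary \<open>d v\<close>; subtracting \<open>D v\<close>
  from \<open>x\<close> gives a cocycle with the same class modulo \<open>I M\<close>.\<close>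

lemma lift_cocycle_mod_image:
  assumes g: "g \<in> carrier G"
    and ex: "\<And>q p'. p' > p + 1 \<Longrightarrow> rel_exact R F b s (Zk q) (Bk q) p'"
    and x: "\<And>\<rho>. x \<rho> \<in> Mg (g \<otimes>\<^bsub>G\<^esub> bdeg \<beta> \<rho> [^]\<^bsub>G\<^esub> a)"
    and dx: "\<And>\<tau>. \<tau> \<in> cells s (p + 1) \<Longrightarrow> cdiff R M b a x \<tau> \<in> image_top"
    and van: "\<And>i J. i \<ge> 1 \<Longrightarrow> J \<in> cells r (int r - i) \<Longrightarrow>
      vanishes (p + i) (g \<otimes>\<^bsub>G\<^esub> inv\<^bsub>G\<^esub> (bdeg \<delta> ({..<r} - J)))"
  obtains k y where "\<And>\<rho>. y \<rho> \<in> Mg (g \<otimes>\<^bsub>G\<^esub> bdeg \<beta> \<rho> [^]\<^bsub>G\<^esub> (a + k))"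
    "\<And>\<tau>. \<tau> \<in> cells s (p + 1) \<Longrightarrow> cdiff R M b (a + k) y \<tau> = \<zero>\<^bsub>M\<^esub>"
    "\<And>\<rho>. \<rho> \<in> cells s p \<Longrightarrow> bprod R b \<rho> [^] k \<odot>\<^bsub>M\<^esub> x \<rho> \<ominus>\<^bsub>M\<^esub> y \<rho> \<in> image_top"
proof -
  let ?dg = "\<lambda>a \<rho>. g \<otimes>\<^bsub>G\<^esub> bdeg \<beta> \<rho> [^]\<^bsub>G\<^esub> (a::nat)"
  have dg: "?dg a \<rho> \<in> carrier G" for a \<rho> using g by simp
  have xc: "x \<rho> \<in> carrier M" for \<rho> by (rule Mg_closed(1)[OF dg x])
  have step: "?dg a (\<tau> - {i}) \<otimes>\<^bsub>G\<^esub> \<beta> i [^]\<^bsub>G\<^esub> a = ?dg a \<tau>" if "finite \<tau>" "i \<in> \<tau>" for a \<tau> i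
    using bdeg_pow_step[OF that, of a] g by (simp add: G.m_assoc)
  define w where "w \<tau> = (if \<tau> \<in> cells s (p + 1) then cdiff R M b a x \<tau> else \<zero>\<^bsub>M\<^esub>)" for \<tau>
  have dxm: "cdiff R M b a x \<tau> \<in> Mg (?dg a \<tau>)" if "finite \<tau>" for \<tau>
    by (rule cdiff_mem[OF hb, of _ _ "?dg a"]) (use that dg x step in auto)
  have w: "w \<tau> \<in> Mg (?dg a \<tau>)" for \<tau>
    using dxm cells_finite Mg_closed(2)[OF dg] by (simp add: w_def)
  have wT: "w \<tau> \<in> image_top" if "\<tau> \<in> cells s (p + 1)" for \<tau> using dx that by (simp add: w_def)
  have dxc: "cdiff R M b a x \<tau> \<in> carrier M" for \<tau> by (rule cdiff_closed[OF b_closed xc])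
  have dw: "cdiff R M b a w \<tau> = \<zero>\<^bsub>M\<^esub>" if \<tau>: "\<tau> \<in> cells s (p + 1 + 1)" for \<tau>
  proof -
    have "cdiff R M b a w \<tau> = cdiff R M b a (cdiff R M b a x) \<tau>"
      using cells_remove[OF \<tau>] by (intro cdiff_cong[OF b_closed dxc]) (simp add: w_def)
    then show ?thesis using cdiff_cdiff[OF b_closed xc cells_finite[OF \<tau>]] by simp
  qed
  have van1: "vanishes (p + 1 + i) (g \<otimes>\<^bsub>G\<^esub> inv\<^bsub>G\<^esub> (bdeg \<delta> ({..<r} - J)))"
    if "i \<ge> 1" "J \<in> cells r (int r - 1 - i)" for i J
    using van[of "1 + i" J] that by (simp add: algebra_simps)
  from lift_image_top[OF g ex w wT dw van1] obtain k u where hu: "hom g (a + k) u"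
    and du: "\<And>\<tau> J. \<tau> \<in> cells s (p + 1 + 1) \<Longrightarrow> J \<in> cells r (int r - 1) \<Longrightarrow> d (a + k) u \<tau> J = \<zero>\<^bsub>M\<^esub>"
    and Du: "\<And>\<rho>. \<rho> \<in> cells s (p + 1) \<Longrightarrow> D (u \<rho>) top = bprod R b \<rho> [^] k \<odot>\<^bsub>M\<^esub> w \<rho>"
    by metis
  have "vanishes (p + 1) (g \<otimes>\<^bsub>G\<^esub> inv\<^bsub>G\<^esub> (bdeg \<delta> ({..<r} - J)))" if "J \<in> cells r (int r - 1)" for J
    using van[of 1 J] that by simp
  from vanishing_family[OF g hu du this] obtain k' v where hv: "hom g (a + k + k') v"
    and dv: "\<And>\<rho> J. \<rho> \<in> cells s (p + 1) \<Longrightarrow> J \<in> cells r (int r - 1) \<Longrightarrow>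
      bprod R b \<rho> [^] k' \<odot>\<^bsub>M\<^esub> u \<rho> J = d (a + k + k') v \<rho> J"
    by metis
  have vc: "v \<rho> J \<in> carrier M" for \<rho> J by (rule hom_closed[OF g hv])
  have uc: "u \<rho> J \<in> carrier M" for \<rho> J by (rule hom_closed[OF g hu])
  let ?K = "k + k'"
  let ?bx = "\<lambda>\<rho>. bprod R b \<rho> [^] ?K \<odot>\<^bsub>M\<^esub> x \<rho>"
  have bxc: "?bx \<rho> \<in> carrier M" for \<rho> using xc by simp
  have Dvc: "D (v \<rho>) top \<in> carrier M" for \<rho> by (rule D_closed[OF vc])
  have bxm: "?bx \<rho> \<in> Mg (?dg (a + ?K) \<rho>)" for \<rho>
    using bpow_mem[OF dg x[of \<rho>], of \<rho> ?K] bdeg_shift[OF g] by simp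
  have Dvm: "D (v \<rho>) top \<in> Mg (?dg (a + ?K) \<rho>)" for \<rho>
    using hom_D[OF g hv] deg_top[OF g] unfolding hom_def by (metis add.assoc)
  show thesis
  proof (rule that[of "\<lambda>\<rho>. ?bx \<rho> \<ominus>\<^bsub>M\<^esub> D (v \<rho>) top" ?K])
    show "?bx \<rho> \<ominus>\<^bsub>M\<^esub> D (v \<rho>) top \<in> Mg (?dg (a + ?K) \<rho>)" for \<rho>
      by (rule Mg_closed(4)[OF dg bxm Dvm])
    show "?bx \<rho> \<ominus>\<^bsub>M\<^esub> (?bx \<rho> \<ominus>\<^bsub>M\<^esub> D (v \<rho>) top) \<in> image_top" for \<rho>
    proof -
      have "x \<ominus>\<^bsub>M\<^esub> (x \<ominus>\<^bsub>M\<^esub> y) = y" if "x \<in> carrier M" "y \<in> carrier M" for x y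
        using that by (simp add: a_minus_def M.minus_add M.r_neg1 M.r_neg2)
      then show ?thesis using image_topI[of "v \<rho>"] vc bxc Dvc by simp
    qed
    fix \<tau> assume \<tau>: "\<tau> \<in> cells s (p + 1)"
    have "cdiff R M b (a + ?K) (\<lambda>\<rho>. ?bx \<rho> \<ominus>\<^bsub>M\<^esub> D (v \<rho>) top) \<tau>
      = cdiff R M b (a + ?K) ?bx \<tau> \<ominus>\<^bsub>M\<^esub> d (a + ?K) (\<lambda>\<rho>. D (v \<rho>)) \<tau> top"
      by (rule cdiff_diff[OF b_closed bxc Dvc])
    also have "cdiff R M b (a + ?K) ?bx \<tau> = bprod R b \<tau> [^] ?K \<odot>\<^bsub>M\<^esub> w \<tau>"
      using cdiff_shift[OF b_closed xc cells_finite[OF \<tau>]] \<tau> by (simp add: w_def)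
    also have "d (a + ?K) (\<lambda>\<rho>. D (v \<rho>)) \<tau> top = D (\<lambda>J. d (a + ?K) v \<tau> J) top"
      by (rule D_d[OF vc, symmetric])
    also have "\<dots> = D (\<lambda>J. bprod R b \<tau> [^] k' \<odot>\<^bsub>M\<^esub> u \<tau> J) top"
      using top_cell uc dv[OF \<tau>] by (intro D_cong[of top "int r - 1"]) (auto simp: add.assoc)
    also have "\<dots> = bprod R b \<tau> [^] k' \<odot>\<^bsub>M\<^esub> D (u \<tau>) top" by (rule D_smult[OF uc bpow_closed])
    also have "\<dots> = bprod R b \<tau> [^] ?K \<odot>\<^bsub>M\<^esub> w \<tau>"
      unfolding Du[OF \<tau>] using smult_pow_add[of "bprod R b \<tau>" "w \<tau>" k' k] b_closed Mg_closed(1)[OF dg w]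
      by (simp add: add.commute)
    finally show "cdiff R M b (a + ?K) (\<lambda>\<rho>. ?bx \<rho> \<ominus>\<^bsub>M\<^esub> D (v \<rho>) top) \<tau> = \<zero>\<^bsub>M\<^esub>"
      using Mg_closed(1)[OF dg w] M.minus_eq_zero_iff by simp
  qed
qed

end

section \<open>Quotient modules\<close>

lemma a_r_coset_mem: "x \<in> N +>\<^bsub>C\<^esub> y \<longleftrightarrow> (\<exists>n\<in>N. x = n \<oplus>\<^bsub>C\<^esub> y)"
  by (auto simp: a_r_coset_def')

context module
begin

lemma coset_eq_iff:
  assumes N: "submodule N R M" and "x \<in> carrier M" "y \<in> carrier M"
  shows "N +>\<^bsub>M\<^esub> x = N +>\<^bsub>M\<^esub> y \<longleftrightarrow> (\<exists>n\<in>N. x = n \<oplus>\<^bsub>M\<^esub> y)"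
proof
  assume "N +>\<^bsub>M\<^esub> x = N +>\<^bsub>M\<^esub> y"
  moreover have "x \<in> N +>\<^bsub>M\<^esub> x"
    unfolding a_r_coset_mem using assms submodule_closed(2)[OF N] by (intro bexI[of _ "\<zero>\<^bsub>M\<^esub>"]) auto
  ultimately show "\<exists>n\<in>N. x = n \<oplus>\<^bsub>M\<^esub> y" by (simp add: a_r_coset_mem)
next
  assume "\<exists>n\<in>N. x = n \<oplus>\<^bsub>M\<^esub> y"
  then obtain n where n: "n \<in> N" "x = n \<oplus>\<^bsub>M\<^esub> y" by blast
  note c = submodule_closed[OF N]
  have nc: "n \<in> carrier M" using n c(1) by blast
  show "N +>\<^bsub>M\<^esub> x = N +>\<^bsub>M\<^esub> y"
  proof (intro subset_antisym subsetI)
    fix z assume "z \<in> N +>\<^bsub>M\<^esub> x"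
    then obtain m where m: "m \<in> N" "z = m \<oplus>\<^bsub>M\<^esub> x" by (auto simp: a_r_coset_mem)
    then have "z = (m \<oplus>\<^bsub>M\<^esub> n) \<oplus>\<^bsub>M\<^esub> y" using n nc c(1) assms(3) by (simp add: M.a_assoc)
    then show "z \<in> N +>\<^bsub>M\<^esub> y" unfolding a_r_coset_mem using c(3)[OF m(1) n(1)] by blast
  next
    fix z assume "z \<in> N +>\<^bsub>M\<^esub> y"
    then obtain m where m: "m \<in> N" "z = m \<oplus>\<^bsub>M\<^esub> y" by (auto simp: a_r_coset_mem)
    have "(m \<ominus>\<^bsub>M\<^esub> n) \<oplus>\<^bsub>M\<^esub> (n \<oplus>\<^bsub>M\<^esub> y) = m \<oplus>\<^bsub>M\<^esub> y"
      using m(1) nc c(1) assms(3) by (simp add: a_minus_def M.a_assoc M.r_neg1)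
    then show "z \<in> N +>\<^bsub>M\<^esub> x" unfolding a_r_coset_mem using c(4)[OF m(1) n(1)] m(2) n(2) by metis
  qed
qed

lemma coset_diff_iff:
  assumes N: "submodule N R M" and "x \<in> carrier M" "y \<in> carrier M"
  shows "N +>\<^bsub>M\<^esub> x = N +>\<^bsub>M\<^esub> y \<longleftrightarrow> x \<ominus>\<^bsub>M\<^esub> y \<in> N"
proof -
  note c = submodule_closed[OF N]
  have "(\<exists>n\<in>N. x = n \<oplus>\<^bsub>M\<^esub> y) \<longleftrightarrow> x \<ominus>\<^bsub>M\<^esub> y \<in> N"
  proof
    assume "\<exists>n\<in>N. x = n \<oplus>\<^bsub>M\<^esub> y"
    then obtain n where n: "n \<in> N" "x = n \<oplus>\<^bsub>M\<^esub> y" by blast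
    have "n \<in> carrier M" using n c(1) by blast
    then have "x \<ominus>\<^bsub>M\<^esub> y = n" using n(2) assms(3) by (simp add: a_minus_def M.a_assoc M.r_neg)
    then show "x \<ominus>\<^bsub>M\<^esub> y \<in> N" using n by simp
  next
    assume "x \<ominus>\<^bsub>M\<^esub> y \<in> N"
    moreover have "x = (x \<ominus>\<^bsub>M\<^esub> y) \<oplus>\<^bsub>M\<^esub> y" using assms by (simp add: a_minus_def M.a_assoc M.l_neg)
    ultimately show "\<exists>n\<in>N. x = n \<oplus>\<^bsub>M\<^esub> y" by blast
  qed
  then show ?thesis using coset_eq_iff[OF assms] by simp
qed

lemma coset_zero_iff:
  assumes N: "submodule N R M" and "x \<in> carrier M"
  shows "N +>\<^bsub>M\<^esub> x = N \<longleftrightarrow> x \<in> N"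
proof -
  have "N +>\<^bsub>M\<^esub> \<zero>\<^bsub>M\<^esub> = N"
    using submodule_closed(1)[OF N] by (auto simp: a_r_coset_def')
  moreover have "(\<exists>n\<in>N. x = n \<oplus>\<^bsub>M\<^esub> \<zero>\<^bsub>M\<^esub>) \<longleftrightarrow> x \<in> N"
    using submodule_closed(1)[OF N] M.r_zero by metis
  ultimately show ?thesis
    using coset_eq_iff[OF N assms(2) M.zero_closed] by simp
qed

lemma coset_self: "submodule N R M \<Longrightarrow> x \<in> carrier M \<Longrightarrow> x \<in> N +>\<^bsub>M\<^esub> x"
  unfolding a_r_coset_mem using submodule_closed(2)[of N] by (intro bexI[of _ "\<zero>\<^bsub>M\<^esub>"]) auto

lemma coset_mem_carrier: "submodule N R M \<Longrightarrow> x \<in> carrier M \<Longrightarrow> y \<in> N +>\<^bsub>M\<^esub> x \<Longrightarrow> y \<in> carrier M"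
  using submodule_closed(1)[of N] by (auto simp: a_r_coset_mem)

lemma quot_carrier: "U \<in> carrier (quot_module M N) \<longleftrightarrow> (\<exists>x\<in>carrier M. U = N +>\<^bsub>M\<^esub> x)"
  by (auto simp: quot_module_def A_RCOSETS_def')

lemma quot_zero: "\<zero>\<^bsub>quot_module M N\<^esub> = N"
  by (simp add: quot_module_def)

lemma quot_add:
  assumes N: "submodule N R M" and x: "x \<in> carrier M" and y: "y \<in> carrier M"
  shows "(N +>\<^bsub>M\<^esub> x) \<oplus>\<^bsub>quot_module M N\<^esub> (N +>\<^bsub>M\<^esub> y) = N +>\<^bsub>M\<^esub> (x \<oplus>\<^bsub>M\<^esub> y)"
proof -
  note c = submodule_closed[OF N]
  have swap: "(m \<oplus>\<^bsub>M\<^esub> x) \<oplus>\<^bsub>M\<^esub> (n \<oplus>\<^bsub>M\<^esub> y) = (m \<oplus>\<^bsub>M\<^esub> n) \<oplus>\<^bsub>M\<^esub> (x \<oplus>\<^bsub>M\<^esub> y)"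
    if "m \<in> N" "n \<in> N" for m n
    using c(1)[OF that(1)] c(1)[OF that(2)] x y by (simp add: M.a_ac)
  have "(N +>\<^bsub>M\<^esub> x) <+>\<^bsub>M\<^esub> (N +>\<^bsub>M\<^esub> y) = N +>\<^bsub>M\<^esub> (x \<oplus>\<^bsub>M\<^esub> y)"
  proof (intro subset_antisym subsetI)
    fix z assume "z \<in> (N +>\<^bsub>M\<^esub> x) <+>\<^bsub>M\<^esub> (N +>\<^bsub>M\<^esub> y)"
    then obtain m n where mn: "m \<in> N" "n \<in> N" "z = (m \<oplus>\<^bsub>M\<^esub> x) \<oplus>\<^bsub>M\<^esub> (n \<oplus>\<^bsub>M\<^esub> y)"
      by (auto simp: set_add_def' a_r_coset_def')
    then show "z \<in> N +>\<^bsub>M\<^esub> (x \<oplus>\<^bsub>M\<^esub> y)"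
      unfolding a_r_coset_mem using swap[OF mn(1,2)] c(3)[OF mn(1,2)] by auto
  next
    fix z assume "z \<in> N +>\<^bsub>M\<^esub> (x \<oplus>\<^bsub>M\<^esub> y)"
    then obtain m where m: "m \<in> N" "z = m \<oplus>\<^bsub>M\<^esub> (x \<oplus>\<^bsub>M\<^esub> y)" by (auto simp: a_r_coset_mem)
    have "z = (m \<oplus>\<^bsub>M\<^esub> x) \<oplus>\<^bsub>M\<^esub> (\<zero>\<^bsub>M\<^esub> \<oplus>\<^bsub>M\<^esub> y)"
      using swap[OF m(1) c(2)] m c(1)[OF m(1)] by simp
    then show "z \<in> (N +>\<^bsub>M\<^esub> x) <+>\<^bsub>M\<^esub> (N +>\<^bsub>M\<^esub> y)"
      using m(1) c(2) by (auto simp: set_add_def' a_r_coset_def')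
  qed
  then show ?thesis by (simp add: quot_module_def)
qed

lemma quot_smult:
  assumes N: "submodule N R M" and a: "a \<in> carrier R" and x: "x \<in> carrier M"
  shows "a \<odot>\<^bsub>quot_module M N\<^esub> (N +>\<^bsub>M\<^esub> x) = N +>\<^bsub>M\<^esub> (a \<odot>\<^bsub>M\<^esub> x)"
proof -
  have "N +>\<^bsub>M\<^esub> (a \<odot>\<^bsub>M\<^esub> y) = N +>\<^bsub>M\<^esub> (a \<odot>\<^bsub>M\<^esub> x)" if y: "y \<in> N +>\<^bsub>M\<^esub> x" for y
  proof -
    obtain n where n: "n \<in> N" "y = n \<oplus>\<^bsub>M\<^esub> x" using y by (auto simp: a_r_coset_mem)
    then have "a \<odot>\<^bsub>M\<^esub> y = a \<odot>\<^bsub>M\<^esub> n \<oplus>\<^bsub>M\<^esub> a \<odot>\<^bsub>M\<^esub> x"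
      using submodule_closed(1)[OF N] a x by (simp add: smult_r_distr)
    then have "\<exists>n\<in>N. a \<odot>\<^bsub>M\<^esub> y = n \<oplus>\<^bsub>M\<^esub> a \<odot>\<^bsub>M\<^esub> x"
      using submodule_closed(6)[OF N a n(1)] by blast
    then show ?thesis
      using coset_eq_iff[OF N smult_closed[OF a coset_mem_carrier[OF N x y]] smult_closed[OF a x]] by blast
  qed
  then have "(\<Union>y\<in>N +>\<^bsub>M\<^esub> x. N +>\<^bsub>M\<^esub> (a \<odot>\<^bsub>M\<^esub> y)) = (\<Union>y\<in>N +>\<^bsub>M\<^esub> x. N +>\<^bsub>M\<^esub> (a \<odot>\<^bsub>M\<^esub> x))"
    by (intro SUP_cong) (rule refl, blast)
  then have "(\<Union>y\<in>N +>\<^bsub>M\<^esub> x. N +>\<^bsub>M\<^esub> (a \<odot>\<^bsub>M\<^esub> y)) = N +>\<^bsub>M\<^esub> (a \<odot>\<^bsub>M\<^esub> x)"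
    using coset_self[OF N x] by blast
  then show ?thesis by (simp add: quot_module_def)
qed

lemma quot_is_module:
  assumes N: "submodule N R M"
  shows "module R (quot_module M N)"
proof (rule moduleI)
  show "cring R" by (rule R.is_cring)
  have z: "\<zero>\<^bsub>quot_module M N\<^esub> = N +>\<^bsub>M\<^esub> \<zero>\<^bsub>M\<^esub>"
    using coset_zero_iff[OF N, of "\<zero>\<^bsub>M\<^esub>"] submodule_closed(2)[OF N] by (simp add: quot_zero)
  show "abelian_group (quot_module M N)"
  proof (rule abelian_groupI)
    fix U assume "U \<in> carrier (quot_module M N)"
    then obtain x where x: "x \<in> carrier M" "U = N +>\<^bsub>M\<^esub> x" by (auto simp: quot_carrier)
    then have "(N +>\<^bsub>M\<^esub> (\<ominus>\<^bsub>M\<^esub> x)) \<oplus>\<^bsub>quot_module M N\<^esub> U = \<zero>\<^bsub>quot_module M N\<^esub>"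
      by (simp add: quot_add[OF N] M.l_neg z)
    moreover have "N +>\<^bsub>M\<^esub> (\<ominus>\<^bsub>M\<^esub> x) \<in> carrier (quot_module M N)"
      using x by (auto simp: quot_carrier)
    ultimately show "\<exists>V\<in>carrier (quot_module M N). V \<oplus>\<^bsub>quot_module M N\<^esub> U = \<zero>\<^bsub>quot_module M N\<^esub>"
      by blast
  next
    fix U V assume "U \<in> carrier (quot_module M N)" "V \<in> carrier (quot_module M N)"
    then obtain x y where "x \<in> carrier M" "U = N +>\<^bsub>M\<^esub> x" "y \<in> carrier M" "V = N +>\<^bsub>M\<^esub> y"
      by (auto simp: quot_carrier)
    then show "U \<oplus>\<^bsub>quot_module M N\<^esub> V = V \<oplus>\<^bsub>quot_module M N\<^esub> U"
      by (simp add: quot_add[OF N] M.a_comm)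
  qed (unfold quot_carrier z, auto simp: quot_add[OF N] M.a_assoc)
qed (unfold quot_carrier, auto simp: quot_add[OF N] quot_smult[OF N] smult_l_distr smult_r_distr smult_assoc1)

lemma linear_map_coset:
  "submodule N R M \<Longrightarrow> linear_map R M (quot_module M N) (\<lambda>x. N +>\<^bsub>M\<^esub> x)"
  by (auto simp: linear_map_def additive_map_def quot_add quot_smult quot_carrier)

section \<open>Fractions\<close>

lemma smult_pow_pow:
  "s \<in> carrier R \<Longrightarrow> x \<in> carrier M \<Longrightarrow> s [^] (m::nat) \<odot>\<^bsub>M\<^esub> (s [^] (n::nat) \<odot>\<^bsub>M\<^esub> x) = s [^] (m + n) \<odot>\<^bsub>M\<^esub> x"
  by (simp add: smult_pow_add)

lemma smult_commute:
  "a \<in> carrier R \<Longrightarrow> c \<in> carrier R \<Longrightarrow> x \<in> carrier M \<Longrightarrow> a \<odot>\<^bsub>M\<^esub> (c \<odot>\<^bsub>M\<^esub> x) = c \<odot>\<^bsub>M\<^esub> (a \<odot>\<^bsub>M\<^esub> x)"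
  by (simp add: R.m_comm flip: smult_assoc1)

lemma frac_mem:
  "(y, n) \<in> frac R M s x a \<longleftrightarrow>
    y \<in> carrier M \<and> (\<exists>k. s [^] (k + n) \<odot>\<^bsub>M\<^esub> x = s [^] (k + a) \<odot>\<^bsub>M\<^esub> y)"
  by (auto simp: frac_def)

lemma frac_rel_mono:
  fixes j k n a :: nat
  assumes "s \<in> carrier R" "x \<in> carrier M" "y \<in> carrier M"
    and "s [^] (k + n) \<odot>\<^bsub>M\<^esub> x = s [^] (k + a) \<odot>\<^bsub>M\<^esub> y"
  shows "s [^] (j + (k + n)) \<odot>\<^bsub>M\<^esub> x = s [^] (j + (k + a)) \<odot>\<^bsub>M\<^esub> y"
  using assms smult_pow_pow[of s x j "k + n"] smult_pow_pow[of s y j "k + a"] by simp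

lemma frac_rel_trans:
  fixes j k n a m :: nat
  assumes s: "s \<in> carrier R" and c: "x \<in> carrier M" "y \<in> carrier M" "z \<in> carrier M"
    and 1: "s [^] (k + n) \<odot>\<^bsub>M\<^esub> x = s [^] (k + a) \<odot>\<^bsub>M\<^esub> y"
    and 2: "s [^] (j + m) \<odot>\<^bsub>M\<^esub> y = s [^] (j + n) \<odot>\<^bsub>M\<^esub> z"
  shows "s [^] (k + j + n + m) \<odot>\<^bsub>M\<^esub> x = s [^] (k + j + n + a) \<odot>\<^bsub>M\<^esub> z"
proof -
  have "s [^] (k + j + n + m) \<odot>\<^bsub>M\<^esub> x = s [^] (j + m + (k + n)) \<odot>\<^bsub>M\<^esub> x"
    by (rule arg_cong[where f = "\<lambda>e. s [^] e \<odot>\<^bsub>M\<^esub> x"]) simp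
  also have "\<dots> = s [^] (j + m + (k + a)) \<odot>\<^bsub>M\<^esub> y" by (rule frac_rel_mono[OF s c(1,2) 1])
  also have "\<dots> = s [^] (k + a + (j + m)) \<odot>\<^bsub>M\<^esub> y"
    by (rule arg_cong[where f = "\<lambda>e. s [^] e \<odot>\<^bsub>M\<^esub> y"]) simp
  also have "\<dots> = s [^] (k + a + (j + n)) \<odot>\<^bsub>M\<^esub> z" by (rule frac_rel_mono[OF s c(2,3) 2])
  also have "\<dots> = s [^] (k + j + n + a) \<odot>\<^bsub>M\<^esub> z"
    by (rule arg_cong[where f = "\<lambda>e. s [^] e \<odot>\<^bsub>M\<^esub> z"]) simp
  finally show ?thesis .
qed

lemma frac_eq_iff:
  assumes s: "s \<in> carrier R" and x: "x \<in> carrier M" and y: "y \<in> carrier M"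
  shows "frac R M s x a = frac R M s y n \<longleftrightarrow>
    (\<exists>k. s [^] (k + n) \<odot>\<^bsub>M\<^esub> x = s [^] (k + a) \<odot>\<^bsub>M\<^esub> y)"
proof
  assume e: "frac R M s x a = frac R M s y n"
  have "(y, n) \<in> frac R M s x a" unfolding e using y by (auto simp: frac_mem)
  then show "\<exists>k. s [^] (k + n) \<odot>\<^bsub>M\<^esub> x = s [^] (k + a) \<odot>\<^bsub>M\<^esub> y" unfolding frac_mem by blast
next
  assume "\<exists>k. s [^] (k + n) \<odot>\<^bsub>M\<^esub> x = s [^] (k + a) \<odot>\<^bsub>M\<^esub> y"
  then obtain k where k: "s [^] (k + n) \<odot>\<^bsub>M\<^esub> x = s [^] (k + a) \<odot>\<^bsub>M\<^esub> y" by blast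
  show "frac R M s x a = frac R M s y n"
  proof (intro subset_antisym subrelI)
    fix z m assume "(z, m) \<in> frac R M s x a"
    then obtain j where z: "z \<in> carrier M" and j: "s [^] (j + m) \<odot>\<^bsub>M\<^esub> x = s [^] (j + a) \<odot>\<^bsub>M\<^esub> z"
      by (auto simp: frac_mem)
    show "(z, m) \<in> frac R M s y n"
      unfolding frac_mem using frac_rel_trans[OF s y x z k[symmetric] j] z by blast
  next
    fix z m assume "(z, m) \<in> frac R M s y n"
    then obtain j where z: "z \<in> carrier M" and j: "s [^] (j + m) \<odot>\<^bsub>M\<^esub> y = s [^] (j + n) \<odot>\<^bsub>M\<^esub> z"
      by (auto simp: frac_mem)
    show "(z, m) \<in> frac R M s x a"
      unfolding frac_mem using frac_rel_trans[OF s x y z k j] z by blast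
  qed
qed

lemma frac_self: "x \<in> carrier M \<Longrightarrow> (x, a) \<in> frac R M s x a"
  by (auto simp: frac_mem)

lemma frac_expand:
  assumes s: "s \<in> carrier R" and x: "x \<in> carrier M"
  shows "frac R M s (s [^] k \<odot>\<^bsub>M\<^esub> x) (a + k) = frac R M s x a"
proof -
  have "s [^] (0 + a) \<odot>\<^bsub>M\<^esub> (s [^] k \<odot>\<^bsub>M\<^esub> x) = s [^] (0 + (a + k)) \<odot>\<^bsub>M\<^esub> x"
    using smult_pow_pow[OF s x, of a k] by simp
  then show ?thesis using s x by (subst frac_eq_iff) (auto intro!: exI[of _ 0])
qed

lemma loc_carrier: "C \<in> carrier (loc_module R M s) \<longleftrightarrow> (\<exists>x a. x \<in> carrier M \<and> C = frac R M s x a)"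
  by (auto simp: loc_module_def)

lemma frac_carrier: "x \<in> carrier M \<Longrightarrow> frac R M s x a \<in> carrier (loc_module R M s)"
  by (auto simp: loc_carrier)

lemma loc_smult:
  assumes s: "s \<in> carrier R" and x: "x \<in> carrier M" and r: "r \<in> carrier R"
  shows "r \<odot>\<^bsub>loc_module R M s\<^esub> frac R M s x a = frac R M s (r \<odot>\<^bsub>M\<^esub> x) a"
proof -
  have e: "frac R M s (r \<odot>\<^bsub>M\<^esub> y) n = frac R M s (r \<odot>\<^bsub>M\<^esub> x) a" if y: "(y, n) \<in> frac R M s x a" for y n
  proof -
    obtain k where yc: "y \<in> carrier M" and k: "s [^] (k + n) \<odot>\<^bsub>M\<^esub> x = s [^] (k + a) \<odot>\<^bsub>M\<^esub> y"
      using y by (auto simp: frac_mem)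
    have "s [^] (k + a) \<odot>\<^bsub>M\<^esub> (r \<odot>\<^bsub>M\<^esub> y) = s [^] (k + n) \<odot>\<^bsub>M\<^esub> (r \<odot>\<^bsub>M\<^esub> x)"
      using smult_commute[of "s [^] (k + a)" r y] smult_commute[of "s [^] (k + n)" r x] k s x r yc by simp
    then show ?thesis using s r x yc by (subst frac_eq_iff) auto
  qed
  have "(\<Union>(y, n)\<in>frac R M s x a. frac R M s (r \<odot>\<^bsub>M\<^esub> y) n) = frac R M s (r \<odot>\<^bsub>M\<^esub> x) a"
    using e frac_self[OF x, of a s] by fast
  then show ?thesis by (simp add: loc_module_def)
qed

lemma loc_add_general:
  assumes s: "s \<in> carrier R" and x: "x \<in> carrier M" and y: "y \<in> carrier M"
  shows "frac R M s x a \<oplus>\<^bsub>loc_module R M s\<^esub> frac R M s y n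
    = frac R M s (s [^] n \<odot>\<^bsub>M\<^esub> x \<oplus>\<^bsub>M\<^esub> s [^] a \<odot>\<^bsub>M\<^esub> y) (a + n)"
proof -
  let ?S = "\<lambda>x a y n. frac R M s (s [^] (n::nat) \<odot>\<^bsub>M\<^esub> x \<oplus>\<^bsub>M\<^esub> s [^] (a::nat) \<odot>\<^bsub>M\<^esub> y) (a + n)"
  have e: "?S x' a' y' n' = ?S x a y n"
    if x': "(x', a') \<in> frac R M s x a" and y': "(y', n') \<in> frac R M s y n" for x' a' y' n'
  proof -
    obtain k where xc: "x' \<in> carrier M" and k: "s [^] (k + a') \<odot>\<^bsub>M\<^esub> x = s [^] (k + a) \<odot>\<^bsub>M\<^esub> x'"
      using x' by (auto simp: frac_mem)
    obtain j where yc: "y' \<in> carrier M" and j: "s [^] (j + n') \<odot>\<^bsub>M\<^esub> y = s [^] (j + n) \<odot>\<^bsub>M\<^esub> y'"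
      using y' by (auto simp: frac_mem)
    have 1: "s [^] (k + j + (a + n)) \<odot>\<^bsub>M\<^esub> (s [^] n' \<odot>\<^bsub>M\<^esub> x') = s [^] (k + j + (a' + n')) \<odot>\<^bsub>M\<^esub> (s [^] n \<odot>\<^bsub>M\<^esub> x)"
    proof -
      have "s [^] (k + j + (a + n)) \<odot>\<^bsub>M\<^esub> (s [^] n' \<odot>\<^bsub>M\<^esub> x') = s [^] ((j + n + n') + (k + a)) \<odot>\<^bsub>M\<^esub> x'"
        using smult_pow_pow[OF s xc] by (simp add: algebra_simps)
      also have "\<dots> = s [^] ((j + n + n') + (k + a')) \<odot>\<^bsub>M\<^esub> x"
        by (rule frac_rel_mono[OF s x xc k, symmetric])
      also have "\<dots> = s [^] (k + j + (a' + n')) \<odot>\<^bsub>M\<^esub> (s [^] n \<odot>\<^bsub>M\<^esub> x)"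
        using smult_pow_pow[OF s x] by (simp add: algebra_simps)
      finally show ?thesis .
    qed
    have 2: "s [^] (k + j + (a + n)) \<odot>\<^bsub>M\<^esub> (s [^] a' \<odot>\<^bsub>M\<^esub> y') = s [^] (k + j + (a' + n')) \<odot>\<^bsub>M\<^esub> (s [^] a \<odot>\<^bsub>M\<^esub> y)"
    proof -
      have "s [^] (k + j + (a + n)) \<odot>\<^bsub>M\<^esub> (s [^] a' \<odot>\<^bsub>M\<^esub> y') = s [^] ((k + a + a') + (j + n)) \<odot>\<^bsub>M\<^esub> y'"
        using smult_pow_pow[OF s yc] by (simp add: algebra_simps)
      also have "\<dots> = s [^] ((k + a + a') + (j + n')) \<odot>\<^bsub>M\<^esub> y"
        by (rule frac_rel_mono[OF s y yc j, symmetric])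
      also have "\<dots> = s [^] (k + j + (a' + n')) \<odot>\<^bsub>M\<^esub> (s [^] a \<odot>\<^bsub>M\<^esub> y)"
        using smult_pow_pow[OF s y] by (simp add: algebra_simps)
      finally show ?thesis .
    qed
    have "s [^] (k + j + (a + n)) \<odot>\<^bsub>M\<^esub> (s [^] n' \<odot>\<^bsub>M\<^esub> x' \<oplus>\<^bsub>M\<^esub> s [^] a' \<odot>\<^bsub>M\<^esub> y')
      = s [^] (k + j + (a' + n')) \<odot>\<^bsub>M\<^esub> (s [^] n \<odot>\<^bsub>M\<^esub> x \<oplus>\<^bsub>M\<^esub> s [^] a \<odot>\<^bsub>M\<^esub> y)"
      using 1 2 s x y xc yc by (simp add: smult_r_distr)
    then show ?thesis using s x y xc yc by (subst frac_eq_iff) blast+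
  qed
  have "(\<Union>(x', a')\<in>frac R M s x a. \<Union>(y', n')\<in>frac R M s y n. ?S x' a' y' n') = ?S x a y n"
    using e frac_self[OF x, of a s] frac_self[OF y, of n s] by fast
  then show ?thesis by (simp add: loc_module_def)
qed

lemma loc_add:
  assumes s: "s \<in> carrier R" and x: "x \<in> carrier M" and y: "y \<in> carrier M"
  shows "frac R M s x a \<oplus>\<^bsub>loc_module R M s\<^esub> frac R M s y a = frac R M s (x \<oplus>\<^bsub>M\<^esub> y) a"
  using loc_add_general[OF s x y, of a a] frac_expand[OF s, of "x \<oplus>\<^bsub>M\<^esub> y" a a] s x y
  by (simp add: smult_r_distr)

lemma frac_zero: "s \<in> carrier R \<Longrightarrow> frac R M s \<zero>\<^bsub>M\<^esub> a = \<zero>\<^bsub>loc_module R M s\<^esub>"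
  using frac_expand[of s "\<zero>\<^bsub>M\<^esub>" a 0] by (simp add: loc_module_def)

lemma loc_common_denominator:
  assumes s: "s \<in> carrier R" and C: "C \<in> carrier (loc_module R M s)" and E: "E \<in> carrier (loc_module R M s)"
  obtains x y a where "x \<in> carrier M" "y \<in> carrier M" "C = frac R M s x a" "E = frac R M s y a"
proof -
  obtain x a y n where "x \<in> carrier M" "y \<in> carrier M" "C = frac R M s x a" "E = frac R M s y n"
    using C E by (auto simp: loc_carrier)
  then show thesis
    using that[of "s [^] n \<odot>\<^bsub>M\<^esub> x" "s [^] a \<odot>\<^bsub>M\<^esub> y" "a + n"] s
      frac_expand[OF s, of x n a] frac_expand[OF s, of y a n] by (simp add: add.commute)
qed

lemma loc_is_module:
  assumes s: "s \<in> carrier R"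
  shows "module R (loc_module R M s)"
proof (rule moduleI)
  let ?L = "loc_module R M s"
  show "cring R" by (rule R.is_cring)
  show "abelian_group ?L"
  proof (rule abelian_groupI)
    fix C E assume "C \<in> carrier ?L" "E \<in> carrier ?L"
    then obtain x y a where xy: "x \<in> carrier M" "y \<in> carrier M" "C = frac R M s x a" "E = frac R M s y a"
      by (rule loc_common_denominator[OF s])
    then show "C \<oplus>\<^bsub>?L\<^esub> E \<in> carrier ?L" by (simp add: loc_add[OF s] frac_carrier)
    show "C \<oplus>\<^bsub>?L\<^esub> E = E \<oplus>\<^bsub>?L\<^esub> C" using xy by (simp add: loc_add[OF s] M.a_comm)
    fix H assume "H \<in> carrier ?L"
    then obtain z n where z: "z \<in> carrier M" "H = frac R M s z n" by (auto simp: loc_carrier)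
    let ?x = "s [^] n \<odot>\<^bsub>M\<^esub> x" and ?y = "s [^] n \<odot>\<^bsub>M\<^esub> y" and ?z = "s [^] a \<odot>\<^bsub>M\<^esub> z"
    have "C = frac R M s ?x (a + n)" "E = frac R M s ?y (a + n)" "H = frac R M s ?z (a + n)"
      using xy z frac_expand[OF s, of x n a] frac_expand[OF s, of y n a] frac_expand[OF s, of z a n]
      by (auto simp: add.commute)
    moreover have "?x \<in> carrier M" "?y \<in> carrier M" "?z \<in> carrier M" using xy z s by auto
    ultimately show "C \<oplus>\<^bsub>?L\<^esub> E \<oplus>\<^bsub>?L\<^esub> H = C \<oplus>\<^bsub>?L\<^esub> (E \<oplus>\<^bsub>?L\<^esub> H)"
      by (simp add: loc_add[OF s] M.a_assoc)
  next
    show "\<zero>\<^bsub>?L\<^esub> \<in> carrier ?L" by (simp add: frac_zero[OF s, of 0, symmetric] frac_carrier)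
    fix C assume "C \<in> carrier ?L"
    then obtain x a where x: "x \<in> carrier M" "C = frac R M s x a" by (auto simp: loc_carrier)
    show "\<zero>\<^bsub>?L\<^esub> \<oplus>\<^bsub>?L\<^esub> C = C"
      using x by (simp add: loc_add[OF s] flip: frac_zero[OF s, of a])
    have "frac R M s (\<ominus>\<^bsub>M\<^esub> x) a \<oplus>\<^bsub>?L\<^esub> C = \<zero>\<^bsub>?L\<^esub>"
      using x by (simp add: loc_add[OF s] M.l_neg frac_zero[OF s])
    moreover have "frac R M s (\<ominus>\<^bsub>M\<^esub> x) a \<in> carrier ?L" using x by (simp add: frac_carrier)
    ultimately show "\<exists>E\<in>carrier ?L. E \<oplus>\<^bsub>?L\<^esub> C = \<zero>\<^bsub>?L\<^esub>" by blast
  qed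
next
  let ?L = "loc_module R M s"
  fix a c C assume a: "a \<in> carrier R" and c: "c \<in> carrier R" and "C \<in> carrier ?L"
  then obtain x n where x: "x \<in> carrier M" "C = frac R M s x n" by (auto simp: loc_carrier)
  show "a \<odot>\<^bsub>?L\<^esub> C \<in> carrier ?L" using x a by (simp add: loc_smult[OF s] frac_carrier)
  show "(a \<oplus> c) \<odot>\<^bsub>?L\<^esub> C = a \<odot>\<^bsub>?L\<^esub> C \<oplus>\<^bsub>?L\<^esub> c \<odot>\<^bsub>?L\<^esub> C"
    using x a c by (simp add: loc_smult[OF s] loc_add[OF s] smult_l_distr)
  show "(a \<otimes> c) \<odot>\<^bsub>?L\<^esub> C = a \<odot>\<^bsub>?L\<^esub> (c \<odot>\<^bsub>?L\<^esub> C)"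
    using x a c by (simp add: loc_smult[OF s] smult_assoc1)
next
  let ?L = "loc_module R M s"
  fix C assume "C \<in> carrier ?L"
  then obtain x n where x: "x \<in> carrier M" "C = frac R M s x n" by (auto simp: loc_carrier)
  then show "\<one> \<odot>\<^bsub>?L\<^esub> C = C" by (simp add: loc_smult[OF s])
next
  let ?L = "loc_module R M s"
  fix a C E assume a: "a \<in> carrier R" and "C \<in> carrier ?L" "E \<in> carrier ?L"
  then obtain x y n where "x \<in> carrier M" "y \<in> carrier M" "C = frac R M s x n" "E = frac R M s y n"
    by (metis loc_common_denominator[OF s])
  then show "a \<odot>\<^bsub>?L\<^esub> (C \<oplus>\<^bsub>?L\<^esub> E) = a \<odot>\<^bsub>?L\<^esub> C \<oplus>\<^bsub>?L\<^esub> a \<odot>\<^bsub>?L\<^esub> E"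
    using a by (simp add: loc_smult[OF s] loc_add[OF s] smult_r_distr)
qed

lemma linear_map_frac:
  "s \<in> carrier R \<Longrightarrow> linear_map R M (loc_module R M s) (\<lambda>x. frac R M s x a)"
  by (auto simp: linear_map_def additive_map_def loc_add loc_smult frac_carrier)

end

section \<open>Cech cochains as families of fractions with a common exponent\<close>

text \<open>The list is extended by ones in order to have a function on all of \<^typ>\<open>nat\<close>, with values in the ring.\<close>

definition bfun :: "('r, 'l) ring_scheme \<Rightarrow> 'r list \<Rightarrow> nat \<Rightarrow> 'r" where
  "bfun R bs i = (if i < length bs then bs ! i else \<one>\<^bsub>R\<^esub>)"

lemma (in module) zero_submodule: "submodule {\<zero>\<^bsub>M\<^esub>} R M"
  by (rule submoduleI) (auto intro: M.add.inv_one)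

locale cech = module R M
  for R :: "('r, 'k) ring_scheme" (structure) and M :: "('r, 'm, 'o) module_scheme" (structure) +
  fixes bs :: "'r list"
  assumes bs_closed: "set bs \<subseteq> carrier R"
begin

abbreviation bb where "bb \<equiv> bfun R bs"
abbreviation ss where "ss \<equiv> length bs"
abbreviation B where "B \<rho> \<equiv> bprod R bb \<rho>"
abbreviation C where "C p \<equiv> cech_module R bs M p"
abbreviation Zc where "Zc p \<equiv> cech_cocycles R bs M p"
abbreviation Nc where "Nc p \<equiv> cech_coboundaries R bs M p"

lemma bb_closed: "bb \<in> UNIV \<rightarrow> carrier R"
  using subsetD[OF bs_closed nth_mem] by (simp add: bfun_def)

lemma B_closed [simp]: "B \<rho> \<in> carrier R"
  by (rule R.bprod_closed[OF bb_closed])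

lemma cech_cells_eq: "cech_cells bs p = cells ss p"
  by (simp add: cech_cells_def cells_def)

lemma cech_elem_eq: "\<rho> \<in> cells ss p \<Longrightarrow> cech_elem R bs \<rho> = B \<rho>"
  unfolding cech_elem_def bprod_def
  by (rule R.finprod_cong') (use bb_closed in \<open>auto simp: cells_def bfun_def\<close>)

lemma cech_loc_eq: "\<rho> \<in> cells ss p \<Longrightarrow> cech_loc R bs M \<rho> = loc_module R M (B \<rho>)"
  by (simp add: cech_loc_def cech_elem_eq)

definition cochain where
  "cochain p a x = (\<lambda>\<rho>\<in>cells ss p. frac R M (B \<rho>) (x \<rho>) a)"

lemma cochain_cong: "(\<And>\<rho>. \<rho> \<in> cells ss p \<Longrightarrow> x \<rho> = y \<rho>) \<Longrightarrow> cochain p a x = cochain p a y"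
  unfolding cochain_def by (intro restrict_ext) simp

lemma cochain_expand:
  "(\<And>\<rho>. x \<rho> \<in> carrier M) \<Longrightarrow> cochain p (a + k) (\<lambda>\<rho>. B \<rho> [^] k \<odot>\<^bsub>M\<^esub> x \<rho>) = cochain p a x"
  unfolding cochain_def by (intro restrict_ext) (simp add: frac_expand)

lemma cech_carrier_PiE: "carrier (C p) = (\<Pi>\<^sub>E \<rho>\<in>cells ss p. carrier (loc_module R M (B \<rho>)))"
  unfolding cech_module_def by (auto simp: cech_cells_eq cech_loc_eq intro!: PiE_cong)

lemma cochain_carrier: "(\<And>\<rho>. x \<rho> \<in> carrier M) \<Longrightarrow> cochain p a x \<in> carrier (C p)"
  unfolding cech_carrier_PiE cochain_def by (auto simp: frac_carrier)

text \<open>All the fractions are expanded to a common exponent, which exists because there are finitely many cells. The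
  predicate \<open>P\<close> can be satisfied at every index, so that the numerators outside the cells can be chosen as well.\<close>

lemma common_exponent:
  assumes c: "c \<in> extensional (cells ss p)"
    and ex: "\<And>\<rho>. \<rho> \<in> cells ss p \<Longrightarrow> \<exists>a x. P \<rho> a x \<and> c \<rho> = frac R M (B \<rho>) x a"
    and mono: "\<And>\<rho> a x k. P \<rho> a x \<Longrightarrow> P \<rho> (a + k) (B \<rho> [^] k \<odot>\<^bsub>M\<^esub> x)"
    and Pc: "\<And>\<rho> a x. P \<rho> a x \<Longrightarrow> x \<in> carrier M"
    and P0: "\<And>\<rho> a. \<exists>x. P \<rho> a x"
  obtains a x where "\<And>\<rho>. P \<rho> a (x \<rho>)" "c = cochain p a x"
proof -
  let ?Q = "\<lambda>\<rho> a. \<exists>x. P \<rho> a x \<and> c \<rho> = frac R M (B \<rho>) x a"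
  have "\<exists>a. \<forall>\<rho>\<in>cells ss p. ?Q \<rho> a"
  proof (rule finite_uniform_exponent[OF finite_cells])
    fix \<rho> assume "\<rho> \<in> cells ss p"
    then show "\<exists>a. ?Q \<rho> a" by (rule ex)
  next
    fix \<rho> a k assume "?Q \<rho> a"
    then obtain x where x: "P \<rho> a x" "c \<rho> = frac R M (B \<rho>) x a" by blast
    have "c \<rho> = frac R M (B \<rho>) (B \<rho> [^] k \<odot>\<^bsub>M\<^esub> x) (a + k)"
      using frac_expand[OF B_closed Pc[OF x(1)], of \<rho> k a] x(2) by simp
    then show "?Q \<rho> (a + k)" using mono[OF x(1)] by blast
  qed
  then obtain a where a: "\<forall>\<rho>\<in>cells ss p. ?Q \<rho> a" by blast
  have "\<exists>x. P \<rho> a x \<and> (\<rho> \<in> cells ss p \<longrightarrow> c \<rho> = frac R M (B \<rho>) x a)" for \<rho>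
    using a P0[of \<rho> a] by blast
  then obtain x where x: "\<And>\<rho>. P \<rho> a (x \<rho>)" "\<And>\<rho>. \<rho> \<in> cells ss p \<Longrightarrow> c \<rho> = frac R M (B \<rho>) (x \<rho>) a"
    by metis
  have "c = cochain p a x"
    by (rule extensionalityI[OF c]) (use x(2) in \<open>auto simp: cochain_def\<close>)
  then show thesis using that x(1) by blast
qed

lemma cochain_rep:
  assumes c: "c \<in> carrier (C p)"
  obtains a x where "\<And>\<rho>. x \<rho> \<in> carrier M" "c = cochain p a x"
proof (rule common_exponent[where P = "\<lambda>\<rho> a x. x \<in> carrier M" and c = c and p = p])
  show "c \<in> extensional (cells ss p)" using c unfolding cech_carrier_PiE by (simp add: PiE_iff)
  show "\<exists>a x. x \<in> carrier M \<and> c \<rho> = frac R M (B \<rho>) x a" if "\<rho> \<in> cells ss p" for \<rho>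
  proof -
    have "c \<rho> \<in> carrier (loc_module R M (B \<rho>))" using c that unfolding cech_carrier_PiE by (rule PiE_mem)
    then show ?thesis unfolding loc_carrier by blast
  qed
qed (use that in auto)

lemma cochain_rep2:
  assumes "c \<in> carrier (C p)" "e \<in> carrier (C p)"
  obtains a x y where "\<And>\<rho>. x \<rho> \<in> carrier M" "\<And>\<rho>. y \<rho> \<in> carrier M"
    "c = cochain p a x" "e = cochain p a y"
proof -
  obtain a x where x: "\<And>\<rho>. x \<rho> \<in> carrier M" "c = cochain p a x" by (rule cochain_rep[OF assms(1)]) (rule that)
  obtain n y where y: "\<And>\<rho>. y \<rho> \<in> carrier M" "e = cochain p n y" by (rule cochain_rep[OF assms(2)]) (rule that)
  show thesis
    by (rule that[of "\<lambda>\<rho>. B \<rho> [^] n \<odot>\<^bsub>M\<^esub> x \<rho>" "\<lambda>\<rho>. B \<rho> [^] a \<odot>\<^bsub>M\<^esub> y \<rho>" "a + n"])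
      (use x y cochain_expand[OF x(1), of p a n] cochain_expand[OF y(1), of p n a] in
        \<open>auto simp: add.commute\<close>)
qed

lemma cochain_eq_iff:
  assumes x: "\<And>\<rho>. x \<rho> \<in> carrier M" and y: "\<And>\<rho>. y \<rho> \<in> carrier M"
  shows "cochain p a x = cochain p n y \<longleftrightarrow>
    (\<exists>k. \<forall>\<rho>\<in>cells ss p. B \<rho> [^] (k + n) \<odot>\<^bsub>M\<^esub> x \<rho> = B \<rho> [^] (k + a) \<odot>\<^bsub>M\<^esub> y \<rho>)"
proof
  assume e: "cochain p a x = cochain p n y"
  show "\<exists>k. \<forall>\<rho>\<in>cells ss p. B \<rho> [^] (k + n) \<odot>\<^bsub>M\<^esub> x \<rho> = B \<rho> [^] (k + a) \<odot>\<^bsub>M\<^esub> y \<rho>"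
  proof (rule finite_uniform_exponent[OF finite_cells])
    fix \<rho> assume \<rho>: "\<rho> \<in> cells ss p"
    have "frac R M (B \<rho>) (x \<rho>) a = frac R M (B \<rho>) (y \<rho>) n"
      using fun_cong[OF e, of \<rho>] \<rho> by (simp add: cochain_def)
    then show "\<exists>k. B \<rho> [^] (k + n) \<odot>\<^bsub>M\<^esub> x \<rho> = B \<rho> [^] (k + a) \<odot>\<^bsub>M\<^esub> y \<rho>"
      using frac_eq_iff[OF B_closed x y] by blast
  next
    fix \<rho> and k j :: nat assume "B \<rho> [^] (k + n) \<odot>\<^bsub>M\<^esub> x \<rho> = B \<rho> [^] (k + a) \<odot>\<^bsub>M\<^esub> y \<rho>"
    from frac_rel_mono[OF B_closed x y this, of j]
    show "B \<rho> [^] (k + j + n) \<odot>\<^bsub>M\<^esub> x \<rho> = B \<rho> [^] (k + j + a) \<odot>\<^bsub>M\<^esub> y \<rho>"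
      by (simp add: ac_simps)
  qed
next
  assume "\<exists>k. \<forall>\<rho>\<in>cells ss p. B \<rho> [^] (k + n) \<odot>\<^bsub>M\<^esub> x \<rho> = B \<rho> [^] (k + a) \<odot>\<^bsub>M\<^esub> y \<rho>"
  then have "frac R M (B \<rho>) (x \<rho>) a = frac R M (B \<rho>) (y \<rho>) n" if "\<rho> \<in> cells ss p" for \<rho>
    using frac_eq_iff[OF B_closed x y] that by blast
  then show "cochain p a x = cochain p n y" unfolding cochain_def by (intro restrict_ext)
qed

lemma cochain_zero: "\<zero>\<^bsub>C p\<^esub> = cochain p a (\<lambda>_. \<zero>\<^bsub>M\<^esub>)"
  by (simp add: cech_module_def cochain_def cech_cells_eq)
    (intro restrict_ext, simp add: cech_loc_eq frac_zero)

lemma cochain_add: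
  assumes x: "\<And>\<rho>. x \<rho> \<in> carrier M" and y: "\<And>\<rho>. y \<rho> \<in> carrier M"
  shows "cochain p a x \<oplus>\<^bsub>C p\<^esub> cochain p a y = cochain p a (\<lambda>\<rho>. x \<rho> \<oplus>\<^bsub>M\<^esub> y \<rho>)"
  by (simp add: cech_module_def cochain_def cech_cells_eq)
    (intro restrict_ext, simp add: cech_loc_eq loc_add[OF B_closed x y])

lemma cochain_smult:
  assumes x: "\<And>\<rho>. x \<rho> \<in> carrier M" and c: "c \<in> carrier R"
  shows "c \<odot>\<^bsub>C p\<^esub> cochain p a x = cochain p a (\<lambda>\<rho>. c \<odot>\<^bsub>M\<^esub> x \<rho>)"
  by (simp add: cech_module_def cochain_def cech_cells_eq)
    (intro restrict_ext, simp add: cech_loc_eq loc_smult[OF B_closed x c])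

lemma cech_is_module: "module R (C p)"
proof (rule moduleI)
  show "cring R" by (rule R.is_cring)
  show "abelian_group (C p)"
  proof (rule abelian_groupI)
    fix c e assume c: "c \<in> carrier (C p)" and e: "e \<in> carrier (C p)"
    obtain a x y where xy: "\<And>\<rho>. x \<rho> \<in> carrier M" "\<And>\<rho>. y \<rho> \<in> carrier M"
      "c = cochain p a x" "e = cochain p a y" by (rule cochain_rep2[OF c e]) (rule that)
    then show "c \<oplus>\<^bsub>C p\<^esub> e \<in> carrier (C p)" by (simp add: cochain_add cochain_carrier)
    show "c \<oplus>\<^bsub>C p\<^esub> e = e \<oplus>\<^bsub>C p\<^esub> c" using xy by (simp add: cochain_add M.a_comm)
    fix h assume "h \<in> carrier (C p)"
    then obtain n z where z: "\<And>\<rho>. z \<rho> \<in> carrier M" "h = cochain p n z" by (rule cochain_rep) (rule that)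
    let ?x = "\<lambda>\<rho>. B \<rho> [^] n \<odot>\<^bsub>M\<^esub> x \<rho>" and ?y = "\<lambda>\<rho>. B \<rho> [^] n \<odot>\<^bsub>M\<^esub> y \<rho>"
      and ?z = "\<lambda>\<rho>. B \<rho> [^] a \<odot>\<^bsub>M\<^esub> z \<rho>"
    have "c = cochain p (a + n) ?x" "e = cochain p (a + n) ?y" "h = cochain p (a + n) ?z"
      using xy z cochain_expand[OF xy(1), of p a n] cochain_expand[OF xy(2), of p a n]
        cochain_expand[OF z(1), of p n a] by (auto simp: add.commute)
    moreover have "?x \<rho> \<in> carrier M" "?y \<rho> \<in> carrier M" "?z \<rho> \<in> carrier M" for \<rho> using xy z by auto
    ultimately show "c \<oplus>\<^bsub>C p\<^esub> e \<oplus>\<^bsub>C p\<^esub> h = c \<oplus>\<^bsub>C p\<^esub> (e \<oplus>\<^bsub>C p\<^esub> h)"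
      by (simp add: cochain_add M.a_assoc)
  next
    show "\<zero>\<^bsub>C p\<^esub> \<in> carrier (C p)" unfolding cochain_zero[of p 0] by (simp add: cochain_carrier)
    fix c assume "c \<in> carrier (C p)"
    then obtain a x where x: "\<And>\<rho>. x \<rho> \<in> carrier M" "c = cochain p a x" by (rule cochain_rep) (rule that)
    show "\<zero>\<^bsub>C p\<^esub> \<oplus>\<^bsub>C p\<^esub> c = c"
      unfolding cochain_zero[of p a] using x by (simp add: cochain_add)
    have "cochain p a (\<lambda>\<rho>. \<ominus>\<^bsub>M\<^esub> x \<rho>) \<oplus>\<^bsub>C p\<^esub> c = \<zero>\<^bsub>C p\<^esub>"
      unfolding cochain_zero[of p a] using x by (simp add: cochain_add M.l_neg)
    moreover have "cochain p a (\<lambda>\<rho>. \<ominus>\<^bsub>M\<^esub> x \<rho>) \<in> carrier (C p)" using x by (simp add: cochain_carrier)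
    ultimately show "\<exists>e\<in>carrier (C p). e \<oplus>\<^bsub>C p\<^esub> c = \<zero>\<^bsub>C p\<^esub>" by blast
  qed
next
  fix a c z assume a: "a \<in> carrier R" and c: "c \<in> carrier R" and "z \<in> carrier (C p)"
  then obtain n x where x: "\<And>\<rho>. x \<rho> \<in> carrier M" "z = cochain p n x" by (metis cochain_rep)
  show "a \<odot>\<^bsub>C p\<^esub> z \<in> carrier (C p)" using x a by (simp add: cochain_smult cochain_carrier)
  show "(a \<oplus> c) \<odot>\<^bsub>C p\<^esub> z = a \<odot>\<^bsub>C p\<^esub> z \<oplus>\<^bsub>C p\<^esub> c \<odot>\<^bsub>C p\<^esub> z"
    using x a c by (simp add: cochain_smult cochain_add smult_l_distr)
  show "(a \<otimes> c) \<odot>\<^bsub>C p\<^esub> z = a \<odot>\<^bsub>C p\<^esub> (c \<odot>\<^bsub>C p\<^esub> z)"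
    using x a c by (simp add: cochain_smult smult_assoc1)
next
  fix z assume "z \<in> carrier (C p)"
  then obtain n x where "\<And>\<rho>. x \<rho> \<in> carrier M" "z = cochain p n x" by (metis cochain_rep)
  then show "\<one> \<odot>\<^bsub>C p\<^esub> z = z" by (simp add: cochain_smult)
next
  fix a c e assume a: "a \<in> carrier R" and c: "c \<in> carrier (C p)" and e: "e \<in> carrier (C p)"
  obtain n x y where "\<And>\<rho>. x \<rho> \<in> carrier M" "\<And>\<rho>. y \<rho> \<in> carrier M"
    "c = cochain p n x" "e = cochain p n y" by (rule cochain_rep2[OF c e]) (rule that)
  then show "a \<odot>\<^bsub>C p\<^esub> (c \<oplus>\<^bsub>C p\<^esub> e) = a \<odot>\<^bsub>C p\<^esub> c \<oplus>\<^bsub>C p\<^esub> a \<odot>\<^bsub>C p\<^esub> e"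
    using a by (simp add: cochain_smult cochain_add smult_r_distr)
qed

section \<open>The Cech differential\<close>

lemma cech_res_frac:
  assumes \<tau>: "\<tau> \<in> cells ss p" and i: "i \<in> \<tau>" and x: "x \<in> carrier M"
  shows "cech_res R bs M \<tau> i (frac R M (B (\<tau> - {i})) x a) = frac R M (B \<tau>) (bb i [^] a \<odot>\<^bsub>M\<^esub> x) a"
proof -
  have bi: "bs ! i = bb i" using \<tau> i by (auto simp: cells_def bfun_def)
  have bc: "bb i \<in> carrier R" using bb_closed by auto
  have B: "B \<tau> = bb i \<otimes> B (\<tau> - {i})" by (rule R.bprod_remove[OF bb_closed cells_finite[OF \<tau>] i])
  have e: "frac R M (B \<tau>) (bb i [^] n \<odot>\<^bsub>M\<^esub> y) n = frac R M (B \<tau>) (bb i [^] a \<odot>\<^bsub>M\<^esub> x) a"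
    if y: "(y, n) \<in> frac R M (B (\<tau> - {i})) x a" for y n
  proof -
    let ?t = "B (\<tau> - {i})"
    obtain k where yc: "y \<in> carrier M" and k: "?t [^] (k + n) \<odot>\<^bsub>M\<^esub> x = ?t [^] (k + a) \<odot>\<^bsub>M\<^esub> y"
      using y by (auto simp: frac_mem)
    have 1: "B \<tau> [^] (k + u) \<odot>\<^bsub>M\<^esub> (bb i [^] v \<odot>\<^bsub>M\<^esub> z) = bb i [^] (k + (u + v)) \<odot>\<^bsub>M\<^esub> (?t [^] (k + u) \<odot>\<^bsub>M\<^esub> z)"
      if "z \<in> carrier M" for u v :: nat and z
    proof -
      have "B \<tau> [^] (k + u) \<otimes> bb i [^] v = (bb i [^] (k + u) \<otimes> bb i [^] v) \<otimes> ?t [^] (k + u)"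
        unfolding B using bc by (simp add: R.nat_pow_distrib R.m_ac)
      also have "\<dots> = bb i [^] (k + (u + v)) \<otimes> ?t [^] (k + u)"
        using bc by (simp add: R.nat_pow_mult add.assoc)
      finally show ?thesis using that bc by (simp flip: smult_assoc1)
    qed
    have "B \<tau> [^] (k + a) \<odot>\<^bsub>M\<^esub> (bb i [^] n \<odot>\<^bsub>M\<^esub> y) = B \<tau> [^] (k + n) \<odot>\<^bsub>M\<^esub> (bb i [^] a \<odot>\<^bsub>M\<^esub> x)"
      unfolding 1[OF yc] 1[OF x] k by (simp add: add.commute[of a n])
    then show ?thesis using yc x bc by (subst frac_eq_iff) auto
  qed
  have "(\<lambda>(x, a). frac R M (B \<tau>) (bb i [^] a \<odot>\<^bsub>M\<^esub> x) a) ` frac R M (B (\<tau> - {i})) x a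
    = {frac R M (B \<tau>) (bb i [^] a \<odot>\<^bsub>M\<^esub> x) a}"
  proof (intro subset_antisym)
    show "(\<lambda>(x, a). frac R M (B \<tau>) (bb i [^] a \<odot>\<^bsub>M\<^esub> x) a) ` frac R M (B (\<tau> - {i})) x a
      \<subseteq> {frac R M (B \<tau>) (bb i [^] a \<odot>\<^bsub>M\<^esub> x) a}"
      by (rule image_subsetI) (clarify, simp only: e singleton_iff)
    show "{frac R M (B \<tau>) (bb i [^] a \<odot>\<^bsub>M\<^esub> x) a}
      \<subseteq> (\<lambda>(x, a). frac R M (B \<tau>) (bb i [^] a \<odot>\<^bsub>M\<^esub> x) a) ` frac R M (B (\<tau> - {i})) x a"
      using frac_self[OF x, of a "B (\<tau> - {i})"] by (simp add: rev_image_eqI)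
  qed
  then show ?thesis unfolding cech_res_def bi cech_elem_eq[OF \<tau>] by simp
qed

lemma cech_diff_cochain:
  assumes x: "\<And>\<rho>. x \<rho> \<in> carrier M"
  shows "cech_diff R bs M p (cochain p a x) = cochain (p + 1) a (cdiff R M bb a x)"
  unfolding cech_diff_def cochain_def cech_cells_eq
proof (rule restrict_ext)
  fix \<tau> assume \<tau>: "\<tau> \<in> cells ss (p + 1)"
  let ?L = "loc_module R M (B \<tau>)"
  interpret L: module R ?L by (rule loc_is_module[OF B_closed])
  have lin: "linear_map R M ?L (\<lambda>x. frac R M (B \<tau>) x a)" by (rule linear_map_frac[OF B_closed])
  have bc: "bb i \<in> carrier R" for i using bb_closed by auto
  have t: "(\<ominus> \<one>) [^] card {j \<in> \<tau>. j < i} \<odot>\<^bsub>?L\<^esub>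
      cech_res R bs M \<tau> i ((\<lambda>\<rho>\<in>cells ss p. frac R M (B \<rho>) (x \<rho>) a) (\<tau> - {i}))
    = frac R M (B \<tau>) (dcoef R bb a \<tau> i \<odot>\<^bsub>M\<^esub> x (\<tau> - {i})) a" if i: "i \<in> \<tau>" for i
    using cells_remove[OF \<tau> i] cech_res_frac[OF \<tau> i x, of "\<tau> - {i}" a] bc x
    by (simp add: loc_smult dcoef_def smult_assoc1)
  have "(\<Oplus>\<^bsub>?L\<^esub>i\<in>\<tau>. (\<ominus> \<one>) [^] card {j \<in> \<tau>. j < i} \<odot>\<^bsub>?L\<^esub>
      cech_res R bs M \<tau> i ((\<lambda>\<rho>\<in>cells ss p. frac R M (B \<rho>) (x \<rho>) a) (\<tau> - {i})))
    = (\<Oplus>\<^bsub>?L\<^esub>i\<in>\<tau>. frac R M (B \<tau>) (dcoef R bb a \<tau> i \<odot>\<^bsub>M\<^esub> x (\<tau> - {i})) a)"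
    using t x bb_closed by (intro L.finsum_cong') (auto simp: frac_carrier)
  also have "\<dots> = frac R M (B \<tau>) (cdiff R M bb a x \<tau>) a"
    unfolding cdiff_def using x bb_closed
    by (intro additive_map_finsum[OF M.abelian_group_axioms L.abelian_group_axioms linear_map_additive[OF lin],
          symmetric]) auto
  finally show "(\<Oplus>\<^bsub>cech_loc R bs M \<tau>\<^esub>i\<in>\<tau>. (\<ominus> \<one>) [^] card {j \<in> \<tau>. j < i} \<odot>\<^bsub>cech_loc R bs M \<tau>\<^esub>
      cech_res R bs M \<tau> i ((\<lambda>\<rho>\<in>cells ss p. frac R M (B \<rho>) (x \<rho>) a) (\<tau> - {i})))
    = frac R M (B \<tau>) (cdiff R M bb a x \<tau>) a"
    unfolding cech_loc_eq[OF \<tau>] .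
qed

lemma cdiff_bb_closed: "(\<And>\<rho>. x \<rho> \<in> carrier M) \<Longrightarrow> cdiff R M bb a x \<rho> \<in> carrier M"
  by (rule cdiff_closed[OF bb_closed])

lemma linear_map_cech_diff: "linear_map R (C p) (C (p + 1)) (cech_diff R bs M p)"
  unfolding linear_map_def additive_map_def
proof (intro conjI ballI funcsetI)
  fix c assume "c \<in> carrier (C p)"
  then obtain a x where "\<And>\<rho>. x \<rho> \<in> carrier M" "c = cochain p a x" by (rule cochain_rep) (rule that)
  then show "cech_diff R bs M p c \<in> carrier (C (p + 1))"
    by (simp add: cech_diff_cochain cochain_carrier cdiff_bb_closed)
next
  fix c e assume c: "c \<in> carrier (C p)" and e: "e \<in> carrier (C p)"
  obtain a x y where "\<And>\<rho>. x \<rho> \<in> carrier M" "\<And>\<rho>. y \<rho> \<in> carrier M"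
    "c = cochain p a x" "e = cochain p a y" by (rule cochain_rep2[OF c e]) (rule that)
  then show "cech_diff R bs M p (c \<oplus>\<^bsub>C p\<^esub> e) = cech_diff R bs M p c \<oplus>\<^bsub>C (p + 1)\<^esub> cech_diff R bs M p e"
    by (simp add: cech_diff_cochain cochain_add cdiff_bb_closed)
      (intro cochain_cong cdiff_add[OF bb_closed], simp_all)
next
  fix r c assume r: "r \<in> carrier R" and "c \<in> carrier (C p)"
  then obtain a x where "\<And>\<rho>. x \<rho> \<in> carrier M" "c = cochain p a x" by (metis cochain_rep)
  then show "cech_diff R bs M p (r \<odot>\<^bsub>C p\<^esub> c) = r \<odot>\<^bsub>C (p + 1)\<^esub> cech_diff R bs M p c"
    using r by (simp add: cech_diff_cochain cochain_smult cdiff_bb_closed)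
      (intro cochain_cong cdiff_smult[OF bb_closed], simp_all)
qed

lemma cochain_zero_iff:
  assumes x: "\<And>\<rho>. x \<rho> \<in> carrier M"
  shows "cochain p a x = \<zero>\<^bsub>C p\<^esub> \<longleftrightarrow> (\<exists>k::nat. \<forall>\<rho>\<in>cells ss p. B \<rho> [^] k \<odot>\<^bsub>M\<^esub> x \<rho> = \<zero>\<^bsub>M\<^esub>)"
  unfolding cochain_zero[of p 0] 
  using cochain_eq_iff[where x = x and y = "\<lambda>_. \<zero>\<^bsub>M\<^esub>" and p = p and a = a and n = 0, OF x] by simp

text \<open>That the differential of a cochain vanishes means that its numerators are killed by a power of the
  denominators. After expanding the fractions by this power, the numerators themselves form a cocycle. The
  predicate \<open>P\<close> carries along a condition such as homogeneity.\<close>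

lemma cocycle_rep:
  assumes c: "c \<in> Zc p"
    and P: "\<And>\<rho>. P \<rho> a (x \<rho>)" and cx: "c = cochain p a x"
    and mono: "\<And>\<rho> a x k. P \<rho> a x \<Longrightarrow> P \<rho> (a + k) (B \<rho> [^] k \<odot>\<^bsub>M\<^esub> x)"
    and Pc: "\<And>\<rho> a x. P \<rho> a x \<Longrightarrow> x \<in> carrier M"
  obtains a x where "\<And>\<rho>. P \<rho> a (x \<rho>)" "c = cochain p a x"
    "\<And>\<tau>. \<tau> \<in> cells ss (p + 1) \<Longrightarrow> cdiff R M bb a x \<tau> = \<zero>\<^bsub>M\<^esub>"
proof -
  have x: "x \<rho> \<in> carrier M" for \<rho> using Pc[OF P] .
  have "cech_diff R bs M p c = \<zero>\<^bsub>C (p + 1)\<^esub>" using c by (simp add: cech_cocycles_def)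
  then obtain k :: nat where k: "\<And>\<tau>. \<tau> \<in> cells ss (p + 1) \<Longrightarrow> B \<tau> [^] k \<odot>\<^bsub>M\<^esub> cdiff R M bb a x \<tau> = \<zero>\<^bsub>M\<^esub>"
    unfolding cx cech_diff_cochain[OF x] cochain_zero_iff[OF cdiff_bb_closed[OF x]] by blast
  show thesis
  proof (rule that[of "a + k" "\<lambda>\<rho>. B \<rho> [^] k \<odot>\<^bsub>M\<^esub> x \<rho>"])
    show "P \<rho> (a + k) (B \<rho> [^] k \<odot>\<^bsub>M\<^esub> x \<rho>)" for \<rho> by (rule mono[OF P])
    show "c = cochain p (a + k) (\<lambda>\<rho>. B \<rho> [^] k \<odot>\<^bsub>M\<^esub> x \<rho>)" unfolding cx by (rule cochain_expand[OF x, symmetric])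
    show "cdiff R M bb (a + k) (\<lambda>\<rho>. B \<rho> [^] k \<odot>\<^bsub>M\<^esub> x \<rho>) \<tau> = \<zero>\<^bsub>M\<^esub>" if \<tau>: "\<tau> \<in> cells ss (p + 1)" for \<tau>
      using cdiff_shift[OF bb_closed x cells_finite[OF \<tau>]] k[OF \<tau>] by simp
  qed
qed

lemma cocycleI:
  assumes x: "\<And>\<rho>. x \<rho> \<in> carrier M"
    and dx: "\<And>\<tau>. \<tau> \<in> cells ss (p + 1) \<Longrightarrow> cdiff R M bb a x \<tau> = \<zero>\<^bsub>M\<^esub>"
  shows "cochain p a x \<in> Zc p"
proof -
  have "cochain (p + 1) a (cdiff R M bb a x) = cochain (p + 1) a (\<lambda>_. \<zero>\<^bsub>M\<^esub>)"
    by (rule cochain_cong[OF dx])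
  then show ?thesis
    by (simp add: cech_cocycles_def cochain_carrier[OF x] cech_diff_cochain[OF x] cochain_zero[of "p + 1" a])
qed

lemma coboundary_iff:
  assumes x: "\<And>\<rho>. x \<rho> \<in> carrier M"
  shows "cochain p a x \<in> Nc p \<longleftrightarrow> (\<exists>k y. (\<forall>\<rho>. y \<rho> \<in> carrier M) \<and>
    (\<forall>\<rho>\<in>cells ss p. B \<rho> [^] k \<odot>\<^bsub>M\<^esub> x \<rho> = cdiff R M bb (a + k) y \<rho>))"
proof
  assume "cochain p a x \<in> Nc p"
  then obtain e where e: "e \<in> carrier (C (p - 1))" "cochain p a x = cech_diff R bs M (p - 1) e"
    by (auto simp: cech_coboundaries_def)
  from e(1) obtain n y where y: "\<And>\<rho>. y \<rho> \<in> carrier M" "e = cochain (p - 1) n y" by (rule cochain_rep) (rule that)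
  have "cochain p a x = cochain p n (cdiff R M bb n y)"
    using e(2) cech_diff_cochain[OF y(1), of "p - 1" n] y(2) by simp
  moreover have "cdiff R M bb n y \<rho> \<in> carrier M" for \<rho> by (rule cdiff_bb_closed[OF y(1)])
  ultimately obtain k where k: "\<And>\<rho>. \<rho> \<in> cells ss p \<Longrightarrow>
      B \<rho> [^] (k + n) \<odot>\<^bsub>M\<^esub> x \<rho> = B \<rho> [^] (k + a) \<odot>\<^bsub>M\<^esub> cdiff R M bb n y \<rho>"
    using cochain_eq_iff[where x = x and y = "cdiff R M bb n y" and p = p and a = a and n = n, OF x] by blast
  let ?y = "\<lambda>\<rho>. B \<rho> [^] (k + a) \<odot>\<^bsub>M\<^esub> y \<rho>"
  have e: "n + (k + a) = a + (k + n)" by simp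
  have "B \<rho> [^] (k + n) \<odot>\<^bsub>M\<^esub> x \<rho> = cdiff R M bb (a + (k + n)) ?y \<rho>" if \<rho>: "\<rho> \<in> cells ss p" for \<rho>
    using k[OF \<rho>] cdiff_shift[OF bb_closed y(1) cells_finite[OF \<rho>], of n "k + a", unfolded e] by simp
  moreover have "\<forall>\<rho>. ?y \<rho> \<in> carrier M" using y(1) by simp
  ultimately show "\<exists>k y. (\<forall>\<rho>. y \<rho> \<in> carrier M) \<and>
    (\<forall>\<rho>\<in>cells ss p. B \<rho> [^] k \<odot>\<^bsub>M\<^esub> x \<rho> = cdiff R M bb (a + k) y \<rho>)"
    by (intro exI[of _ "k + n"] exI[of _ ?y]) blast
next
  assume "\<exists>k y. (\<forall>\<rho>. y \<rho> \<in> carrier M) \<and>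
    (\<forall>\<rho>\<in>cells ss p. B \<rho> [^] k \<odot>\<^bsub>M\<^esub> x \<rho> = cdiff R M bb (a + k) y \<rho>)"
  then obtain k y where y: "\<And>\<rho>. y \<rho> \<in> carrier M"
    and k: "\<And>\<rho>. \<rho> \<in> cells ss p \<Longrightarrow> B \<rho> [^] k \<odot>\<^bsub>M\<^esub> x \<rho> = cdiff R M bb (a + k) y \<rho>" by blast
  have "cochain p a x = cochain p (a + k) (\<lambda>\<rho>. B \<rho> [^] k \<odot>\<^bsub>M\<^esub> x \<rho>)"
    by (rule cochain_expand[OF x, symmetric])
  also have "\<dots> = cochain p (a + k) (cdiff R M bb (a + k) y)" by (rule cochain_cong[OF k])
  also have "\<dots> = cech_diff R bs M (p - 1) (cochain (p - 1) (a + k) y)"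
    using cech_diff_cochain[OF y, of "p - 1" "a + k"] by simp
  finally show "cochain p a x \<in> Nc p"
    using cochain_carrier[OF y] by (auto simp: cech_coboundaries_def)
qed

lemma coboundary_subset_cocycle: "Nc p \<subseteq> Zc p"
proof
  fix c assume "c \<in> Nc p"
  then obtain e where e: "e \<in> carrier (C (p - 1))" "c = cech_diff R bs M (p - 1) e"
    by (auto simp: cech_coboundaries_def)
  from e(1) obtain n y where y: "\<And>\<rho>. y \<rho> \<in> carrier M" "e = cochain (p - 1) n y" by (rule cochain_rep) (rule that)
  have "c = cochain p n (cdiff R M bb n y)"
    using e(2) cech_diff_cochain[OF y(1), of "p - 1" n] y(2) by simp
  then show "c \<in> Zc p"
    using cocycleI[OF cdiff_bb_closed[OF y(1)], of p n] cdiff_cdiff[OF bb_closed y(1) cells_finite] by simp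
qed

end

sublocale cech \<subseteq> Cp: module R "cech_module R bs M p" for p
  by (rule cech_is_module)

context cech
begin

lemma cocycle_submodule: "submodule (Zc p) R (C p)"
proof -
  have "submodule {\<zero>\<^bsub>C (p + 1)\<^esub>} R (C (p + 1))"
    by (rule Cp.submoduleI) (auto intro: Cp.add.inv_one)
  from submodule_preimage[OF cech_is_module cech_is_module linear_map_cech_diff this]
  show ?thesis by (simp add: cech_cocycles_def)
qed

lemma cocycle_carrier: "c \<in> Zc p \<Longrightarrow> c \<in> carrier (C p)"
  by (simp add: cech_cocycles_def)

lemma coboundary_submodule: "submodule (Nc p) R (C p)"
proof -
  let ?d = "cech_diff R bs M (p - 1)"
  have lin: "linear_map R (C (p - 1)) (C p) ?d" using linear_map_cech_diff[of "p - 1"] by simp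
  note ad = linear_map_additive[OF lin]
  show ?thesis
    unfolding cech_coboundaries_def
  proof (rule Cp.submoduleI)
    show "?d ` carrier (C (p - 1)) \<subseteq> carrier (C p)" using additive_map_closed[OF ad] by auto
    show "\<zero>\<^bsub>C p\<^esub> \<in> ?d ` carrier (C (p - 1))"
      using additive_map_zero[OF Cp.abelian_group_axioms Cp.abelian_group_axioms ad]
      by (metis Cp.zero_closed image_eqI)
    show "\<ominus>\<^bsub>C p\<^esub> c \<in> ?d ` carrier (C (p - 1))" if c: "c \<in> ?d ` carrier (C (p - 1))" for c
    proof -
      obtain e where "e \<in> carrier (C (p - 1))" "c = ?d e" using c by blast
      then show ?thesis
        using additive_map_minus[OF Cp.abelian_group_axioms Cp.abelian_group_axioms ad] Cp.a_inv_closed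
        by (metis image_eqI)
    qed
    show "c \<oplus>\<^bsub>C p\<^esub> c' \<in> ?d ` carrier (C (p - 1))"
      if c: "c \<in> ?d ` carrier (C (p - 1))" and c': "c' \<in> ?d ` carrier (C (p - 1))" for c c'
    proof -
      obtain e e' where "e \<in> carrier (C (p - 1))" "c = ?d e" "e' \<in> carrier (C (p - 1))" "c' = ?d e'"
        using c c' by blast
      then show ?thesis using additive_map_add[OF ad] Cp.a_closed by (metis image_eqI)
    qed
    show "r \<odot>\<^bsub>C p\<^esub> c \<in> ?d ` carrier (C (p - 1))"
      if r: "r \<in> carrier R" and c: "c \<in> ?d ` carrier (C (p - 1))" for r c
    proof -
      obtain e where "e \<in> carrier (C (p - 1))" "c = ?d e" using c by blast
      then show ?thesis using linear_map_smult[OF lin r] Cp.smult_closed[OF r] by (metis image_eqI)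
    qed
  qed
qed

lemma coset_restrict: "N +>\<^bsub>(C p)\<lparr>carrier := W\<rparr>\<^esub> c = N +>\<^bsub>C p\<^esub> c"
  by (simp add: a_r_coset_def')

abbreviation CZ where "CZ p \<equiv> (C p)\<lparr>carrier := Zc p\<rparr>"

lemma CZ_module: "module R (CZ p)"
  by (rule submodule.submodule_is_module[OF cocycle_submodule cech_is_module])

lemma coboundary_submodule_CZ: "submodule (Nc p) R (CZ p)"
proof -
  interpret Z: module R "CZ p" by (rule CZ_module)
  note c = Cp.submodule_closed[OF coboundary_submodule[of p]]
  have minus: "\<ominus>\<^bsub>CZ p\<^esub> x = \<ominus>\<^bsub>C p\<^esub> x" if "x \<in> Zc p" for x
    using that Z.minus_equality[of "\<ominus>\<^bsub>C p\<^esub> x" x] Cp.submodule_closed(5)[OF cocycle_submodule that]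
      cocycle_carrier[OF that] Cp.l_neg by simp
  show ?thesis
  proof (rule Z.submoduleI)
    show "\<ominus>\<^bsub>CZ p\<^esub> x \<in> Nc p" if "x \<in> Nc p" for x
      using minus[OF subsetD[OF coboundary_subset_cocycle that]] c(5)[OF that] by simp
  qed (use c coboundary_subset_cocycle[of p] in auto)
qed

lemma H_carrier: "U \<in> carrier (cech_H R bs M p) \<longleftrightarrow> (\<exists>c\<in>Zc p. U = Nc p +>\<^bsub>C p\<^esub> c)"
  unfolding cech_H_def module.quot_carrier[OF CZ_module] by (simp add: coset_restrict)

lemma H_zero: "\<zero>\<^bsub>cech_H R bs M p\<^esub> = Nc p"
  unfolding cech_H_def by (rule module.quot_zero[OF CZ_module])

lemma H_module: "module R (cech_H R bs M p)"
  unfolding cech_H_def by (rule module.quot_is_module[OF CZ_module coboundary_submodule_CZ])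

lemma H_add:
  "c \<in> Zc p \<Longrightarrow> e \<in> Zc p \<Longrightarrow>
    (Nc p +>\<^bsub>C p\<^esub> c) \<oplus>\<^bsub>cech_H R bs M p\<^esub> (Nc p +>\<^bsub>C p\<^esub> e) = Nc p +>\<^bsub>C p\<^esub> (c \<oplus>\<^bsub>C p\<^esub> e)"
  using module.quot_add[OF CZ_module coboundary_submodule_CZ, of c p e]
  unfolding cech_H_def by (simp add: coset_restrict)

lemma H_smult:
  "r \<in> carrier R \<Longrightarrow> c \<in> Zc p \<Longrightarrow>
    r \<odot>\<^bsub>cech_H R bs M p\<^esub> (Nc p +>\<^bsub>C p\<^esub> c) = Nc p +>\<^bsub>C p\<^esub> (r \<odot>\<^bsub>C p\<^esub> c)"
  using module.quot_smult[OF CZ_module coboundary_submodule_CZ, of r c p]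
  unfolding cech_H_def by (simp add: coset_restrict)

lemma H_eq_zero_iff: "c \<in> Zc p \<Longrightarrow> Nc p +>\<^bsub>C p\<^esub> c = Nc p \<longleftrightarrow> c \<in> Nc p"
  by (rule Cp.coset_zero_iff[OF coboundary_submodule cocycle_carrier])

lemma H_trivialD:
  assumes "carrier (cech_H R bs M p) = {\<zero>\<^bsub>cech_H R bs M p\<^esub>}"
  shows "Zc p \<subseteq> Nc p"
proof
  fix c assume c: "c \<in> Zc p"
  then have "Nc p +>\<^bsub>C p\<^esub> c \<in> carrier (cech_H R bs M p)" by (auto simp: H_carrier)
  then show "c \<in> Nc p" using assms H_eq_zero_iff[OF c] by (simp add: H_zero)
qed

lemma cd_less_imp:
  assumes "cech_cd R bs M < ereal (real_of_int l)" "j \<ge> l"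
  shows "Zc j \<subseteq> Nc j"
proof -
  obtain i where "\<forall>j>i. carrier (cech_H R bs M j) = {\<zero>\<^bsub>cech_H R bs M j\<^esub>}"
    "ereal (real_of_int i) < ereal (real_of_int l)"
    using assms(1) unfolding cech_cd_def INF_less_iff by blast
  then show ?thesis using assms(2) by (intro H_trivialD) simp
qed

text \<open>This translates the definition of the cohomological dimension, which is about a quotient module, into
  exactness of a subquotient.\<close>

lemma rel_exact_of_quotient:
  assumes N: "submodule N R M"
    and ex: "cech_cocycles R bs (quot_module M N) p \<subseteq> cech_coboundaries R bs (quot_module M N) p"
  shows "rel_exact R M bb ss (carrier M) N p"
  unfolding rel_exact_def
proof (intro allI impI)
  fix a x assume x: "\<forall>\<rho>. x \<rho> \<in> carrier M" and dx: "\<forall>\<tau>\<in>cells ss (p + 1). cdiff R M bb a x \<tau> \<in> N"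
  let ?Q = "quot_module M N"
  let ?\<pi> = "\<lambda>x. N +>\<^bsub>M\<^esub> x"
  have Qm: "module R ?Q" by (rule quot_is_module[OF N])
  interpret Q: cech R ?Q bs by (intro cech.intro cech_axioms.intro Qm bs_closed)
  have lin: "linear_map R M ?Q ?\<pi>" by (rule linear_map_coset[OF N])
  note ad = linear_map_additive[OF lin]
  have xc: "x \<rho> \<in> carrier M" for \<rho> using x by blast
  have px: "?\<pi> (z \<rho>) \<in> carrier ?Q" if "\<And>\<rho>. z \<rho> \<in> carrier M" for z :: "nat set \<Rightarrow> 'm" and \<rho>
    using additive_map_closed[OF ad that] .
  have dp: "cdiff R ?Q bb n (\<lambda>\<rho>. ?\<pi> (z \<rho>)) \<tau> = ?\<pi> (cdiff R M bb n z \<tau>)"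
    if "\<And>\<rho>. z \<rho> \<in> carrier M" for z n \<tau>
    by (rule cdiff_linear_map[OF module_axioms Qm bb_closed that lin, symmetric])
  have "Q.cochain p a (\<lambda>\<rho>. ?\<pi> (x \<rho>)) \<in> Q.Zc p"
  proof (rule Q.cocycleI[OF px[OF xc]])
    fix \<tau> assume \<tau>: "\<tau> \<in> cells ss (p + 1)"
    have "cdiff R M bb a x \<tau> \<in> carrier M" by (rule cdiff_bb_closed[OF xc])
    then have "?\<pi> (cdiff R M bb a x \<tau>) = N"
      using coset_zero_iff[OF N] dx \<tau> by simp
    then show "cdiff R ?Q bb a (\<lambda>\<rho>. ?\<pi> (x \<rho>)) \<tau> = \<zero>\<^bsub>?Q\<^esub>"
      using dp[OF xc] by (simp add: quot_zero)
  qed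
  then have "Q.cochain p a (\<lambda>\<rho>. ?\<pi> (x \<rho>)) \<in> Q.Nc p" using ex by (rule subsetD[rotated])
  moreover have pxc: "?\<pi> (x \<rho>) \<in> carrier ?Q" for \<rho> by (rule px[OF xc])
  ultimately have "\<exists>k v. (\<forall>\<rho>. v \<rho> \<in> carrier ?Q) \<and>
      (\<forall>\<rho>\<in>cells ss p. B \<rho> [^] k \<odot>\<^bsub>?Q\<^esub> ?\<pi> (x \<rho>) = cdiff R ?Q bb (a + k) v \<rho>)"
    using Q.coboundary_iff[where x = "\<lambda>\<rho>. ?\<pi> (x \<rho>)" and p = p and a = a, OF pxc] by simp
  then obtain k v where kv: "(\<forall>\<rho>. v \<rho> \<in> carrier ?Q) \<and>
      (\<forall>\<rho>\<in>cells ss p. B \<rho> [^] k \<odot>\<^bsub>?Q\<^esub> ?\<pi> (x \<rho>) = cdiff R ?Q bb (a + k) v \<rho>)"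
    by (elim exE) (rule that)
  have v: "v \<rho> \<in> carrier ?Q" for \<rho> using kv by simp
  have xv: "B \<rho> [^] k \<odot>\<^bsub>?Q\<^esub> ?\<pi> (x \<rho>) = cdiff R ?Q bb (a + k) v \<rho>" if "\<rho> \<in> cells ss p" for \<rho>
    using kv that by simp
  have "\<exists>y. y \<in> carrier M \<and> v \<rho> = ?\<pi> y" for \<rho> using v[of \<rho>] by (auto simp: quot_carrier)
  then obtain y where y: "\<And>\<rho>. y \<rho> \<in> carrier M" and vy: "\<And>\<rho>. v \<rho> = ?\<pi> (y \<rho>)" by metis
  have "B \<rho> [^] k \<odot>\<^bsub>M\<^esub> x \<rho> \<ominus>\<^bsub>M\<^esub> cdiff R M bb (a + k) y \<rho> \<in> N" if \<rho>: "\<rho> \<in> cells ss p" for \<rho>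
  proof -
    have "v = (\<lambda>\<rho>. ?\<pi> (y \<rho>))" using vy by auto
    then have "?\<pi> (B \<rho> [^] k \<odot>\<^bsub>M\<^esub> x \<rho>) = ?\<pi> (cdiff R M bb (a + k) y \<rho>)"
      using xv[OF \<rho>] dp[OF y] linear_map_smult[OF lin, of "B \<rho> [^] k" "x \<rho>"] xc by simp
    then show ?thesis using coset_diff_iff[OF N] xc cdiff_bb_closed[OF y] by simp
  qed
  then show "\<exists>k y. (\<forall>\<rho>. y \<rho> \<in> carrier M) \<and>
      (\<forall>\<rho>\<in>cells ss p. B \<rho> [^] k \<odot>\<^bsub>M\<^esub> x \<rho> \<ominus>\<^bsub>M\<^esub> cdiff R M bb (a + k) y \<rho> \<in> N)"
    using y by blast
qed

end

section \<open>Graded Cech cochains\<close>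

text \<open>An element \<open>s\<close> with more than one degree is zero. Then all fractions are equal, and the numerator can be
  taken to be zero, which is homogeneous of every degree.\<close>

lemma (in module) loc_grade_rep:
  assumes s: "s \<in> carrier R" and sd: "s \<in> Rg d" and d: "d \<in> carrier G" and g: "g \<in> carrier G"
    and unique: "\<And>d'. d' \<in> carrier G \<Longrightarrow> s \<in> Rg d' \<Longrightarrow> d' = d \<or> s = \<zero>"
    and Mg: "\<And>h x. h \<in> carrier G \<Longrightarrow> x \<in> Mg h \<Longrightarrow> x \<in> carrier M"
    and zero: "\<And>h. h \<in> carrier G \<Longrightarrow> \<zero>\<^bsub>M\<^esub> \<in> Mg h"
    and G: "comm_group G"
  shows "E \<in> loc_grade G R Rg M Mg s g \<longleftrightarrow>
    (\<exists>a x. x \<in> Mg (g \<otimes>\<^bsub>G\<^esub> d [^]\<^bsub>G\<^esub> a) \<and> E = frac R M s x (a::nat))"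
proof
  interpret G: comm_group G by fact
  assume "E \<in> loc_grade G R Rg M Mg s g"
  then obtain x and a :: nat and d' where d': "d' \<in> carrier G" "s \<in> Rg d'" "x \<in> Mg (g \<otimes>\<^bsub>G\<^esub> d' [^]\<^bsub>G\<^esub> a)"
    and E: "E = frac R M s x a" by (auto simp: loc_grade_def)
  have xc: "x \<in> carrier M" using Mg d'(1,3) g by (meson G.m_closed G.nat_pow_closed)
  show "\<exists>a x. x \<in> Mg (g \<otimes>\<^bsub>G\<^esub> d [^]\<^bsub>G\<^esub> a) \<and> E = frac R M s x (a::nat)"
  proof (cases "d' = d")
    case True
    then show ?thesis using d' E by blast
  next
    case False
    then have s0: "s = \<zero>" using unique d' by blast
    have "s [^] (Suc 0 + a) \<odot>\<^bsub>M\<^esub> x = s [^] (Suc 0 + a) \<odot>\<^bsub>M\<^esub> \<zero>\<^bsub>M\<^esub>"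
      using xc unfolding s0 by simp
    then have "frac R M s x a = frac R M s \<zero>\<^bsub>M\<^esub> a"
      using frac_eq_iff[OF s xc M.zero_closed] by blast
    then show ?thesis using E zero[of "g \<otimes>\<^bsub>G\<^esub> d [^]\<^bsub>G\<^esub> a"] g d by (metis G.m_closed G.nat_pow_closed)
  qed
next
  assume "\<exists>a x. x \<in> Mg (g \<otimes>\<^bsub>G\<^esub> d [^]\<^bsub>G\<^esub> a) \<and> E = frac R M s x (a::nat)"
  then show "E \<in> loc_grade G R Rg M Mg s g" using sd d by (auto simp: loc_grade_def)
qed

lemma (in module) loc_map_frac:
  assumes Q: "module R Q" and h: "linear_map R M Q h" and s: "s \<in> carrier R" and x: "x \<in> carrier M"
  shows "loc_map R Q s h (frac R M s x a) = frac R Q s (h x) a"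
proof -
  interpret Q: module R Q by (rule Q)
  note hc = additive_map_closed[OF linear_map_additive[OF h]]
  have e: "frac R Q s (h y) n = frac R Q s (h x) a" if y: "(y, n) \<in> frac R M s x a" for y n
  proof -
    obtain k where yc: "y \<in> carrier M" and k: "s [^] (k + n) \<odot>\<^bsub>M\<^esub> x = s [^] (k + a) \<odot>\<^bsub>M\<^esub> y"
      using y by (auto simp: frac_mem)
    have "s [^] (k + a) \<odot>\<^bsub>Q\<^esub> h y = s [^] (k + n) \<odot>\<^bsub>Q\<^esub> h x"
      using arg_cong[OF k, of h] linear_map_smult[OF h] s x yc by simp
    then show ?thesis using s hc x yc by (subst Q.frac_eq_iff) auto
  qed
  have "(\<lambda>(x, a). frac R Q s (h x) a) ` frac R M s x a = {frac R Q s (h x) a}"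
  proof (intro subset_antisym)
    show "(\<lambda>(x, a). frac R Q s (h x) a) ` frac R M s x a \<subseteq> {frac R Q s (h x) a}"
      by (rule image_subsetI) (clarify, simp only: e singleton_iff)
    show "{frac R Q s (h x) a} \<subseteq> (\<lambda>(x, a). frac R Q s (h x) a) ` frac R M s x a"
      using frac_self[OF x, of a s] by (simp add: rev_image_eqI)
  qed
  then show ?thesis by (simp add: loc_map_def)
qed

locale cech_hom = cech R M bs + Q: cech R Q bs
  for R :: "('r, 'k) ring_scheme" (structure) and M :: "('r, 'm, 'o) module_scheme" (structure)
    and bs and Q :: "('r, 'n, 'p) module_scheme" +
  fixes h
  assumes linear: "linear_map R M Q h"
begin

lemma h_closed: "x \<in> carrier M \<Longrightarrow> h x \<in> carrier Q"
  by (rule additive_map_closed[OF linear_map_additive[OF linear]])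

abbreviation cmap where "cmap p \<equiv> cech_map R bs Q h p"

lemma cmap_cochain:
  assumes x: "\<And>\<rho>. x \<rho> \<in> carrier M"
  shows "cmap p (cochain p a x) = Q.cochain p a (\<lambda>\<rho>. h (x \<rho>))"
  unfolding cech_map_def cech_cells_eq Q.cochain_def
  by (intro restrict_ext) (simp add: cochain_def cech_elem_eq loc_map_frac[OF Q.module_axioms linear B_closed x])

lemma cdiff_h:
  "(\<And>\<rho>. x \<rho> \<in> carrier M) \<Longrightarrow> cdiff R Q bb a (\<lambda>\<rho>. h (x \<rho>)) \<tau> = h (cdiff R M bb a x \<tau>)"
  by (rule cdiff_linear_map[OF module_axioms Q.module_axioms bb_closed _ linear, symmetric])

lemma h_zero: "h \<zero>\<^bsub>M\<^esub> = \<zero>\<^bsub>Q\<^esub>"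
  by (rule additive_map_zero[OF M.abelian_group_axioms Q.abelian_group_axioms linear_map_additive[OF linear]])

lemma cmap_cocycle:
  assumes c: "c \<in> Zc p"
  shows "cmap p c \<in> Q.Zc p"
proof -
  obtain a x where x: "\<And>\<rho>. x \<rho> \<in> carrier M" and c': "c = cochain p a x"
    by (rule cochain_rep[OF cocycle_carrier[OF c]]) (rule that)
  obtain a x where x: "\<And>\<rho>. x \<rho> \<in> carrier M" and c': "c = cochain p a x"
    and dx: "\<And>\<tau>. \<tau> \<in> cells ss (p + 1) \<Longrightarrow> cdiff R M bb a x \<tau> = \<zero>\<^bsub>M\<^esub>"
    by (rule cocycle_rep[where P = "\<lambda>_ _ x. x \<in> carrier M", OF c x c']) (simp, assumption, rule that)
  have hx: "h (x \<rho>) \<in> carrier Q" for \<rho> by (rule h_closed[OF x])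
  show ?thesis unfolding c' cmap_cochain[OF x]
    by (rule Q.cocycleI[OF hx]) (simp add: cdiff_h[OF x] dx h_zero)
qed

lemma cmap_coboundary:
  assumes c: "c \<in> Nc p"
  shows "cmap p c \<in> Q.Nc p"
proof -
  obtain e where e: "e \<in> carrier (C (p - 1))" "c = cech_diff R bs M (p - 1) e"
    using c by (auto simp: cech_coboundaries_def)
  obtain n y where y: "\<And>\<rho>. y \<rho> \<in> carrier M" "e = cochain (p - 1) n y"
    by (rule cochain_rep[OF e(1)]) (rule that)
  have hy: "h (y \<rho>) \<in> carrier Q" for \<rho> by (rule h_closed[OF y(1)])
  have dy: "cdiff R M bb n y \<rho> \<in> carrier M" for \<rho> by (rule cdiff_bb_closed[OF y(1)])
  have "c = cochain p n (cdiff R M bb n y)"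
    using e(2) cech_diff_cochain[OF y(1), of "p - 1" n] y(2) by simp
  then have "cmap p c = Q.cochain p n (\<lambda>\<rho>. cdiff R Q bb n (\<lambda>\<rho>. h (y \<rho>)) \<rho>)"
    by (simp add: cmap_cochain[OF dy] cdiff_h[OF y(1)])
  also have "\<dots> = cech_diff R bs Q (p - 1) (Q.cochain (p - 1) n (\<lambda>\<rho>. h (y \<rho>)))"
    using Q.cech_diff_cochain[where x = "\<lambda>\<rho>. h (y \<rho>)" and p = "p - 1" and a = n, OF hy] by simp
  finally show ?thesis
    using Q.cochain_carrier[where x = "\<lambda>\<rho>. h (y \<rho>)", OF hy] by (auto simp: cech_coboundaries_def)
qed

lemma linear_map_cmap: "linear_map R (C p) (Q.C p) (cmap p)"
  unfolding linear_map_def additive_map_def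
proof (intro conjI ballI funcsetI)
  fix c assume "c \<in> carrier (C p)"
  then obtain a x where "\<And>\<rho>. x \<rho> \<in> carrier M" "c = cochain p a x" by (rule cochain_rep) (rule that)
  then show "cmap p c \<in> carrier (Q.C p)" by (simp add: cmap_cochain Q.cochain_carrier h_closed)
next
  fix c e assume c: "c \<in> carrier (C p)" and e: "e \<in> carrier (C p)"
  obtain a x y where "\<And>\<rho>. x \<rho> \<in> carrier M" "\<And>\<rho>. y \<rho> \<in> carrier M"
    "c = cochain p a x" "e = cochain p a y" by (rule cochain_rep2[OF c e]) (rule that)
  then show "cmap p (c \<oplus>\<^bsub>C p\<^esub> e) = cmap p c \<oplus>\<^bsub>Q.C p\<^esub> cmap p e"
    by (simp add: cmap_cochain cochain_add Q.cochain_add h_closed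
        additive_map_add[OF linear_map_additive[OF linear]])
next
  fix r c assume r: "r \<in> carrier R" and "c \<in> carrier (C p)"
  then obtain a x where "\<And>\<rho>. x \<rho> \<in> carrier M" "c = cochain p a x" by (metis cochain_rep)
  then show "cmap p (r \<odot>\<^bsub>C p\<^esub> c) = r \<odot>\<^bsub>Q.C p\<^esub> cmap p c"
    using r by (simp add: cmap_cochain cochain_smult Q.cochain_smult h_closed linear_map_smult[OF linear])
qed

abbreviation Hmap where "Hmap p \<equiv> cech_H_map R bs Q h p"

lemma Hmap_coset:
  assumes c: "c \<in> Zc p"
  shows "Hmap p (Nc p +>\<^bsub>C p\<^esub> c) = Q.Nc p +>\<^bsub>Q.C p\<^esub> cmap p c"
proof -
  note cc = cocycle_carrier[OF c]
  have e: "Q.Nc p +>\<^bsub>Q.C p\<^esub> cmap p c' = Q.Nc p +>\<^bsub>Q.C p\<^esub> cmap p c" if c': "c' \<in> Nc p +>\<^bsub>C p\<^esub> c" for c'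
  proof -
    obtain n where n: "n \<in> Nc p" "c' = n \<oplus>\<^bsub>C p\<^esub> c" using c' by (auto simp: a_r_coset_mem)
    have nc: "n \<in> carrier (C p)" using Cp.submodule_closed(1)[OF coboundary_submodule n(1)] .
    have "cmap p c' = cmap p n \<oplus>\<^bsub>Q.C p\<^esub> cmap p c"
      unfolding n(2) by (rule additive_map_add[OF linear_map_additive[OF linear_map_cmap] nc cc])
    moreover have "cmap p c' \<in> carrier (Q.C p)" "cmap p c \<in> carrier (Q.C p)"
      using additive_map_closed[OF linear_map_additive[OF linear_map_cmap]] cc nc n(2) by auto
    ultimately show ?thesis
      using Q.Cp.coset_eq_iff[OF Q.coboundary_submodule] cmap_coboundary[OF n(1)] by blast
  qed
  have "(\<lambda>c. Q.Nc p +>\<^bsub>Q.C p\<^esub> cmap p c) ` (Nc p +>\<^bsub>C p\<^esub> c) = {Q.Nc p +>\<^bsub>Q.C p\<^esub> cmap p c}"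
  proof (intro subset_antisym)
    show "(\<lambda>c. Q.Nc p +>\<^bsub>Q.C p\<^esub> cmap p c) ` (Nc p +>\<^bsub>C p\<^esub> c) \<subseteq> {Q.Nc p +>\<^bsub>Q.C p\<^esub> cmap p c}"
      by (rule image_subsetI) (simp only: e singleton_iff)
    show "{Q.Nc p +>\<^bsub>Q.C p\<^esub> cmap p c} \<subseteq> (\<lambda>c. Q.Nc p +>\<^bsub>Q.C p\<^esub> cmap p c) ` (Nc p +>\<^bsub>C p\<^esub> c)"
      using Cp.coset_self[OF coboundary_submodule cc] by (simp add: rev_image_eqI)
  qed
  then show ?thesis by (simp add: cech_H_map_def)
qed

lemma linear_map_Hmap: "linear_map R (cech_H R bs M p) (cech_H R bs Q p) (Hmap p)"
  unfolding linear_map_def additive_map_def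
proof (intro conjI ballI funcsetI)
  fix U assume "U \<in> carrier (cech_H R bs M p)"
  then obtain c where c: "c \<in> Zc p" "U = Nc p +>\<^bsub>C p\<^esub> c" by (auto simp: H_carrier)
  then show "Hmap p U \<in> carrier (cech_H R bs Q p)"
    using cmap_cocycle by (auto simp: Hmap_coset Q.H_carrier)
next
  fix U V assume "U \<in> carrier (cech_H R bs M p)" "V \<in> carrier (cech_H R bs M p)"
  then obtain c e where ce: "c \<in> Zc p" "U = Nc p +>\<^bsub>C p\<^esub> c" "e \<in> Zc p" "V = Nc p +>\<^bsub>C p\<^esub> e"
    by (auto simp: H_carrier)
  have "c \<oplus>\<^bsub>C p\<^esub> e \<in> Zc p" by (rule Cp.submodule_closed(3)[OF cocycle_submodule ce(1,3)])
  then show "Hmap p (U \<oplus>\<^bsub>cech_H R bs M p\<^esub> V) = Hmap p U \<oplus>\<^bsub>cech_H R bs Q p\<^esub> Hmap p V"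
    using ce cmap_cocycle additive_map_add[OF linear_map_additive[OF linear_map_cmap] cocycle_carrier cocycle_carrier]
    by (simp add: Hmap_coset H_add Q.H_add)
next
  fix r U assume r: "r \<in> carrier R" and "U \<in> carrier (cech_H R bs M p)"
  then obtain c where c: "c \<in> Zc p" "U = Nc p +>\<^bsub>C p\<^esub> c" by (auto simp: H_carrier)
  have "r \<odot>\<^bsub>C p\<^esub> c \<in> Zc p" by (rule Cp.submodule_closed(6)[OF cocycle_submodule r c(1)])
  then show "Hmap p (r \<odot>\<^bsub>cech_H R bs M p\<^esub> U) = r \<odot>\<^bsub>cech_H R bs Q p\<^esub> Hmap p U"
    using r c cmap_cocycle linear_map_smult[OF linear_map_cmap r cocycle_carrier]
    by (simp add: Hmap_coset H_smult Q.H_smult)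
qed

end

lemma ideal_smult_submodule:
  fixes M :: "('r, 'm) module"
  assumes "module R M" "I \<subseteq> carrier R"
  shows "submodule (ideal_smult R I M) R M"
proof -
  interpret module R M by fact
  show ?thesis
  proof (rule submoduleI)
    let ?S = "{N. submodule N R M \<and> (\<forall>a\<in>I. \<forall>x\<in>carrier M. a \<odot>\<^bsub>M\<^esub> x \<in> N)}"
    have "carrier M \<in> ?S" using carrier_is_submodule assms(2) by auto
    then show "ideal_smult R I M \<subseteq> carrier M" unfolding ideal_smult_def by blast
  qed (use submodule_closed in \<open>auto simp: ideal_smult_def\<close>)
qed

lemma ideal_smultI: "a \<in> I \<Longrightarrow> x \<in> carrier M \<Longrightarrow> a \<odot>\<^bsub>M\<^esub> x \<in> ideal_smult R I M"
  by (auto simp: ideal_smult_def)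

lemma ideal_smult_least:
  "submodule N R M \<Longrightarrow> (\<And>a x. a \<in> I \<Longrightarrow> x \<in> carrier M \<Longrightarrow> a \<odot>\<^bsub>M\<^esub> x \<in> N) \<Longrightarrow> ideal_smult R I M \<subseteq> N"
  by (auto simp: ideal_smult_def)

text \<open>The degree of \<open>b\<^sub>\<rho>\<close> in the grading \<open>Rg\<close> must agree with the degree by which it acts on \<open>M\<close>; it
  is determined unless \<open>b\<^sub>\<rho> = 0\<close>.\<close>

locale graded_cech = double_complex R M G Mg pr "bfun R bs" \<beta> "length bs" f \<delta> r + cech R M bs
  for R :: "('r, 'k) ring_scheme" (structure) and M :: "('r, 'm) module" (structure)
    and G :: "('g, 'q) monoid_scheme" (structure) and Mg pr bs \<beta> f \<delta> r +
  fixes Rg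
  assumes Rg_bprod: "\<rho> \<subseteq> {..<length bs} \<Longrightarrow> bprod R (bfun R bs) \<rho> \<in> Rg (bdeg \<beta> \<rho>)"
    and Rg_unique: "e \<in> carrier G \<Longrightarrow> e' \<in> carrier G \<Longrightarrow> c \<in> Rg e \<Longrightarrow> c \<in> Rg e' \<Longrightarrow> e' = e \<or> c = \<zero>"
begin

abbreviation dgr where "dgr g a \<rho> \<equiv> g \<otimes>\<^bsub>G\<^esub> bdeg \<beta> \<rho> [^]\<^bsub>G\<^esub> (a::nat)"

lemma loc_grade_cell:
  assumes Q: "module R Q" and \<rho>: "\<rho> \<in> cells ss p" and g: "g \<in> carrier G"
    and Qg: "\<And>h x. h \<in> carrier G \<Longrightarrow> x \<in> Qg h \<Longrightarrow> x \<in> carrier Q"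
    and zero: "\<And>h. h \<in> carrier G \<Longrightarrow> \<zero>\<^bsub>Q\<^esub> \<in> Qg h"
  shows "E \<in> loc_grade G R Rg Q Qg (cech_elem R bs \<rho>) g \<longleftrightarrow>
    (\<exists>a x. x \<in> Qg (dgr g a \<rho>) \<and> E = frac R Q (B \<rho>) x a)"
  unfolding cech_elem_eq[OF \<rho>]
proof (rule module.loc_grade_rep[OF Q B_closed _ _ g _ Qg zero G.comm_group_axioms])
  show r: "B \<rho> \<in> Rg (bdeg \<beta> \<rho>)" using \<rho> by (intro Rg_bprod) (simp add: cells_def)
  show "bdeg \<beta> \<rho> \<in> carrier G" by simp
  show "e = bdeg \<beta> \<rho> \<or> B \<rho> = \<zero>" if "e \<in> carrier G" "B \<rho> \<in> Rg e" for e
    using Rg_unique[OF _ that(1) r that(2)] by simp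
qed

lemma loc_grade_M:
  assumes "\<rho> \<in> cells ss p" "g \<in> carrier G"
  shows "E \<in> loc_grade G R Rg M Mg (cech_elem R bs \<rho>) g \<longleftrightarrow>
    (\<exists>a x. x \<in> Mg (dgr g a \<rho>) \<and> E = frac R M (B \<rho>) x a)"
  by (rule loc_grade_cell[OF module_axioms assms]) (simp_all add: Mg_closed)

lemma graded_cochain:
  assumes g: "g \<in> carrier G" and x: "\<And>\<rho>. x \<rho> \<in> Mg (dgr g a \<rho>)"
  shows "cochain p a x \<in> cech_grade G R Rg bs M Mg p g"
  unfolding cech_grade_def cech_cells_eq cochain_def
proof (intro restrict_PiE_iff[THEN iffD2] ballI)
  fix \<rho> assume \<rho>: "\<rho> \<in> cells ss p"
  show "frac R M (B \<rho>) (x \<rho>) a \<in> loc_grade G R Rg M Mg (cech_elem R bs \<rho>) g"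
    unfolding loc_grade_M[OF \<rho> g] by (intro exI conjI) (rule x, rule refl)
qed

lemma graded_cochain_rep:
  assumes g: "g \<in> carrier G" and c: "c \<in> cech_grade G R Rg bs M Mg p g"
  obtains a x where "\<And>\<rho>. x \<rho> \<in> Mg (dgr g a \<rho>)" "c = cochain p a x"
proof (rule common_exponent[where P = "\<lambda>\<rho> a x. x \<in> Mg (dgr g a \<rho>)" and c = c and p = p])
  have dg: "dgr g a \<rho> \<in> carrier G" for a \<rho> using g by simp
  show "c \<in> extensional (cells ss p)"
    using c by (simp add: cech_grade_def cech_cells_eq PiE_iff)
  show "\<exists>a x. x \<in> Mg (dgr g a \<rho>) \<and> c \<rho> = frac R M (B \<rho>) x a" if \<rho>: "\<rho> \<in> cells ss p" for \<rho>
  proof -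
    have "c \<rho> \<in> loc_grade G R Rg M Mg (cech_elem R bs \<rho>) g"
      using c \<rho> unfolding cech_grade_def cech_cells_eq by (rule PiE_mem)
    then show ?thesis unfolding loc_grade_M[OF \<rho> g] .
  qed
  show "B \<rho> [^] k \<odot>\<^bsub>M\<^esub> x \<in> Mg (dgr g (a + k) \<rho>)" if "x \<in> Mg (dgr g a \<rho>)" for \<rho> a x k
    using bpow_mem[OF dg that, of \<rho> k] bdeg_shift[OF g] by simp
  show "x \<in> carrier M" if "x \<in> Mg (dgr g a \<rho>)" for \<rho> a x by (rule Mg_closed(1)[OF dg that])
  show "\<exists>x. x \<in> Mg (dgr g a \<rho>)" for \<rho> a using Mg_closed(2)[OF dg] by blast
qed (rule that)

lemma graded_cocycle_rep:
  assumes g: "g \<in> carrier G" and c: "c \<in> Zc p" "c \<in> cech_grade G R Rg bs M Mg p g"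
  obtains a x where "\<And>\<rho>. x \<rho> \<in> Mg (dgr g a \<rho>)" "c = cochain p a x"
    "\<And>\<tau>. \<tau> \<in> cells ss (p + 1) \<Longrightarrow> cdiff R M bb a x \<tau> = \<zero>\<^bsub>M\<^esub>"
proof -
  have dg: "dgr g a \<rho> \<in> carrier G" for a \<rho> using g by simp
  obtain a x where x: "\<And>\<rho>. x \<rho> \<in> Mg (dgr g a \<rho>)" and c': "c = cochain p a x"
    by (rule graded_cochain_rep[OF g c(2)]) (rule that)
  show thesis
  proof (rule cocycle_rep[where P = "\<lambda>\<rho> a x. x \<in> Mg (dgr g a \<rho>)", OF c(1) x c'])
    show "B \<rho> [^] k \<odot>\<^bsub>M\<^esub> x \<in> Mg (dgr g (a + k) \<rho>)" if "x \<in> Mg (dgr g a \<rho>)" for \<rho> a x k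
      using bpow_mem[OF dg that, of \<rho> k] bdeg_shift[OF g] by simp
    show "x \<in> carrier M" if "x \<in> Mg (dgr g a \<rho>)" for \<rho> a x by (rule Mg_closed(1)[OF dg that])
  qed (rule that)
qed

lemma H_grade_iff:
  "U \<in> cech_H_grade G R Rg bs M Mg p g \<longleftrightarrow>
    (\<exists>c\<in>Zc p \<inter> cech_grade G R Rg bs M Mg p g. U = Nc p +>\<^bsub>C p\<^esub> c)"
  unfolding cech_H_grade_def quot_grade_def by (auto simp: coset_restrict)

lemma zero_graded_cocycle:
  assumes g: "g \<in> carrier G"
  shows "cochain p 0 (\<lambda>_. \<zero>\<^bsub>M\<^esub>) \<in> Zc p \<inter> cech_grade G R Rg bs M Mg p g"
proof -
  have "dgr g 0 \<rho> \<in> carrier G" for \<rho> using g by simp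
  then show ?thesis
    using cocycleI[of "\<lambda>_. \<zero>\<^bsub>M\<^esub>" p 0] graded_cochain[OF g, of "\<lambda>_. \<zero>\<^bsub>M\<^esub>" 0 p]
      cdiff_zero[OF bb_closed] Mg_closed(2) by simp
qed

lemma vanishes_of_not_supp:
  assumes g: "g \<in> carrier G" and "g \<notin> cech_H_supp G R Rg bs M Mg p"
  shows "vanishes p g"
  unfolding vanishes_def
proof (intro allI impI)
  fix a x assume x: "\<forall>\<rho>. x \<rho> \<in> Mg (dgr g a \<rho>)"
    and dx: "\<forall>\<tau>\<in>cells ss (p + 1). cdiff R M bb a x \<tau> = \<zero>\<^bsub>M\<^esub>"
  have dg: "dgr g a \<rho> \<in> carrier G" for a \<rho> using g by simp
  have xm: "x \<rho> \<in> Mg (dgr g a \<rho>)" for \<rho> using x by blast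
  have xc: "x \<rho> \<in> carrier M" for \<rho> by (rule Mg_closed(1)[OF dg xm])
  have c: "cochain p a x \<in> Zc p" by (rule cocycleI[OF xc]) (use dx in blast)
  have "Nc p +>\<^bsub>C p\<^esub> cochain p a x \<in> cech_H_grade G R Rg bs M Mg p g"
    unfolding H_grade_iff using c graded_cochain[OF g xm] by blast
  moreover have "cech_H_grade G R Rg bs M Mg p g = {Nc p}"
    using assms by (simp add: cech_H_supp_def supp_def H_zero)
  ultimately have "cochain p a x \<in> Nc p" using H_eq_zero_iff[OF c] by simp
  then obtain k y where ky: "(\<forall>\<rho>. y \<rho> \<in> carrier M) \<and>
      (\<forall>\<rho>\<in>cells ss p. B \<rho> [^] k \<odot>\<^bsub>M\<^esub> x \<rho> = cdiff R M bb (a + k) y \<rho>)"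
    using coboundary_iff[where x = x and p = p and a = a, OF xc] by blast
  have y: "y \<rho> \<in> carrier M" for \<rho> using ky by blast
  \<comment> \<open>The cochain \<open>y\<close> need not be homogeneous, but its component of degree \<open>g\<close> has the same differential.\<close>
  let ?y = "\<lambda>\<rho>. pr (dgr g (a + k) \<rho>) (y \<rho>)"
  have "B \<rho> [^] k \<odot>\<^bsub>M\<^esub> x \<rho> = cdiff R M bb (a + k) ?y \<rho>" if \<rho>: "\<rho> \<in> cells ss p" for \<rho>
  proof -
    have step: "dgr g (a + k) (\<rho> - {i}) \<otimes>\<^bsub>G\<^esub> \<beta> i [^]\<^bsub>G\<^esub> (a + k) = dgr g (a + k) \<rho>" if "i \<in> \<rho>" for i
      using bdeg_pow_step[OF cells_finite[OF \<rho>] that, of "a + k"] g by (simp add: G.m_assoc)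
    have bx: "B \<rho> [^] k \<odot>\<^bsub>M\<^esub> x \<rho> \<in> Mg (dgr g (a + k) \<rho>)"
      using bpow_mem[OF dg xm[of \<rho>], of \<rho> k] bdeg_shift[OF g] by simp
    have "B \<rho> [^] k \<odot>\<^bsub>M\<^esub> x \<rho> = pr (dgr g (a + k) \<rho>) (B \<rho> [^] k \<odot>\<^bsub>M\<^esub> x \<rho>)"
      by (rule pr_id[OF dg bx, symmetric])
    also have "\<dots> = pr (dgr g (a + k) \<rho>) (cdiff R M bb (a + k) y \<rho>)" using ky \<rho> by simp
    also have "\<dots> = cdiff R M bb (a + k) ?y \<rho>"
      by (rule pr_cdiff[OF hb dg, of "dgr g (a + k)"]) (use dg step y in auto)
    finally show ?thesis .
  qed
  then show "\<exists>k y. (\<forall>\<rho>. y \<rho> \<in> Mg (dgr g (a + k) \<rho>)) \<and>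
      (\<forall>\<rho>\<in>cells ss p. B \<rho> [^] k \<odot>\<^bsub>M\<^esub> x \<rho> = cdiff R M bb (a + k) y \<rho>)"
    using pr_mem[OF dg y] by (intro exI[of _ k] exI[of _ ?y]) blast
qed

lemma not_supp_of_vanishes:
  assumes g: "g \<in> carrier G" and van: "vanishes p g"
  shows "g \<notin> cech_H_supp G R Rg bs M Mg p"
proof -
  have dg: "dgr g a \<rho> \<in> carrier G" for a \<rho> using g by simp
  have "U = Nc p" if U: "U \<in> cech_H_grade G R Rg bs M Mg p g" for U
  proof -
    obtain c where c: "c \<in> Zc p" "c \<in> cech_grade G R Rg bs M Mg p g" "U = Nc p +>\<^bsub>C p\<^esub> c"
      using U unfolding H_grade_iff by blast
    obtain a x where x: "\<And>\<rho>. x \<rho> \<in> Mg (dgr g a \<rho>)" and c': "c = cochain p a x"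
      and dx: "\<And>\<tau>. \<tau> \<in> cells ss (p + 1) \<Longrightarrow> cdiff R M bb a x \<tau> = \<zero>\<^bsub>M\<^esub>"
      by (rule graded_cocycle_rep[OF g c(1,2)]) (rule that)
    have xc: "x \<rho> \<in> carrier M" for \<rho> by (rule Mg_closed(1)[OF dg x])
    obtain k y where ky: "(\<forall>\<rho>. y \<rho> \<in> Mg (dgr g (a + k) \<rho>)) \<and>
      (\<forall>\<rho>\<in>cells ss p. B \<rho> [^] k \<odot>\<^bsub>M\<^esub> x \<rho> = cdiff R M bb (a + k) y \<rho>)"
      using van[unfolded vanishes_def, rule_format, of x a] x dx by blast
    have yc: "\<forall>\<rho>. y \<rho> \<in> carrier M" using ky Mg_closed(1)[OF dg] by blast
    have "c \<in> Nc p"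
      unfolding c' coboundary_iff[where x = x and p = p and a = a, OF xc] using ky yc by blast
    then show ?thesis using H_eq_zero_iff[OF c(1)] c(3) by simp
  qed
  moreover have "cech_H_grade G R Rg bs M Mg p g \<noteq> {}"
    using zero_graded_cocycle[OF g, of p] H_grade_iff[of _ p g] by blast
  ultimately have "cech_H_grade G R Rg bs M Mg p g = {Nc p}" by blast
  then show ?thesis by (simp add: cech_H_supp_def supp_def H_zero)
qed

end

context graded_cech
begin

section \<open>Vanishing of the Cech cohomology of Koszul cohomology\<close>

abbreviation II where "II \<equiv> genideal R (f ` {..<r})"
abbreviation JJ where "JJ \<equiv> II <+>\<^bsub>R\<^esub> annihilator R M"

lemma f_image_closed: "f ` {..<r} \<subseteq> carrier R"
  using f_closed by auto

lemma II_ideal: "ideal II R"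
  by (rule R.genideal_ideal[OF f_image_closed])

lemma II_closed: "c \<in> II \<Longrightarrow> c \<in> carrier R"
  using additive_subgroup.a_Hcarr[OF ideal.axioms(1)[OF II_ideal]] .

lemma annihilator_ideal: "ideal (annihilator R M) R"
proof -
  have "annihilator R M = {c \<in> carrier R. \<forall>z\<in>carrier M. c \<odot>\<^bsub>M\<^esub> z \<in> {\<zero>\<^bsub>M\<^esub>}}"
    by (simp add: annihilator_def)
  then show ?thesis using ideal_transporter[OF subset_refl zero_submodule] by simp
qed

lemma JJ_ideal: "ideal JJ R"
  by (rule R.add_ideals[OF II_ideal annihilator_ideal])

lemma II_kills: 
  assumes "c \<in> II" "z \<in> Zk q"
  shows "c \<odot>\<^bsub>F\<^esub> z \<in> Bk q"
proof -
  interpret F: module R F by (rule F_module)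
  have "Zk q \<subseteq> carrier F" by (auto simp: Zk_def)
  note id = F.ideal_transporter[OF this Bk_submodule, of q]
  have "II \<subseteq> {c \<in> carrier R. \<forall>z\<in>Zk q. c \<odot>\<^bsub>F\<^esub> z \<in> Bk q}"
    by (rule R.genideal_minimal[OF id]) (use f_kills f_image_closed in blast)
  then show ?thesis using assms by blast
qed

lemma JJ_decompose:
  assumes "c \<in> JJ"
  obtains i n where "i \<in> II" "n \<in> annihilator R M" "c = i \<oplus> n"
  using assms by (auto simp: set_add_def')

lemma JJ_kills: 
  assumes c: "c \<in> JJ" and z: "z \<in> Zk q"
  shows "c \<odot>\<^bsub>F\<^esub> z \<in> Bk q"
proof -
  obtain i n where i: "i \<in> II" and n: "n \<in> annihilator R M" and c': "c = i \<oplus> n"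
    using c by (rule JJ_decompose)
  have zc: "z J \<in> carrier M" for J using z by (simp add: Zk_def)
  have "c \<odot>\<^bsub>F\<^esub> z = i \<odot>\<^bsub>F\<^esub> z"
    using n II_closed[OF i] zc by (auto simp: c' annihilator_def smult_l_distr)
  then show ?thesis using II_kills[OF i z] by metis
qed

lemma II_smult_top:
  assumes c: "c \<in> II" and x: "x \<in> carrier M"
  shows "c \<odot>\<^bsub>M\<^esub> x \<in> image_top"
proof -
  have "(\<lambda>_. x) \<in> Zk (int r)" using x cells_above[of r "int r + 1"] by (simp add: Zk_def)
  from II_kills[OF c this] obtain y where "y \<in> carrier F" "c \<odot>\<^bsub>M\<^esub> x = D y top"
    using top_cell by (auto simp: Bk_def)
  then show ?thesis by (auto simp: image_top_def)
qed

lemma dcoef_f_mem: "i < r \<Longrightarrow> dcoef R f 1 J i \<in> II"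
  using R.genideal_self[OF f_image_closed] ideal.I_l_closed[OF II_ideal] II_closed
  by (auto simp: dcoef_def)

lemma image_top_eq: "ideal_smult R II M = image_top"
proof (intro subset_antisym)
  show "ideal_smult R II M \<subseteq> image_top"
    by (rule ideal_smult_least[OF image_top_submodule II_smult_top])
  have sub: "submodule (ideal_smult R II M) R M"
    by (rule ideal_smult_submodule[OF module_axioms]) (use II_closed in blast)
  show "image_top \<subseteq> ideal_smult R II M"
  proof
    fix x assume "x \<in> image_top"
    then obtain v where v: "\<And>J. v J \<in> carrier M" and x: "x = D v top" by (auto simp: image_top_def)
    show "x \<in> ideal_smult R II M"
      unfolding x D_cell[OF top_cell] cdiff_def
      by (intro submodule_finsum[OF sub] funcsetI ideal_smultI dcoef_f_mem v) simp
  qed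
qed

text \<open>Both the Koszul cohomology and \<open>M / I M\<close> are killed by \<open>I + ann M\<close>.\<close>

lemma exact_above_cd:
  assumes cd: "cech_cd R bs (quot_module (self_module R) JJ) < ereal (real_of_int l)" and p: "p \<ge> l"
  shows "rel_exact R F bb ss (Zk q) (Bk q) p" "rel_exact R M bb ss (carrier M) image_top p"
proof -
  have Sm: "module R (self_module R)" by (rule R.self_module_is_module)
  interpret S: cech R "self_module R" bs by (intro cech.intro cech_axioms.intro Sm bs_closed)
  have JS: "submodule JJ R (self_module R)" by (rule ideal_imp_submodule_self[OF R.is_cring JJ_ideal])
  have Qm: "module R (quot_module (self_module R) JJ)" by (rule S.quot_is_module[OF JS])
  interpret Q: cech R "quot_module (self_module R) JJ" bs
    by (intro cech.intro cech_axioms.intro Qm bs_closed)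
  have self: "rel_exact R (self_module R) bb ss (carrier R) JJ i" if "i \<ge> l" for i
    using S.rel_exact_of_quotient[OF JS Q.cd_less_imp[OF cd that]] by simp
  show "rel_exact R F bb ss (Zk q) (Bk q) p"
    by (rule rel_exact_of_killed[OF F_module bb_closed Zk_submodule Bk_submodule JJ_ideal JJ_kills self p])
  show "rel_exact R M bb ss (carrier M) image_top p"
  proof (rule rel_exact_of_killed[OF module_axioms bb_closed carrier_is_submodule image_top_submodule
        JJ_ideal _ self p])
    fix c x assume c: "c \<in> JJ" and x: "x \<in> carrier M"
    obtain i n where i: "i \<in> II" and n: "n \<in> annihilator R M" and c': "c = i \<oplus> n"
      using c by (rule JJ_decompose)
    have "c \<odot>\<^bsub>M\<^esub> x = i \<odot>\<^bsub>M\<^esub> x"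
      using n II_closed[OF i] x by (simp add: c' annihilator_def smult_l_distr)
    then show "c \<odot>\<^bsub>M\<^esub> x \<in> image_top" using II_smult_top[OF i x] by simp
  qed
qed

text \<open>The complement of \<open>J\<close> has \<open>k\<close> elements, so the sum of their degrees is one of the sums of \<open>k\<close> distinct
  \<open>\<delta>\<^sub>j\<close>.\<close>

lemma vanishes_of_deg_sums:
  assumes g: "g \<in> carrier G" and J: "J \<in> cells r (int r - int k)"
    and supp: "g \<notin> cech_H_supp G R Rg bs M Mg p <#>\<^bsub>G\<^esub> deg_sums G r \<delta> k"
  shows "vanishes p (g \<otimes>\<^bsub>G\<^esub> inv\<^bsub>G\<^esub> (bdeg \<delta> ({..<r} - J)))"
proof (rule vanishes_of_not_supp)
  let ?e = "bdeg \<delta> ({..<r} - J)"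
  show c: "g \<otimes>\<^bsub>G\<^esub> inv\<^bsub>G\<^esub> ?e \<in> carrier G" using g by simp
  show "g \<otimes>\<^bsub>G\<^esub> inv\<^bsub>G\<^esub> ?e \<notin> cech_H_supp G R Rg bs M Mg p"
  proof
    assume h: "g \<otimes>\<^bsub>G\<^esub> inv\<^bsub>G\<^esub> ?e \<in> cech_H_supp G R Rg bs M Mg p"
    have J': "J \<subseteq> {..<r}" "int (card J) = int r - int k" using J by (auto simp: cells_def)
    have "card ({..<r} - J) = k"
      using J' card_Diff_subset[OF finite_subset[OF J'(1)] J'(1)] by simp
    then have "?e \<in> deg_sums G r \<delta> k" by (auto simp: deg_sums_def bdeg_def)
    moreover have "g = (g \<otimes>\<^bsub>G\<^esub> inv\<^bsub>G\<^esub> ?e) \<otimes>\<^bsub>G\<^esub> ?e" using g by (simp add: G.m_assoc)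
    ultimately have "g \<in> cech_H_supp G R Rg bs M Mg p <#>\<^bsub>G\<^esub> deg_sums G r \<delta> k"
      using h unfolding set_mult_def by blast
    then show False using supp by blast
  qed
qed

section \<open>The natural map\<close>

lemma coset_image_top_hom: "cech_hom R M bs (quot_module M image_top) (\<lambda>x. image_top +>\<^bsub>M\<^esub> x)"
proof -
  have "module R (quot_module M image_top)" by (rule quot_is_module[OF image_top_submodule])
  then show ?thesis
    by (intro cech_hom.intro cech_hom_axioms.intro cech.intro cech_axioms.intro
        module_axioms bs_closed linear_map_coset image_top_submodule)
qed

end

sublocale graded_cech \<subseteq> Pi: cech_hom R M bs "quot_module M image_top" "\<lambda>x. image_top +>\<^bsub>M\<^esub> x"
  by (rule coset_image_top_hom)

context graded_cech
begin

abbreviation QM where "QM \<equiv> quot_module M image_top"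
abbreviation H where "H p \<equiv> cech_H R bs M p"
abbreviation IH where "IH p \<equiv> ideal_smult R II (H p)"

lemma IH_submodule: "submodule (IH p) R (H p)"
  by (rule ideal_smult_submodule[OF H_module]) (use II_closed in blast)

lemma II_kills_Hmap:
  assumes a: "a \<in> II" and U: "U \<in> carrier (H p)"
  shows "Pi.Hmap p (a \<odot>\<^bsub>H p\<^esub> U) = \<zero>\<^bsub>cech_H R bs QM p\<^esub>"
proof -
  have ac: "a \<in> carrier R" by (rule II_closed[OF a])
  obtain c where c: "c \<in> Zc p" "U = Nc p +>\<^bsub>C p\<^esub> c" using U by (auto simp: H_carrier)
  obtain n y where y: "\<And>\<rho>. y \<rho> \<in> carrier M" "c = cochain p n y"
    by (rule cochain_rep[OF cocycle_carrier[OF c(1)]]) (rule that)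
  have ay: "a \<odot>\<^bsub>M\<^esub> y \<rho> \<in> carrier M" for \<rho> using ac y by simp
  have "a \<odot>\<^bsub>C p\<^esub> c = cochain p n (\<lambda>\<rho>. a \<odot>\<^bsub>M\<^esub> y \<rho>)"
    unfolding y(2) by (rule cochain_smult[OF y(1) ac])
  then have "Pi.cmap p (a \<odot>\<^bsub>C p\<^esub> c) = Pi.Q.cochain p n (\<lambda>\<rho>. image_top +>\<^bsub>M\<^esub> (a \<odot>\<^bsub>M\<^esub> y \<rho>))"
    using Pi.cmap_cochain[OF ay] by simp
  also have "(\<lambda>\<rho>. image_top +>\<^bsub>M\<^esub> (a \<odot>\<^bsub>M\<^esub> y \<rho>)) = (\<lambda>_. \<zero>\<^bsub>QM\<^esub>)"
    using coset_zero_iff[OF image_top_submodule] ay II_smult_top[OF a y(1)] by (auto simp: quot_zero)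
  also have "Pi.Q.cochain p n (\<lambda>_. \<zero>\<^bsub>QM\<^esub>) = \<zero>\<^bsub>Pi.Q.C p\<^esub>" by (rule Pi.Q.cochain_zero[symmetric])
  finally have "Pi.cmap p (a \<odot>\<^bsub>C p\<^esub> c) = \<zero>\<^bsub>Pi.Q.C p\<^esub>" .
  moreover have "a \<odot>\<^bsub>C p\<^esub> c \<in> Zc p" by (rule Cp.submodule_closed(6)[OF cocycle_submodule ac c(1)])
  moreover have "\<zero>\<^bsub>Pi.Q.C p\<^esub> \<in> Pi.Q.Nc p" by (rule Pi.Q.Cp.submodule_closed(2)[OF Pi.Q.coboundary_submodule])
  ultimately show ?thesis
    using H_smult[OF ac c(1)] Pi.Hmap_coset c(2)
      Pi.Q.Cp.coset_zero_iff[OF Pi.Q.coboundary_submodule Pi.Q.Cp.zero_closed]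
    by (simp add: Pi.Q.H_zero)
qed

lemma Hmap_IH:
  assumes "U \<in> IH p"
  shows "Pi.Hmap p U = \<zero>\<^bsub>cech_H R bs QM p\<^esub>"
proof -
  let ?HQ = "cech_H R bs QM p"
  interpret Hm: module R "H p" by (rule H_module)
  interpret HQ: module R ?HQ by (rule Pi.Q.H_module)
  have z: "submodule {\<zero>\<^bsub>?HQ\<^esub>} R ?HQ" by (rule HQ.zero_submodule)
  have "IH p \<subseteq> {U \<in> carrier (H p). Pi.Hmap p U \<in> {\<zero>\<^bsub>?HQ\<^esub>}}"
    by (rule ideal_smult_least[OF submodule_preimage[OF H_module Pi.Q.H_module Pi.linear_map_Hmap z]])
      (use II_kills_Hmap II_closed in simp)
  then show ?thesis using assms by blast
qed

lemma quot_map_coset: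
  assumes U: "U \<in> carrier (H p)"
  shows "cech_H_quot_map R bs II M p (IH p +>\<^bsub>H p\<^esub> U) = Pi.Hmap p U"
proof -
  interpret Hm: module R "H p" by (rule H_module)
  interpret HQ: module R "cech_H R bs QM p" by (rule Pi.Q.H_module)
  note ad = linear_map_additive[OF Pi.linear_map_Hmap]
  have e: "Pi.Hmap p V = Pi.Hmap p U" if V: "V \<in> IH p +>\<^bsub>H p\<^esub> U" for V
  proof -
    obtain W where W: "W \<in> IH p" "V = W \<oplus>\<^bsub>H p\<^esub> U" using V by (auto simp: a_r_coset_mem)
    have "W \<in> carrier (H p)" by (rule Hm.submodule_closed(1)[OF IH_submodule W(1)])
    then show ?thesis
      using additive_map_add[OF ad _ U] Hmap_IH[OF W(1)] additive_map_closed[OF ad U] W(2) by simp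
  qed
  have "Pi.Hmap p ` (IH p +>\<^bsub>H p\<^esub> U) = {Pi.Hmap p U}"
  proof (intro subset_antisym)
    show "Pi.Hmap p ` (IH p +>\<^bsub>H p\<^esub> U) \<subseteq> {Pi.Hmap p U}"
      by (rule image_subsetI) (simp only: e singleton_iff)
    show "{Pi.Hmap p U} \<subseteq> Pi.Hmap p ` (IH p +>\<^bsub>H p\<^esub> U)"
      using Hm.coset_self[OF IH_submodule U] by (simp add: rev_image_eqI)
  qed
  then show ?thesis by (simp add: cech_H_quot_map_def image_top_eq)
qed

text \<open>The cochain of the values \<open>D (u \<rho>) top\<close> is a combination with coefficients in \<open>I\<close> of the cochains
  \<open>u \<rho> (top - {j})\<close>, so if these are cocycles then its class lies in \<open>I H\<close>.\<close>

lemma D_top_mem_IH: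
  assumes u: "\<And>\<rho> J. u \<rho> J \<in> carrier M"
    and du: "\<And>\<tau> J. \<tau> \<in> cells ss (p + 1) \<Longrightarrow> J \<in> cells r (int r - 1) \<Longrightarrow> d a u \<tau> J = \<zero>\<^bsub>M\<^esub>"
  shows "cochain p a (\<lambda>\<rho>. D (u \<rho>) top) \<in> Zc p"
    "Nc p +>\<^bsub>C p\<^esub> cochain p a (\<lambda>\<rho>. D (u \<rho>) top) \<in> IH p"
proof -
  interpret Hm: module R "H p" by (rule H_module)
  let ?c = "\<lambda>j. dcoef R f 1 top j"
  have cc: "?c j \<in> carrier R" for j by (rule R.dcoef_closed[OF f_closed])
  let ?s = "\<lambda>T \<rho>. \<Oplus>\<^bsub>M\<^esub>j\<in>T. ?c j \<odot>\<^bsub>M\<^esub> u \<rho> (top - {j})"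
  have sc: "?s T \<rho> \<in> carrier M" for T \<rho> using cc u by (intro M.finsum_closed) auto
  have "cochain p a (?s T) \<in> Zc p \<and> Nc p +>\<^bsub>C p\<^esub> cochain p a (?s T) \<in> IH p"
    if "finite T" "T \<subseteq> top" for T
    using that
  proof (induction T)
    case empty
    have "cochain p a (?s {}) = \<zero>\<^bsub>C p\<^esub>" by (simp add: cochain_zero[of p a])
    moreover have "\<zero>\<^bsub>C p\<^esub> \<in> Nc p" by (rule Cp.submodule_closed(2)[OF coboundary_submodule])
    ultimately show ?case
      using Cp.submodule_closed(2)[OF cocycle_submodule] H_eq_zero_iff[of "\<zero>\<^bsub>C p\<^esub>" p]
        Hm.submodule_closed(2)[OF IH_submodule] by (simp add: H_zero)
  next
    case (insert j T)
    then have j: "j < r" by simp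
    have uj: "u \<rho> (top - {j}) \<in> carrier M" for \<rho> by (rule u)
    let ?u = "cochain p a (\<lambda>\<rho>. u \<rho> (top - {j}))"
    have Jr: "top - {j} \<in> cells r (int r - 1)" using cells_remove'[OF top_cell, of j] j by simp
    have uZ: "?u \<in> Zc p" by (rule cocycleI[OF uj]) (rule du[OF _ Jr])
    have cuZ: "?c j \<odot>\<^bsub>C p\<^esub> ?u \<in> Zc p" by (rule Cp.submodule_closed(6)[OF cocycle_submodule cc uZ])
    have IHs: "cochain p a (?s T) \<in> Zc p" "Nc p +>\<^bsub>C p\<^esub> cochain p a (?s T) \<in> IH p"
      using insert by auto
    have "Nc p +>\<^bsub>C p\<^esub> ?u \<in> carrier (H p)" using uZ by (auto simp: H_carrier)
    then have "?c j \<odot>\<^bsub>H p\<^esub> (Nc p +>\<^bsub>C p\<^esub> ?u) \<in> IH p" by (rule ideal_smultI[OF dcoef_f_mem[OF j]])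
    then have cuI: "Nc p +>\<^bsub>C p\<^esub> (?c j \<odot>\<^bsub>C p\<^esub> ?u) \<in> IH p" by (simp only: H_smult[OF cc uZ])
    have cuj: "?c j \<odot>\<^bsub>M\<^esub> u \<rho> (top - {j}) \<in> carrier M" for \<rho> using cc u by simp
    have "?s (insert j T) \<rho> = ?c j \<odot>\<^bsub>M\<^esub> u \<rho> (top - {j}) \<oplus>\<^bsub>M\<^esub> ?s T \<rho>" for \<rho>
      using insert.hyps cc u by (intro M.finsum_insert) auto
    then have "cochain p a (?s (insert j T)) = cochain p a (\<lambda>\<rho>. ?c j \<odot>\<^bsub>M\<^esub> u \<rho> (top - {j}) \<oplus>\<^bsub>M\<^esub> ?s T \<rho>)"
      by presburger
    also have "\<dots> = cochain p a (\<lambda>\<rho>. ?c j \<odot>\<^bsub>M\<^esub> u \<rho> (top - {j})) \<oplus>\<^bsub>C p\<^esub> cochain p a (?s T)"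
      by (rule cochain_add[OF cuj sc, symmetric])
    also have "cochain p a (\<lambda>\<rho>. ?c j \<odot>\<^bsub>M\<^esub> u \<rho> (top - {j})) = ?c j \<odot>\<^bsub>C p\<^esub> ?u"
      by (rule cochain_smult[OF uj cc, symmetric])
    finally have e: "cochain p a (?s (insert j T)) = ?c j \<odot>\<^bsub>C p\<^esub> ?u \<oplus>\<^bsub>C p\<^esub> cochain p a (?s T)" .
    show ?case
      unfolding e H_add[OF cuZ IHs(1), symmetric]
      using Cp.submodule_closed(3)[OF cocycle_submodule cuZ IHs(1)]
        Hm.submodule_closed(3)[OF IH_submodule cuI IHs(2)] by blast
  qed
  from this[of top] show "cochain p a (\<lambda>\<rho>. D (u \<rho>) top) \<in> Zc p"
    "Nc p +>\<^bsub>C p\<^esub> cochain p a (\<lambda>\<rho>. D (u \<rho>) top) \<in> IH p"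
    unfolding D_cell[OF top_cell] cdiff_def by simp_all
qed

text \<open>If the class of \<open>z\<close> dies in the cohomology of \<open>M / I M\<close>, then \<open>z\<close> is a coboundary up to values in
  \<open>I M\<close>, which is the situation of \<open>cocycle_in_image\<close>.\<close>

lemma kernel_subset_IH:
  assumes g: "g \<in> carrier G"
    and ex: "\<And>q p'. p' > p \<Longrightarrow> rel_exact R F bb ss (Zk q) (Bk q) p'"
    and van: "\<And>i J. i \<ge> 1 \<Longrightarrow> J \<in> cells r (int r - 1 - i) \<Longrightarrow>
      vanishes (p + i) (g \<otimes>\<^bsub>G\<^esub> inv\<^bsub>G\<^esub> (bdeg \<delta> ({..<r} - J)))"
    and z: "\<And>\<rho>. z \<rho> \<in> Mg (dgr g a \<rho>)"
    and dz: "\<And>\<tau>. \<tau> \<in> cells ss (p + 1) \<Longrightarrow> cdiff R M bb a z \<tau> = \<zero>\<^bsub>M\<^esub>"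
    and zN: "Pi.cmap p (cochain p a z) \<in> Pi.Q.Nc p"
  shows "Nc p +>\<^bsub>C p\<^esub> cochain p a z \<in> IH p"
proof -
  interpret Hm: module R "H p" by (rule H_module)
  let ?\<pi> = "\<lambda>x. image_top +>\<^bsub>M\<^esub> x"
  have dg: "dgr g a \<rho> \<in> carrier G" for a \<rho> using g by simp
  have zc: "z \<rho> \<in> carrier M" for \<rho> by (rule Mg_closed(1)[OF dg z])
  have pz: "?\<pi> (z \<rho>) \<in> carrier QM" for \<rho> by (rule Pi.h_closed[OF zc])
  have zN': "Pi.Q.cochain p a (\<lambda>\<rho>. ?\<pi> (z \<rho>)) \<in> Pi.Q.Nc p" using zN Pi.cmap_cochain[OF zc] by simp
  obtain k v where kv: "(\<forall>\<rho>. v \<rho> \<in> carrier QM) \<and>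
      (\<forall>\<rho>\<in>cells ss p. B \<rho> [^] k \<odot>\<^bsub>QM\<^esub> ?\<pi> (z \<rho>) = cdiff R QM bb (a + k) v \<rho>)"
    using iffD1[OF Pi.Q.coboundary_iff[where x = "\<lambda>\<rho>. ?\<pi> (z \<rho>)" and p = p and a = a, OF pz] zN']
    by (elim exE) (rule that)
  have "\<exists>y. y \<in> carrier M \<and> v \<rho> = ?\<pi> y" for \<rho>
    using kv quot_carrier[of "v \<rho>" image_top] by blast
  then obtain y where y: "\<And>\<rho>. y \<rho> \<in> carrier M" and vy: "\<And>\<rho>. v \<rho> = ?\<pi> (y \<rho>)" by metis
  have v: "v = (\<lambda>\<rho>. ?\<pi> (y \<rho>))" using vy by auto
  have zy: "B \<rho> [^] k \<odot>\<^bsub>M\<^esub> z \<rho> \<ominus>\<^bsub>M\<^esub> cdiff R M bb (a + k) y \<rho> \<in> image_top" if \<rho>: "\<rho> \<in> cells ss p" for \<rho>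
  proof -
    have dyc: "cdiff R M bb (a + k) y \<rho> \<in> carrier M" by (rule cdiff_bb_closed[OF y])
    have "?\<pi> (B \<rho> [^] k \<odot>\<^bsub>M\<^esub> z \<rho>) = B \<rho> [^] k \<odot>\<^bsub>QM\<^esub> ?\<pi> (z \<rho>)"
      by (rule linear_map_smult[OF Pi.linear bpow_closed zc])
    also have "\<dots> = cdiff R QM bb (a + k) (\<lambda>\<rho>. ?\<pi> (y \<rho>)) \<rho>" using kv \<rho> v by simp
    also have "\<dots> = ?\<pi> (cdiff R M bb (a + k) y \<rho>)" by (rule Pi.cdiff_h[OF y])
    finally show ?thesis using coset_diff_iff[OF image_top_submodule] zc dyc by simp
  qed
  from cocycle_in_image[OF g ex z dz y zy van] obtain k' y' u where
    y': "\<And>\<rho>. y' \<rho> \<in> Mg (dgr g (a + k') \<rho>)" and hu: "hom g (a + k') u"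
    and du: "\<And>\<tau> J. \<tau> \<in> cells ss (p + 1) \<Longrightarrow> J \<in> cells r (int r - 1) \<Longrightarrow> d (a + k') u \<tau> J = \<zero>\<^bsub>M\<^esub>"
    and zu: "\<And>\<rho>. \<rho> \<in> cells ss p \<Longrightarrow>
      B \<rho> [^] k' \<odot>\<^bsub>M\<^esub> z \<rho> = cdiff R M bb (a + k') y' \<rho> \<oplus>\<^bsub>M\<^esub> D (u \<rho>) top"
    by metis
  have y'c: "y' \<rho> \<in> carrier M" for \<rho> by (rule Mg_closed(1)[OF dg y'])
  have uc: "u \<rho> J \<in> carrier M" for \<rho> J by (rule hom_closed[OF g hu])
  have dy'c: "cdiff R M bb (a + k') y' \<rho> \<in> carrier M" for \<rho> by (rule cdiff_bb_closed[OF y'c])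
  have Duc: "D (u \<rho>) top \<in> carrier M" for \<rho> by (rule D_closed[OF uc])
  let ?n = "cochain p (a + k') (cdiff R M bb (a + k') y')"
  let ?w = "cochain p (a + k') (\<lambda>\<rho>. D (u \<rho>) top)"
  note w = D_top_mem_IH[where u = u and p = p and a = "a + k'", OF uc du]
  have "cochain p a z = cochain p (a + k') (\<lambda>\<rho>. B \<rho> [^] k' \<odot>\<^bsub>M\<^esub> z \<rho>)" by (rule cochain_expand[OF zc, symmetric])
  also have "\<dots> = cochain p (a + k') (\<lambda>\<rho>. cdiff R M bb (a + k') y' \<rho> \<oplus>\<^bsub>M\<^esub> D (u \<rho>) top)"
    by (rule cochain_cong[OF zu])
  also have "\<dots> = ?n \<oplus>\<^bsub>C p\<^esub> ?w" by (rule cochain_add[OF dy'c Duc, symmetric])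
  finally have e: "cochain p a z = ?n \<oplus>\<^bsub>C p\<^esub> ?w" .
  have "?n = cech_diff R bs M (p - 1) (cochain (p - 1) (a + k') y')"
    using cech_diff_cochain[where x = y' and p = "p - 1" and a = "a + k'", OF y'c] by simp
  then have nN: "?n \<in> Nc p"
    using cochain_carrier[where x = y', OF y'c] by (auto simp: cech_coboundaries_def)
  have "Nc p +>\<^bsub>C p\<^esub> cochain p a z = Nc p +>\<^bsub>C p\<^esub> ?w"
    using Cp.coset_eq_iff[OF coboundary_submodule, of "cochain p a z" p ?w] e nN
      cochain_carrier[where x = z, OF zc] cocycle_carrier[OF w(1)] by blast
  then show ?thesis using w(2) by simp
qed

lemma source_iff:
  "V \<in> quot_grade (H p) (IH p) (cech_H_grade G R Rg bs M Mg p) g \<longleftrightarrow>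
    (\<exists>c\<in>Zc p \<inter> cech_grade G R Rg bs M Mg p g. V = IH p +>\<^bsub>H p\<^esub> (Nc p +>\<^bsub>C p\<^esub> c))"
  unfolding quot_grade_def image_iff Bex_def H_grade_iff by blast

lemma quot_map_inj:
  assumes g: "g \<in> carrier G"
    and ex: "\<And>q p'. p' > p \<Longrightarrow> rel_exact R F bb ss (Zk q) (Bk q) p'"
    and van: "\<And>i J. i \<ge> 1 \<Longrightarrow> J \<in> cells r (int r - 1 - i) \<Longrightarrow>
      vanishes (p + i) (g \<otimes>\<^bsub>G\<^esub> inv\<^bsub>G\<^esub> (bdeg \<delta> ({..<r} - J)))"
  shows "inj_on (cech_H_quot_map R bs II M p) (quot_grade (H p) (IH p) (cech_H_grade G R Rg bs M Mg p) g)"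
proof (rule inj_onI)
  interpret Hm: module R "H p" by (rule H_module)
  interpret HQ: module R "cech_H R bs QM p" by (rule Pi.Q.H_module)
  note ad = linear_map_additive[OF Pi.linear_map_Hmap]
  have dg: "dgr g a \<rho> \<in> carrier G" for a \<rho> using g by simp
  fix V W assume "V \<in> quot_grade (H p) (IH p) (cech_H_grade G R Rg bs M Mg p) g"
    "W \<in> quot_grade (H p) (IH p) (cech_H_grade G R Rg bs M Mg p) g"
    and eq: "cech_H_quot_map R bs II M p V = cech_H_quot_map R bs II M p W"
  then obtain c e where c: "c \<in> Zc p" "c \<in> cech_grade G R Rg bs M Mg p g" "V = IH p +>\<^bsub>H p\<^esub> (Nc p +>\<^bsub>C p\<^esub> c)"
    and e: "e \<in> Zc p" "e \<in> cech_grade G R Rg bs M Mg p g" "W = IH p +>\<^bsub>H p\<^esub> (Nc p +>\<^bsub>C p\<^esub> e)"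
    unfolding source_iff by blast
  obtain a x where x: "\<And>\<rho>. x \<rho> \<in> Mg (dgr g a \<rho>)" and cx: "c = cochain p a x"
    and dx: "\<And>\<tau>. \<tau> \<in> cells ss (p + 1) \<Longrightarrow> cdiff R M bb a x \<tau> = \<zero>\<^bsub>M\<^esub>"
    by (rule graded_cocycle_rep[OF g c(1,2)]) (rule that)
  obtain n y where y: "\<And>\<rho>. y \<rho> \<in> Mg (dgr g n \<rho>)" and ey: "e = cochain p n y"
    and dy: "\<And>\<tau>. \<tau> \<in> cells ss (p + 1) \<Longrightarrow> cdiff R M bb n y \<tau> = \<zero>\<^bsub>M\<^esub>"
    by (rule graded_cocycle_rep[OF g e(1,2)]) (rule that)
  have xc: "x \<rho> \<in> carrier M" for \<rho> by (rule Mg_closed(1)[OF dg x])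
  have yc: "y \<rho> \<in> carrier M" for \<rho> by (rule Mg_closed(1)[OF dg y])
  let ?x = "\<lambda>\<rho>. B \<rho> [^] n \<odot>\<^bsub>M\<^esub> x \<rho>" and ?y = "\<lambda>\<rho>. B \<rho> [^] a \<odot>\<^bsub>M\<^esub> y \<rho>"
  have bxc: "?x \<rho> \<in> carrier M" for \<rho> using xc by simp
  have byc: "?y \<rho> \<in> carrier M" for \<rho> using yc by simp
  have bx: "?x \<rho> \<in> Mg (dgr g (a + n) \<rho>)" for \<rho>
    using bpow_mem[OF dg x[of \<rho>], of \<rho> n] bdeg_shift[OF g] by simp
  have by': "?y \<rho> \<in> Mg (dgr g (a + n) \<rho>)" for \<rho>
    using bpow_mem[OF dg y[of \<rho>], of \<rho> a] bdeg_shift[OF g] by (simp add: add.commute)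
  \<comment> \<open>The difference of the two classes, represented by a homogeneous cocycle over a common denominator.\<close>
  define z where "z \<rho> = ?x \<rho> \<ominus>\<^bsub>M\<^esub> ?y \<rho>" for \<rho>
  have z: "z \<rho> \<in> Mg (dgr g (a + n) \<rho>)" for \<rho>
    unfolding z_def by (rule Mg_closed(4)[OF dg bx by'])
  have zc: "z \<rho> \<in> carrier M" for \<rho> by (rule Mg_closed(1)[OF dg z])
  have dz: "cdiff R M bb (a + n) z \<tau> = \<zero>\<^bsub>M\<^esub>" if \<tau>: "\<tau> \<in> cells ss (p + 1)" for \<tau>
  proof -
    have "cdiff R M bb (a + n) z \<tau> = cdiff R M bb (a + n) ?x \<tau> \<ominus>\<^bsub>M\<^esub> cdiff R M bb (a + n) ?y \<tau>"
      unfolding z_def by (rule cdiff_diff[OF bb_closed bxc byc])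
    also have "cdiff R M bb (a + n) ?x \<tau> = \<zero>\<^bsub>M\<^esub>"
      using cdiff_shift[OF bb_closed xc cells_finite[OF \<tau>], of a n] dx[OF \<tau>] by simp
    also have "cdiff R M bb (a + n) ?y \<tau> = \<zero>\<^bsub>M\<^esub>"
      using cdiff_shift[OF bb_closed yc cells_finite[OF \<tau>], of n a] dy[OF \<tau>] by (simp add: add.commute)
    finally show ?thesis using M.minus_eq_zero_iff[of "\<zero>\<^bsub>M\<^esub>" "\<zero>\<^bsub>M\<^esub>"] by simp
  qed
  let ?z = "cochain p (a + n) z"
  have zZ: "?z \<in> Zc p" by (rule cocycleI[OF zc dz])
  have zy: "z \<rho> \<oplus>\<^bsub>M\<^esub> ?y \<rho> = ?x \<rho>" for \<rho>
    unfolding z_def a_minus_def using M.a_assoc[OF bxc[of \<rho>] M.a_inv_closed[OF byc[of \<rho>]] byc[of \<rho>]]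
      M.l_neg[OF byc[of \<rho>]] M.r_zero[OF bxc[of \<rho>]] by simp
  have e': "e = cochain p (a + n) ?y"
    unfolding ey using cochain_expand[OF yc, of p n a] by (simp add: add.commute)
  have "c = cochain p (a + n) ?x" unfolding cx by (rule cochain_expand[OF xc, symmetric])
  also have "\<dots> = ?z \<oplus>\<^bsub>C p\<^esub> e" unfolding e' cochain_add[OF zc byc] zy ..
  finally have cze: "c = ?z \<oplus>\<^bsub>C p\<^esub> e" .
  let ?U = "\<lambda>c. Nc p +>\<^bsub>C p\<^esub> c"
  have Uc: "?U c \<in> carrier (H p)" "?U e \<in> carrier (H p)" "?U ?z \<in> carrier (H p)"
    using c(1) e(1) zZ by (auto simp: H_carrier)
  have U: "?U c = ?U ?z \<oplus>\<^bsub>H p\<^esub> ?U e" unfolding cze by (rule H_add[OF zZ e(1), symmetric])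
  have "Pi.Hmap p (?U c) = Pi.Hmap p (?U e)"
    using eq unfolding c(3) e(3) quot_map_coset[OF Uc(1)] quot_map_coset[OF Uc(2)] .
  moreover have "Pi.Hmap p (?U c) = Pi.Hmap p (?U ?z) \<oplus>\<^bsub>cech_H R bs QM p\<^esub> Pi.Hmap p (?U e)"
    unfolding U by (rule additive_map_add[OF ad Uc(3,2)])
  ultimately have "Pi.Hmap p (?U ?z) = \<zero>\<^bsub>cech_H R bs QM p\<^esub>"
    using additive_map_closed[OF ad] Uc HQ.add.l_cancel_one' HQ.add.r_cancel_one' by metis
  then have "Pi.Q.Nc p +>\<^bsub>Pi.Q.C p\<^esub> Pi.cmap p ?z = Pi.Q.Nc p"
    using Pi.Hmap_coset[OF zZ] by (simp add: Pi.Q.H_zero)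
  then have "Pi.cmap p ?z \<in> Pi.Q.Nc p" using Pi.Q.H_eq_zero_iff[OF Pi.cmap_cocycle[OF zZ]] by simp
  from kernel_subset_IH[OF g ex van z dz this] have "?U ?z \<in> IH p" .
  then show "V = W"
    unfolding c(3) e(3) using Hm.coset_eq_iff[OF IH_submodule Uc(1,2)] U by blast
qed

lemma target_iff:
  "U \<in> cech_H_grade G R Rg bs QM (quot_grade M image_top Mg) p g \<longleftrightarrow>
    (\<exists>c\<in>Pi.Q.Zc p \<inter> cech_grade G R Rg bs QM (quot_grade M image_top Mg) p g. U = Pi.Q.Nc p +>\<^bsub>Pi.Q.C p\<^esub> c)"
  unfolding cech_H_grade_def quot_grade_def by (auto simp: Pi.Q.coset_restrict)

lemma loc_grade_QM:
  assumes \<rho>: "\<rho> \<in> cells ss p" and g: "g \<in> carrier G"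
  shows "E \<in> loc_grade G R Rg QM (quot_grade M image_top Mg) (cech_elem R bs \<rho>) g \<longleftrightarrow>
    (\<exists>a x. x \<in> Mg (dgr g a \<rho>) \<and> E = frac R QM (B \<rho>) (image_top +>\<^bsub>M\<^esub> x) a)"
proof -
  have "E \<in> loc_grade G R Rg QM (quot_grade M image_top Mg) (cech_elem R bs \<rho>) g \<longleftrightarrow>
    (\<exists>a y. y \<in> quot_grade M image_top Mg (dgr g a \<rho>) \<and> E = frac R QM (B \<rho>) y a)"
  proof (rule loc_grade_cell[OF Pi.Q.module_axioms \<rho> g])
    show "y \<in> carrier QM" if "h \<in> carrier G" "y \<in> quot_grade M image_top Mg h" for h y
      using that Pi.h_closed Mg_closed(1)[OF that(1)] by (auto simp: quot_grade_def)
    show "\<zero>\<^bsub>QM\<^esub> \<in> quot_grade M image_top Mg h" if "h \<in> carrier G" for h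
      using Pi.h_zero Mg_closed(2)[OF that] by (auto simp: quot_grade_def intro!: image_eqI)
  qed
  also have "\<dots> \<longleftrightarrow> (\<exists>a x. x \<in> Mg (dgr g a \<rho>) \<and> E = frac R QM (B \<rho>) (image_top +>\<^bsub>M\<^esub> x) a)"
    unfolding quot_grade_def by blast
  finally show ?thesis .
qed

lemma graded_cochain_QM:
  assumes g: "g \<in> carrier G" and x: "\<And>\<rho>. x \<rho> \<in> Mg (dgr g a \<rho>)"
  shows "Pi.Q.cochain p a (\<lambda>\<rho>. image_top +>\<^bsub>M\<^esub> x \<rho>) \<in> cech_grade G R Rg bs QM (quot_grade M image_top Mg) p g"
  unfolding cech_grade_def cech_cells_eq Pi.Q.cochain_def
proof (intro restrict_PiE_iff[THEN iffD2] ballI)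
  fix \<rho> assume \<rho>: "\<rho> \<in> cells ss p"
  show "frac R QM (B \<rho>) (image_top +>\<^bsub>M\<^esub> x \<rho>) a
    \<in> loc_grade G R Rg QM (quot_grade M image_top Mg) (cech_elem R bs \<rho>) g"
    unfolding loc_grade_QM[OF \<rho> g] by (intro exI conjI) (rule x, rule refl)
qed

lemma quot_map_image_subset:
  assumes g: "g \<in> carrier G"
  shows "cech_H_quot_map R bs II M p ` quot_grade (H p) (IH p) (cech_H_grade G R Rg bs M Mg p) g
    \<subseteq> cech_H_grade G R Rg bs QM (quot_grade M image_top Mg) p g"
proof (rule image_subsetI)
  have dg: "dgr g a \<rho> \<in> carrier G" for a \<rho> using g by simp
  fix V assume "V \<in> quot_grade (H p) (IH p) (cech_H_grade G R Rg bs M Mg p) g"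
  then obtain c where c: "c \<in> Zc p" "c \<in> cech_grade G R Rg bs M Mg p g" "V = IH p +>\<^bsub>H p\<^esub> (Nc p +>\<^bsub>C p\<^esub> c)"
    unfolding source_iff by blast
  obtain a x where x: "\<And>\<rho>. x \<rho> \<in> Mg (dgr g a \<rho>)" and cx: "c = cochain p a x"
    by (rule graded_cochain_rep[OF g c(2)]) (rule that)
  have xc: "x \<rho> \<in> carrier M" for \<rho> by (rule Mg_closed(1)[OF dg x])
  have "Nc p +>\<^bsub>C p\<^esub> c \<in> carrier (H p)" using c(1) by (auto simp: H_carrier)
  then have "cech_H_quot_map R bs II M p V = Pi.Q.Nc p +>\<^bsub>Pi.Q.C p\<^esub> Pi.cmap p c"
    unfolding c(3) using quot_map_coset Pi.Hmap_coset[OF c(1)] by simp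
  moreover have "Pi.cmap p c \<in> cech_grade G R Rg bs QM (quot_grade M image_top Mg) p g"
    unfolding cx Pi.cmap_cochain[OF xc] by (rule graded_cochain_QM[OF g x])
  ultimately show "cech_H_quot_map R bs II M p V \<in> cech_H_grade G R Rg bs QM (quot_grade M image_top Mg) p g"
    unfolding target_iff using Pi.cmap_cocycle[OF c(1)] by blast
qed

lemma quot_map_surj:
  assumes g: "g \<in> carrier G"
    and ex: "\<And>q p'. p' > p + 1 \<Longrightarrow> rel_exact R F bb ss (Zk q) (Bk q) p'"
    and van: "\<And>i J. i \<ge> 1 \<Longrightarrow> J \<in> cells r (int r - i) \<Longrightarrow>
      vanishes (p + i) (g \<otimes>\<^bsub>G\<^esub> inv\<^bsub>G\<^esub> (bdeg \<delta> ({..<r} - J)))"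
  shows "cech_H_grade G R Rg bs QM (quot_grade M image_top Mg) p g \<subseteq>
    cech_H_quot_map R bs II M p ` quot_grade (H p) (IH p) (cech_H_grade G R Rg bs M Mg p) g"
proof
  let ?\<pi> = "\<lambda>x. image_top +>\<^bsub>M\<^esub> x"
  have dg: "dgr g a \<rho> \<in> carrier G" for a \<rho> using g by simp
  fix U assume "U \<in> cech_H_grade G R Rg bs QM (quot_grade M image_top Mg) p g"
  then obtain e where e: "e \<in> Pi.Q.Zc p" "e \<in> cech_grade G R Rg bs QM (quot_grade M image_top Mg) p g"
    and U: "U = Pi.Q.Nc p +>\<^bsub>Pi.Q.C p\<^esub> e" unfolding target_iff by blast
  obtain a v where v: "\<And>\<rho>. \<exists>x. x \<in> Mg (dgr g a \<rho>) \<and> v \<rho> = ?\<pi> x" and ev: "e = Pi.Q.cochain p a v"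
  proof (rule Pi.Q.common_exponent[where P = "\<lambda>\<rho> a v. \<exists>x. x \<in> Mg (dgr g a \<rho>) \<and> v = ?\<pi> x" and c = e and p = p])
    show "e \<in> extensional (cells ss p)" using e(2) by (simp add: cech_grade_def cech_cells_eq PiE_iff)
    show "\<exists>a v. (\<exists>x. x \<in> Mg (dgr g a \<rho>) \<and> v = ?\<pi> x) \<and> e \<rho> = frac R QM (B \<rho>) v a" if \<rho>: "\<rho> \<in> cells ss p" for \<rho>
    proof -
      have "e \<rho> \<in> loc_grade G R Rg QM (quot_grade M image_top Mg) (cech_elem R bs \<rho>) g"
        using e(2) \<rho> unfolding cech_grade_def cech_cells_eq by (rule PiE_mem)
      then show ?thesis unfolding loc_grade_QM[OF \<rho> g] by blast
    qed
    show "\<exists>x. x \<in> Mg (dgr g (a + k) \<rho>) \<and> B \<rho> [^] k \<odot>\<^bsub>QM\<^esub> v = ?\<pi> x"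
      if v: "\<exists>x. x \<in> Mg (dgr g a \<rho>) \<and> v = ?\<pi> x" for \<rho> a v k
    proof -
      obtain x where x: "x \<in> Mg (dgr g a \<rho>)" "v = ?\<pi> x" using v by blast
      have "B \<rho> [^] k \<odot>\<^bsub>M\<^esub> x \<in> Mg (dgr g (a + k) \<rho>)"
        using bpow_mem[OF dg x(1), of \<rho> k] bdeg_shift[OF g] by simp
      moreover have "?\<pi> (B \<rho> [^] k \<odot>\<^bsub>M\<^esub> x) = B \<rho> [^] k \<odot>\<^bsub>QM\<^esub> v"
        unfolding x(2) by (rule linear_map_smult[OF Pi.linear bpow_closed Mg_closed(1)[OF dg x(1)]])
      ultimately show ?thesis by metis
    qed
    show "v \<in> carrier QM" if "\<exists>x. x \<in> Mg (dgr g a \<rho>) \<and> v = ?\<pi> x" for \<rho> a v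
      using that Pi.h_closed Mg_closed(1)[OF dg] by blast
    show "\<exists>v x. x \<in> Mg (dgr g a \<rho>) \<and> v = ?\<pi> x" for \<rho> a using Mg_closed(2)[OF dg] by blast
  qed (rule that)
  obtain x where x: "\<And>\<rho>. x \<rho> \<in> Mg (dgr g a \<rho>)" and vx: "\<And>\<rho>. v \<rho> = ?\<pi> (x \<rho>)" using v by metis
  have v': "v = (\<lambda>\<rho>. ?\<pi> (x \<rho>))" using vx by auto
  have xc: "x \<rho> \<in> carrier M" for \<rho> by (rule Mg_closed(1)[OF dg x])
  have px: "?\<pi> (x \<rho>) \<in> carrier QM" for \<rho> by (rule Pi.h_closed[OF xc])
  have dpx: "cdiff R QM bb a (\<lambda>\<rho>. ?\<pi> (x \<rho>)) \<rho> \<in> carrier QM" for \<rho> by (rule Pi.Q.cdiff_bb_closed[OF px])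
  have "Pi.Q.cochain (p + 1) a (cdiff R QM bb a (\<lambda>\<rho>. ?\<pi> (x \<rho>))) = \<zero>\<^bsub>Pi.Q.C (p + 1)\<^esub>"
    using e(1) Pi.Q.cech_diff_cochain[where x = "\<lambda>\<rho>. ?\<pi> (x \<rho>)", OF px] unfolding ev v'
    by (simp add: cech_cocycles_def)
  then obtain k :: nat where k: "\<forall>\<tau>\<in>cells ss (p + 1). B \<tau> [^] k \<odot>\<^bsub>QM\<^esub> cdiff R QM bb a (\<lambda>\<rho>. ?\<pi> (x \<rho>)) \<tau> = \<zero>\<^bsub>QM\<^esub>"
    using iffD1[OF Pi.Q.cochain_zero_iff[where x = "cdiff R QM bb a (\<lambda>\<rho>. ?\<pi> (x \<rho>))", OF dpx]] by blast
  let ?x = "\<lambda>\<rho>. B \<rho> [^] k \<odot>\<^bsub>M\<^esub> x \<rho>"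
  have bx: "?x \<rho> \<in> Mg (dgr g (a + k) \<rho>)" for \<rho>
    using bpow_mem[OF dg x[of \<rho>], of \<rho> k] bdeg_shift[OF g] by simp
  have dbx: "cdiff R M bb (a + k) ?x \<tau> \<in> image_top" if \<tau>: "\<tau> \<in> cells ss (p + 1)" for \<tau>
  proof -
    have dxc: "cdiff R M bb a x \<tau> \<in> carrier M" by (rule cdiff_bb_closed[OF xc])
    have "?\<pi> (B \<tau> [^] k \<odot>\<^bsub>M\<^esub> cdiff R M bb a x \<tau>) = B \<tau> [^] k \<odot>\<^bsub>QM\<^esub> ?\<pi> (cdiff R M bb a x \<tau>)"
      by (rule linear_map_smult[OF Pi.linear bpow_closed dxc])
    also have "\<dots> = image_top" using k \<tau> Pi.cdiff_h[OF xc] by (simp add: quot_zero)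
    finally have "B \<tau> [^] k \<odot>\<^bsub>M\<^esub> cdiff R M bb a x \<tau> \<in> image_top"
      using coset_zero_iff[OF image_top_submodule] dxc by simp
    then show ?thesis using cdiff_shift[OF bb_closed xc cells_finite[OF \<tau>]] by simp
  qed
  from lift_cocycle_mod_image[OF g ex bx dbx van] obtain n y where
    y: "\<And>\<rho>. y \<rho> \<in> Mg (dgr g (a + k + n) \<rho>)"
    and dy: "\<And>\<tau>. \<tau> \<in> cells ss (p + 1) \<Longrightarrow> cdiff R M bb (a + k + n) y \<tau> = \<zero>\<^bsub>M\<^esub>"
    and xy: "\<And>\<rho>. \<rho> \<in> cells ss p \<Longrightarrow> B \<rho> [^] n \<odot>\<^bsub>M\<^esub> ?x \<rho> \<ominus>\<^bsub>M\<^esub> y \<rho> \<in> image_top"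
    by metis
  have yc: "y \<rho> \<in> carrier M" for \<rho> by (rule Mg_closed(1)[OF dg y])
  let ?c = "cochain p (a + k + n) y"
  have cZ: "?c \<in> Zc p" by (rule cocycleI[OF yc dy])
  have cg: "?c \<in> cech_grade G R Rg bs M Mg p g" by (rule graded_cochain[OF g y])
  have bxc: "?x \<rho> \<in> carrier M" for \<rho> using xc by simp
  have pbx: "?\<pi> (?x \<rho>) \<in> carrier QM" for \<rho> by (rule Pi.h_closed[OF bxc])
  have "Pi.cmap p ?c = Pi.Q.cochain p (a + k + n) (\<lambda>\<rho>. ?\<pi> (y \<rho>))" by (rule Pi.cmap_cochain[OF yc])
  also have "\<dots> = Pi.Q.cochain p (a + k + n) (\<lambda>\<rho>. B \<rho> [^] n \<odot>\<^bsub>QM\<^esub> ?\<pi> (?x \<rho>))"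
  proof (rule Pi.Q.cochain_cong)
    fix \<rho> assume \<rho>: "\<rho> \<in> cells ss p"
    have "?\<pi> (B \<rho> [^] n \<odot>\<^bsub>M\<^esub> ?x \<rho>) = ?\<pi> (y \<rho>)"
      using iffD2[OF coset_diff_iff[OF image_top_submodule smult_closed[OF bpow_closed bxc] yc] xy[OF \<rho>]] .
    then show "?\<pi> (y \<rho>) = B \<rho> [^] n \<odot>\<^bsub>QM\<^esub> ?\<pi> (?x \<rho>)"
      using linear_map_smult[OF Pi.linear bpow_closed bxc, of \<rho> n \<rho>] by metis
  qed
  also have "\<dots> = Pi.Q.cochain p (a + k) (\<lambda>\<rho>. ?\<pi> (?x \<rho>))" by (rule Pi.Q.cochain_expand[OF pbx])
  also have "\<dots> = Pi.Q.cochain p (a + k) (\<lambda>\<rho>. B \<rho> [^] k \<odot>\<^bsub>QM\<^esub> ?\<pi> (x \<rho>))"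
    by (rule Pi.Q.cochain_cong) (rule linear_map_smult[OF Pi.linear bpow_closed xc])
  also have "\<dots> = e" unfolding ev v' by (rule Pi.Q.cochain_expand[OF px])
  finally have ce: "Pi.cmap p ?c = e" .
  have Uc: "Nc p +>\<^bsub>C p\<^esub> ?c \<in> carrier (H p)" using cZ by (auto simp: H_carrier)
  have "U = cech_H_quot_map R bs II M p (IH p +>\<^bsub>H p\<^esub> (Nc p +>\<^bsub>C p\<^esub> ?c))"
    unfolding quot_map_coset[OF Uc] Pi.Hmap_coset[OF cZ] ce U ..
  moreover have "IH p +>\<^bsub>H p\<^esub> (Nc p +>\<^bsub>C p\<^esub> ?c) \<in> quot_grade (H p) (IH p) (cech_H_grade G R Rg bs M Mg p) g"
    unfolding source_iff using cZ cg by blast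
  ultimately show "U \<in> cech_H_quot_map R bs II M p ` quot_grade (H p) (IH p) (cech_H_grade G R Rg bs M Mg p) g"
    by blast
qed

end

section \<open>The grading of the polynomial ring\<close>

lemma (in ring) indexed_pset_support:
  assumes "P \<in> indexed_pset I K" "P m \<noteq> \<zero>"
  shows "set_mset m \<subseteq> I"
  using assms
proof (induction arbitrary: m)
  case (indexed_const k)
  then show ?case by (auto simp: indexed_const_def split: if_splits)
next
  case (indexed_padd P Q)
  then have "P m \<noteq> \<zero> \<or> Q m \<noteq> \<zero>" by (auto simp: indexed_padd_def)
  then show ?case using indexed_padd.IH by blast
next
  case (indexed_pmult P i)
  then have i: "i \<in># m" "P (m - {#i#}) \<noteq> \<zero>" by (auto simp: indexed_pmult_def split: if_splits)
  have "m = add_mset i (m - {#i#})" using i(1) by simp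
  then have "set_mset m = insert i (set_mset (m - {#i#}))" by (metis set_mset_add_mset_insert)
  then show ?case using indexed_pmult.IH[OF i(2)] indexed_pmult.hyps by auto
qed

lemma monom_deg_eq_finprod:
  assumes "comm_group G" "finite A" "set_mset m \<subseteq> A" "\<And>i. i \<in> A \<Longrightarrow> \<gamma> i \<in> carrier G"
  shows "monom_deg G \<gamma> m = (\<Otimes>\<^bsub>G\<^esub>i\<in>A. \<gamma> i [^]\<^bsub>G\<^esub> count m i)"
proof -
  interpret comm_group G by fact
  show ?thesis
    unfolding monom_deg_def
    using assms by (intro finprod_mono_neutral_cong_left) (auto simp: not_in_iff)
qed

lemma monom_deg_add:
  assumes "comm_group G" "\<And>i. i \<in># m + k \<Longrightarrow> \<gamma> i \<in> carrier G"
  shows "monom_deg G \<gamma> (m + k) = monom_deg G \<gamma> m \<otimes>\<^bsub>G\<^esub> monom_deg G \<gamma> k"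
proof -
  interpret comm_group G by fact
  let ?A = "set_mset (m + k)"
  have c: "\<gamma> i \<in> carrier G" if "i \<in> ?A" for i using assms(2) that by blast
  have "monom_deg G \<gamma> (m + k) = (\<Otimes>\<^bsub>G\<^esub>i\<in>?A. \<gamma> i [^]\<^bsub>G\<^esub> count m i \<otimes>\<^bsub>G\<^esub> \<gamma> i [^]\<^bsub>G\<^esub> count k i)"
    unfolding monom_deg_def using c by (intro finprod_cong') (auto simp: nat_pow_mult)
  also have "\<dots> = (\<Otimes>\<^bsub>G\<^esub>i\<in>?A. \<gamma> i [^]\<^bsub>G\<^esub> count m i) \<otimes>\<^bsub>G\<^esub> (\<Otimes>\<^bsub>G\<^esub>i\<in>?A. \<gamma> i [^]\<^bsub>G\<^esub> count k i)"
    using c by (intro finprod_multf) auto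
  also have "\<dots> = monom_deg G \<gamma> m \<otimes>\<^bsub>G\<^esub> monom_deg G \<gamma> k"
    using monom_deg_eq_finprod[OF assms(1), of ?A m \<gamma>] monom_deg_eq_finprod[OF assms(1), of ?A k \<gamma>] c
    by simp
  finally show ?thesis .
qed

lemma mpoly_grade_mult:
  assumes "cring S" and G: "comm_group G" and \<gamma>: "\<forall>i<n. \<gamma> i \<in> carrier G"
    and R: "cring (mpoly_ring S n)"
    and p: "p \<in> mpoly_grade S n G \<gamma> g" and q: "q \<in> mpoly_grade S n G \<gamma> h"
  shows "p \<otimes>\<^bsub>mpoly_ring S n\<^esub> q \<in> mpoly_grade S n G \<gamma> (g \<otimes>\<^bsub>G\<^esub> h)"
proof -
  interpret S: cring S by fact
  interpret R: cring "mpoly_ring S n" by fact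
  have pc: "p \<in> S.indexed_pset {..<n} (carrier S)" and qc: "q \<in> S.indexed_pset {..<n} (carrier S)"
    using p q by (auto simp: mpoly_grade_def mpoly_ring_def)
  have coef: "p k \<in> carrier S" "q k \<in> carrier S" for k
    using S.indexed_pset_in_carrier[OF subset_refl pc] S.indexed_pset_in_carrier[OF subset_refl qc]
    by (auto simp: S.carrier_coeff_def)
  have "monom_deg G \<gamma> m = g \<otimes>\<^bsub>G\<^esub> h" if m: "(p \<otimes>\<^bsub>mpoly_ring S n\<^esub> q) m \<noteq> \<zero>\<^bsub>S\<^esub>" for m
  proof -
    have "(p \<otimes>\<^bsub>mpoly_ring S n\<^esub> q) m = (\<Oplus>\<^bsub>S\<^esub>k\<in>{k. k \<subseteq># m}. p k \<otimes>\<^bsub>S\<^esub> q (m - k))"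
      by (simp add: mpoly_ring_def)
    then obtain k where k: "k \<subseteq># m" "p k \<otimes>\<^bsub>S\<^esub> q (m - k) \<noteq> \<zero>\<^bsub>S\<^esub>"
      using m S.finsum_all_zero[of "{k. k \<subseteq># m}" "\<lambda>k. p k \<otimes>\<^bsub>S\<^esub> q (m - k)"] by auto
    then have nz: "p k \<noteq> \<zero>\<^bsub>S\<^esub>" "q (m - k) \<noteq> \<zero>\<^bsub>S\<^esub>" using coef by auto
    have mk: "m = k + (m - k)" using k(1) by simp
    have "set_mset k \<subseteq> {..<n}" "set_mset (m - k) \<subseteq> {..<n}"
      using S.indexed_pset_support[OF pc nz(1)] S.indexed_pset_support[OF qc nz(2)] by auto
    then have "\<gamma> i \<in> carrier G" if "i \<in># k + (m - k)" for i using that \<gamma> by auto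
    then have "monom_deg G \<gamma> (k + (m - k)) = monom_deg G \<gamma> k \<otimes>\<^bsub>G\<^esub> monom_deg G \<gamma> (m - k)"
      by (rule monom_deg_add[OF G])
    then show ?thesis using p q nz mk by (auto simp: mpoly_grade_def)
  qed
  moreover have "p \<otimes>\<^bsub>mpoly_ring S n\<^esub> q \<in> carrier (mpoly_ring S n)"
    using p q by (intro R.m_closed) (auto simp: mpoly_grade_def)
  ultimately show ?thesis by (simp add: mpoly_grade_def)
qed

lemma mpoly_grade_one:
  assumes "cring S" "comm_group G" "cring (mpoly_ring S n)"
  shows "\<one>\<^bsub>mpoly_ring S n\<^esub> \<in> mpoly_grade S n G \<gamma> \<one>\<^bsub>G\<^esub>"
proof -
  interpret S: cring S by fact
  interpret G: comm_group G by fact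
  interpret R: cring "mpoly_ring S n" by fact
  have "\<one>\<^bsub>mpoly_ring S n\<^esub> = S.indexed_const \<one>\<^bsub>S\<^esub>" by (simp add: mpoly_ring_def)
  then have "m = {#}" if "\<one>\<^bsub>mpoly_ring S n\<^esub> m \<noteq> \<zero>\<^bsub>S\<^esub>" for m
    using that by (auto simp: S.indexed_const_def split: if_splits)
  moreover have "monom_deg G \<gamma> {#} = \<one>\<^bsub>G\<^esub>" by (simp add: monom_deg_def)
  ultimately show ?thesis using R.one_closed by (auto simp: mpoly_grade_def)
qed

lemma mpoly_grade_unique:
  assumes "cring S" "p \<in> mpoly_grade S n G \<gamma> g" "p \<in> mpoly_grade S n G \<gamma> h"
  shows "h = g \<or> p = \<zero>\<^bsub>mpoly_ring S n\<^esub>"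
proof (cases "\<exists>m. p m \<noteq> \<zero>\<^bsub>S\<^esub>")
  case True
  then show ?thesis using assms by (auto simp: mpoly_grade_def)
next
  case False
  interpret S: cring S by fact
  have "p = (\<lambda>_. \<zero>\<^bsub>S\<^esub>)" using False by auto
  then show ?thesis by (simp add: mpoly_ring_def S.indexed_zero_def)
qed

section \<open>Homogeneous components\<close>

text \<open>The value at \<open>h\<close> of the family whose existence and uniqueness is part of \<^const>\<open>graded_module\<close>.\<close>

definition component ::
  "('g, 'k) monoid_scheme \<Rightarrow> ('r, 'm, 'o) module_scheme \<Rightarrow> ('g \<Rightarrow> 'm set) \<Rightarrow> 'g \<Rightarrow> 'm \<Rightarrow> 'm" where
  "component G M Mg h x = (THE c. c \<in> (\<Pi>\<^sub>E g\<in>carrier G. Mg g) \<and>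
       finite {g \<in> carrier G. c g \<noteq> \<zero>\<^bsub>M\<^esub>} \<and>
       x = (\<Oplus>\<^bsub>M\<^esub>g\<in>{g \<in> carrier G. c g \<noteq> \<zero>\<^bsub>M\<^esub>}. c g)) h"

lemma graded_piece:
  assumes "graded_module G R Rg M Mg" "g \<in> carrier G"
  shows "x \<in> Mg g \<Longrightarrow> x \<in> carrier M" "\<zero>\<^bsub>M\<^esub> \<in> Mg g"
    "x \<in> Mg g \<Longrightarrow> y \<in> Mg g \<Longrightarrow> x \<oplus>\<^bsub>M\<^esub> y \<in> Mg g"
proof -
  have s: "subgroup (Mg g) (add_monoid M)" using assms by (simp add: graded_module_def)
  show "x \<in> Mg g \<Longrightarrow> x \<in> carrier M" using subgroup.subset[OF s] by auto
  show "\<zero>\<^bsub>M\<^esub> \<in> Mg g" using subgroup.one_closed[OF s] by simp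
  show "x \<in> Mg g \<Longrightarrow> y \<in> Mg g \<Longrightarrow> x \<oplus>\<^bsub>M\<^esub> y \<in> Mg g"
    using subgroup.m_closed[OF s] by simp
qed

lemma component_unique:
  assumes gm: "graded_module G R Rg M Mg"
    and T: "finite T" "T \<subseteq> carrier G" and e: "\<And>g. g \<in> carrier G \<Longrightarrow> e g \<in> Mg g"
    and e0: "\<And>g. g \<in> carrier G \<Longrightarrow> g \<notin> T \<Longrightarrow> e g = \<zero>\<^bsub>M\<^esub>"
    and x: "x = (\<Oplus>\<^bsub>M\<^esub>g\<in>T. e g)" and h: "h \<in> carrier G"
  shows "component G M Mg h x = e h"
proof -
  interpret module R M using gm by (simp add: graded_module_def)
  have ec: "e g \<in> carrier M" if "g \<in> carrier G" for g using e that graded_piece(1)[OF gm that] by blast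
  let ?c = "restrict e (carrier G)"
  let ?S = "{g \<in> carrier G. ?c g \<noteq> \<zero>\<^bsub>M\<^esub>}"
  have S: "?S \<subseteq> T" using e0 by auto
  have fin: "finite ?S" using S T(1) by (rule finite_subset)
  have "(\<Oplus>\<^bsub>M\<^esub>g\<in>?S. ?c g) = (\<Oplus>\<^bsub>M\<^esub>g\<in>T. e g)"
    using T S ec by (intro M.add.finprod_mono_neutral_cong_left) auto
  then have P: "?c \<in> (\<Pi>\<^sub>E g\<in>carrier G. Mg g) \<and> finite ?S \<and> x = (\<Oplus>\<^bsub>M\<^esub>g\<in>?S. ?c g)"
    using x e fin by auto
  have "x \<in> carrier M" unfolding x using T ec by (intro M.finsum_closed) auto
  then have "\<exists>!c. c \<in> (\<Pi>\<^sub>E g\<in>carrier G. Mg g) \<and> finite {g \<in> carrier G. c g \<noteq> \<zero>\<^bsub>M\<^esub>} \<and>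
       x = (\<Oplus>\<^bsub>M\<^esub>g\<in>{g \<in> carrier G. c g \<noteq> \<zero>\<^bsub>M\<^esub>}. c g)"
    using gm by (simp add: graded_module_def)
  from the1_equality[OF this, OF P] show ?thesis unfolding component_def using h by simp
qed

lemma component_sum:
  assumes gm: "graded_module G R Rg M Mg" and x: "x \<in> carrier M"
  obtains T where "finite T" "T \<subseteq> carrier G" "\<And>g. g \<in> carrier G \<Longrightarrow> component G M Mg g x \<in> Mg g"
    "\<And>g. g \<in> carrier G \<Longrightarrow> g \<notin> T \<Longrightarrow> component G M Mg g x = \<zero>\<^bsub>M\<^esub>"
    "x = (\<Oplus>\<^bsub>M\<^esub>g\<in>T. component G M Mg g x)"
proof -
  let ?P = "\<lambda>c. c \<in> (\<Pi>\<^sub>E g\<in>carrier G. Mg g) \<and> finite {g \<in> carrier G. c g \<noteq> \<zero>\<^bsub>M\<^esub>} \<and>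
       x = (\<Oplus>\<^bsub>M\<^esub>g\<in>{g \<in> carrier G. c g \<noteq> \<zero>\<^bsub>M\<^esub>}. c g)"
  have "\<exists>!c. ?P c" using gm x by (simp add: graded_module_def)
  from theI'[OF this] have P: "?P (THE c. ?P c)" .
  have c: "(THE c. ?P c) = (\<lambda>g. component G M Mg g x)" by (simp add: component_def)
  show thesis
    by (rule that[of "{g \<in> carrier G. component G M Mg g x \<noteq> \<zero>\<^bsub>M\<^esub>}"])
      (use P in \<open>unfold c, auto simp: PiE_iff\<close>)
qed

lemma graded_mod_component:
  assumes G: "comm_group G" and gm: "graded_module G R Rg M Mg"
  shows "graded_mod R M G Mg (component G M Mg)"
proof -
  interpret module R M using gm by (simp add: graded_module_def)
  interpret G: comm_group G by fact
  note piece = graded_piece[OF gm]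
  show ?thesis
  proof (intro graded_mod.intro graded_mod_axioms.intro module_axioms G)
    fix h assume h: "h \<in> carrier G"
    show "subgroup (Mg h) (add_monoid M)" using gm h by (simp add: graded_module_def)
    fix x
    show "component G M Mg h x = x" if x: "x \<in> Mg h"
    proof -
      have xc: "x \<in> carrier M" by (rule piece(1)[OF h x])
      let ?e = "\<lambda>g. if g = h then x else \<zero>\<^bsub>M\<^esub>"
      have "component G M Mg h x = ?e h"
      proof (rule component_unique[OF gm, of "{h}" ?e])
        show "x = (\<Oplus>\<^bsub>M\<^esub>g\<in>{h}. ?e g)" using xc by simp
      qed (use h x piece(2) in auto)
      then show ?thesis by simp
    qed
    assume x: "x \<in> carrier M"
    show "component G M Mg h x \<in> Mg h"
      by (rule component_sum[OF gm x]) (use h in blast)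
    fix y assume y: "y \<in> carrier M"
    obtain T where T: "finite T" "T \<subseteq> carrier G" "\<And>g. g \<in> carrier G \<Longrightarrow> component G M Mg g x \<in> Mg g"
      "\<And>g. g \<in> carrier G \<Longrightarrow> g \<notin> T \<Longrightarrow> component G M Mg g x = \<zero>\<^bsub>M\<^esub>"
      "x = (\<Oplus>\<^bsub>M\<^esub>g\<in>T. component G M Mg g x)" using component_sum[OF gm x] by metis
    obtain U where U: "finite U" "U \<subseteq> carrier G" "\<And>g. g \<in> carrier G \<Longrightarrow> component G M Mg g y \<in> Mg g"
      "\<And>g. g \<in> carrier G \<Longrightarrow> g \<notin> U \<Longrightarrow> component G M Mg g y = \<zero>\<^bsub>M\<^esub>"
      "y = (\<Oplus>\<^bsub>M\<^esub>g\<in>U. component G M Mg g y)" using component_sum[OF gm y] by metis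
    have Tc: "component G M Mg g x \<in> carrier M" "component G M Mg g y \<in> carrier M" if "g \<in> carrier G" for g
      using piece(1)[OF that] T(3)[OF that] U(3)[OF that] by auto
    have "(\<Oplus>\<^bsub>M\<^esub>g\<in>T. component G M Mg g x) = (\<Oplus>\<^bsub>M\<^esub>g\<in>T \<union> U. component G M Mg g x)"
      using T(1,2,4) U(1,2) Tc by (intro M.add.finprod_mono_neutral_cong_left) auto
    then have x': "x = (\<Oplus>\<^bsub>M\<^esub>g\<in>T \<union> U. component G M Mg g x)" using T(5) by simp
    have "(\<Oplus>\<^bsub>M\<^esub>g\<in>U. component G M Mg g y) = (\<Oplus>\<^bsub>M\<^esub>g\<in>T \<union> U. component G M Mg g y)"
      using U(1,2,4) T(1,2) Tc by (intro M.add.finprod_mono_neutral_cong_left) auto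
    then have y': "y = (\<Oplus>\<^bsub>M\<^esub>g\<in>T \<union> U. component G M Mg g y)" using U(5) by simp
    have "(\<Oplus>\<^bsub>M\<^esub>g\<in>T \<union> U. component G M Mg g x \<oplus>\<^bsub>M\<^esub> component G M Mg g y)
      = (\<Oplus>\<^bsub>M\<^esub>g\<in>T \<union> U. component G M Mg g x) \<oplus>\<^bsub>M\<^esub> (\<Oplus>\<^bsub>M\<^esub>g\<in>T \<union> U. component G M Mg g y)"
      using Tc T(2) U(2) by (intro M.finsum_addf) auto
    then have s: "x \<oplus>\<^bsub>M\<^esub> y = (\<Oplus>\<^bsub>M\<^esub>g\<in>T \<union> U. component G M Mg g x \<oplus>\<^bsub>M\<^esub> component G M Mg g y)"
      using x' y' by simp
    show "component G M Mg h (x \<oplus>\<^bsub>M\<^esub> y) = component G M Mg h x \<oplus>\<^bsub>M\<^esub> component G M Mg h y"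
      by (rule component_unique[OF gm _ _ _ _ s h]) (use T U piece(3) in auto)
  qed
qed

text \<open>Multiplying the components of \<open>x\<close> by \<open>c\<close> gives a decomposition of \<open>c x\<close> in which the degrees are shifted
  by \<open>d\<close>, and the decomposition is unique.\<close>

lemma homog_of_graded_module:
  assumes G: "comm_group G" and gm: "graded_module G R Rg M Mg"
    and d: "d \<in> carrier G" and c: "c \<in> Rg d" "c \<in> carrier R"
  shows "graded_mod.homog R M G (component G M Mg) c d"
proof -
  interpret graded_mod R M G Mg "component G M Mg" by (rule graded_mod_component[OF G gm])
  show ?thesis
    unfolding homog_def
  proof (intro conjI ballI c d)
    fix h x assume h: "h \<in> carrier G" and x: "x \<in> carrier M"
    obtain T where T: "finite T" "T \<subseteq> carrier G" "\<And>g. g \<in> carrier G \<Longrightarrow> component G M Mg g x \<in> Mg g"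
      "\<And>g. g \<in> carrier G \<Longrightarrow> g \<notin> T \<Longrightarrow> component G M Mg g x = \<zero>\<^bsub>M\<^esub>"
      "x = (\<Oplus>\<^bsub>M\<^esub>g\<in>T. component G M Mg g x)" using component_sum[OF gm x] by metis
    have Tc: "component G M Mg g x \<in> carrier M" if "g \<in> carrier G" for g
      using Mg_closed(1)[OF that T(3)[OF that]] .
    let ?t = "\<lambda>g. g \<otimes>\<^bsub>G\<^esub> d"
    let ?e = "\<lambda>g. c \<odot>\<^bsub>M\<^esub> component G M Mg (g \<otimes>\<^bsub>G\<^esub> inv\<^bsub>G\<^esub> d) x"
    have cancel: "?t g \<otimes>\<^bsub>G\<^esub> inv\<^bsub>G\<^esub> d = g" "g \<otimes>\<^bsub>G\<^esub> inv\<^bsub>G\<^esub> d \<otimes>\<^bsub>G\<^esub> d = g" if "g \<in> carrier G" for g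
      using that d by (simp_all add: G.m_assoc)
    have inj: "inj_on ?t T" 
      by (rule inj_on_inverseI[where g = "\<lambda>g. g \<otimes>\<^bsub>G\<^esub> inv\<^bsub>G\<^esub> d"]) (use cancel(1) T(2) in auto)
    have e: "?e g \<in> Mg g" if g: "g \<in> carrier G" for g
    proof -
      have "g \<otimes>\<^bsub>G\<^esub> inv\<^bsub>G\<^esub> d \<in> carrier G" using g d by simp
      then have "c \<odot>\<^bsub>M\<^esub> component G M Mg (g \<otimes>\<^bsub>G\<^esub> inv\<^bsub>G\<^esub> d) x \<in> Mg (d \<otimes>\<^bsub>G\<^esub> (g \<otimes>\<^bsub>G\<^esub> inv\<^bsub>G\<^esub> d))"
        using gm d c(1) T(3) unfolding graded_module_def by blast
      moreover have "d \<otimes>\<^bsub>G\<^esub> (g \<otimes>\<^bsub>G\<^esub> inv\<^bsub>G\<^esub> d) = g" using cancel(2)[OF g] g d by (simp add: G.m_comm)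
      ultimately show ?thesis by simp
    qed
    have "c \<odot>\<^bsub>M\<^esub> x = (\<Oplus>\<^bsub>M\<^esub>g\<in>T. c \<odot>\<^bsub>M\<^esub> component G M Mg g x)"
      using finsum_smult_ldistr[OF T(1) c(2), of "\<lambda>g. component G M Mg g x"] T(2,5) Tc by auto
    also have "\<dots> = (\<Oplus>\<^bsub>M\<^esub>g\<in>T. ?e (?t g))"
      using T(2) cancel(1) Tc c(2) by (intro M.finsum_cong') (auto simp: subset_iff)
    also have "\<dots> = (\<Oplus>\<^bsub>M\<^esub>g\<in>?t ` T. ?e g)"
      using inj T(2) d c(2) Tc by (intro M.finsum_reindex[symmetric]) auto
    finally have s: "c \<odot>\<^bsub>M\<^esub> x = (\<Oplus>\<^bsub>M\<^esub>g\<in>?t ` T. ?e g)" .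
    have "component G M Mg (h \<otimes>\<^bsub>G\<^esub> d) (c \<odot>\<^bsub>M\<^esub> x) = ?e (h \<otimes>\<^bsub>G\<^esub> d)"
    proof (rule component_unique[OF gm _ _ e _ s])
      show "?e g = \<zero>\<^bsub>M\<^esub>" if g: "g \<in> carrier G" "g \<notin> ?t ` T" for g
      proof -
        have "g \<otimes>\<^bsub>G\<^esub> inv\<^bsub>G\<^esub> d \<notin> T" using g cancel(2)[OF g(1)] by (metis image_eqI)
        then show ?thesis using T(4) g(1) d c(2) by simp
      qed
    qed (use T d h in auto)
    then show "component G M Mg (h \<otimes>\<^bsub>G\<^esub> d) (c \<odot>\<^bsub>M\<^esub> x) = c \<odot>\<^bsub>M\<^esub> component G M Mg h x"
      using cancel(1)[OF h] by simp
  qed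
qed

section \<open>The theorem\<close>

lemma deg_sums_cong:
  assumes "comm_group G" "\<And>i. i < r \<Longrightarrow> \<delta> i = \<delta>' i" "\<And>i. i < r \<Longrightarrow> \<delta>' i \<in> carrier G"
  shows "deg_sums G r \<delta> k = deg_sums G r \<delta>' k"
proof -
  interpret comm_group G by fact
  have "(\<Otimes>\<^bsub>G\<^esub>j\<in>J. \<delta> j) = (\<Otimes>\<^bsub>G\<^esub>j\<in>J. \<delta>' j)" if "J \<subseteq> {..<r}" for J
    using assms(2,3) that by (intro finprod_cong') auto
  then show ?thesis unfolding deg_sums_def by (metis (no_types, lifting))
qed

theorem lemma3p9:
  fixes G :: "'g monoid"
    and S :: "'s ring"
    and n r :: nat
    and \<gamma> \<delta> :: "nat \<Rightarrow> 'g"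
    and R :: "(nat multiset \<Rightarrow> 's) ring"
    and Rg :: "'g \<Rightarrow> (nat multiset \<Rightarrow> 's) set"
    and B I :: "(nat multiset \<Rightarrow> 's) set"
    and bs :: "(nat multiset \<Rightarrow> 's) list"
    and f :: "nat \<Rightarrow> nat multiset \<Rightarrow> 's"
    and M :: "(nat multiset \<Rightarrow> 's, 'm) module"
    and Mg :: "'g \<Rightarrow> 'm set"
    and l :: int
    and g :: 'g
  assumes "comm_group G"
    and "\<exists>A. finite A \<and> A \<subseteq> carrier G \<and> generate G A = carrier G"
    and "cring S"
    and "\<forall>i<n. \<gamma> i \<in> carrier G"
    and "R = mpoly_ring S n"
    and "Rg = mpoly_grade S n G \<gamma>"
    and "\<forall>b\<in>set bs. \<exists>d\<in>carrier G. b \<in> Rg d"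
    and "B = genideal R (set bs)"
    and "B \<subseteq> genideal R (ring.indexed_var S ` {..<n})"
    and "graded_module G R Rg M Mg"
    and "\<forall>j<r. \<delta> j \<in> carrier G \<and> f j \<in> Rg (\<delta> j)"
    and "I = genideal R (f ` {..<r})"
    and "g \<in> carrier G"
  shows
    "(cech_cd R bs (quot_module (self_module R) (I <+>\<^bsub>R\<^esub> annihilator R M)) < ereal (real_of_int l)
        \<longrightarrow> g \<notin> (\<Union>i::nat. cech_H_supp G R Rg bs M Mg (l + int i) <#>\<^bsub>G\<^esub> deg_sums G r \<delta> (i + 1))
        \<longrightarrow> g \<notin> cech_H_supp G R Rg bs M Mg l)
     \<and>
     (cech_cd R bs (quot_module (self_module R) (I <+>\<^bsub>R\<^esub> annihilator R M)) = ereal (real_of_int l)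
        \<longrightarrow> g \<notin> (\<Union>i\<in>{i::nat. i > 0}.
                 cech_H_supp G R Rg bs M Mg (l + int i) <#>\<^bsub>G\<^esub> deg_sums G r \<delta> (i + 1))
        \<longrightarrow> (let H = cech_H R bs M l;
                 IM = ideal_smult R I M;
                 source = quot_grade H (ideal_smult R I H) (cech_H_grade G R Rg bs M Mg l) g;
                 target = cech_H_grade G R Rg bs (quot_module M IM) (quot_grade M IM Mg) l g;
                 \<phi> = cech_H_quot_map R bs I M l
             in inj_on \<phi> source \<and> \<phi> ` source \<subseteq> target \<and>
                (g \<notin> (\<Union>i\<in>{i::nat. i > 0}.
                        cech_H_supp G R Rg bs M Mg (l + int i) <#>\<^bsub>G\<^esub> deg_sums G r \<delta> i)
                  \<longrightarrow> \<phi> ` source = target)))"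
proof -
  note G = \<open>comm_group G\<close> and S = \<open>cring S\<close> and gm = \<open>graded_module G R Rg M Mg\<close> and g = \<open>g \<in> carrier G\<close>
  interpret G0: comm_group G by (rule G)
  have mod: "module R M" using gm by (simp add: graded_module_def)
  have R: "cring R" using mod by (rule module.axioms(1))
  interpret R0: cring R by (rule R)
  have Rgc: "c \<in> carrier R" if "c \<in> Rg d" for c d
    using that assms(5,6) by (simp add: mpoly_grade_def)
  have Rmult: "c \<otimes>\<^bsub>R\<^esub> c' \<in> Rg (d \<otimes>\<^bsub>G\<^esub> d')" if "c \<in> Rg d" "c' \<in> Rg d'" for c c' d d'
    using mpoly_grade_mult[OF S G assms(4) R[unfolded assms(5)]] that unfolding assms(5,6) by blast
  have Rone: "\<one>\<^bsub>R\<^esub> \<in> Rg \<one>\<^bsub>G\<^esub>"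
    using mpoly_grade_one[OF S G R[unfolded assms(5)]] unfolding assms(5,6) .
  have "\<forall>i. \<exists>d. i < length bs \<longrightarrow> d \<in> carrier G \<and> bs ! i \<in> Rg d"
    using assms(7) nth_mem by blast
  then obtain dg where dg: "\<And>i. i < length bs \<Longrightarrow> dg i \<in> carrier G \<and> bs ! i \<in> Rg (dg i)" by metis
  \<comment> \<open>All sequences are extended by units, in order to be homogeneous at every index.\<close>
  define \<beta> where "\<beta> i = (if i < length bs then dg i else \<one>\<^bsub>G\<^esub>)" for i
  define f' where "f' i = (if i < r then f i else \<one>\<^bsub>R\<^esub>)" for i
  define \<delta>' where "\<delta>' i = (if i < r then \<delta> i else \<one>\<^bsub>G\<^esub>)" for i
  let ?pr = "component G M Mg"
  interpret N: graded_mod R M G Mg ?pr by (rule graded_mod_component[OF G gm])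
  have \<beta>: "\<beta> i \<in> carrier G" "bfun R bs i \<in> Rg (\<beta> i)" for i
    using dg[of i] Rone by (simp_all add: \<beta>_def bfun_def)
  have \<delta>': "\<delta>' i \<in> carrier G" "f' i \<in> Rg (\<delta>' i)" for i
    using assms(11) Rone by (simp_all add: \<delta>'_def f'_def)
  have hb: "N.homog (bfun R bs i) (\<beta> i)" for i
    by (rule homog_of_graded_module[OF G gm \<beta> Rgc[OF \<beta>(2)]])
  have hf: "N.homog (f' i) (\<delta>' i)" for i
    by (rule homog_of_graded_module[OF G gm \<delta>' Rgc[OF \<delta>'(2)]])
  have bsc: "set bs \<subseteq> carrier R" using assms(7) Rgc by blast
  have bprod: "bprod R (bfun R bs) \<rho> \<in> Rg (N.bdeg \<beta> \<rho>)" if "finite \<rho>" for \<rho>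
    using that
  proof (induction \<rho>)
    case empty
    then show ?case using Rone by (simp add: bprod_def N.bdeg_def)
  next
    case (insert i \<rho>)
    have "bprod R (bfun R bs) (insert i \<rho>) = bfun R bs i \<otimes>\<^bsub>R\<^esub> bprod R (bfun R bs) \<rho>"
      unfolding bprod_def using insert.hyps Rgc[OF \<beta>(2)] by (intro R0.finprod_insert) auto
    then show ?case
      using Rmult[OF \<beta>(2) insert.IH, of i] N.bdeg_insert[of \<beta>, OF \<beta>(1) insert.hyps] by simp
  qed
  interpret K: graded_cech R M G Mg ?pr bs \<beta> f' \<delta>' r Rg
  proof (intro graded_cech.intro graded_cech_axioms.intro double_complex.intro double_complex_axioms.intro
      cech.intro cech_axioms.intro N.graded_mod_axioms mod bsc hb hf)
    show "bprod R (bfun R bs) \<rho> \<in> Rg (N.bdeg \<beta> \<rho>)" if "\<rho> \<subseteq> {..<length bs}" for \<rho>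
      by (rule bprod[OF finite_subset[OF that finite_lessThan]])
    show "e' = e \<or> c = \<zero>\<^bsub>R\<^esub>" if "c \<in> Rg e" "c \<in> Rg e'" for e e' c
      using mpoly_grade_unique[OF S that[unfolded assms(6)]] unfolding assms(5) .
  qed
  have I: "genideal R (f' ` {..<r}) = I"
    unfolding assms(12) by (rule arg_cong[where f = "genideal R"]) (auto simp: f'_def)
  have IM: "K.image_top = ideal_smult R I M" using K.image_top_eq unfolding I by simp
  have ds: "deg_sums G r \<delta> k = deg_sums G r \<delta>' k" for k
    by (rule deg_sums_cong[OF G]) (use assms(11) in \<open>auto simp: \<delta>'_def\<close>)
  let ?cd = "cech_cd R bs (quot_module (self_module R) (I <+>\<^bsub>R\<^esub> annihilator R M))"
  let ?supp = "\<lambda>i k. cech_H_supp G R Rg bs M Mg (l + int i) <#>\<^bsub>G\<^esub> deg_sums G r \<delta> k"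
  have van: "K.vanishes (l + i) (g \<otimes>\<^bsub>G\<^esub> inv\<^bsub>G\<^esub> (N.bdeg \<delta>' ({..<r} - J)))"
    if "i \<ge> 0" "J \<in> cells r (int r - int k)" "g \<notin> ?supp (nat i) k" for i J k
    using K.vanishes_of_deg_sums[OF g that(2)] that(1,3) unfolding ds by simp
  note ex = K.exact_above_cd[unfolded I]
  show ?thesis
  proof (intro conjI impI)
    assume cd: "?cd < ereal (real_of_int l)" and supp: "g \<notin> (\<Union>i. ?supp i (i + 1))"
    have "K.vanishes l g"
    proof (rule K.vanishes_above[OF g])
      show "rel_exact R K.F (bfun R bs) (length bs) (K.Zk q) (K.Bk q) p'" if "p' > l" for q p'
        using ex(1)[OF cd] that by simp
      show "rel_exact R M (bfun R bs) (length bs) (carrier M) K.image_top l" using ex(2)[OF cd] by simp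
      show "K.vanishes (l + i) (g \<otimes>\<^bsub>G\<^esub> inv\<^bsub>G\<^esub> (N.bdeg \<delta>' ({..<r} - J)))"
        if "0 \<le> i" "J \<in> cells r (int r - 1 - i)" for i J
      proof -
        have "g \<notin> ?supp (nat i) (nat i + 1)" using supp by blast
        then show ?thesis using van[of i J "nat i + 1"] that by (simp add: algebra_simps)
      qed
    qed
    then show "g \<notin> cech_H_supp G R Rg bs M Mg l" by (rule K.not_supp_of_vanishes[OF g])
  next
    assume cd: "?cd = ereal (real_of_int l)" and supp: "g \<notin> (\<Union>i\<in>{i. 0 < i}. ?supp i (i + 1))"
    \<comment> \<open>In the degrees above \<open>l\<close> there is exactness as in part (a).\<close>
    have cd': "?cd < ereal (real_of_int (l + 1))" unfolding cd by simp
    have ex1: "rel_exact R K.F (bfun R bs) (length bs) (K.Zk q) (K.Bk q) p'" if "p' > l" for q p'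
      using ex(1)[OF cd'] that by simp
    have van1: "K.vanishes (l + i) (g \<otimes>\<^bsub>G\<^esub> inv\<^bsub>G\<^esub> (N.bdeg \<delta>' ({..<r} - J)))"
      if "1 \<le> i" "J \<in> cells r (int r - 1 - i)" for i J
    proof -
      have "0 < nat i" using that(1) by simp
      then have "g \<notin> ?supp (nat i) (nat i + 1)" using supp by blast
      then show ?thesis using van[of i J "nat i + 1"] that by (simp add: algebra_simps)
    qed
    note inj = K.quot_map_inj[OF g ex1 van1, unfolded I]
    note sub = K.quot_map_image_subset[OF g, of l, unfolded I IM]
    have surj: "cech_H_grade G R Rg bs (quot_module M (ideal_smult R I M)) (quot_grade M (ideal_smult R I M) Mg) l g
      \<subseteq> cech_H_quot_map R bs I M l ` quot_grade (cech_H R bs M l) (ideal_smult R I (cech_H R bs M l))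
        (cech_H_grade G R Rg bs M Mg l) g" if supp2: "g \<notin> (\<Union>i\<in>{i. 0 < i}. ?supp i i)"
    proof (rule K.quot_map_surj[unfolded I IM, OF g])
      show "rel_exact R K.F (bfun R bs) (length bs) (K.Zk q) (K.Bk q) p'" if "p' > l + 1" for q p'
        using ex1 that by simp
      show "K.vanishes (l + i) (g \<otimes>\<^bsub>G\<^esub> inv\<^bsub>G\<^esub> (N.bdeg \<delta>' ({..<r} - J)))"
        if "1 \<le> i" "J \<in> cells r (int r - i)" for i J
      proof -
        have "0 < nat i" using that(1) by simp
        then have "g \<notin> ?supp (nat i) (nat i)" using supp2 by blast
        then show ?thesis using van[of i J "nat i"] that by simp
      qed
    qed
    show "let H = cech_H R bs M l;
                 IM = ideal_smult R I M;
                 source = quot_grade H (ideal_smult R I H) (cech_H_grade G R Rg bs M Mg l) g;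
                 target = cech_H_grade G R Rg bs (quot_module M IM) (quot_grade M IM Mg) l g;
                 \<phi> = cech_H_quot_map R bs I M l
             in inj_on \<phi> source \<and> \<phi> ` source \<subseteq> target \<and>
                (g \<notin> (\<Union>i\<in>{i::nat. i > 0}. ?supp i i) \<longrightarrow> \<phi> ` source = target)"
      unfolding Let_def
    proof (intro conjI impI)
      show "inj_on (cech_H_quot_map R bs I M l) (quot_grade (cech_H R bs M l)
          (ideal_smult R I (cech_H R bs M l)) (cech_H_grade G R Rg bs M Mg l) g)" by (rule inj)
    qed (use sub surj in \<open>auto intro!: subset_antisym\<close>)
  qed
qed

end
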